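(* Let $\Phi$ be an indecomposable root system of rank $>1$ and let $R$ be either a number field or a ring of algebraic integers. Then the Diophantine problem in $R$ is undecidable if and only if the Diophantine problem in the Chevalley group $G_\pi(\Phi,R)$ is undecidable.
   Context: A number field is a finite algebraic extension $F$ of $\mathbb Q$; its ring of algebraic integers $\mathcal O_F$ is the subring of all roots in $F$ of monic polynomials with integer coefficients. Root systems are reduced. Let $\pi$ be a faithful finite-dimensional representation of the complex semisimple Lie algebra with root system $\Phi$, with weight lattice $\Lambda_\pi$. $G_\pi(\Phi,R)$ denotes the Chevalley group of type $(\Phi,\Lambda_\pi)$ over a commutative ring $R$ with $1$, i.e. the group of $R$-points of the Chevalley--Demazure group scheme, realized as the subgroup of $\mathrm{SL}_n(R)$, $n=\dim\pi$, given by polynomial equations with integer coefficients in the matrix entries. For a countable structure $\mathcal A$ given with an enumeration $\nu:\mathbb N\to\mathcal A$ (a surjective map), the Diophantine problem $\mathcal D(\mathcal A)$ asks for an algorithm which, given a finite system of equations in finitely many variables with coefficients in $\mathcal A$ (presented through $\nu$), decides whether it has a solution in $\mathcal A$; $\mathcal D(\mathcal A)$ is decidable if such an algorithm exists (for some enumeration) and undecidable otherwise. An enumeration of $R$ induces one of $G_\pi(\Phi,R)$ by representing elements as matrices over $R$. *)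

theory Defs
  imports
    "HOL-Analysis.Analysis"
    "HOL-Library.Poly_Mapping"
    "HOL-Library.Nat_Bijection"
    "HOL-Computational_Algebra.Computational_Algebra"
begin

section \<open>Partial recursive functions\<close>

datatype recf = Zero | Succ | Proj nat | Comp recf "recf list" | PrimRec recf recf | Mu recf

text \<open>\<open>computes f xs y\<close>: the (possibly partial) function denoted by \<open>f\<close> is defined at \<open>xs\<close> and has
  value \<open>y\<close> there.\<close>

inductive computes :: "recf \<Rightarrow> nat list \<Rightarrow> nat \<Rightarrow> bool" where
  zero: "computes Zero xs 0"
| succ: "computes Succ [x] (Suc x)"
| proj: "i < length xs \<Longrightarrow> computes (Proj i) xs (xs ! i)"
| comp: "list_all2 (\<lambda>g y. computes g xs y) gs ys \<Longrightarrow> computes f ys z \<Longrightarrow> computes (Comp f gs) xs z"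
| prec_0: "computes f xs y \<Longrightarrow> computes (PrimRec f g) (0 # xs) y"
| prec_Suc: "computes (PrimRec f g) (n # xs) y \<Longrightarrow> computes g (y # n # xs) z
    \<Longrightarrow> computes (PrimRec f g) (Suc n # xs) z"
| mu: "computes f (n # xs) 0 \<Longrightarrow> (\<forall>m<n. \<exists>k. computes f (m # xs) (Suc k))
    \<Longrightarrow> computes (Mu f) xs n"


section \<open>The Diophantine problem of a countable structure\<close>

text \<open>A structure with finitely many operations, each listed with its arity.\<close>

record 'a struct =
  dom :: "'a set"
  ops :: "(nat \<times> ('a list \<Rightarrow> 'a)) list"

text \<open>\<open>Const c\<close> stands for the element \<open>\<nu> c\<close>, where \<open>\<nu>\<close> is the enumeration of the structure.\<close>

datatype trm = Var nat | Const nat | App nat "trm list"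

fun wf_trm :: "'a struct \<Rightarrow> trm \<Rightarrow> bool" where
  "wf_trm A (Var i) \<longleftrightarrow> True"
| "wf_trm A (Const c) \<longleftrightarrow> True"
| "wf_trm A (App f ts) \<longleftrightarrow>
     f < length (ops A) \<and> length ts = fst (ops A ! f) \<and> (\<forall>t\<in>set ts. wf_trm A t)"

fun eval_trm :: "'a struct \<Rightarrow> (nat \<Rightarrow> 'a) \<Rightarrow> (nat \<Rightarrow> 'a) \<Rightarrow> trm \<Rightarrow> 'a" where
  "eval_trm A \<nu> \<rho> (Var i) = \<rho> i"
| "eval_trm A \<nu> \<rho> (Const c) = \<nu> c"
| "eval_trm A \<nu> \<rho> (App f ts) = snd (ops A ! f) (map (eval_trm A \<nu> \<rho>) ts)"

type_synonym system = "(trm \<times> trm) list"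

definition wf_system :: "'a struct \<Rightarrow> system \<Rightarrow> bool" where
  "wf_system A S \<longleftrightarrow> (\<forall>(s, t)\<in>set S. wf_trm A s \<and> wf_trm A t)"

definition solvable_in :: "'a struct \<Rightarrow> (nat \<Rightarrow> 'a) \<Rightarrow> system \<Rightarrow> bool" where
  "solvable_in A \<nu> S \<longleftrightarrow>
     (\<exists>\<rho>. (\<forall>i. \<rho> i \<in> dom A) \<and> (\<forall>(s, t)\<in>set S. eval_trm A \<nu> \<rho> s = eval_trm A \<nu> \<rho> t))"

fun code_trm :: "trm \<Rightarrow> nat" where
  "code_trm (Var i) = prod_encode (0, i)"
| "code_trm (Const c) = prod_encode (1, c)"
| "code_trm (App f ts) = prod_encode (2, prod_encode (f, list_encode (map code_trm ts)))"

definition code_system :: "system \<Rightarrow> nat" where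
  "code_system S = list_encode (map (\<lambda>(s, t). prod_encode (code_trm s, code_trm t)) S)"

definition diophantine_decidable :: "'a struct \<Rightarrow> bool" where
  "diophantine_decidable A \<longleftrightarrow>
     (\<exists>\<nu>. range \<nu> = dom A \<and>
       (\<exists>f. \<forall>S. wf_system A S \<longrightarrow>
          computes f [code_system S] (if solvable_in A \<nu> S then 1 else 0)))"


section \<open>Rings\<close>

definition ring_struct :: "'a::comm_ring_1 set \<Rightarrow> 'a struct" where
  "ring_struct R = \<lparr>dom = R,
     ops = [(2, \<lambda>xs. xs ! 0 + xs ! 1), (2, \<lambda>xs. xs ! 0 * xs ! 1), (1, \<lambda>xs. - (xs ! 0)),
            (0, \<lambda>_. 0), (0, \<lambda>_. 1)]\<rparr>"

definition number_field :: "'f::field_char_0 itself \<Rightarrow> bool" where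
  "number_field _ \<longleftrightarrow>
     (\<exists>B::'f set. finite B \<and> module.span (\<lambda>(q::rat) x. of_rat q * x) B = UNIV)"

definition ring_of_integers :: "'f::field_char_0 set" where
  "ring_of_integers = {x. algebraic_int x}"


section \<open>Root systems\<close>

definition cartan_integer :: "'v::euclidean_space \<Rightarrow> 'v \<Rightarrow> real" where
  "cartan_integer \<beta> \<alpha> = 2 * (\<beta> \<bullet> \<alpha>) / (\<alpha> \<bullet> \<alpha>)"

definition root_system :: "'v::euclidean_space set \<Rightarrow> bool" where
  "root_system \<Phi> \<longleftrightarrow>
     finite \<Phi> \<and> 0 \<notin> \<Phi> \<and> span \<Phi> = UNIV \<and>
     (\<forall>\<alpha>\<in>\<Phi>. \<forall>\<beta>\<in>\<Phi>. \<beta> - cartan_integer \<beta> \<alpha> *\<^sub>R \<alpha> \<in> \<Phi>) \<and>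
     (\<forall>\<alpha>\<in>\<Phi>. \<forall>\<beta>\<in>\<Phi>. cartan_integer \<beta> \<alpha> \<in> \<int>) \<and>
     (\<forall>\<alpha>\<in>\<Phi>. \<forall>c. c *\<^sub>R \<alpha> \<in> \<Phi> \<longrightarrow> c = 1 \<or> c = -1)"

definition indecomposable :: "'v::euclidean_space set \<Rightarrow> bool" where
  "indecomposable \<Phi> \<longleftrightarrow>
     \<Phi> \<noteq> {} \<and>
     \<not> (\<exists>A B. A \<noteq> {} \<and> B \<noteq> {} \<and> A \<inter> B = {} \<and> A \<union> B = \<Phi> \<and> (\<forall>\<alpha>\<in>A. \<forall>\<beta>\<in>B. \<alpha> \<bullet> \<beta> = 0))"


section \<open>Complex semisimple Lie algebras and their representations\<close>

primrec mat_pow :: "'a::semiring_1^'n^'n \<Rightarrow> nat \<Rightarrow> 'a^'n^'n" where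
  "mat_pow A 0 = mat 1"
| "mat_pow A (Suc k) = A ** mat_pow A k"

definition mat_exp :: "complex^'n^'n \<Rightarrow> complex^'n^'n" where
  "mat_exp A = suminf (\<lambda>k. mat (1 / fact k) ** mat_pow A k)"

locale complex_lie_algebra = vector_space scale
  for scale :: "complex \<Rightarrow> 'l::ab_group_add \<Rightarrow> 'l" +
  fixes br :: "'l \<Rightarrow> 'l \<Rightarrow> 'l"
  assumes br_add_left: "br (x + y) z = br x z + br y z"
    and br_add_right: "br x (y + z) = br x y + br x z"
    and br_scale_left: "br (scale c x) y = scale c (br x y)"
    and br_scale_right: "br x (scale c y) = scale c (br x y)"
    and br_self: "br x x = 0"
    and jacobi: "br x (br y z) + br y (br z x) + br z (br x y) = 0"
begin

definition bracket_span :: "'l set \<Rightarrow> 'l set \<Rightarrow> 'l set" where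
  "bracket_span A B = span {br a b | a b. a \<in> A \<and> b \<in> B}"

definition lie_ideal :: "'l set \<Rightarrow> bool" where
  "lie_ideal I \<longleftrightarrow> subspace I \<and> (\<forall>x. \<forall>y\<in>I. br x y \<in> I)"

definition solvable :: "'l set \<Rightarrow> bool" where
  "solvable I \<longleftrightarrow> (\<exists>k. ((\<lambda>D. bracket_span D D) ^^ k) I = {0})"

definition nilpotent :: "'l set \<Rightarrow> bool" where
  "nilpotent K \<longleftrightarrow> (\<exists>k. ((\<lambda>C. bracket_span K C) ^^ k) K = {0})"

definition semisimple :: bool where
  "semisimple \<longleftrightarrow>
     (\<exists>B. finite B \<and> span B = UNIV) \<and> (\<forall>I. lie_ideal I \<and> solvable I \<longrightarrow> I = {0})"

definition cartan_subalgebra :: "'l set \<Rightarrow> bool" where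
  "cartan_subalgebra H \<longleftrightarrow>
     subspace H \<and> (\<forall>x\<in>H. \<forall>y\<in>H. br x y \<in> H) \<and> nilpotent H \<and>
     {x. \<forall>h\<in>H. br x h \<in> H} = H"

text \<open>Functionals on \<open>H\<close> are represented by functions on the whole Lie algebra of which only
  the restriction to \<open>H\<close> matters. Linearity of a root on \<open>H\<close> follows from the definition.\<close>

definition is_root :: "'l set \<Rightarrow> ('l \<Rightarrow> complex) \<Rightarrow> bool" where
  "is_root H a \<longleftrightarrow>
     (\<exists>h\<in>H. a h \<noteq> 0) \<and> (\<exists>x. x \<noteq> 0 \<and> (\<forall>h\<in>H. br h x = scale (a h) x))"

text \<open>\<open>r\<close> identifies \<open>\<Phi>\<close> with the set of roots relative to \<open>H\<close>: it is an injective real-linear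
  map into the dual of \<open>H\<close> that maps \<open>\<Phi>\<close> onto the set of roots. Such a map automatically
  preserves the Cartan integers.\<close>

definition roots_identified :: "'l set \<Rightarrow> 'v::euclidean_space set \<Rightarrow> ('v \<Rightarrow> 'l \<Rightarrow> complex) \<Rightarrow> bool" where
  "roots_identified H \<Phi> r \<longleftrightarrow>
     (\<forall>h\<in>H. linear (\<lambda>v. r v h)) \<and>
     (\<forall>v. (\<forall>h\<in>H. r v h = 0) \<longrightarrow> v = 0) \<and>
     (\<forall>a. is_root H a \<longleftrightarrow> (\<exists>\<alpha>\<in>\<Phi>. \<forall>h\<in>H. a h = r \<alpha> h))"

text \<open>The root vectors of a Chevalley basis. The remaining basis elements are the coroots
  \<open>br (x \<alpha>) (x (- \<alpha>))\<close> for simple \<open>\<alpha>\<close>. As Chevalley showed, the last clause amounts to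
  \<open>br (x \<alpha>) (x \<beta>) = \<plusminus> (p + 1) x (\<alpha> + \<beta>)\<close>, where \<open>p\<close> is the largest
  integer with \<open>\<beta> - p \<alpha>\<close> in \<open>\<Phi>\<close>.\<close>

definition chevalley_basis ::
    "'l set \<Rightarrow> 'v::euclidean_space set \<Rightarrow> ('v \<Rightarrow> 'l \<Rightarrow> complex) \<Rightarrow> ('v \<Rightarrow> 'l) \<Rightarrow> bool" where
  "chevalley_basis H \<Phi> r x \<longleftrightarrow>
     (\<forall>\<alpha>\<in>\<Phi>. \<forall>h\<in>H. br h (x \<alpha>) = scale (r \<alpha> h) (x \<alpha>)) \<and>
     (\<forall>\<alpha>\<in>\<Phi>. br (x \<alpha>) (x (- \<alpha>)) \<in> H \<and>
        (\<forall>\<beta>\<in>\<Phi>. r \<beta> (br (x \<alpha>) (x (- \<alpha>))) = of_real (cartan_integer \<beta> \<alpha>))) \<and>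
     (\<forall>\<alpha>\<in>\<Phi>. \<forall>\<beta>\<in>\<Phi>. \<alpha> + \<beta> \<in> \<Phi> \<longrightarrow>
        (\<exists>c. br (x \<alpha>) (x \<beta>) = scale c (x (\<alpha> + \<beta>)) \<and>
             br (x (- \<alpha>)) (x (- \<beta>)) = scale (- c) (x (- (\<alpha> + \<beta>)))))"

definition lie_representation :: "('l \<Rightarrow> complex^'n^'n) \<Rightarrow> bool" where
  "lie_representation \<pi> \<longleftrightarrow>
     (\<forall>y z. \<pi> (y + z) = \<pi> y + \<pi> z) \<and>
     (\<forall>c y. \<pi> (scale c y) = mat c ** \<pi> y) \<and>
     (\<forall>y z. \<pi> (br y z) = \<pi> y ** \<pi> z - \<pi> z ** \<pi> y)"

definition faithful_representation :: "('l \<Rightarrow> complex^'n^'n) \<Rightarrow> bool" where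
  "faithful_representation \<pi> \<longleftrightarrow> lie_representation \<pi> \<and> inj \<pi>"

end


section \<open>Chevalley groups\<close>

text \<open>The columns of \<open>P\<close> form a \<open>\<int>\<close>-basis of an admissible lattice: a lattice that spans the
  representation space and is stable under the Kostant \<open>\<int>\<close>-form, which is generated by
  the divided powers of the root vectors \<open>x \<alpha>\<close>.\<close>

definition integer_lattice :: "complex^'n^'n \<Rightarrow> (complex^'n) set" where
  "integer_lattice P = {P *v z | z. \<forall>i. z $ i \<in> \<int>}"

definition admissible_lattice_basis ::
    "'v set \<Rightarrow> ('l \<Rightarrow> complex^'n^'n) \<Rightarrow> ('v \<Rightarrow> 'l) \<Rightarrow> complex^'n^'n \<Rightarrow> bool" where
  "admissible_lattice_basis \<Phi> \<pi> x P \<longleftrightarrow>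
     invertible P \<and>
     (\<forall>\<alpha>\<in>\<Phi>. \<forall>k. \<forall>v\<in>integer_lattice P.
        (mat (1 / fact k) ** mat_pow (\<pi> (x \<alpha>)) k) *v v \<in> integer_lattice P)"

text \<open>The complex group generated by the \<open>exp (t \<pi>(x \<alpha>))\<close>, written in the basis \<open>P\<close>. The inverse
  of a generator is the generator with parameter \<open>- t\<close>.\<close>

inductive_set complex_chevalley_group ::
    "'v set \<Rightarrow> ('l \<Rightarrow> complex^'n^'n) \<Rightarrow> ('v \<Rightarrow> 'l) \<Rightarrow> complex^'n^'n \<Rightarrow> (complex^'n^'n) set"
  for \<Phi> \<pi> x P where
  one: "mat 1 \<in> complex_chevalley_group \<Phi> \<pi> x P"
| step: "\<alpha> \<in> \<Phi> \<Longrightarrow> g \<in> complex_chevalley_group \<Phi> \<pi> x P \<Longrightarrow>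
    (matrix_inv P ** mat_exp (mat t ** \<pi> (x \<alpha>)) ** P) ** g \<in> complex_chevalley_group \<Phi> \<pi> x P"

text \<open>Polynomials with integer coefficients in the matrix entries; a monomial is its exponent map.\<close>

type_synonym 'n entry_poly = "('n \<times> 'n \<Rightarrow>\<^sub>0 nat) \<Rightarrow>\<^sub>0 int"

definition eval_entry_poly :: "'n::finite entry_poly \<Rightarrow> 'r::comm_ring_1^'n^'n \<Rightarrow> 'r" where
  "eval_entry_poly p A =
     (\<Sum>m\<in>Poly_Mapping.keys p. of_int (Poly_Mapping.lookup p m) *
        (\<Prod>(i, j)\<in>UNIV. (A $ i $ j) ^ Poly_Mapping.lookup m (i, j)))"

text \<open>The \<open>R\<close>-points of the closed subscheme of \<open>SL\<^sub>n\<close> over \<open>\<int>\<close> defined by all integer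
  polynomials that vanish on the complex group.\<close>

definition chevalley_group ::
    "'v set \<Rightarrow> ('l \<Rightarrow> complex^'n^'n) \<Rightarrow> ('v \<Rightarrow> 'l) \<Rightarrow> complex^'n^'n \<Rightarrow>
     'r::comm_ring_1 set \<Rightarrow> ('r^'n^'n) set" where
  "chevalley_group \<Phi> \<pi> x P R =
     {A. (\<forall>i j. A $ i $ j \<in> R) \<and> det A = 1 \<and>
         (\<forall>p. (\<forall>g\<in>complex_chevalley_group \<Phi> \<pi> x P. eval_entry_poly p g = 0) \<longrightarrow>
              eval_entry_poly p A = 0)}"

definition matrix_group_struct :: "('r::comm_ring_1^'n^'n) set \<Rightarrow> ('r^'n^'n) struct" where
  "matrix_group_struct G = \<lparr>dom = G,
     ops = [(2, \<lambda>xs. xs ! 0 ** xs ! 1), (1, \<lambda>xs. matrix_inv (xs ! 0)), (0, \<lambda>_. mat 1)]\<rparr>"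

end

(*
  D(R) decidable implies D(G(R)) decidable: by Hilbert's basis theorem G(R) is cut out of SL_n(R) by
  finitely many integer polynomials, so an equation in G(R) is a finite system in the matrix entries.

  D(G(R)) decidable implies D(R) decidable: let a be a long root. The elements of G(R) that commute with
  x_c(1) for all roots c with c.a >= 0 form a set that is defined by finitely many equations, and each of
  them is x_a(t) times a central element, with t in R. Commutators with constants remove the central
  factor, and a suitable word u(t), v(s) -> [[[u, c1], v], c2] in two such sets, of parameters t and s,
  takes the value x_c(k t s) for a fixed root c and a fixed nonzero integer k. So R is interpreted in G(R)
  on the elements x_c(k r): addition is the group multiplication and multiplication is the word.
  The structure constants needed for this are those of long roots, where they are 1 up to sign.
*)
theory Submission
  imports Defs
begin

section \<open>Closure properties of total recursive functions\<close>

text \<open>A point of G over R need not be a product of root elements. So G(R) enters only through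
  entries in R, determinant 1, and the integer polynomials that vanish on the complex group. That
  conjugation preserves the span of root vectors and coroots is a system of such polynomials, since
  a subspace spanned by integral matrices has the same integral equations over every field of
  characteristic zero. The analysis of the centralizer starts from this and finds the parameter t in
  the field only. That t lies in R is a separate matter of divisibility: conjugating a suitable root
  vector adds t, up to sign, times an integral matrix whose entries have gcd 1, and these gcds are
  controlled by structure constants 1, -1, 2, -2. The rank provides a root with Cartan integer -1 at
  a long root. The two roots can be chosen to span a plane of type A_2 or B_2, since in type G_2 the
  long roots form an A_2. The integer k is 1 or -1 for A_2 and 2 or -2 for B_2. Decidability refers
  to some enumeration, so both directions rest on one transfer theorem that also constructs an
  enumeration.\<close>

definition recfn :: "nat \<Rightarrow> (nat list \<Rightarrow> nat) \<Rightarrow> bool" where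
  "recfn n F \<longleftrightarrow> (\<exists>f. \<forall>xs. length xs = n \<longrightarrow> computes f xs (F xs))"

definition recpred :: "nat \<Rightarrow> (nat list \<Rightarrow> bool) \<Rightarrow> bool" where
  "recpred n Q \<longleftrightarrow> recfn n (\<lambda>xs. if Q xs then 1 else 0)"

lemma recfn_cong:
  assumes "recfn n F" and "\<And>xs. length xs = n \<Longrightarrow> F xs = G xs"
  shows "recfn n G"
proof -
  obtain f where f: "\<forall>xs. length xs = n \<longrightarrow> computes f xs (F xs)"
    using assms(1) unfolding recfn_def by blast
  have "\<forall>xs. length xs = n \<longrightarrow> computes f xs (G xs)"
    using f assms(2) by simp
  then show ?thesis unfolding recfn_def by blast
qed

lemma recfn_zero: "recfn n (\<lambda>_. 0)"
  unfolding recfn_def using computes.zero by blast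

lemma recfn_proj: "i < n \<Longrightarrow> recfn n (\<lambda>xs. xs ! i)"
  unfolding recfn_def using computes.proj by blast

lemma recfn_compose:
  assumes F: "recfn (length Gs) F" and G: "\<And>G. G \<in> set Gs \<Longrightarrow> recfn n G"
  shows "recfn n (\<lambda>xs. F (map (\<lambda>G. G xs) Gs))"
proof -
  obtain f where f: "\<And>xs. length xs = length Gs \<Longrightarrow> computes f xs (F xs)"
    using F unfolding recfn_def by blast
  define g where "g G = (SOME g. \<forall>xs. length xs = n \<longrightarrow> computes g xs (G xs))" for G
  have g: "computes (g G) xs (G xs)" if "G \<in> set Gs" "length xs = n" for G xs
    using someI_ex[OF G[OF that(1), unfolded recfn_def]] that(2) unfolding g_def by blast
  have "computes (Comp f (map g Gs)) xs (F (map (\<lambda>G. G xs) Gs))" if "length xs = n" for xs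
  proof (rule computes.comp)
    show "list_all2 (\<lambda>g y. computes g xs y) (map g Gs) (map (\<lambda>G. G xs) Gs)"
      using g that by (auto simp: list_all2_conv_all_nth)
    show "computes f (map (\<lambda>G. G xs) Gs) (F (map (\<lambda>G. G xs) Gs))"
      by (rule f) simp
  qed
  then show ?thesis unfolding recfn_def by blast
qed

lemma recfn_compose1:
  assumes "recfn 1 (\<lambda>xs. f (xs ! 0))" and "recfn n G"
  shows "recfn n (\<lambda>xs. f (G xs))"
  using recfn_compose[of "[G]" "\<lambda>xs. f (xs ! 0)" n] assms by simp

lemma recfn_compose2:
  assumes "recfn 2 (\<lambda>xs. f (xs ! 0) (xs ! 1))" and "recfn n G" and "recfn n H"
  shows "recfn n (\<lambda>xs. f (G xs) (H xs))"
  using recfn_compose[of "[G, H]" "\<lambda>xs. f (xs ! 0) (xs ! 1)" n] assms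
  by (auto simp: numeral_2_eq_2)

lemma recfn_Suc:
  assumes "recfn n G" shows "recfn n (\<lambda>xs. Suc (G xs))"
proof (rule recfn_compose1[OF _ assms])
  have "computes Succ xs (Suc (xs ! 0))" if "length xs = 1" for xs
    using that computes.succ by (cases xs) auto
  then show "recfn 1 (\<lambda>xs. Suc (xs ! 0))"
    unfolding recfn_def by blast
qed

lemma recfn_const: "recfn n (\<lambda>_. c)"
  by (induction c) (auto intro: recfn_zero recfn_Suc)

text \<open>Inside a primitive recursion the accumulated value and the counter stand in front of the
  parameters. This carries a function of the parameters alone into that setting, with k = 2.\<close>

lemma recfn_drop:
  assumes "recfn n H" shows "recfn (n + k) (\<lambda>zs. H (drop k zs))"
proof -
  have "recfn (n + k) (\<lambda>zs. H (map (\<lambda>G. G zs) (map (\<lambda>i zs. zs ! (k + i)) [0..<n])))"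
    by (rule recfn_compose) (use assms in \<open>auto intro: recfn_proj\<close>)
  then show ?thesis
  proof (rule recfn_cong)
    fix zs :: "nat list" assume "length zs = n + k"
    then have "map (\<lambda>G. G zs) (map (\<lambda>i zs. zs ! (k + i)) [0..<n]) = drop k zs"
      by (intro nth_equalityI) auto
    then show "H (map (\<lambda>G. G zs) (map (\<lambda>i zs. zs ! (k + i)) [0..<n])) = H (drop k zs)"
      by simp
  qed
qed

text \<open>\<open>PrimRec\<close> hands its step function the previous value, then the counter,
  then the parameters; hence \<open>zs ! 0\<close>, \<open>zs ! 1\<close> and
  \<open>drop 2 zs\<close>. One further composition lets the length of the recursion depend on the
  parameters.\<close>

lemma recfn_rec_nat:
  assumes K: "recfn n K" and A: "recfn n A"
    and G: "recfn (n + 2) (\<lambda>zs. G (zs ! 0) (zs ! 1) (drop 2 zs))"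
  shows "recfn n (\<lambda>xs. rec_nat (A xs) (\<lambda>k y. G y k xs) (K xs))"
proof -
  obtain a where a: "\<And>xs. length xs = n \<Longrightarrow> computes a xs (A xs)"
    using A unfolding recfn_def by blast
  obtain g where g: "\<And>zs. length zs = n + 2 \<Longrightarrow> computes g zs (G (zs ! 0) (zs ! 1) (drop 2 zs))"
    using G unfolding recfn_def by blast
  have "computes (PrimRec a g) (k # xs) (rec_nat (A xs) (\<lambda>k y. G y k xs) k)"
    if "length xs = n" for k xs
  proof (induction k)
    case 0
    show ?case using computes.prec_0[OF a[OF that]] by simp
  next
    case (Suc k)
    show ?case
      using computes.prec_Suc[OF Suc g[of "rec_nat (A xs) (\<lambda>k y. G y k xs) k # k # xs"]] that
      by simp
  qed
  then have "computes (PrimRec a g) zs (rec_nat (A (tl zs)) (\<lambda>k y. G y k (tl zs)) (hd zs))"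
    if "length zs = Suc n" for zs
    using that by (cases zs) auto
  then have 1: "recfn (Suc n) (\<lambda>zs. rec_nat (A (tl zs)) (\<lambda>k y. G y k (tl zs)) (hd zs))"
    unfolding recfn_def by blast
  let ?Gs = "K # map (\<lambda>i xs. xs ! i) [0..<n]"
  have "recfn n (\<lambda>xs. (\<lambda>zs. rec_nat (A (tl zs)) (\<lambda>k y. G y k (tl zs)) (hd zs))
          (map (\<lambda>G. G xs) ?Gs))"
    by (rule recfn_compose) (use 1 K in \<open>auto intro: recfn_proj\<close>)
  then show ?thesis
  proof (rule recfn_cong)
    fix xs :: "nat list" assume "length xs = n"
    then have "map (\<lambda>i. xs ! i) [0..<n] = xs"
      by (intro nth_equalityI) auto
    then have "map ((\<lambda>G. G xs) \<circ> (\<lambda>i xs. xs ! i)) [0..<n] = xs"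
      by (simp add: o_def)
    then show "(\<lambda>zs. rec_nat (A (tl zs)) (\<lambda>k y. G y k (tl zs)) (hd zs)) (map (\<lambda>G. G xs) ?Gs) =
        rec_nat (A xs) (\<lambda>k y. G y k xs) (K xs)" by simp
  qed
qed

lemma recfn_Least:
  assumes F: "recfn (Suc n) (\<lambda>zs. F (zs ! 0) (tl zs))"
    and ex: "\<And>xs. length xs = n \<Longrightarrow> \<exists>k. F k xs = 0"
  shows "recfn n (\<lambda>xs. LEAST k. F k xs = 0)"
proof -
  obtain f where f: "\<And>zs. length zs = Suc n \<Longrightarrow> computes f zs (F (zs ! 0) (tl zs))"
    using F unfolding recfn_def by blast
  have "computes (Mu f) xs (LEAST k. F k xs = 0)" if xs: "length xs = n" for xs
  proof (rule computes.mu)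
    have "F (LEAST k. F k xs = 0) xs = 0"
      using ex[OF xs] LeastI_ex by fast
    then show "computes f ((LEAST k. F k xs = 0) # xs) 0"
      using f[of "(LEAST k. F k xs = 0) # xs"] xs by simp
    show "\<forall>m<LEAST k. F k xs = 0. \<exists>k. computes f (m # xs) (Suc k)"
    proof (intro allI impI)
      fix m assume "m < (LEAST k. F k xs = 0)"
      then have "F m xs \<noteq> 0" by (metis not_less_Least)
      then show "\<exists>k. computes f (m # xs) (Suc k)"
        using f[of "m # xs"] xs by (metis length_Cons list.sel(3) not0_implies_Suc nth_Cons_0)
    qed
  qed
  then show ?thesis unfolding recfn_def by blast
qed

lemma recfn_If:
  assumes "recpred n Q" "recfn n A" "recfn n B"
  shows "recfn n (\<lambda>xs. if Q xs then A xs else B xs)"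
proof -
  \<comment> \<open>A case distinction is a recursion of length 0 or 1: length 0 returns
    \<open>B\<close>, length 1 returns \<open>A\<close>.\<close>
  have "recfn n (\<lambda>xs. rec_nat (B xs) (\<lambda>k y. A xs) (if Q xs then 1 else 0))"
    by (rule recfn_rec_nat) (use assms recfn_drop[of n A 2] in \<open>auto simp: recpred_def\<close>)
  then show ?thesis by (rule recfn_cong) auto
qed

lemma recfn_add:
  assumes "recfn n A" "recfn n B" shows "recfn n (\<lambda>xs. A xs + B xs)"
proof -
  have "recfn n (\<lambda>xs. rec_nat (A xs) (\<lambda>k y. Suc y) (B xs))"
    by (rule recfn_rec_nat) (use assms in \<open>auto intro: recfn_Suc recfn_proj\<close>)
  moreover have "rec_nat a (\<lambda>k y. Suc y) b = a + b" for a b by (induction b) auto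
  ultimately show ?thesis by simp
qed

lemma recfn_mult:
  assumes "recfn n A" "recfn n B" shows "recfn n (\<lambda>xs. A xs * B xs)"
proof -
  have "recfn n (\<lambda>xs. rec_nat 0 (\<lambda>k y. y + A xs) (B xs))"
    by (rule recfn_rec_nat)
      (use assms recfn_drop[of n A 2] in \<open>auto intro: recfn_zero recfn_add recfn_proj\<close>)
  moreover have "rec_nat 0 (\<lambda>k y. y + a) b = a * b" for a b :: nat by (induction b) auto
  ultimately show ?thesis by simp
qed

lemma recfn_diff:
  assumes "recfn n A" "recfn n B" shows "recfn n (\<lambda>xs. A xs - B xs)"
proof -
  have pred: "recfn m (\<lambda>xs. C xs - 1)" if "recfn m C" for m C
  proof -
    have "recfn m (\<lambda>xs. rec_nat 0 (\<lambda>k y. k) (C xs))"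
      by (rule recfn_rec_nat) (use that in \<open>auto intro: recfn_zero recfn_proj\<close>)
    moreover have "rec_nat 0 (\<lambda>k y. k) b = b - 1" for b :: nat by (cases b) auto
    ultimately show ?thesis by simp
  qed
  have "recfn n (\<lambda>xs. rec_nat (A xs) (\<lambda>k y. y - 1) (B xs))"
    by (rule recfn_rec_nat) (use assms in \<open>auto intro: pred[simplified] recfn_proj\<close>)
  moreover have "rec_nat a (\<lambda>k y. y - 1) b = a - b" for a b :: nat by (induction b) auto
  ultimately show ?thesis by simp
qed

lemma recpred_le:
  assumes "recfn n A" "recfn n B" shows "recpred n (\<lambda>xs. A xs \<le> B xs)"
proof -
  have "recfn n (\<lambda>xs. 1 - (A xs - B xs))"
    using assms by (intro recfn_diff recfn_const)
  then show ?thesis unfolding recpred_def by (rule recfn_cong) auto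
qed

lemma recpred_conj:
  assumes "recpred n Q" "recpred n Q'" shows "recpred n (\<lambda>xs. Q xs \<and> Q' xs)"
proof -
  have "recfn n (\<lambda>xs. if Q xs then (if Q' xs then 1 else 0) else 0)"
    using assms by (intro recfn_If recfn_const)
  then show ?thesis unfolding recpred_def by (rule recfn_cong) auto
qed

lemma recpred_not:
  assumes "recpred n Q" shows "recpred n (\<lambda>xs. \<not> Q xs)"
proof -
  have "recfn n (\<lambda>xs. if Q xs then 0 else 1)"
    using assms by (intro recfn_If recfn_const)
  then show ?thesis unfolding recpred_def by (rule recfn_cong) auto
qed

lemma recpred_eq:
  assumes "recfn n A" "recfn n B" shows "recpred n (\<lambda>xs. A xs = B xs)"
  unfolding eq_iff using assms by (intro recpred_conj recpred_le)

lemma recfn_prod_encode: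
  assumes "recfn n A" "recfn n B" shows "recfn n (\<lambda>xs. prod_encode (A xs, B xs))"
proof -
  have tri: "recfn m (\<lambda>xs. triangle (C xs))" if "recfn m C" for m C
  proof -
    have "recfn m (\<lambda>xs. rec_nat 0 (\<lambda>k y. y + Suc k) (C xs))"
      by (rule recfn_rec_nat) (use that in \<open>auto intro!: recfn_zero recfn_proj recfn_add recfn_Suc\<close>)
    moreover have "rec_nat 0 (\<lambda>k y. y + Suc k) b = triangle b" for b :: nat by (induction b) auto
    ultimately show ?thesis by simp
  qed
  show ?thesis unfolding prod_encode_def prod.case
    using assms by (intro recfn_add tri)
qed

text \<open>\<open>prod_encode (a, b)\<close> is \<open>triangle (a + b) + a\<close>, so the
  diagonal a + b is the least s for which k lies below \<open>triangle (Suc s)\<close>, and a is the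
  position on it. The bound is written as a zero of a truncated difference to fit unbounded
  search.\<close>

lemma prod_decode_Least:
  fixes k :: nat
  defines "s \<equiv> LEAST s. Suc k - triangle (Suc s) = 0"
  shows "prod_decode k = (k - triangle s, s - (k - triangle s))"
proof -
  obtain a b where k: "k = prod_encode (a, b)"
    by (metis prod_decode_inverse surj_pair)
  have mono: "triangle i \<le> triangle j" if "i \<le> j" for i j
    using that by (induction rule: dec_induct) auto
  have "s = a + b" unfolding s_def
  proof (rule Least_equality)
    show "Suc k - triangle (Suc (a + b)) = 0"
      by (simp add: k prod_encode_def)
  next
    fix y assume y: "Suc k - triangle (Suc y) = 0"
    show "a + b \<le> y"
    proof (rule ccontr)
      assume "\<not> a + b \<le> y"
      then have "triangle (Suc y) \<le> triangle (a + b)" by (intro mono) auto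
      then show False using y by (simp add: k prod_encode_def)
    qed
  qed
  then show ?thesis
    using prod_encode_inverse[of "(a, b)"] by (simp add: k prod_encode_def)
qed

lemma
  assumes "recfn n A"
  shows recfn_fst: "recfn n (\<lambda>xs. fst (prod_decode (A xs)))"
    and recfn_snd: "recfn n (\<lambda>xs. snd (prod_decode (A xs)))"
proof -
  define s where "s k = (LEAST s. Suc k - triangle (Suc s) = 0)" for k
  \<comment> \<open>On the pair (0, c) the pairing function takes the value
    \<open>triangle c\<close>.\<close>
  have tri: "recfn m (\<lambda>xs. triangle (C xs))" if "recfn m C" for m C
    using recfn_prod_encode[OF recfn_const[of m 0] that] by (simp add: prod_encode_def)
  have "recfn 1 (\<lambda>xs. LEAST s. (\<lambda>s xs. Suc (xs ! 0) - triangle (Suc s)) s xs = 0)"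
  proof (rule recfn_Least)
    show "recfn (Suc 1) (\<lambda>zs. Suc (tl zs ! 0) - triangle (Suc (zs ! 0)))"
    proof (rule recfn_cong)
      show "recfn (Suc 1) (\<lambda>zs. Suc (zs ! 1) - triangle (Suc (zs ! 0)))"
        by (intro recfn_diff recfn_Suc tri recfn_proj) auto
    qed (auto simp: nth_tl)
    have "k \<le> triangle k" for k by (induction k) auto
    then show "\<exists>k. Suc (xs ! 0) - triangle (Suc k) = 0" for xs :: "nat list"
      by (metis diff_is_0_eq')
  qed
  then have s: "recfn n (\<lambda>xs. s (A xs))"
    using recfn_compose1[OF _ assms, of s] unfolding s_def by simp
  have *: "prod_decode k = (k - triangle (s k), s k - (k - triangle (s k)))" for k
    unfolding s_def by (rule prod_decode_Least)
  show "recfn n (\<lambda>xs. fst (prod_decode (A xs)))" "recfn n (\<lambda>xs. snd (prod_decode (A xs)))"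
    unfolding * fst_conv snd_conv by (intro recfn_diff assms s tri)+
qed

lemma recfn_list_encode:
  assumes "\<And>G. G \<in> set Gs \<Longrightarrow> recfn n G"
  shows "recfn n (\<lambda>xs. list_encode (map (\<lambda>G. G xs) Gs))"
  using assms by (induction Gs) (auto intro!: recfn_zero recfn_Suc recfn_prod_encode)

section \<open>Computable families of systems\<close>

fun subst_trm :: "(nat \<Rightarrow> trm) \<Rightarrow> trm \<Rightarrow> trm" where
  "subst_trm \<sigma> (Var i) = \<sigma> i"
| "subst_trm \<sigma> (Const c) = Const c"
| "subst_trm \<sigma> (App f ts) = App f (map (subst_trm \<sigma>) ts)"

definition subst_sys :: "(nat \<Rightarrow> trm) \<Rightarrow> system \<Rightarrow> system" where
  "subst_sys \<sigma> S = map (\<lambda>(s, t). (subst_trm \<sigma> s, subst_trm \<sigma> t)) S"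

definition holds :: "'a struct \<Rightarrow> (nat \<Rightarrow> 'a) \<Rightarrow> (nat \<Rightarrow> 'a) \<Rightarrow> system \<Rightarrow> bool" where
  "holds A \<nu> \<rho> S \<longleftrightarrow> (\<forall>(s, t)\<in>set S. eval_trm A \<nu> \<rho> s = eval_trm A \<nu> \<rho> t)"

text \<open>The relation that a system defines existentially: the first \<open>length xs\<close>
  variables are prescribed, all others are quantified over the domain.\<close>

definition sat :: "'a struct \<Rightarrow> (nat \<Rightarrow> 'a) \<Rightarrow> system \<Rightarrow> 'a list \<Rightarrow> bool" where
  "sat A \<nu> S xs \<longleftrightarrow>
     (\<exists>\<rho>. range \<rho> \<subseteq> dom A \<and> (\<forall>i<length xs. \<rho> i = xs ! i) \<and> holds A \<nu> \<rho> S)"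

lemma solvable_in_iff_holds:
  "solvable_in A \<nu> S \<longleftrightarrow> (\<exists>\<rho>. range \<rho> \<subseteq> dom A \<and> holds A \<nu> \<rho> S)"
  unfolding solvable_in_def holds_def by (simp add: image_subset_iff)

lemma eval_subst_trm: "eval_trm A \<nu> \<rho> (subst_trm \<sigma> t) = eval_trm A \<nu> (\<lambda>i. eval_trm A \<nu> \<rho> (\<sigma> i)) t"
proof (induction t)
  case (App f ts)
  then have "map (eval_trm A \<nu> \<rho> \<circ> subst_trm \<sigma>) ts = map (eval_trm A \<nu> (\<lambda>i. eval_trm A \<nu> \<rho> (\<sigma> i))) ts"
    by simp
  then show ?case by (simp only: subst_trm.simps eval_trm.simps map_map)
qed auto

lemma wf_subst_trm: "wf_trm A t \<Longrightarrow> (\<And>i. wf_trm A (\<sigma> i)) \<Longrightarrow> wf_trm A (subst_trm \<sigma> t)"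
  by (induction t) auto

lemma holds_subst_sys:
  "holds A \<nu> \<rho> (subst_sys \<sigma> S) \<longleftrightarrow> holds A \<nu> (\<lambda>i. eval_trm A \<nu> \<rho> (\<sigma> i)) S"
  unfolding holds_def subst_sys_def by (auto simp: eval_subst_trm)

lemma holds_append: "holds A \<nu> \<rho> (S @ S') \<longleftrightarrow> holds A \<nu> \<rho> S \<and> holds A \<nu> \<rho> S'"
  unfolding holds_def by auto

lemma wf_system_append: "wf_system A (S @ S') \<longleftrightarrow> wf_system A S \<and> wf_system A S'"
  unfolding wf_system_def by auto

lemma wf_subst_sys: "wf_system A S \<Longrightarrow> (\<And>i. wf_trm A (\<sigma> i)) \<Longrightarrow> wf_system A (subst_sys \<sigma> S)"
  unfolding wf_system_def subst_sys_def by (auto intro!: wf_subst_trm)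

text \<open>\<open>T\<close> is a fixed template, so the recursion over it takes place outside the
  recursive functions; only the substituted terms depend on the input.\<close>

lemma recfn_code_subst_trm:
  assumes "\<And>j. recfn n (\<lambda>xs. code_trm (\<sigma> xs j))"
  shows "recfn n (\<lambda>xs. code_trm (subst_trm (\<sigma> xs) T))"
proof (induction T)
  case (App f ts)
  have "recfn n (\<lambda>xs. list_encode (map (\<lambda>G. G xs) (map (\<lambda>t xs. code_trm (subst_trm (\<sigma> xs) t)) ts)))"
    by (rule recfn_list_encode) (use App in auto)
  then have "recfn n (\<lambda>xs. list_encode (map (\<lambda>t. code_trm (subst_trm (\<sigma> xs) t)) ts))"
    by (simp add: o_def)
  then show ?case
    by (auto intro!: recfn_prod_encode recfn_const simp: o_def)
qed (auto intro!: assms recfn_const)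

text \<open>The code of a list begins with its head, so a fixed list is put in front of a coded one
  by pairing alone, without decoding. Systems are therefore grown at the front.\<close>

definition code_append :: "system \<Rightarrow> nat \<Rightarrow> nat" where
  "code_append S y =
     foldr (\<lambda>(s, t) y. Suc (prod_encode (prod_encode (code_trm s, code_trm t), y))) S y"

lemma code_system_append: "code_system (S @ X) = code_append S (code_system X)"
  by (induction S) (auto simp: code_append_def code_system_def)

lemma recfn_code_append_subst_sys:
  assumes "\<And>j. recfn n (\<lambda>xs. code_trm (\<sigma> xs j))" and "recfn n Y"
  shows "recfn n (\<lambda>xs. code_append (subst_sys (\<sigma> xs) T) (Y xs))"
proof (induction T)
  case (Cons p T)
  obtain s t where p: "p = (s, t)" by fastforce
  have "code_append (subst_sys \<sigma>' (p # T)) y =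
      Suc (prod_encode (prod_encode (code_trm (subst_trm \<sigma>' s), code_trm (subst_trm \<sigma>' t)),
                        code_append (subst_sys \<sigma>' T) y))" for \<sigma>' y
    by (simp add: code_append_def subst_sys_def p)
  then show ?case
    using Cons by (auto intro!: recfn_Suc recfn_prod_encode recfn_code_subst_trm assms(1))
qed (simp add: subst_sys_def code_append_def assms(2))

text \<open>A rule \<open>(Q, \<sigma>, T)\<close> contributes at stage \<open>k\<close> the instance of the template \<open>T\<close> under \<open>\<sigma> k c\<close>,
  provided that \<open>Q k c\<close> holds.\<close>

type_synonym rule = "(nat \<Rightarrow> nat \<Rightarrow> bool) \<times> (nat \<Rightarrow> nat \<Rightarrow> nat \<Rightarrow> trm) \<times> system"

fun stage :: "rule list \<Rightarrow> nat \<Rightarrow> nat \<Rightarrow> system \<Rightarrow> system" where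
  "stage [] k c X = X"
| "stage ((Q, \<sigma>, T) # rs) k c X =
     (if Q k c then subst_sys (\<sigma> k c) T @ stage rs k c X else stage rs k c X)"

text \<open>All systems that the reductions produce have this form: finitely many templates,
  instantiated for every k below a bound by substitutions computable from k and c. One primitive
  recursion then computes the code.\<close>

primrec stages :: "rule list \<Rightarrow> nat \<Rightarrow> nat \<Rightarrow> system" where
  "stages rs c 0 = []"
| "stages rs c (Suc k) = stage rs k c (stages rs c k)"

definition computable_rule :: "rule \<Rightarrow> bool" where
  "computable_rule = (\<lambda>(Q, \<sigma>, T).
     recpred 2 (\<lambda>xs. Q (xs ! 0) (xs ! 1)) \<and> (\<forall>j. recfn 2 (\<lambda>xs. code_trm (\<sigma> (xs ! 0) (xs ! 1) j))))"

lemma holds_stage: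
  "holds A \<nu> \<rho> (stage rs k c X) \<longleftrightarrow>
     holds A \<nu> \<rho> X \<and> (\<forall>(Q, \<sigma>, T)\<in>set rs. Q k c \<longrightarrow> holds A \<nu> (\<lambda>i. eval_trm A \<nu> \<rho> (\<sigma> k c i)) T)"
  by (induction rs k c X rule: stage.induct) (auto simp: holds_append holds_subst_sys)

lemma holds_stages:
  "holds A \<nu> \<rho> (stages rs c K) \<longleftrightarrow>
     (\<forall>k<K. \<forall>(Q, \<sigma>, T)\<in>set rs. Q k c \<longrightarrow> holds A \<nu> (\<lambda>i. eval_trm A \<nu> \<rho> (\<sigma> k c i)) T)"
  by (induction K) (auto simp: holds_stage less_Suc_eq, simp add: holds_def)

lemma wf_stages:
  assumes "\<And>Q \<sigma> T k c i. (Q, \<sigma>, T) \<in> set rs \<Longrightarrow> wf_system A T \<and> wf_trm A (\<sigma> k c i)"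
  shows "wf_system A (stages rs c K)"
proof (induction K)
  case (Suc K)
  have "wf_system A (stage rs' K c X)" if "set rs' \<subseteq> set rs" "wf_system A X" for rs' X
    using that
  proof (induction rs')
    case (Cons r rs')
    obtain Q \<sigma> T where "r = (Q, \<sigma>, T)" using prod_cases3 by blast
    then show ?case using Cons assms[of Q \<sigma> T]
      by (auto simp: wf_system_append intro!: wf_subst_sys)
  qed auto
  then show ?case using Suc by simp
qed (simp add: wf_system_def)

fun code_stage :: "rule list \<Rightarrow> nat \<Rightarrow> nat \<Rightarrow> nat \<Rightarrow> nat" where
  "code_stage [] k c y = y"
| "code_stage ((Q, \<sigma>, T) # rs) k c y =
     (if Q k c then code_append (subst_sys (\<sigma> k c) T) (code_stage rs k c y)
      else code_stage rs k c y)"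

lemma code_system_stage: "code_system (stage rs k c X) = code_stage rs k c (code_system X)"
  by (induction rs k c X rule: stage.induct) (auto simp: code_system_append)

lemma recfn_code_stage:
  assumes "\<And>r. r \<in> set rs \<Longrightarrow> computable_rule r"
    and K: "recfn n K" and C: "recfn n C" and Y: "recfn n Y"
  shows "recfn n (\<lambda>xs. code_stage rs (K xs) (C xs) (Y xs))"
  using assms(1)
proof (induction rs)
  case (Cons r rs)
  obtain Q \<sigma> T where r: "r = (Q, \<sigma>, T)" using prod_cases3 by blast
  have "recpred n (\<lambda>xs. Q (K xs) (C xs))"
    using Cons.prems[of r] recfn_compose2[OF _ K C, of "\<lambda>k c. if Q k c then 1 else 0"]
    by (auto simp: r computable_rule_def recpred_def)
  moreover have "recfn n (\<lambda>xs. code_trm (\<sigma> (K xs) (C xs) j))" for j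
    using Cons.prems[of r] recfn_compose2[OF _ K C, of "\<lambda>k c. code_trm (\<sigma> k c j)"]
    by (auto simp: r computable_rule_def)
  ultimately have "recfn n (\<lambda>xs. if Q (K xs) (C xs)
      then code_append (subst_sys (\<sigma> (K xs) (C xs)) T) (code_stage rs (K xs) (C xs) (Y xs))
      else code_stage rs (K xs) (C xs) (Y xs))"
    using Cons by (intro recfn_If recfn_code_append_subst_sys) auto
  then show ?case by (rule recfn_cong) (simp add: r)
qed (simp add: Y)

lemma recfn_code_stages:
  assumes rs: "\<And>r. r \<in> set rs \<Longrightarrow> computable_rule r"
    and K: "recfn n K" and C: "recfn n C"
  shows "recfn n (\<lambda>xs. code_system (stages rs (C xs) (K xs)))"
proof -
  have "recfn n (\<lambda>xs. rec_nat 0 (\<lambda>k y. code_stage rs k (C xs) y) (K xs))"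
    by (rule recfn_rec_nat)
      (use K in \<open>auto intro!: recfn_zero recfn_code_stage rs recfn_proj recfn_drop[OF C, of 2, simplified]\<close>)
  moreover have "rec_nat 0 (\<lambda>k y. code_stage rs k c y) K = code_system (stages rs c K)" for c K
    by (induction K) (auto simp: code_system_stage, simp add: code_system_def)
  ultimately show ?thesis by simp
qed

text \<open>The assumed algorithm as a subroutine on any computable family of systems. It is called
  for the final answer, and also to decide which tuples of constants represent elements of the
  interpreted structure.\<close>

lemma recpred_solvable:
  assumes f: "\<forall>S. wf_system B S \<longrightarrow> computes f [code_system S] (if solvable_in B \<nu> S then 1 else 0)"
    and wf: "\<And>xs. wf_system B (S xs)" and S: "recfn n (\<lambda>xs. code_system (S xs))"
  shows "recpred n (\<lambda>xs. solvable_in B \<nu> (S xs))"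
proof -
  obtain g where g: "\<forall>xs. length xs = n \<longrightarrow> computes g xs (code_system (S xs))"
    using S unfolding recfn_def by blast
  have "computes (Comp f [g]) xs (if solvable_in B \<nu> (S xs) then 1 else 0)" if "length xs = n" for xs
    by (rule computes.comp[where ys = "[code_system (S xs)]"]) (use g f wf that in auto)
  then show ?thesis unfolding recpred_def recfn_def by blast
qed

section \<open>Decoding\<close>

definition tl_code :: "nat \<Rightarrow> nat" where "tl_code l = snd (prod_decode (l - 1))"
definition hd_code :: "nat \<Rightarrow> nat" where "hd_code l = fst (prod_decode (l - 1))"
definition nth_code :: "nat \<Rightarrow> nat \<Rightarrow> nat" where "nth_code l i = hd_code ((tl_code ^^ i) l)"

text \<open>Past the end the value stays at 0, the code of the empty list: truncated subtraction
  keeps 0, and \<open>prod_decode 0\<close> is (0, 0).\<close>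

lemma tl_code_list_encode: "(tl_code ^^ i) (list_encode ys) = list_encode (drop i ys)"
proof (induction i arbitrary: ys)
  case (Suc i)
  show ?case
  proof (cases "drop i ys")
    case Nil
    then show ?thesis using Suc[of ys]
      by (simp add: tl_code_def prod_decode_def prod_decode_aux.simps)
  next
    case (Cons z zs)
    then have "drop (Suc i) ys = zs" by (metis drop_Suc list.sel(3) tl_drop)
    then show ?thesis using Suc[of ys] Cons by (simp add: tl_code_def)
  qed
qed simp

lemma nth_code_list_encode: "i < length ys \<Longrightarrow> nth_code (list_encode ys) i = ys ! i"
  by (simp add: nth_code_def tl_code_list_encode hd_code_def Cons_nth_drop_Suc[symmetric])

lemma recfn_iterate_tl_code:
  assumes "recfn n L" "recfn n I"
  shows "recfn n (\<lambda>xs. (tl_code ^^ (I xs)) (L xs))"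
proof -
  have "recfn n (\<lambda>xs. rec_nat (L xs) (\<lambda>k y. tl_code y) (I xs))"
    unfolding tl_code_def using assms
    by (intro recfn_rec_nat recfn_snd recfn_diff recfn_const recfn_proj) auto
  moreover have "rec_nat l (\<lambda>k y. tl_code y) i = (tl_code ^^ i) l" for l i
    by (induction i) auto
  ultimately show ?thesis by simp
qed

lemma recfn_nth_code:
  assumes "recfn n L" "recfn n I"
  shows "recfn n (\<lambda>xs. nth_code (L xs) (I xs))"
  unfolding nth_code_def hd_code_def
  by (intro recfn_fst recfn_diff recfn_iterate_tl_code recfn_const assms)

text \<open>Only the empty list has code 0, so an iterated tail tells whether position i
  exists.\<close>

lemma less_length_list_decode_iff: "i < length (list_decode l) \<longleftrightarrow> (tl_code ^^ i) l \<noteq> 0"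
proof -
  have "(tl_code ^^ i) l = list_encode (drop i (list_decode l))"
    using tl_code_list_encode[of i "list_decode l"] by simp
  moreover have "list_encode zs = 0 \<longleftrightarrow> zs = []" for zs
    by (cases zs) auto
  ultimately show ?thesis by (simp add: not_le)
qed

lemma recpred_less_length:
  assumes "recfn n L" "recfn n I"
  shows "recpred n (\<lambda>xs. I xs < length (list_decode (L xs)))"
  unfolding less_length_list_decode_iff using assms
  by (intro recpred_not recpred_eq recfn_iterate_tl_code recfn_const)

lemma recpred_length_eq:
  assumes "recfn n L" shows "recpred n (\<lambda>xs. length (list_decode (L xs)) = r)"
proof (cases r)
  case 0
  have "recpred n (\<lambda>xs. \<not> 0 < length (list_decode (L xs)))"
    using assms by (intro recpred_not recpred_less_length recfn_const)
  then show ?thesis by (simp add: 0)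
next
  case (Suc r')
  have "recpred n (\<lambda>xs. r' < length (list_decode (L xs)) \<and> \<not> r < length (list_decode (L xs)))"
    using assms by (intro recpred_conj recpred_not recpred_less_length recfn_const)
  moreover have "r' < m \<and> \<not> r < m \<longleftrightarrow> m = r" for m using Suc by auto
  ultimately show ?thesis by simp
qed

lemma less_list_encode: "y \<in> set ys \<Longrightarrow> y < list_encode ys"
proof (induction ys)
  case (Cons a ys)
  have "a \<le> prod_encode (a, list_encode ys)" "list_encode ys \<le> prod_encode (a, list_encode ys)"
    by (rule le_prod_encode_1 le_prod_encode_2)+
  then show ?case using Cons by fastforce
qed simp

section \<open>Interpretations\<close>

text \<open>Evaluation on codes, extended to all natural numbers: a number of any other shape gets
  the default value e. The translated system has a block of variables for every number up to the
  code of the given system, so each of these numbers needs a value.\<close>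

function code_val :: "'a struct \<Rightarrow> (nat \<Rightarrow> 'a) \<Rightarrow> (nat \<Rightarrow> 'a) \<Rightarrow> 'a \<Rightarrow> nat \<Rightarrow> 'a" where
  "code_val A \<nu> \<rho> e k =
     (case prod_decode k of (tag, m) \<Rightarrow>
        if tag = 0 then \<rho> m else if tag = 1 then \<nu> m
        else if tag = 2 then (case prod_decode m of (f, l) \<Rightarrow>
          if f < length (ops A) \<and> length (list_decode l) = fst (ops A ! f)
          then snd (ops A ! f) (map (code_val A \<nu> \<rho> e) (list_decode l)) else e)
        else e)"
  by pat_completeness auto
termination
proof (relation "Wellfounded.measure (\<lambda>(_, _, _, _, k). k)")
  show "wf (Wellfounded.measure (\<lambda>(_, _, _, _, k). k))" by simp
next
  fix A :: "'a struct" and \<nu> \<rho> :: "nat \<Rightarrow> 'a" and e :: 'a and k tag m f l a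
  assume k: "(tag, m) = prod_decode k" and m: "(f, l) = prod_decode m" and a: "a \<in> set (list_decode l)"
  have "a < l" using less_list_encode[OF a] by simp
  also have "l \<le> prod_encode (f, l)" by (rule le_prod_encode_2)
  also have "\<dots> = m" using m by simp
  also have "m \<le> prod_encode (tag, m)" by (rule le_prod_encode_2)
  also have "\<dots> = k" using k by simp
  finally show "((A, \<nu>, \<rho>, e, a), A, \<nu>, \<rho>, e, k) \<in> Wellfounded.measure (\<lambda>(_, _, _, _, k). k)" by simp
qed

declare code_val.simps [simp del]

lemma code_val_simps:
  "code_val A \<nu> \<rho> e (prod_encode (0, i)) = \<rho> i"
  "code_val A \<nu> \<rho> e (prod_encode (Suc 0, c)) = \<nu> c"
  "f < length (ops A) \<Longrightarrow> length ks = fst (ops A ! f) \<Longrightarrow>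
     code_val A \<nu> \<rho> e (prod_encode (2, prod_encode (f, list_encode ks))) =
     snd (ops A ! f) (map (code_val A \<nu> \<rho> e) ks)"
  by (simp_all add: code_val.simps[of A \<nu> \<rho> e "prod_encode (_, _)"])

lemma code_val_code_trm:
  "wf_trm A t \<Longrightarrow> code_val A \<nu> \<rho> e (code_trm t) = eval_trm A \<nu> \<rho> t"
proof (induction t)
  case (App f ts)
  then have "map (code_val A \<nu> \<rho> e \<circ> code_trm) ts = map (eval_trm A \<nu> \<rho>) ts" by simp
  then show ?case
    using App.prems code_val_simps(3)[of f A "map code_trm ts"]
    by (simp only: code_trm.simps eval_trm.simps map_map wf_trm.simps length_map)
qed (simp_all add: code_val_simps)

lemma code_val_in:
  assumes "\<And>i. \<rho> i \<in> E" "\<And>c. \<nu> c \<in> E" "e \<in> E"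
    and "\<And>f es. f < length (ops A) \<Longrightarrow> length es = fst (ops A ! f) \<Longrightarrow> set es \<subseteq> E \<Longrightarrow>
           snd (ops A ! f) es \<in> E"
  shows "code_val A \<nu> \<rho> e k \<in> E"
proof (induction k rule: less_induct)
  case (less k)
  obtain tag m where k: "k = prod_encode (tag, m)" by (metis prod_decode_inverse surj_pair)
  obtain f l where m: "m = prod_encode (f, l)" by (metis prod_decode_inverse surj_pair)
  obtain as where l: "l = list_encode as" by (metis list_decode_inverse)
  have "code_val A \<nu> \<rho> e a \<in> E" if "a \<in> set as" for a
  proof (rule less)
    have "a < l" using less_list_encode[OF that] l by simp
    also have "l \<le> m" unfolding m by (rule le_prod_encode_2)
    also have "\<dots> \<le> k" unfolding k by (rule le_prod_encode_2)
    finally show "a < k" .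
  qed
  then have "set (map (code_val A \<nu> \<rho> e) as) \<subseteq> E" by auto
  then show ?case
    unfolding code_val.simps[of A \<nu> \<rho> e k] using assms by (simp add: k m l)
qed

lemma code_trm_arg_le: "t \<in> set ts \<Longrightarrow> code_trm t \<le> code_trm (App f ts)"
proof -
  assume "t \<in> set ts"
  then have "code_trm t \<le> list_encode (map code_trm ts)"
    using less_list_encode[of "code_trm t" "map code_trm ts"] by simp
  also have "\<dots> \<le> prod_encode (f, list_encode (map code_trm ts))" by (rule le_prod_encode_2)
  also have "\<dots> \<le> code_trm (App f ts)" unfolding code_trm.simps by (rule le_prod_encode_2)
  finally show ?thesis .
qed

lemma length_le_list_encode: "length ys \<le> list_encode ys"
proof (induction ys)
  case (Cons a ys)
  then show ?case using le_prod_encode_2[of "list_encode ys" a] by simp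
qed simp

lemma nth_concat_eq_length:
  assumes "\<forall>ys\<in>set yss. length ys = d" "i < d * length yss"
  shows "concat yss ! i = yss ! (i div d) ! (i mod d)"
  using assms
proof (induction yss arbitrary: i)
  case (Cons ys yss)
  show ?case
  proof (cases "i < d")
    case True
    then show ?thesis using Cons.prems by (simp add: nth_append)
  next
    case False
    have "d > 0" using Cons.prems by (auto intro: gr0I)
    then have "i div d = Suc ((i - d) div d)" "i mod d = (i - d) mod d"
      using False by (auto simp: le_div_geq le_mod_geq not_less)
    then show ?thesis using Cons False by (simp add: nth_append)
  qed
qed simp

text \<open>\<open>Rep\<close> represents the elements of \<open>E\<close> by d-tuples over
  \<open>B\<close>. \<open>E\<close> is a superset of \<open>dom A\<close> with evident closure
  under the operations, for instance SL_n(R) around a group of matrices. The assumptions on systems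
  make three relations existentially definable in \<open>B\<close>: to represent an element of
  \<open>dom A\<close>, to represent equal elements, and the graph of each operation. A system over
  \<open>A\<close> with code c is translated by reading every k \<le> c as the code of a term and
  reserving d variables for a representative of its value. The shape of k decides which condition
  these variables satisfy, and each equation asks that two representatives be equal.\<close>

theorem interpretation_decidable:
  fixes A :: "'a struct" and B :: "'b struct" and Rep :: "'b list \<Rightarrow> 'a \<Rightarrow> bool"
  assumes dec: "diophantine_decidable B"
    and ne: "dom A \<noteq> {}" and AE: "dom A \<subseteq> E"
    and closed: "\<And>f es. f < length (ops A) \<Longrightarrow> length es = fst (ops A ! f) \<Longrightarrow> set es \<subseteq> E \<Longrightarrow>
           snd (ops A ! f) es \<in> E"
    and Rep: "\<And>xs e. Rep xs e \<Longrightarrow> length xs = d \<and> set xs \<subseteq> dom B"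
    and Rep_ex: "\<And>e. e \<in> E \<Longrightarrow> \<exists>xs. Rep xs e"
    and SD: "\<And>\<nu>. range \<nu> = dom B \<Longrightarrow> \<exists>S. wf_system B S \<and>
       (\<forall>xs. length xs = d \<longrightarrow> set xs \<subseteq> dom B \<longrightarrow> sat B \<nu> S xs = (\<exists>e\<in>dom A. Rep xs e))"
    and SE: "\<And>\<nu>. range \<nu> = dom B \<Longrightarrow> \<exists>S. wf_system B S \<and>
       (\<forall>xs ys e e'. e \<in> E \<longrightarrow> e' \<in> E \<longrightarrow> Rep xs e \<longrightarrow> Rep ys e' \<longrightarrow> sat B \<nu> S (xs @ ys) = (e = e'))"
    and ST: "\<And>\<nu> f. range \<nu> = dom B \<Longrightarrow> f < length (ops A) \<Longrightarrow> \<exists>S. wf_system B S \<and>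
       (\<forall>ys xss es. length ys = d \<longrightarrow> set ys \<subseteq> dom B \<longrightarrow> length es = fst (ops A ! f) \<longrightarrow>
          set es \<subseteq> E \<longrightarrow> list_all2 Rep xss es \<longrightarrow>
          sat B \<nu> S (ys @ concat xss) = Rep ys (snd (ops A ! f) es))"
  shows "diophantine_decidable A"
proof -
  obtain \<nu> fB where \<nu>: "range \<nu> = dom B"
    and fB: "\<forall>S. wf_system B S \<longrightarrow> computes fB [code_system S] (if solvable_in B \<nu> S then 1 else 0)"
    using dec unfolding diophantine_decidable_def by blast
  obtain TD where wfD: "wf_system B TD" and TD: "\<And>xs. length xs = d \<Longrightarrow> set xs \<subseteq> dom B \<Longrightarrow>
      sat B \<nu> TD xs = (\<exists>e\<in>dom A. Rep xs e)"
    using SD[OF \<nu>] by blast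
  obtain TE where wfE: "wf_system B TE" and TE: "\<And>xs ys e e'. e \<in> E \<Longrightarrow> e' \<in> E \<Longrightarrow> Rep xs e \<Longrightarrow>
      Rep ys e' \<Longrightarrow> sat B \<nu> TE (xs @ ys) = (e = e')"
    using SE[OF \<nu>] by metis
  have "\<exists>TT. \<forall>f<length (ops A). wf_system B (TT f) \<and>
       (\<forall>ys xss es. length ys = d \<longrightarrow> set ys \<subseteq> dom B \<longrightarrow> length es = fst (ops A ! f) \<longrightarrow>
          set es \<subseteq> E \<longrightarrow> list_all2 Rep xss es \<longrightarrow>
          sat B \<nu> (TT f) (ys @ concat xss) = Rep ys (snd (ops A ! f) es))"
    using ST[OF \<nu>] by metis
  then obtain TT where wfT: "\<And>f. f < length (ops A) \<Longrightarrow> wf_system B (TT f)"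
    and TT: "\<And>f ys xss es. f < length (ops A) \<Longrightarrow> length ys = d \<Longrightarrow> set ys \<subseteq> dom B \<Longrightarrow>
          length es = fst (ops A ! f) \<Longrightarrow> set es \<subseteq> E \<Longrightarrow> list_all2 Rep xss es \<Longrightarrow>
          sat B \<nu> (TT f) (ys @ concat xss) = Rep ys (snd (ops A ! f) es)"
    by blast
  \<comment> \<open>The equality system with \<open>xs\<close> in both halves is satisfied because e
    = e, and read for e and e' it says e = e'.\<close>
  have Rep_inj: "e = e'" if "Rep xs e" "Rep xs e'" "e \<in> E" "e' \<in> E" for xs e e'
    using TE[of e e xs xs] TE[of e e' xs xs] that by simp
  \<comment> \<open>A fixed element with a fixed representative, written by constants of
    \<open>B\<close>; it stands in for tuples that represent nothing in
    \<open>dom A\<close>.\<close>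
  obtain a0 where a0: "a0 \<in> dom A" using ne by blast
  obtain xs0 where xs0: "Rep xs0 a0" using Rep_ex a0 AE by blast
  define n0 where "n0 j = (SOME n. \<nu> n = xs0 ! j)" for j
  have n0: "\<nu> (n0 j) = xs0 ! j" if "j < d" for j
  proof -
    have "xs0 ! j \<in> range \<nu>" using Rep[OF xs0] \<nu> that nth_mem by (metis subsetD)
    then show ?thesis unfolding n0_def by (metis (mono_tags, lifting) imageE someI_ex)
  qed

  \<comment> \<open>A list code m names the tuple of constants with these indices. Whether it
    represents an element of \<open>dom A\<close> is a solvability question over \<open>B\<close>,
    which the given algorithm answers; a tuple that fails is replaced. So every m names an element
    of \<open>dom A\<close>, and its representative is computable from m.\<close>
  define chk where "chk m = solvable_in B \<nu> (subst_sys (\<lambda>j. if j < d then Const (nth_code m j) else Var j) TD)" for m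
  define cidx where "cidx m j = (if chk m then nth_code m j else n0 j)" for m j
  have chk: "chk m \<longleftrightarrow> (\<exists>e\<in>dom A. Rep (map (\<lambda>j. \<nu> (nth_code m j)) [0..<d]) e)" for m
  proof -
    let ?xs = "map (\<lambda>j. \<nu> (nth_code m j)) [0..<d]"
    let ?\<sigma> = "\<lambda>j. if j < d then Const (nth_code m j) else Var j"
    have *: "\<nu> n \<in> dom B" for n using \<nu> by blast
    have "chk m \<longleftrightarrow> sat B \<nu> TD ?xs"
    proof
      assume "chk m"
      then obtain \<rho> where \<rho>: "range \<rho> \<subseteq> dom B" "holds B \<nu> (\<lambda>i. eval_trm B \<nu> \<rho> (?\<sigma> i)) TD"
        unfolding chk_def solvable_in_iff_holds holds_subst_sys by blast
      show "sat B \<nu> TD ?xs" unfolding sat_def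
        by (rule exI[of _ "\<lambda>i. eval_trm B \<nu> \<rho> (?\<sigma> i)"]) (use \<rho> * in auto)
    next
      assume "sat B \<nu> TD ?xs"
      then obtain \<rho> where \<rho>: "range \<rho> \<subseteq> dom B" "\<forall>i<d. \<rho> i = \<nu> (nth_code m i)" "holds B \<nu> \<rho> TD"
        unfolding sat_def by auto
      have "(\<lambda>i. eval_trm B \<nu> \<rho> (?\<sigma> i)) = \<rho>" using \<rho>(2) by auto
      then show "chk m"
        unfolding chk_def solvable_in_iff_holds holds_subst_sys
        using \<rho> by (intro exI[of _ \<rho>]) simp
    qed
    also have "\<dots> \<longleftrightarrow> (\<exists>e\<in>dom A. Rep ?xs e)"
      by (rule TD) (use * in auto)
    finally show ?thesis .
  qed
  define crep where "crep m = map (\<lambda>j. \<nu> (cidx m j)) [0..<d]" for m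
  have crep: "\<exists>e\<in>dom A. Rep (crep m) e" for m
  proof (cases "chk m")
    case True then show ?thesis unfolding crep_def cidx_def using chk[of m] by simp
  next
    case False
    have "crep m = xs0" unfolding crep_def cidx_def
      using False n0 Rep[OF xs0] by (intro nth_equalityI) auto
    then show ?thesis using xs0 a0 by auto
  qed
  define \<nu>A where "\<nu>A m = (SOME e. e \<in> dom A \<and> Rep (crep m) e)" for m
  have \<nu>A: "\<nu>A m \<in> dom A \<and> Rep (crep m) (\<nu>A m)" for m
    unfolding \<nu>A_def by (rule someI_ex) (use crep in blast)
  have range_\<nu>A: "range \<nu>A = dom A"
  proof
    show "range \<nu>A \<subseteq> dom A" using \<nu>A by blast
    show "dom A \<subseteq> range \<nu>A"
    proof
      fix a assume a: "a \<in> dom A"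
      obtain xs where xs: "Rep xs a" using Rep_ex a AE by blast
      have "\<forall>x\<in>set xs. \<exists>n. \<nu> n = x" using Rep[OF xs] \<nu> by (metis imageE subsetD)
      then obtain g where g: "\<And>x. x \<in> set xs \<Longrightarrow> \<nu> (g x) = x" by metis
      define m where "m = list_encode (map g xs)"
      have eq: "map (\<lambda>j. \<nu> (nth_code m j)) [0..<d] = xs"
        using Rep[OF xs] g unfolding m_def
        by (intro nth_equalityI) (auto simp: nth_code_list_encode)
      then have "chk m" using chk a xs by auto
      then have "crep m = xs" using eq unfolding crep_def cidx_def by simp
      then have "\<nu>A m = a" using \<nu>A[of m] Rep_inj xs a AE by blast
      then show "a \<in> range \<nu>A" by blast
    qed
  qed

  \<comment> \<open>Block 2k holds the representative for the code k in its first d variables and,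
    beyond them, the auxiliary variables of the template applied to k. Blocks 2k + 1 serve the
    auxiliary variables of the k-th equation, because the number k also occurs as a term
    code.\<close>
  define ve where "ve k j = Var (prod_encode (2 * k, j))" for k j
  define tag where "tag k = fst (prod_decode k)" for k
  define arg where "arg k = snd (prod_decode k)" for k
  define fn where "fn k = fst (prod_decode (arg k))" for k
  define fargs where "fargs k = snd (prod_decode (arg k))" for k
  define ar where "ar f = fst (ops A ! f)" for f
  define TC :: system where "TC = map (\<lambda>j. (Var j, Var (d + j))) [0..<d]"
  define Q2 where "Q2 f k \<longleftrightarrow> tag k = 2 \<and> fn k = f \<and> length (list_decode (fargs k)) = ar f" for f k
  \<comment> \<open>The substitutions belong to variables, constants, applications of f, and
    equations. In \<open>\<sigma>2\<close> the list \<open>fargs k\<close> holds the codes of the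
    arguments, and position d + i d + j is sent to variable j in the block of the i-th
    argument.\<close>
  define \<sigma>0 where "\<sigma>0 k c j = ve k j" for k c :: nat and j
  define \<sigma>1 where "\<sigma>1 k c j = (if j < d then ve k j else Const (cidx (arg k) (j - d)))" for k c :: nat and j
  define \<sigma>2 where "\<sigma>2 f k c j = (if j < d then ve k j else if j < d + d * ar f
       then ve (nth_code (fargs k) ((j - d) div d)) ((j - d) mod d) else ve k j)" for f k and c :: nat and j
  define \<sigma>3 where "\<sigma>3 k c j = (if j < d then ve (fst (prod_decode (nth_code c k))) j
       else if j < 2 * d then ve (snd (prod_decode (nth_code c k))) (j - d)
       else Var (prod_encode (2 * k + 1, j)))" for k c :: nat and j
  define rs :: "rule list" where "rs =
     [(\<lambda>k c. tag k = 0, \<sigma>0, TD), (\<lambda>k c. tag k = 1, \<sigma>1, TC),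
      (\<lambda>k c. k < length (list_decode c), \<sigma>3, TE)] @
     map (\<lambda>f. (\<lambda>k c. Q2 f k, \<sigma>2 f, TT f)) [0..<length (ops A)]"

  have rec_ve: "recfn n (\<lambda>xs. code_trm (ve (K xs) (J xs)))" if "recfn n K" "recfn n J" for n K J
    unfolding ve_def code_trm.simps using that
    by (intro recfn_prod_encode recfn_const recfn_mult)
  have rec_chk: "recpred n (\<lambda>xs. chk (K xs))" if "recfn n K" for n K
    unfolding chk_def
  proof (rule recpred_solvable[OF fB])
    show "wf_system B (subst_sys (\<lambda>j. if j < d then Const (nth_code (K xs) j) else Var j) TD)" for xs
      by (rule wf_subst_sys[OF wfD]) auto
    have "recfn n (\<lambda>xs. code_append (subst_sys (\<lambda>j. if j < d then Const (nth_code (K xs) j) else Var j) TD) 0)"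
    proof (rule recfn_code_append_subst_sys)
      show "recfn n (\<lambda>xs. code_trm (if j < d then Const (nth_code (K xs) j) else Var j))" for j
        using that by (cases "j < d") (auto intro!: recfn_prod_encode recfn_const recfn_nth_code)
    qed (rule recfn_const)
    then show "recfn n (\<lambda>xs. code_system (subst_sys (\<lambda>j. if j < d then Const (nth_code (K xs) j) else Var j) TD))"
      using code_system_append[of _ "[]"] by (simp add: code_system_def)
  qed
  have rec_tag: "recfn n (\<lambda>xs. tag (K xs))" and rec_arg: "recfn n (\<lambda>xs. arg (K xs))"
    and rec_fn: "recfn n (\<lambda>xs. fn (K xs))" and rec_fargs: "recfn n (\<lambda>xs. fargs (K xs))"
    if "recfn n K" for n K
    unfolding fn_def fargs_def tag_def arg_def using that by (intro recfn_fst recfn_snd; simp)+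
  have rec_cidx: "recfn n (\<lambda>xs. cidx (K xs) j)" if "recfn n K" for n K j
    unfolding cidx_def using that by (intro recfn_If rec_chk recfn_nth_code recfn_const)
  have 0: "recfn 2 (\<lambda>xs. xs ! 0)" and 1: "recfn 2 (\<lambda>xs. xs ! 1)" by (auto intro: recfn_proj)
  have comp: "computable_rule r" if r_rs: "r \<in> set rs" for r
  proof -
    consider "r = (\<lambda>k c. tag k = 0, \<sigma>0, TD)" | "r = (\<lambda>k c. tag k = 1, \<sigma>1, TC)"
      | "r = (\<lambda>k c. k < length (list_decode c), \<sigma>3, TE)"
      | f where "r = (\<lambda>k c. Q2 f k, \<sigma>2 f, TT f)"
      using r_rs unfolding rs_def by auto
    then show ?thesis
    proof cases
      case 1
      then show ?thesis unfolding computable_rule_def \<sigma>0_def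
        by (auto intro!: recpred_eq rec_tag rec_ve recfn_const recfn_proj)
    next
      case 2
      have "recfn 2 (\<lambda>xs. code_trm (\<sigma>1 (xs ! 0) (xs ! 1) j))" for j
        unfolding \<sigma>1_def
        by (cases "j < d") (auto intro!: rec_ve rec_cidx rec_arg recfn_prod_encode recfn_const recfn_proj)
      then show ?thesis unfolding computable_rule_def 2
        by (auto intro!: recpred_eq rec_tag recfn_const recfn_proj)
    next
      case 3
      have "recfn 2 (\<lambda>xs. code_trm (\<sigma>3 (xs ! 0) (xs ! 1) j))" for j
        unfolding \<sigma>3_def
        by (cases "j < d"; cases "j < 2 * d")
          (auto intro!: rec_ve recfn_fst recfn_snd recfn_nth_code recfn_prod_encode recfn_const
            recfn_Suc recfn_mult recfn_proj)
      then show ?thesis unfolding computable_rule_def 3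
        by (auto intro!: recpred_less_length recfn_proj)
    next
      case (4 f)
      have "recfn 2 (\<lambda>xs. code_trm (\<sigma>2 f (xs ! 0) (xs ! 1) j))" for j
        unfolding \<sigma>2_def
        by (cases "j < d"; cases "j < d + d * ar f")
          (auto intro!: rec_ve rec_fargs recfn_nth_code recfn_const recfn_proj)
      then show ?thesis unfolding computable_rule_def 4 Q2_def
        by (auto intro!: recpred_conj recpred_eq recpred_length_eq rec_tag rec_fn rec_fargs recfn_const recfn_proj)
    qed
  qed
  have wfC: "wf_system B TC" by (simp add: wf_system_def TC_def)
  have wf_rs: "wf_system B T \<and> wf_trm B (\<sigma> k c i)" if "(Q, \<sigma>, T) \<in> set rs" for Q \<sigma> T k c i
    using that wfD wfE wfT wfC
    by (auto simp: rs_def \<sigma>0_def \<sigma>1_def \<sigma>2_def \<sigma>3_def ve_def)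
  \<comment> \<open>Stages up to c suffice: the codes of all terms of the system and the number of
    its equations are at most c. Stage k treats k both as a term code and as the index of an
    equation.\<close>
  define X where "X c = stages rs c (Suc c)" for c
  have wfX: "wf_system B (X c)" for c unfolding X_def by (rule wf_stages) (use wf_rs in blast)
  have recX: "recpred 1 (\<lambda>xs. solvable_in B \<nu> (X (xs ! 0)))"
  proof (rule recpred_solvable[OF fB wfX])
    show "recfn 1 (\<lambda>xs. code_system (X (xs ! 0)))"
      unfolding X_def by (intro recfn_code_stages comp recfn_Suc recfn_proj) auto
  qed
  then obtain fA where fA: "\<And>xs. length xs = 1 \<Longrightarrow> computes fA xs (if solvable_in B \<nu> (X (xs ! 0)) then 1 else 0)"
    unfolding recpred_def recfn_def by blast

  have holds_X: "holds B \<nu> \<rho> (X c) \<longleftrightarrow> (\<forall>k\<le>c.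
      (tag k = 0 \<longrightarrow> holds B \<nu> (\<lambda>i. eval_trm B \<nu> \<rho> (\<sigma>0 k c i)) TD) \<and>
      (tag k = 1 \<longrightarrow> holds B \<nu> (\<lambda>i. eval_trm B \<nu> \<rho> (\<sigma>1 k c i)) TC) \<and>
      (k < length (list_decode c) \<longrightarrow> holds B \<nu> (\<lambda>i. eval_trm B \<nu> \<rho> (\<sigma>3 k c i)) TE) \<and>
      (\<forall>f<length (ops A). Q2 f k \<longrightarrow> holds B \<nu> (\<lambda>i. eval_trm B \<nu> \<rho> (\<sigma>2 f k c i)) (TT f)))" for \<rho> c
    unfolding X_def holds_stages rs_def less_Suc_eq_le by auto

  have main: "solvable_in B \<nu> (X (code_system S)) \<longleftrightarrow> solvable_in A \<nu>A S" if S: "wf_system A S" for S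
  proof -
    define c where "c = code_system S"
    define L where "L = map (\<lambda>(s, t). prod_encode (code_trm s, code_trm t)) S"
    have c: "c = list_encode L" unfolding c_def code_system_def L_def by simp
    have Lk: "nth_code c k = prod_encode (code_trm (fst (S ! k)), code_trm (snd (S ! k)))"
      if "k < length S" for k
      using that unfolding c by (simp add: nth_code_list_encode L_def split: prod.split)
    have lenL: "length (list_decode c) = length S" by (simp add: c L_def)
    have le_c: "code_trm s \<le> c" "code_trm t \<le> c" if "(s, t) \<in> set S" for s t
    proof -
      have "prod_encode (code_trm s, code_trm t) < c"
        unfolding c by (rule less_list_encode) (use that in \<open>force simp: L_def\<close>)
      then show "code_trm s \<le> c" "code_trm t \<le> c"
        using le_prod_encode_1[of "code_trm s" "code_trm t"] le_prod_encode_2[of "code_trm t" "code_trm s"]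
        by linarith+
    qed
    have wfS: "wf_trm A (fst (S ! k))" "wf_trm A (snd (S ! k))" if "k < length S" for k
      using S nth_mem[OF that] unfolding wf_system_def by force+
    show ?thesis unfolding c_def[symmetric]
    proof
      assume "solvable_in A \<nu>A S"
      then obtain \<rho> where \<rho>: "range \<rho> \<subseteq> dom A" and hS: "holds A \<nu>A \<rho> S"
        unfolding solvable_in_iff_holds by blast
      define val where "val = code_val A \<nu>A \<rho> a0"
      have val_E: "val k \<in> E" for k unfolding val_def
        by (rule code_val_in) (use \<rho> AE a0 \<nu>A closed in auto)
      \<comment> \<open>From a solution over \<open>A\<close> to one over \<open>B\<close>:
        representatives may be chosen freely except at constants, where the template prescribes the
        tuple.\<close>
      define rp where "rp k = (if tag k = 1 then crep (arg k) else SOME xs. Rep xs (val k))" for k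
      have tagk: "k = prod_encode (tag k, arg k)" for k
        unfolding tag_def arg_def by simp
      have val0: "val k = \<rho> (arg k)" if "tag k = 0" for k
        using code_val_simps(1)[of A \<nu>A \<rho> a0 "arg k"] tagk[of k] that unfolding val_def by simp
      have val1: "val k = \<nu>A (arg k)" if "tag k = 1" for k
        using code_val_simps(2)[of A \<nu>A \<rho> a0 "arg k"] tagk[of k] that unfolding val_def by simp
      have val2: "val k = snd (ops A ! f) (map val (list_decode (fargs k)))"
        if "Q2 f k" "f < length (ops A)" for f k
      proof -
        have "k = prod_encode (2, prod_encode (f, list_encode (list_decode (fargs k))))"
          using that(1) tagk[of k] unfolding Q2_def fn_def fargs_def by (metis list_decode_inverse prod.collapse prod_decode_inverse)
        then show ?thesis
          using code_val_simps(3)[of f A "list_decode (fargs k)" \<nu>A \<rho> a0] that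
          unfolding val_def Q2_def ar_def by simp
      qed
      have rp: "Rep (rp k) (val k)" for k
      proof (cases "tag k = 1")
        case True then show ?thesis using \<nu>A val1 unfolding rp_def by simp
      next
        case False then show ?thesis unfolding rp_def using someI_ex[OF Rep_ex[OF val_E]] by simp
      qed
      have lrp: "length (rp k) = d" "set (rp k) \<subseteq> dom B" for k using Rep[OF rp] by auto
      \<comment> \<open>At most one template applies to the even block of k, since the tag and the
        function symbol are read off from k. Auxiliary variables can thus be chosen block by
        block.\<close>
      have "\<exists>w. range w \<subseteq> dom B \<and> (\<forall>j<d. w j = rp k ! j) \<and>
           (tag k = 0 \<longrightarrow> holds B \<nu> w TD) \<and>
           (\<forall>f<length (ops A). Q2 f k \<longrightarrow> holds B \<nu> w (TT f) \<and>
              (\<forall>j<d * ar f. w (d + j) = rp (nth_code (fargs k) (j div d)) ! (j mod d)))" for k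
      proof -
        consider "tag k = 0" | f where "f < length (ops A)" "Q2 f k" "tag k = 2" "fn k = f"
          | "tag k \<noteq> 0" "\<not> (\<exists>f<length (ops A). Q2 f k)"
          unfolding Q2_def by blast
        then show ?thesis
        proof cases
          case 1
          have "sat B \<nu> TD (rp k)"
            using TD[OF lrp] rp[of k] val0[OF 1] \<rho> by (metis rangeI subsetD)
          then show ?thesis unfolding sat_def lrp using 1 by (auto simp: Q2_def)
        next
          case (2 f)
          let ?as = "list_decode (fargs k)"
          have len: "length ?as = fst (ops A ! f)" using 2(2) unfolding Q2_def ar_def by simp
          have "sat B \<nu> (TT f) (rp k @ concat (map rp ?as)) = Rep (rp k) (snd (ops A ! f) (map val ?as))"
            by (rule TT) (use 2 lrp val_E rp len in \<open>auto simp: list_all2_conv_all_nth\<close>)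
          then have "sat B \<nu> (TT f) (rp k @ concat (map rp ?as))"
            using rp[of k] val2 2 by simp
          then obtain w where w: "range w \<subseteq> dom B" "holds B \<nu> w (TT f)"
            and wi: "\<And>i. i < length (rp k @ concat (map rp ?as)) \<Longrightarrow> w i = (rp k @ concat (map rp ?as)) ! i"
            unfolding sat_def by blast
          have lc: "length (concat (map rp ?as)) = d * ar f"
            using len lrp by (simp add: length_concat o_def ar_def sum_list_triv)
          have "w j = rp k ! j" if "j < d" for j
            using wi[of j] that lrp by (simp add: nth_append)
          moreover have "w (d + j) = rp (nth_code (fargs k) (j div d)) ! (j mod d)" if j: "j < d * ar f" for j
          proof -
            have "j div d < length ?as"
              using j len by (simp add: ar_def less_mult_imp_div_less mult.commute)
            then have "nth_code (fargs k) (j div d) = ?as ! (j div d)"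
              using nth_code_list_encode[of "j div d" ?as] by simp
            then show ?thesis
              using wi[of "d + j"] j lrp lc nth_concat_eq_length[of "map rp ?as" d j] len \<open>j div d < length ?as\<close>
              by (simp add: nth_append ar_def)
          qed
          ultimately show ?thesis using w 2 by (intro exI[of _ w]) (auto simp: Q2_def)
        next
          case 3
          obtain b where "b \<in> dom B" using \<nu> by blast
          have "rp k ! j \<in> dom B" if "j < d" for j
            using lrp[of k] that nth_mem by blast
          then show ?thesis
            by (intro exI[of _ "\<lambda>j. if j < d then rp k ! j else b"]) (use 3 \<open>b \<in> dom B\<close> in auto)
        qed
      qed
      then obtain W where W: "\<And>k. range (W k) \<subseteq> dom B" "\<And>k j. j < d \<Longrightarrow> W k j = rp k ! j"
        "\<And>k. tag k = 0 \<Longrightarrow> holds B \<nu> (W k) TD"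
        "\<And>k f. f < length (ops A) \<Longrightarrow> Q2 f k \<Longrightarrow> holds B \<nu> (W k) (TT f)"
        "\<And>k f j. f < length (ops A) \<Longrightarrow> Q2 f k \<Longrightarrow> j < d * ar f \<Longrightarrow>
            W k (d + j) = rp (nth_code (fargs k) (j div d)) ! (j mod d)"
        by metis
      have "\<exists>w. range w \<subseteq> dom B \<and> (k < length S \<longrightarrow> holds B \<nu> w TE \<and>
          (\<forall>j<d. w j = rp (code_trm (fst (S ! k))) ! j) \<and>
          (\<forall>j<d. w (d + j) = rp (code_trm (snd (S ! k))) ! j))" for k
      proof (cases "k < length S")
        case True
        have "eval_trm A \<nu>A \<rho> (fst (S ! k)) = eval_trm A \<nu>A \<rho> (snd (S ! k))"
          using hS nth_mem[OF True] unfolding holds_def by force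
        then have "val (code_trm (fst (S ! k))) = val (code_trm (snd (S ! k)))"
          unfolding val_def using code_val_code_trm wfS[OF True] by metis
        then have "sat B \<nu> TE (rp (code_trm (fst (S ! k))) @ rp (code_trm (snd (S ! k))))"
          using TE[OF val_E val_E rp rp] by blast
        then obtain w where w: "range w \<subseteq> dom B" "holds B \<nu> w TE" and
          wi: "\<And>i. i < 2 * d \<Longrightarrow> w i = (rp (code_trm (fst (S ! k))) @ rp (code_trm (snd (S ! k)))) ! i"
          unfolding sat_def using lrp by auto
        show ?thesis
          by (rule exI[of _ w]) (use w wi lrp in \<open>auto simp: nth_append\<close>)
      next
        case False
        then show ?thesis using W(1) by blast
      qed
      then obtain V where V: "\<And>k. range (V k) \<subseteq> dom B" "\<And>k. k < length S \<Longrightarrow> holds B \<nu> (V k) TE"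
        "\<And>k j. k < length S \<Longrightarrow> j < d \<Longrightarrow> V k j = rp (code_trm (fst (S ! k))) ! j"
        "\<And>k j. k < length S \<Longrightarrow> j < d \<Longrightarrow> V k (d + j) = rp (code_trm (snd (S ! k))) ! j"
        by metis
      define \<rho>B where "\<rho>B v = (case prod_decode v of (k, j) \<Rightarrow>
          if even k then W (k div 2) j else V (k div 2) j)" for v
      have ev: "eval_trm B \<nu> \<rho>B (ve k j) = W k j" for k j unfolding ve_def \<rho>B_def by simp
      have "W k j \<in> dom B" "V k j \<in> dom B" for k j using W(1)[of k] V(1)[of k] by blast+
      then have "range \<rho>B \<subseteq> dom B" unfolding \<rho>B_def by (auto split: prod.split)
      moreover have "holds B \<nu> \<rho>B (X c)" unfolding holds_X
      proof (intro allI impI conjI)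
        fix k assume "tag k = 0"
        then show "holds B \<nu> (\<lambda>i. eval_trm B \<nu> \<rho>B (\<sigma>0 k c i)) TD"
          unfolding \<sigma>0_def ev using W(3) by simp
      next
        fix k assume "tag k = 1"
        then have "rp k = crep (arg k)" unfolding rp_def by simp
        then show "holds B \<nu> (\<lambda>i. eval_trm B \<nu> \<rho>B (\<sigma>1 k c i)) TC"
          unfolding holds_def TC_def \<sigma>1_def by (auto simp: ev W(2) crep_def)
      next
        fix k assume "k < length (list_decode c)"
        then have k: "k < length S" using lenL by simp
        have "(\<lambda>i. eval_trm B \<nu> \<rho>B (\<sigma>3 k c i)) = V k"
        proof
          fix i
          consider "i < d" | j where "i = d + j" "j < d" | "i \<ge> 2 * d"
            by (metis le_Suc_ex mult_2 nat_add_left_cancel_less not_less)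
          then show "eval_trm B \<nu> \<rho>B (\<sigma>3 k c i) = V k i"
            by cases (auto simp: \<sigma>3_def ev Lk[OF k] W(2) V(3,4)[OF k], simp add: \<rho>B_def)
        qed
        then show "holds B \<nu> (\<lambda>i. eval_trm B \<nu> \<rho>B (\<sigma>3 k c i)) TE" using V(2)[OF k] by simp
      next
        fix k f assume f: "f < length (ops A)" "Q2 f k"
        have "(\<lambda>i. eval_trm B \<nu> \<rho>B (\<sigma>2 f k c i)) = W k"
        proof
          fix i
          consider "i < d" | j where "i = d + j" "j < d * ar f" | "i \<ge> d + d * ar f"
            by (metis le_Suc_ex nat_add_left_cancel_less not_less)
          then show "eval_trm B \<nu> \<rho>B (\<sigma>2 f k c i) = W k i"
          proof cases
            case (2 j)
            then have "d > 0" by (auto intro: gr0I)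
            then show ?thesis using 2 by (simp add: \<sigma>2_def ev W(2) W(5)[OF f])
          qed (auto simp: \<sigma>2_def ev)
        qed
        then show "holds B \<nu> (\<lambda>i. eval_trm B \<nu> \<rho>B (\<sigma>2 f k c i)) (TT f)" using W(4)[OF f] by simp
      qed
      ultimately show "solvable_in B \<nu> (X c)" unfolding solvable_in_iff_holds by blast
    next
      assume "solvable_in B \<nu> (X c)"
      then obtain \<rho>B where \<rho>B: "range \<rho>B \<subseteq> dom B" and "holds B \<nu> \<rho>B (X c)"
        unfolding solvable_in_iff_holds by blast
      then have h0: "\<And>k. k \<le> c \<Longrightarrow> tag k = 0 \<Longrightarrow> holds B \<nu> (\<lambda>i. eval_trm B \<nu> \<rho>B (\<sigma>0 k c i)) TD"
        and h1: "\<And>k. k \<le> c \<Longrightarrow> tag k = 1 \<Longrightarrow> holds B \<nu> (\<lambda>i. eval_trm B \<nu> \<rho>B (\<sigma>1 k c i)) TC"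
        and h3: "\<And>k. k \<le> c \<Longrightarrow> k < length S \<Longrightarrow> holds B \<nu> (\<lambda>i. eval_trm B \<nu> \<rho>B (\<sigma>3 k c i)) TE"
        and h2: "\<And>k f. k \<le> c \<Longrightarrow> f < length (ops A) \<Longrightarrow> Q2 f k \<Longrightarrow>
            holds B \<nu> (\<lambda>i. eval_trm B \<nu> \<rho>B (\<sigma>2 f k c i)) (TT f)"
        unfolding holds_X lenL by blast+
      have evB: "eval_trm B \<nu> \<rho>B (ve k j) \<in> dom B" for k j unfolding ve_def using \<rho>B by auto
      define rp where "rp k = map (\<lambda>j. eval_trm B \<nu> \<rho>B (ve k j)) [0..<d]" for k
      have lrp: "length (rp k) = d" "set (rp k) \<subseteq> dom B" for k unfolding rp_def using evB by auto
      \<comment> \<open>A variable with code above c does not occur in the system and is set to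
        \<open>a0\<close>. For every other variable the domain template guarantees that its block
        represents some element.\<close>
      define \<rho> where "\<rho> i = (let k = code_trm (Var i) in
          if k \<le> c then SOME e. e \<in> dom A \<and> Rep (rp k) e else a0)" for i
      have \<rho>i: "\<rho> i \<in> dom A \<and> Rep (rp (code_trm (Var i))) (\<rho> i)" if i: "code_trm (Var i) \<le> c" for i
      proof -
        let ?k = "code_trm (Var i)"
        have "holds B \<nu> (\<lambda>j. eval_trm B \<nu> \<rho>B (ve ?k j)) TD"
          using h0[OF i] unfolding \<sigma>0_def tag_def by simp
        then have "sat B \<nu> TD (rp ?k)" unfolding sat_def
          by (intro exI[of _ "\<lambda>j. eval_trm B \<nu> \<rho>B (ve ?k j)"]) (use evB in \<open>auto simp: rp_def\<close>)
        then have "\<exists>e. e \<in> dom A \<and> Rep (rp ?k) e" using TD[OF lrp] by blast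
        from someI_ex[OF this] show ?thesis unfolding \<rho>_def Let_def using i by simp
      qed
      have \<rho>: "\<rho> i \<in> dom A" for i
        using \<rho>i[of i] a0 by (cases "code_trm (Var i) \<le> c") (auto simp: \<rho>_def)
      have ev: "eval_trm A \<nu>A \<rho> t \<in> E \<and> Rep (rp (code_trm t)) (eval_trm A \<nu>A \<rho> t)"
        if "wf_trm A t" "code_trm t \<le> c" for t
        using that
      proof (induction t)
        case (Var i)
        then show ?case using \<rho>i AE by auto
      next
        case (Const m)
        let ?k = "prod_encode (Suc 0, m)"
        have "rp ?k = crep m"
          using h1[of ?k] Const unfolding holds_def TC_def \<sigma>1_def tag_def arg_def
          by (intro nth_equalityI) (auto simp: crep_def rp_def)
        then show ?case using \<nu>A[of m] AE by auto
      next
        case (App f ts)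
        let ?k = "code_trm (App f ts)" and ?es = "map (eval_trm A \<nu>A \<rho>) ts"
        have f: "f < length (ops A)" "length ts = fst (ops A ! f)" "\<forall>t\<in>set ts. wf_trm A t"
          using App.prems by auto
        have IH: "eval_trm A \<nu>A \<rho> t \<in> E \<and> Rep (rp (code_trm t)) (eval_trm A \<nu>A \<rho> t)" if "t \<in> set ts" for t
          using App.IH[OF that] f(3) that code_trm_arg_le[OF that, of f] App.prems(2) by auto
        have fargs: "fargs ?k = list_encode (map code_trm ts)" unfolding fargs_def arg_def by simp
        have Q2: "Q2 f ?k" unfolding Q2_def fargs
          using f by (auto simp: tag_def fn_def arg_def ar_def)
        let ?xss = "map (\<lambda>t. rp (code_trm t)) ts"
        let ?w = "\<lambda>i. eval_trm B \<nu> \<rho>B (\<sigma>2 f ?k c i)"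
        have lc: "length (concat ?xss) = d * ar f"
          using f(2) lrp by (simp add: length_concat o_def ar_def sum_list_triv)
        have "sat B \<nu> (TT f) (rp ?k @ concat ?xss)" unfolding sat_def
        proof (intro exI[of _ ?w] conjI allI impI)
          show "range ?w \<subseteq> dom B" unfolding \<sigma>2_def using evB by auto
          show "holds B \<nu> ?w (TT f)" using h2[OF App.prems(2) f(1) Q2] .
          fix i assume "i < length (rp ?k @ concat ?xss)"
          then have "i < d + d * ar f" using lrp lc by simp
          then consider "i < d" | j where "i = d + j" "j < d * ar f"
            by (metis le_Suc_ex nat_add_left_cancel_less not_less)
          then show "?w i = (rp ?k @ concat ?xss) ! i"
          proof cases
            case 1
            then show ?thesis using lrp by (simp add: nth_append \<sigma>2_def rp_def)
          next
            case (2 j)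
            then have d: "d > 0" by (auto intro: gr0I)
            have jl: "j div d < length ts"
              using 2 f(2) by (simp add: ar_def less_mult_imp_div_less mult.commute)
            have "concat ?xss ! j = rp (code_trm (ts ! (j div d))) ! (j mod d)"
              using nth_concat_eq_length[of ?xss d j] 2 f(2) lrp jl by (auto simp: ar_def)
            moreover have "nth_code (fargs ?k) (j div d) = code_trm (ts ! (j div d))"
              using nth_code_list_encode[of "j div d" "map code_trm ts"] jl unfolding fargs by simp
            ultimately show ?thesis using 2 lrp d
              by (simp del: code_trm.simps add: nth_append \<sigma>2_def rp_def)
          qed
        qed
        moreover have "sat B \<nu> (TT f) (rp ?k @ concat ?xss) = Rep (rp ?k) (snd (ops A ! f) ?es)"
          by (rule TT) (use f lrp IH in \<open>auto simp: list_all2_conv_all_nth\<close>)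
        ultimately have "Rep (rp ?k) (eval_trm A \<nu>A \<rho> (App f ts))" by simp
        moreover have "eval_trm A \<nu>A \<rho> (App f ts) \<in> E"
          using closed[OF f(1), of ?es] f IH by auto
        ultimately show ?case by blast
      qed
      have "holds A \<nu>A \<rho> S" unfolding holds_def
      proof clarify
        fix s t assume st: "(s, t) \<in> set S"
        then obtain k where k: "k < length S" "S ! k = (s, t)" by (metis in_set_conv_nth)
        have wf: "wf_trm A s" "wf_trm A t" using wfS[OF k(1)] k(2) by auto
        have "k \<le> c" using k(1) length_le_list_encode[of L] unfolding c L_def by simp
        let ?w = "\<lambda>i. eval_trm B \<nu> \<rho>B (\<sigma>3 k c i)"
        have "sat B \<nu> TE (rp (code_trm s) @ rp (code_trm t))" unfolding sat_def
        proof (intro exI[of _ ?w] conjI allI impI)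
          have "\<rho>B v \<in> dom B" for v using \<rho>B by blast
          then show "range ?w \<subseteq> dom B" unfolding \<sigma>3_def using evB by auto
          show "holds B \<nu> ?w TE" using h3[OF \<open>k \<le> c\<close> k(1)] .
          fix i assume "i < length (rp (code_trm s) @ rp (code_trm t))"
          then show "?w i = (rp (code_trm s) @ rp (code_trm t)) ! i"
            using lrp Lk[OF k(1)] k(2) by (auto simp: nth_append \<sigma>3_def rp_def)
        qed
        then show "eval_trm A \<nu>A \<rho> s = eval_trm A \<nu>A \<rho> t"
          using TE ev[OF wf(1) le_c(1)[OF st]] ev[OF wf(2) le_c(2)[OF st]] by blast
      qed
      then show "solvable_in A \<nu>A S" unfolding solvable_in_iff_holds using \<rho> by blast
    qed
  qed
  have "\<forall>S. wf_system A S \<longrightarrow> computes fA [code_system S] (if solvable_in A \<nu>A S then 1 else 0)"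
  proof (intro allI impI)
    fix S assume "wf_system A S"
    then show "computes fA [code_system S] (if solvable_in A \<nu>A S then 1 else 0)"
      using fA[of "[code_system S]"] main[of S] by simp
  qed
  then show ?thesis unfolding diophantine_decidable_def using range_\<nu>A by blast
qed

section \<open>Nilpotent exponentials\<close>

abbreviation (input) lie :: "'r::ring \<Rightarrow> 'r \<Rightarrow> 'r" where
  "lie x y \<equiv> x * y - y * x"

locale assoc_algebra =
  fixes sm :: "'k::field_char_0 \<Rightarrow> 'r::ring_1 \<Rightarrow> 'r"
  assumes sm_add_left: "sm (a + b) x = sm a x + sm b x"
    and sm_add_right: "sm a (x + y) = sm a x + sm a y"
    and sm_sm [simp]: "sm a (sm b x) = sm (a * b) x"
    and sm_1 [simp]: "sm 1 x = x"
    and sm_mult_left [simp]: "sm a x * y = sm a (x * y)"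
    and sm_mult_right [simp]: "x * sm a y = sm a (x * y)"
begin

sublocale vs: vector_space sm
  by unfold_locales (auto simp: sm_add_left sm_add_right)

lemmas sm_0_left [simp] = vs.scale_zero_left
  and sm_0_right [simp] = vs.scale_zero_right
  and sm_eq_0_iff [simp] = vs.scale_eq_0_iff
  and sm_minus_left [simp] = vs.scale_minus_left
  and sm_minus_right [simp] = vs.scale_minus_right
  and sm_diff_left = vs.scale_left_diff_distrib
  and sm_diff_right = vs.scale_right_diff_distrib
  and sm_sum_right = vs.scale_sum_right

lemma sm_cancel: "sm a x = sm a y \<Longrightarrow> a \<noteq> 0 \<Longrightarrow> x = y"
  using vs.scale_left_imp_eq by blast

lemma lie_sm_right: "lie x (sm a y) = sm a (lie x y)"
  by (simp add: sm_diff_right)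

lemma lie_sm_left: "lie (sm a x) y = sm a (lie x y)"
  by (simp add: sm_diff_right)

lemma power_sm: "(sm a x) ^ n = sm (a ^ n) (x ^ n)"
  by (induction n) auto

definition nilp :: "'r \<Rightarrow> bool" where "nilp x \<longleftrightarrow> (\<exists>n. x ^ n = 0)"

definition dp :: "'r \<Rightarrow> nat \<Rightarrow> 'r" where "dp x n = sm (1 / fact n) (x ^ n)"

text \<open>For nilpotent x this is the exponential series, a finite sum over the exponents with
  nonzero power, and so available over any field of characteristic zero.\<close>

definition nexp :: "'r \<Rightarrow> 'r" where "nexp x = (\<Sum>n | x ^ n \<noteq> 0. dp x n)"

lemma power_eq_0_mono: "x ^ n = 0 \<Longrightarrow> n \<le> m \<Longrightarrow> x ^ m = (0::'r)"
  by (metis le_add_diff_inverse mult_zero_left power_add)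

lemma dp_eq_0: "x ^ n = 0 \<Longrightarrow> n \<le> m \<Longrightarrow> dp x m = 0"
  unfolding dp_def using power_eq_0_mono[of x n m] by simp

lemma dp_0: "dp x 0 = 1" by (simp add: dp_def)

lemma dp_Suc: "sm (of_nat (Suc n)) (dp x (Suc n)) = x * dp x n"
proof -
  have "of_nat (Suc n) * (1 / fact (Suc n)) = (1 / fact n :: 'k)"
    by (simp add: field_simps del: of_nat_Suc)
  then show ?thesis unfolding dp_def by (simp del: of_nat_Suc)
qed

lemma commute_power: "g * x = x * g \<Longrightarrow> g * x ^ n = x ^ n * (g::'r)"
proof (induction n)
  case (Suc n)
  have "g * x ^ Suc n = x * (g * x ^ n)" using Suc.prems by (simp add: mult.assoc[symmetric])
  also have "\<dots> = x ^ Suc n * g" using Suc by (simp add: mult.assoc)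
  finally show ?case .
qed simp

lemma commute_dp: "g * x = x * g \<Longrightarrow> g * dp x n = dp x n * g"
  unfolding dp_def using commute_power[of g x n] by simp

lemma nexp_eq:
  assumes "x ^ n = 0" shows "nexp x = (\<Sum>i<n. dp x i)"
  unfolding nexp_def
proof (rule sum.mono_neutral_cong_left)
  show "{n. x ^ n \<noteq> 0} \<subseteq> {..<n}"
    using power_eq_0_mono[OF assms] by (force simp: not_less[symmetric])
  show "\<forall>i\<in>{..<n} - {n. x ^ n \<noteq> 0}. dp x i = 0" by (auto simp: dp_def)
qed auto

lemma nilp_sm: "nilp x \<Longrightarrow> nilp (sm a x)"
  unfolding nilp_def power_sm by auto

lemma nilp_minus: "nilp x \<Longrightarrow> nilp (- x)"
  using nilp_sm[of x "- 1"] by simp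

lemma nexp_0: "nexp 0 = 1"
  using nexp_eq[of 0 1] by (simp add: dp_0)

lemma sm_split_sum:
  assumes "(i::nat) \<le> m" shows "sm (of_nat i) x + sm (of_nat (m - i)) x = sm (of_nat m) x"
proof -
  have "of_nat m = (of_nat i + of_nat (m - i) :: 'k)"
    using assms by (metis le_add_diff_inverse of_nat_add)
  then show ?thesis using sm_add_left by metis
qed

text \<open>The binomial theorem in the normalization x^n / n!. After multiplication by Suc n the
  claim becomes x + y times the claim for n; the two halves carry the weights i and Suc n - i, which
  add up to Suc n.\<close>

lemma dp_add:
  assumes "x * y = y * x"
  shows "dp (x + y) n = (\<Sum>i\<le>n. dp x i * dp y (n - i))"
proof (induction n)
  case 0
  show ?case by (simp add: dp_0)
next
  case (Suc n)
  have yd: "y * dp x i = dp x i * y" for i by (rule commute_dp) (use assms in simp)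
  let ?f = "\<lambda>i. dp x i * dp y (Suc n - i)"
  have "sm (of_nat (Suc n)) (dp (x + y) (Suc n)) = (x + y) * (\<Sum>i\<le>n. dp x i * dp y (n - i))"
    using Suc dp_Suc by simp
  also have "\<dots> = (\<Sum>i\<le>n. x * dp x i * dp y (n - i)) + (\<Sum>i\<le>n. y * dp x i * dp y (n - i))"
    by (simp add: distrib_right sum_distrib_left mult.assoc sum.distrib)
  also have "(\<Sum>i\<le>n. x * dp x i * dp y (n - i)) = (\<Sum>i\<le>n. sm (of_nat (Suc i)) (?f (Suc i)))"
    by (intro sum.cong refl) (simp add: dp_Suc[symmetric] del: of_nat_Suc)
  also have "\<dots> = (\<Sum>i\<le>Suc n. sm (of_nat i) (?f i))"
    by (simp add: sum.atMost_Suc_shift del: of_nat_Suc sum.atMost_Suc)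
  also have "(\<Sum>i\<le>n. y * dp x i * dp y (n - i)) = (\<Sum>i\<le>n. sm (of_nat (Suc n - i)) (?f i))"
  proof (intro sum.cong refl)
    fix i assume "i \<in> {..n}"
    then have *: "Suc n - i = Suc (n - i)" by simp
    have "y * dp x i * dp y (n - i) = dp x i * (y * dp y (n - i))" using yd by (simp add: mult.assoc)
    then show "y * dp x i * dp y (n - i) = sm (of_nat (Suc n - i)) (?f i)"
      unfolding * dp_Suc[symmetric] by simp
  qed
  also have "\<dots> = (\<Sum>i\<le>Suc n. sm (of_nat (Suc n - i)) (?f i))" by simp
  also have "(\<Sum>i\<le>Suc n. sm (of_nat i) (?f i)) + (\<Sum>i\<le>Suc n. sm (of_nat (Suc n - i)) (?f i)) =
      (\<Sum>i\<le>Suc n. sm (of_nat (Suc n)) (?f i))"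
    unfolding sum.distrib[symmetric] by (intro sum.cong refl sm_split_sum) simp
  also have "\<dots> = sm (of_nat (Suc n)) (\<Sum>i\<le>Suc n. ?f i)" by (simp only: sm_sum_right)
  finally show ?case by (rule sm_cancel) (simp del: of_nat_Suc)
qed

lemma sum_square_eq_triangle:
  fixes f :: "nat \<Rightarrow> nat \<Rightarrow> 'r"
  assumes "\<And>i j. a \<le> i \<or> b \<le> j \<Longrightarrow> f i j = 0"
  shows "(\<Sum>i<a. \<Sum>j<b. f i j) = (\<Sum>n<a + b. \<Sum>i\<le>n. f i (n - i))"
proof -
  have "(\<Sum>i<a. \<Sum>j<b. f i j) = (\<Sum>(i, j)\<in>{..<a} \<times> {..<b}. f i j)"
    by (simp add: sum.cartesian_product)
  also have "\<dots> = (\<Sum>(i, j)\<in>{(i, j). i + j < a + b}. f i j)"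
  proof (rule sum.mono_neutral_left)
    have "{(i, j). i + j < a + b} \<subseteq> {..<a + b} \<times> {..<a + b}" by auto
    then show "finite {(i, j). i + j < a + b}" by (rule finite_subset) simp
  qed (use assms in \<open>force simp: not_less[symmetric]\<close>)+
  also have "\<dots> = (\<Sum>n<a + b. \<Sum>i\<le>n. f i (n - i))" by (rule sum.triangle_reindex)
  finally show ?thesis .
qed

lemma
  assumes xy: "x * y = y * x" and x: "nilp x" and y: "nilp y"
  shows nilp_add: "nilp (x + y)" and nexp_add: "nexp (x + y) = nexp x * nexp y"
proof -
  obtain a b where a: "x ^ a = 0" and b: "y ^ b = 0" using x y unfolding nilp_def by blast
  have "dp (x + y) (a + b) = 0"
    unfolding dp_add[OF xy]
  proof (intro sum.neutral ballI)
    fix i assume "i \<in> {..a + b}"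
    then have "a \<le> i \<or> b \<le> a + b - i" by auto
    then show "dp x i * dp y (a + b - i) = 0"
      using dp_eq_0[OF a, of i] dp_eq_0[OF b, of "a + b - i"] by auto
  qed
  then have ab: "(x + y) ^ (a + b) = 0" unfolding dp_def by simp
  then show "nilp (x + y)" unfolding nilp_def by blast
  have "nexp x * nexp y = (\<Sum>i<a. \<Sum>j<b. dp x i * dp y j)"
    by (simp add: nexp_eq[OF a] nexp_eq[OF b] sum_product)
  also have "\<dots> = (\<Sum>n<a + b. \<Sum>i\<le>n. dp x i * dp y (n - i))"
    by (rule sum_square_eq_triangle) (use dp_eq_0[OF a] dp_eq_0[OF b] in auto)
  also have "\<dots> = nexp (x + y)" by (simp add: nexp_eq[OF ab] dp_add[OF xy])
  finally show "nexp (x + y) = nexp x * nexp y" by simp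
qed

lemma nexp_minus: "nilp x \<Longrightarrow> nexp x * nexp (- x) = 1" "nilp x \<Longrightarrow> nexp (- x) * nexp x = 1"
  using nexp_add[of x "- x"] nexp_add[of "- x" x] nilp_minus[of x] nexp_0 by auto

lemma commute_nexp: "g * x = x * g \<Longrightarrow> g * nexp x = nexp x * g"
  unfolding nexp_def by (simp add: sum_distrib_left sum_distrib_right commute_dp)

lemma conj_power:
  assumes "v * u = (1::'r)" shows "(u * x * v) ^ Suc n = u * x ^ Suc n * v"
proof (induction n)
  case (Suc n)
  have "(u * x * v) ^ Suc (Suc n) = u * x * (v * u) * x ^ Suc n * v"
    using Suc by (simp add: mult.assoc)
  then show ?case by (simp add: assms mult.assoc)
qed simp

lemma conj_nexp:
  assumes uv: "u * v = 1" "v * u = 1" and x: "nilp x"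
  shows "nexp (u * x * v) = u * nexp x * v"
proof -
  obtain m where m: "x ^ m = 0" using x unfolding nilp_def by blast
  have m': "x ^ Suc m = 0" using power_eq_0_mono[OF m, of "Suc m"] by simp
  have dpc: "dp (u * x * v) n = u * dp x n * v" for n
    by (cases n) (auto simp: dp_0 uv dp_def conj_power[OF uv(2)] simp del: power_Suc)
  show ?thesis
    using conj_power[OF uv(2), of x m] m'
    by (simp add: nexp_eq[OF m'] nexp_eq[of "u * x * v" "Suc m"] dpc sum_distrib_left sum_distrib_right
        del: power_Suc sum.lessThan_Suc)
qed

section \<open>Conjugation by an exponential\<close>

primrec adp :: "'r \<Rightarrow> 'r \<Rightarrow> nat \<Rightarrow> 'r" where
  "adp x y 0 = y"
| "adp x y (Suc n) = sm (1 / of_nat (Suc n)) (lie x (adp x y n))"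

text \<open>\<open>adp x y n\<close> is the n-th divided power of ad x applied to y. The operator ad
  x is the difference of left and right multiplication by x, and these commute, so the binomial rule
  expands its divided powers.\<close>

lemma adp_eq: "adp x y n = (\<Sum>i\<le>n. dp x i * y * dp (- x) (n - i))"
proof (induction n)
  case (Suc n)
  let ?f = "\<lambda>i. dp x i * y * dp (- x) (Suc n - i)"
  let ?S = "\<Sum>i\<le>n. dp x i * y * dp (- x) (n - i)"
  have "x * ?S = (\<Sum>i\<le>n. x * dp x i * y * dp (- x) (n - i))"
    by (simp add: sum_distrib_left mult.assoc)
  also have "\<dots> = (\<Sum>i\<le>n. sm (of_nat (Suc i)) (?f (Suc i)))"
    by (intro sum.cong refl) (simp add: dp_Suc[symmetric] del: of_nat_Suc)
  also have "\<dots> = (\<Sum>i\<le>Suc n. sm (of_nat i) (?f i))"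
    by (simp add: sum.atMost_Suc_shift del: of_nat_Suc sum.atMost_Suc)
  finally have 1: "x * ?S = (\<Sum>i\<le>Suc n. sm (of_nat i) (?f i))" .
  have "- (?S * x) = (\<Sum>i\<le>n. sm (of_nat (Suc n - i)) (?f i))"
    unfolding sum_distrib_right sum_negf[symmetric]
  proof (intro sum.cong refl)
    fix i assume "i \<in> {..n}"
    then have *: "Suc n - i = Suc (n - i)" by simp
    have "dp (- x) (n - i) * x = x * dp (- x) (n - i)"
      using commute_dp[of x "- x" "n - i"] by simp
    then have "- (dp x i * y * dp (- x) (n - i) * x) = dp x i * y * (- x * dp (- x) (n - i))"
      by (simp add: mult.assoc)
    then show "- (dp x i * y * dp (- x) (n - i) * x) = sm (of_nat (Suc n - i)) (?f i)"
      unfolding * dp_Suc[symmetric] by simp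
  qed
  also have "\<dots> = (\<Sum>i\<le>Suc n. sm (of_nat (Suc n - i)) (?f i))" by simp
  finally have 2: "- (?S * x) = (\<Sum>i\<le>Suc n. sm (of_nat (Suc n - i)) (?f i))" .
  have "lie x ?S = x * ?S + - (?S * x)" by simp
  also have "\<dots> = (\<Sum>i\<le>Suc n. sm (of_nat (Suc n)) (?f i))"
    unfolding 1 2 sum.distrib[symmetric] by (intro sum.cong refl sm_split_sum) simp
  also have "\<dots> = sm (of_nat (Suc n)) (\<Sum>i\<le>Suc n. ?f i)" by (simp only: sm_sum_right)
  finally show ?case using Suc by (simp del: of_nat_Suc sum.atMost_Suc)
qed (simp add: dp_0)

text \<open>Ad (exp x) = exp (ad x). The claim holds for all large M, so that the sum can be cut
  wherever this is convenient.\<close>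

lemma nexp_conj_eq_sum_adp:
  assumes "nilp x" shows "\<exists>N. \<forall>M\<ge>N. nexp x * y * nexp (- x) = (\<Sum>n<M. adp x y n)"
proof -
  obtain a where a: "x ^ a = 0" using assms unfolding nilp_def by blast
  then have a': "(- x) ^ a = 0" using power_sm[of "- 1" x a] by simp
  have z: "adp x y n = 0" if "n \<ge> a + a" for n
    unfolding adp_eq
  proof (intro sum.neutral ballI)
    fix i
    have "a \<le> i \<or> a \<le> n - i" using that by auto
    then show "dp x i * y * dp (- x) (n - i) = 0"
      using dp_eq_0[OF a, of i] dp_eq_0[OF a', of "n - i"] by auto
  qed
  have "nexp x * y * nexp (- x) = (\<Sum>i<a. dp x i * y) * (\<Sum>j<a. dp (- x) j)"
    by (simp add: nexp_eq[OF a] nexp_eq[OF a'] sum_distrib_right)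
  also have "\<dots> = (\<Sum>i<a. \<Sum>j<a. dp x i * y * dp (- x) j)" by (rule sum_product)
  also have "\<dots> = (\<Sum>n<a + a. adp x y n)" unfolding adp_eq
    by (rule sum_square_eq_triangle) (use dp_eq_0[OF a] dp_eq_0[OF a'] in auto)
  finally have "nexp x * y * nexp (- x) = (\<Sum>n<M. adp x y n)" if "M \<ge> a + a" for M
    using that z sum.mono_neutral_left[of "{..<M}" "{..<a + a}" "adp x y"] by auto
  then show ?thesis by blast
qed

lemma nexp_conj_in_subspace:
  assumes "nilp x" "y \<in> V" "vs.subspace V" and "\<And>v. v \<in> V \<Longrightarrow> lie x v \<in> V"
  shows "nexp x * y * nexp (- x) \<in> V"
proof -
  obtain N where N: "nexp x * y * nexp (- x) = (\<Sum>n<N. adp x y n)"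
    using nexp_conj_eq_sum_adp[OF assms(1)] by blast
  have "adp x y n \<in> V" for n
    by (induction n) (use assms in \<open>auto intro: vs.subspace_scale simp del: of_nat_Suc\<close>)
  then show ?thesis unfolding N by (intro vs.subspace_sum[OF assms(3)])
qed

lemma nexp_conj_of_lie3_eq_0:
  assumes "nilp x" "lie x (lie x (lie x y)) = 0"
  shows "nexp x * y * nexp (- x) = y + lie x y + sm (1 / 2) (lie x (lie x y))"
proof -
  obtain N where N: "\<And>M. M \<ge> N \<Longrightarrow> nexp x * y * nexp (- x) = (\<Sum>n<M. adp x y n)"
    using nexp_conj_eq_sum_adp[OF assms(1)] by blast
  have 2: "adp x y 2 = sm (1 / 2) (lie x (lie x y))"
    by (simp add: numeral_2_eq_2)
  have "adp x y 3 = sm (1 / 3) (lie x (adp x y 2))" by (simp add: numeral_3_eq_3 numeral_2_eq_2)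
  also have "lie x (adp x y 2) = 0" unfolding 2 lie_sm_right using assms(2) by simp
  finally have 3: "adp x y 3 = 0" by simp
  have z: "adp x y (3 + n) = 0" for n by (induction n) (use 3 in \<open>auto simp only: adp.simps add_0_right add_Suc_right mult_zero_left mult_zero_right diff_self sm_0_right\<close>)
  have "(\<Sum>n<N + 3. adp x y n) = (\<Sum>n<3. adp x y n)"
  proof (rule sum.mono_neutral_right)
    show "\<forall>i\<in>{..<N + 3} - {..<3}. adp x y i = 0"
    proof
      fix i assume "i \<in> {..<N + 3} - {..<3}"
      then have "i = 3 + (i - 3)" by auto
      then show "adp x y i = 0" using z by metis
    qed
  qed auto
  also have "\<dots> = y + lie x y + adp x y 2" by (simp add: numeral_3_eq_3 numeral_2_eq_2)
  finally show ?thesis using N[of "N + 3"] 2 by simp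
qed

text \<open>An element that commutes with a unipotent element commutes with its logarithm; the proof
  avoids the logarithm series. Write exp x - 1 = x y with y = 1 + x z, where y and z are polynomials
  in x. Descending induction on m, starting at the nilpotency index, shows that g commutes with x^m
  for m \<ge> 1: it commutes with (x y)^m = x^m y^m, which differs from x^m by a combination of
  higher powers of x.\<close>

lemma commute_of_commute_nexp:
  assumes x: "nilp x" and g: "g * nexp x = nexp x * g"
  shows "g * x = x * g"
proof -
  obtain N where N: "x ^ N = 0" using x unfolding nilp_def by blast
  define y where "y = (\<Sum>i<N. sm (1 / fact (Suc i)) (x ^ i))"
  define z where "z = (\<Sum>i<N. sm (1 / fact (Suc (Suc i))) (x ^ i))"
  have yx: "x * y = y * x" and zx: "x * z = z * x"
    unfolding y_def z_def sum_distrib_left sum_distrib_right by (simp_all add: power_commutes)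
  have "x ^ Suc N = 0" using power_eq_0_mono[OF N, of "Suc N"] by simp
  then have "nexp x = (\<Sum>i<Suc N. dp x i)" by (rule nexp_eq)
  also have "\<dots> = 1 + (\<Sum>i<N. dp x (Suc i))" by (simp add: sum.lessThan_Suc_shift dp_0 del: sum.lessThan_Suc)
  also have "(\<Sum>i<N. dp x (Suc i)) = x * y"
    unfolding y_def sum_distrib_left dp_def by simp
  finally have E: "nexp x - 1 = x * y" by simp
  have "y + sm (1 / fact (Suc N)) (x ^ N) = (\<Sum>i<Suc N. sm (1 / fact (Suc i)) (x ^ i))"
    unfolding y_def by simp
  also have "\<dots> = 1 + x * z"
    unfolding z_def sum_distrib_left by (simp add: sum.lessThan_Suc_shift del: sum.lessThan_Suc fact_Suc)
  finally have yz: "y = 1 + x * z" using N by simp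
  have "g * x ^ m = x ^ m * g" if "m \<ge> 1" for m
    using that
  proof (induction "N - m" arbitrary: m rule: less_induct)
    case less
    show ?case
    proof (cases "m < N")
      case False
      then show ?thesis using power_eq_0_mono[OF N, of m] by simp
    next
      case True
      \<comment> \<open>\<open>C p\<close> says that g commutes with the products of p with all
        powers of x beyond m. The induction hypothesis gives \<open>C 1\<close>, and multiplication
        by x, sums and scalars preserve \<open>C\<close>; this covers all polynomials in x.\<close>
      define C where "C p \<longleftrightarrow> (\<forall>j>m. g * (x ^ j * p) = x ^ j * p * g)" for p
      have C1: "C 1" unfolding C_def using less(1) True less(2) by auto
      have Cx: "C (x * p)" if "C p" for p
        using that unfolding C_def by (metis less_SucI mult.assoc power_Suc2)
      have Csum: "C (\<Sum>i\<in>I. p i)" if "\<And>i. i \<in> I \<Longrightarrow> C (p i)" for p :: "nat \<Rightarrow> 'r" and I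
        using that unfolding C_def by (simp add: sum_distrib_left sum_distrib_right)
      have Csm: "C (sm a p)" if "C p" for a p using that unfolding C_def by simp
      have Cp: "C (x ^ i * p)" if "C p" for i p
        by (induction i) (use that Cx in \<open>auto simp: mult.assoc\<close>)
      have Cy: "C (y * p)" and Cz: "C (z * p)" if "C p" for p
        unfolding y_def z_def sum_distrib_right using that by (auto intro!: Csum Csm Cp simp del: fact_Suc)
      have Cyk: "C (y ^ k)" for k by (induction k) (use C1 Cy in auto)
      have D: "g * (x ^ m * y ^ k - x ^ m) = (x ^ m * y ^ k - x ^ m) * g" for k
      proof (induction k)
        case (Suc k)
        have "x ^ m * y ^ Suc k - x ^ m = (x ^ m * y ^ k - x ^ m) + x ^ Suc m * (z * y ^ k)"
        proof -
          have "y ^ Suc k = (1 + x * z) * y ^ k" using yz by (metis power_Suc)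
          then have "x ^ m * y ^ Suc k = x ^ m * y ^ k + x ^ m * x * (z * y ^ k)"
            by (simp add: distrib_left distrib_right mult.assoc)
          then show ?thesis by (simp add: power_commutes del: power_Suc) (simp add: power_commutes)
        qed
        moreover have "g * (x ^ Suc m * (z * y ^ k)) = x ^ Suc m * (z * y ^ k) * g"
          using Cz[OF Cyk, of k] unfolding C_def by blast
        ultimately show ?case using Suc by (simp only: distrib_left distrib_right)
      qed simp
      have xy: "(x * y) ^ n = x ^ n * y ^ n" for n
      proof (induction n)
        case (Suc n)
        have "(x * y) ^ Suc n = x * (y * x ^ n) * y ^ n" using Suc by (simp add: mult.assoc)
        also have "y * x ^ n = x ^ n * y" using commute_power[of y x n] yx by simp
        finally show ?case by (simp add: mult.assoc)
      qed simp
      have "g * (nexp x - 1) = (nexp x - 1) * g" using g by (simp add: algebra_simps)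
      then have "g * (x * y) ^ m = (x * y) ^ m * g" unfolding E by (rule commute_power)
      then show ?thesis using D[of m] unfolding xy by (simp add: algebra_simps)
    qed
  qed
  from this[of 1] show ?thesis by simp
qed

end

section \<open>Root systems\<close>

context
  fixes \<Phi> :: "'v::euclidean_space set"
  assumes rs: "root_system \<Phi>"
begin

lemma finite_roots: "finite \<Phi>" using rs unfolding root_system_def by blast

lemma root_nonzero: "\<alpha> \<in> \<Phi> \<Longrightarrow> \<alpha> \<noteq> 0" using rs unfolding root_system_def by blast

lemma root_reflection: "\<alpha> \<in> \<Phi> \<Longrightarrow> \<beta> \<in> \<Phi> \<Longrightarrow> \<beta> - cartan_integer \<beta> \<alpha> *\<^sub>R \<alpha> \<in> \<Phi>"
  using rs unfolding root_system_def by blast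

lemma cartan_integer_Ints: "\<alpha> \<in> \<Phi> \<Longrightarrow> \<beta> \<in> \<Phi> \<Longrightarrow> cartan_integer \<beta> \<alpha> \<in> \<int>"
  using rs unfolding root_system_def by blast

lemma root_multiple: "\<alpha> \<in> \<Phi> \<Longrightarrow> c *\<^sub>R \<alpha> \<in> \<Phi> \<Longrightarrow> c = 1 \<or> c = - 1"
  using rs unfolding root_system_def by blast

lemma cartan_integer_self: "\<alpha> \<in> \<Phi> \<Longrightarrow> cartan_integer \<alpha> \<alpha> = 2"
  using root_nonzero by (simp add: cartan_integer_def)

lemma root_minus: "\<alpha> \<in> \<Phi> \<Longrightarrow> - \<alpha> \<in> \<Phi>"
  using root_reflection[of \<alpha> \<alpha>] by (simp add: cartan_integer_self scaleR_2)

lemma roots_span: "span \<Phi> = UNIV" using rs unfolding root_system_def by blast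

text \<open>The roots span, so a vector orthogonal to all of them is 0. This is what separates
  weights by the action of the coroots.\<close>

lemma eq_if_cartan_integer_eq:
  assumes "\<And>\<epsilon>. \<epsilon> \<in> \<Phi> \<Longrightarrow> cartan_integer w \<epsilon> = cartan_integer w' \<epsilon>"
  shows "w = w'"
proof -
  have "(w - w') \<bullet> \<epsilon> = 0" if "\<epsilon> \<in> \<Phi>" for \<epsilon>
    using assms[OF that] root_nonzero[OF that] by (simp add: cartan_integer_def inner_diff_left)
  then have "orthogonal (w - w') y" if "y \<in> span \<Phi>" for y
    using orthogonal_to_span[OF that] by (simp add: orthogonal_def)
  then have "orthogonal (w - w') (w - w')" using roots_span by blast
  then show ?thesis by (simp add: orthogonal_def)
qed

definition long :: "'v \<Rightarrow> bool" where
  "long \<alpha> \<longleftrightarrow> \<alpha> \<in> \<Phi> \<and> (\<forall>\<beta>\<in>\<Phi>. \<beta> \<bullet> \<beta> \<le> \<alpha> \<bullet> \<alpha>)"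

lemma long_root: "long \<alpha> \<Longrightarrow> \<alpha> \<in> \<Phi>" unfolding long_def by blast

lemma long_minus: "long \<alpha> \<Longrightarrow> long (- \<alpha>)" unfolding long_def using root_minus by simp

lemma long_norm_eq: "long \<alpha> \<Longrightarrow> \<beta> \<in> \<Phi> \<Longrightarrow> \<beta> \<bullet> \<beta> = \<alpha> \<bullet> \<alpha> \<Longrightarrow> long \<beta>"
  unfolding long_def by simp

text \<open>The vectors \<alpha> - \<beta> and \<alpha> + \<beta> have positive squared length and
  \<beta> is not longer than \<alpha>. Hence the inner product of \<alpha> and \<beta> is smaller in
  absolute value than the squared length of \<alpha>, and the Cartan integer lies strictly between
  -2 and 2.\<close>

lemma cartan_integer_long:
  assumes a: "long \<alpha>" and b: "\<beta> \<in> \<Phi>" and ne: "\<beta> \<noteq> \<alpha>" "\<beta> \<noteq> - \<alpha>"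
  shows "cartan_integer \<beta> \<alpha> \<in> {-1, 0, 1}"
proof -
  have aR: "\<alpha> \<in> \<Phi>" and le: "\<beta> \<bullet> \<beta> \<le> \<alpha> \<bullet> \<alpha>" using a b unfolding long_def by auto
  have pos: "\<alpha> \<bullet> \<alpha> > 0" using root_nonzero[OF aR] by simp
  obtain k where k: "cartan_integer \<beta> \<alpha> = of_int k"
    using cartan_integer_Ints[OF aR b] by (auto elim: Ints_cases)
  have eq: "2 * (\<beta> \<bullet> \<alpha>) = of_int k * (\<alpha> \<bullet> \<alpha>)"
    using k pos by (simp add: cartan_integer_def field_simps)
  have plus: "\<alpha> \<bullet> \<alpha> > \<beta> \<bullet> \<alpha>"
  proof -
    have "(\<alpha> - \<beta>) \<bullet> (\<alpha> - \<beta>) > 0" using ne by simp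
    then show ?thesis using le by (simp add: inner_diff_left inner_diff_right inner_commute)
  qed
  have minus: "\<alpha> \<bullet> \<alpha> > - (\<beta> \<bullet> \<alpha>)"
  proof -
    have "(\<alpha> + \<beta>) \<bullet> (\<alpha> + \<beta>) > 0" using ne by (simp add: add_eq_0_iff)
    then show ?thesis using le by (simp add: inner_add_left inner_add_right inner_commute)
  qed
  have "of_int k * (\<alpha> \<bullet> \<alpha>) < 2 * (\<alpha> \<bullet> \<alpha>)" "of_int k * (\<alpha> \<bullet> \<alpha>) > - 2 * (\<alpha> \<bullet> \<alpha>)"
    using plus minus eq by auto
  then have "(of_int k :: real) < 2" "(of_int k :: real) > - 2"
    using mult_less_cancel_right_pos[OF pos] by blast+
  then have "k \<in> {-1, 0, 1}" by auto
  then show ?thesis using k by auto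
qed

text \<open>The sum is longer than the longest root.\<close>

lemma long_inner_nonneg_add:
  assumes a: "long \<alpha>" and b: "\<beta> \<in> \<Phi>" and "\<beta> \<bullet> \<alpha> \<ge> 0"
  shows "\<alpha> + \<beta> \<notin> \<Phi>" "\<alpha> + \<beta> \<noteq> 0"
proof -
  have "\<beta> \<bullet> \<beta> > 0" using root_nonzero[OF b] by simp
  then have *: "(\<alpha> + \<beta>) \<bullet> (\<alpha> + \<beta>) > \<alpha> \<bullet> \<alpha>"
  proof -
    have "(\<alpha> + \<beta>) \<bullet> (\<alpha> + \<beta>) = \<alpha> \<bullet> \<alpha> + 2 * (\<beta> \<bullet> \<alpha>) + \<beta> \<bullet> \<beta>"
      by (simp add: inner_add_left inner_add_right inner_commute)
    then show ?thesis using assms(3) \<open>\<beta> \<bullet> \<beta> > 0\<close> by linarith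
  qed
  then show "\<alpha> + \<beta> \<notin> \<Phi>" using a unfolding long_def by fastforce
  show "\<alpha> + \<beta> \<noteq> 0"
  proof
    assume "\<alpha> + \<beta> = 0"
    then have "(\<alpha> + \<beta>) \<bullet> (\<alpha> + \<beta>) = 0" by simp
    then show False using * by (metis inner_ge_zero not_less)
  qed
qed

text \<open>The reflection in \<alpha> takes \<beta> to \<alpha> + \<beta>, which is therefore a
  root of the same length as \<beta>.\<close>

lemma cartan_integer_neg_one:
  assumes a: "\<alpha> \<in> \<Phi>" and b: "\<beta> \<in> \<Phi>" and c: "cartan_integer \<beta> \<alpha> = -1"
  shows "\<alpha> + \<beta> \<in> \<Phi>" "2 * (\<beta> \<bullet> \<alpha>) = - (\<alpha> \<bullet> \<alpha>)" "(\<alpha> + \<beta>) \<bullet> (\<alpha> + \<beta>) = \<beta> \<bullet> \<beta>"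
    "cartan_integer \<alpha> (\<alpha> + \<beta>) = - cartan_integer \<alpha> \<beta>" "cartan_integer \<alpha> \<beta> \<noteq> 0" "\<beta> \<bullet> \<alpha> < 0"
proof -
  have pos: "\<alpha> \<bullet> \<alpha> > 0" using root_nonzero[OF a] by simp
  show "\<alpha> + \<beta> \<in> \<Phi>" using root_reflection[OF a b] c by (simp add: add.commute)
  show 1: "2 * (\<beta> \<bullet> \<alpha>) = - (\<alpha> \<bullet> \<alpha>)"
    using c pos by (simp add: cartan_integer_def divide_eq_eq)
  then show "\<beta> \<bullet> \<alpha> < 0" using pos by linarith
  show 2: "(\<alpha> + \<beta>) \<bullet> (\<alpha> + \<beta>) = \<beta> \<bullet> \<beta>"
    using 1 by (simp add: inner_add_left inner_add_right inner_commute)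
  show "cartan_integer \<alpha> (\<alpha> + \<beta>) = - cartan_integer \<alpha> \<beta>"
  proof -
    have "\<alpha> \<bullet> (\<alpha> + \<beta>) = - (\<alpha> \<bullet> \<beta>)" using 1 by (simp add: inner_add_right inner_commute)
    then show ?thesis unfolding cartan_integer_def 2 by simp
  qed
  show "cartan_integer \<alpha> \<beta> \<noteq> 0"
    using 1 pos root_nonzero[OF b] by (auto simp: cartan_integer_def inner_commute)
qed

lemma cartan_integer_add: "cartan_integer (v + w) \<alpha> = cartan_integer v \<alpha> + cartan_integer w \<alpha>"
  by (simp add: cartan_integer_def inner_add_left add_divide_distrib)

lemma cartan_integer_minus_left: "cartan_integer (- v) \<alpha> = - cartan_integer v \<alpha>"
  by (simp add: cartan_integer_def)

lemma cartan_integer_minus_right: "cartan_integer v (- \<alpha>) = - cartan_integer v \<alpha>"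
  by (simp add: cartan_integer_def)

lemma cartan_integer_zero: "cartan_integer 0 \<alpha> = 0"
  by (simp add: cartan_integer_def)

lemma long_diff_not_root:
  assumes a: "long \<alpha>" and b: "\<beta> \<in> \<Phi>" and c: "cartan_integer \<beta> \<alpha> = -1"
  shows "\<beta> - \<alpha> \<notin> \<Phi>" "\<beta> - \<alpha> \<noteq> 0" "\<alpha> - \<beta> \<notin> \<Phi>" "\<alpha> - \<beta> \<noteq> 0"
proof -
  have "\<beta> \<bullet> (- \<alpha>) \<ge> 0" using cartan_integer_neg_one(6)[OF long_root[OF a] b c] by simp
  from long_inner_nonneg_add[OF long_minus[OF a] b this]
  show "\<beta> - \<alpha> \<notin> \<Phi>" "\<beta> - \<alpha> \<noteq> 0" by auto
  then show "\<alpha> - \<beta> \<notin> \<Phi>" "\<alpha> - \<beta> \<noteq> 0" using root_minus[of "\<alpha> - \<beta>"] by auto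
qed

lemma ex_long: "\<Phi> \<noteq> {} \<Longrightarrow> \<exists>\<alpha>. long \<alpha>"
proof -
  assume "\<Phi> \<noteq> {}"
  then have "Max ((\<lambda>\<beta>. \<beta> \<bullet> \<beta>) ` \<Phi>) \<in> (\<lambda>\<beta>. \<beta> \<bullet> \<beta>) ` \<Phi>"
    using finite_roots by (intro Max_in) auto
  then obtain \<alpha> where "\<alpha> \<in> \<Phi>" "\<alpha> \<bullet> \<alpha> = Max ((\<lambda>\<beta>. \<beta> \<bullet> \<beta>) ` \<Phi>)" by auto
  then show ?thesis unfolding long_def using finite_roots by auto
qed

text \<open>Otherwise \<alpha> and -\<alpha> would be orthogonal to all other roots, which exist
  because the rank exceeds 1, and \<Phi> would decompose. The sign is adjusted by passing to
  -\<beta>.\<close>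

lemma ex_cartan_integer_neg_one:
  assumes ind: "indecomposable \<Phi>" and dim: "dim \<Phi> > 1" and a: "long \<alpha>"
  shows "\<exists>\<beta>\<in>\<Phi>. cartan_integer \<beta> \<alpha> = -1"
proof -
  have aR: "\<alpha> \<in> \<Phi>" using a by (rule long_root)
  have "\<exists>\<beta>\<in>\<Phi>. \<beta> \<noteq> \<alpha> \<and> \<beta> \<noteq> - \<alpha> \<and> \<beta> \<bullet> \<alpha> \<noteq> 0"
  proof (rule ccontr)
    assume not: "\<not> ?thesis"
    let ?A = "{\<alpha>, - \<alpha>}"
    have "\<Phi> - ?A \<noteq> {}"
    proof
      assume "\<Phi> - ?A = {}"
      then have "\<Phi> \<subseteq> span {\<alpha>}" by (auto simp: span_base span_neg)
      then have "dim \<Phi> \<le> dim {\<alpha>}" by (rule dim_mono)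
      also have "\<dots> \<le> 1" using dim_le_card'[of "{\<alpha>}"] by simp
      finally show False using dim by simp
    qed
    moreover have "?A \<union> (\<Phi> - ?A) = \<Phi>" using aR root_minus by auto
    moreover have "\<forall>x\<in>?A. \<forall>y\<in>\<Phi> - ?A. x \<bullet> y = 0" using not by (auto simp: inner_commute)
    ultimately show False using ind unfolding indecomposable_def by blast
  qed
  then obtain \<beta> where b: "\<beta> \<in> \<Phi>" "\<beta> \<noteq> \<alpha>" "\<beta> \<noteq> - \<alpha>" "\<beta> \<bullet> \<alpha> \<noteq> 0" by blast
  have "cartan_integer \<beta> \<alpha> \<noteq> 0" using b(4) root_nonzero[OF aR] by (simp add: cartan_integer_def)
  then have "cartan_integer \<beta> \<alpha> = -1 \<or> cartan_integer \<beta> \<alpha> = 1"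
    using cartan_integer_long[OF a b(1-3)] by auto
  then show ?thesis
    using b(1) root_minus[OF b(1)] cartan_integer_minus_left[of \<beta> \<alpha>] by fastforce
qed

end

section \<open>Chevalley systems in associative algebras\<close>

text \<open>The root vectors live in an associative algebra over an arbitrary field of
  characteristic zero, with the commutator as bracket. A Cartan integer is a real number that is
  integral at roots; its floor transports it to the field.\<close>

locale chevalley_system = assoc_algebra sm
  for sm :: "'k::field_char_0 \<Rightarrow> 'r::ring_1 \<Rightarrow> 'r" +
  fixes \<Phi> :: "'v::euclidean_space set" and X :: "'v \<Rightarrow> 'r"
  assumes rs: "root_system \<Phi>"
    and nilp_X: "\<alpha> \<in> \<Phi> \<Longrightarrow> nilp (X \<alpha>)"
    and X_nonzero: "\<alpha> \<in> \<Phi> \<Longrightarrow> X \<alpha> \<noteq> 0"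
    and lie_X_eq_0: "\<alpha> \<in> \<Phi> \<Longrightarrow> \<beta> \<in> \<Phi> \<Longrightarrow> \<alpha> + \<beta> \<notin> \<Phi> \<Longrightarrow> \<alpha> + \<beta> \<noteq> 0 \<Longrightarrow> lie (X \<alpha>) (X \<beta>) = 0"
    and lie_X_X: "\<alpha> \<in> \<Phi> \<Longrightarrow> \<beta> \<in> \<Phi> \<Longrightarrow> \<alpha> + \<beta> \<in> \<Phi> \<Longrightarrow>
      \<exists>c. lie (X \<alpha>) (X \<beta>) = sm c (X (\<alpha> + \<beta>)) \<and> lie (X (- \<alpha>)) (X (- \<beta>)) = sm (- c) (X (- (\<alpha> + \<beta>)))"
    and lie_H_X_floor: "\<alpha> \<in> \<Phi> \<Longrightarrow> \<beta> \<in> \<Phi> \<Longrightarrow>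
      lie (lie (X \<alpha>) (X (- \<alpha>))) (X \<beta>) = sm (of_int \<lfloor>cartan_integer \<beta> \<alpha>\<rfloor>) (X \<beta>)"
begin

section \<open>Weights, and the Lie algebra spanned by root vectors and coroots\<close>

definition H :: "'v \<Rightarrow> 'r" where "H \<alpha> = lie (X \<alpha>) (X (- \<alpha>))"

definition ev :: "'v \<Rightarrow> 'v \<Rightarrow> 'k" where "ev w \<alpha> = of_int \<lfloor>cartan_integer w \<alpha>\<rfloor>"

definition wt :: "'v \<Rightarrow> bool" where "wt w \<longleftrightarrow> (\<forall>\<alpha>\<in>\<Phi>. cartan_integer w \<alpha> \<in> \<int>)"

definition has_wt :: "'v \<Rightarrow> 'r \<Rightarrow> bool" where
  "has_wt w y \<longleftrightarrow> wt w \<and> (\<forall>\<alpha>\<in>\<Phi>. lie (H \<alpha>) y = sm (ev w \<alpha>) y)"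

definition S :: "'r set" where "S = vs.span (X ` \<Phi> \<union> H ` \<Phi>)"

lemma jacobi: "lie (x::'r) (lie y z) = lie (lie x y) z + lie y (lie x z)"
  by (simp add: algebra_simps)

lemma lie_anti: "lie (x::'r) y = - lie y x" by simp

lemma lie_add_right: "lie (x::'r) (y + z) = lie x y + lie x z" by (simp add: algebra_simps)

lemma lie_sum_right: "lie (x::'r) (sum f I) = (\<Sum>i\<in>I. lie x (f i))"
  by (simp add: sum_distrib_left sum_distrib_right sum_subtractf)

lemma wt_root: "\<beta> \<in> \<Phi> \<Longrightarrow> wt \<beta>" unfolding wt_def using cartan_integer_Ints[OF rs] by blast

lemma wt_0: "wt 0" unfolding wt_def by (simp add: cartan_integer_zero[OF rs])

lemma wt_add: "wt v \<Longrightarrow> wt w \<Longrightarrow> wt (v + w)"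
  unfolding wt_def by (simp add: cartan_integer_add[OF rs])

lemma ev_add: "wt v \<Longrightarrow> wt w \<Longrightarrow> \<alpha> \<in> \<Phi> \<Longrightarrow> ev (v + w) \<alpha> = ev v \<alpha> + ev w \<alpha>"
  unfolding wt_def ev_def by (auto simp: cartan_integer_add[OF rs] elim!: ballE Ints_cases)

lemma ev_0: "ev 0 \<alpha> = 0" by (simp add: ev_def cartan_integer_zero[OF rs])

lemma ev_of_int: "cartan_integer w \<alpha> = of_int k \<Longrightarrow> ev w \<alpha> = of_int k" by (simp add: ev_def)

lemma ev_minus: "wt w \<Longrightarrow> \<alpha> \<in> \<Phi> \<Longrightarrow> ev (- w) \<alpha> = - ev w \<alpha>"
  unfolding wt_def ev_def by (auto simp: cartan_integer_minus_left[OF rs] elim!: ballE Ints_cases)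

lemma ev_self: "\<alpha> \<in> \<Phi> \<Longrightarrow> ev \<alpha> \<alpha> = 2"
  using ev_of_int[of \<alpha> \<alpha> 2] cartan_integer_self[OF rs] by simp

lemma lie_H_X: "\<alpha> \<in> \<Phi> \<Longrightarrow> \<beta> \<in> \<Phi> \<Longrightarrow> lie (H \<alpha>) (X \<beta>) = sm (ev \<beta> \<alpha>) (X \<beta>)"
  unfolding H_def ev_def by (rule lie_H_X_floor)

lemma lie_X_H: "\<alpha> \<in> \<Phi> \<Longrightarrow> \<beta> \<in> \<Phi> \<Longrightarrow> lie (X \<beta>) (H \<alpha>) = sm (- ev \<beta> \<alpha>) (X \<beta>)"
  using lie_anti[of "X \<beta>" "H \<alpha>"] lie_H_X by simp

lemma has_wt_X: "\<beta> \<in> \<Phi> \<Longrightarrow> has_wt \<beta> (X \<beta>)"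
  unfolding has_wt_def using wt_root lie_H_X by blast

lemma has_wt_sm: "has_wt w y \<Longrightarrow> has_wt w (sm c y)"
  unfolding has_wt_def by (simp only: lie_sm_right sm_sm) (simp add: mult.commute)

lemma has_wt_lie:
  assumes "has_wt v x" "has_wt w y" shows "has_wt (v + w) (lie x y)"
proof -
  have "lie (H \<alpha>) (lie x y) = sm (ev (v + w) \<alpha>) (lie x y)" if "\<alpha> \<in> \<Phi>" for \<alpha>
  proof -
    have "lie (H \<alpha>) (lie x y) = lie (sm (ev v \<alpha>) x) y + lie x (sm (ev w \<alpha>) y)"
      using jacobi[of "H \<alpha>" x y] assms that unfolding has_wt_def by metis
    also have "\<dots> = sm (ev v \<alpha> + ev w \<alpha>) (lie x y)"
      by (simp only: lie_sm_left lie_sm_right sm_add_left)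
    finally show ?thesis using assms that ev_add unfolding has_wt_def by simp
  qed
  then show ?thesis using assms wt_add unfolding has_wt_def by blast
qed

lemma H_nonzero: assumes "\<alpha> \<in> \<Phi>" shows "H \<alpha> \<noteq> 0"
proof
  assume "H \<alpha> = 0"
  then have "sm 2 (X \<alpha>) = 0" using lie_H_X[OF assms assms] ev_self[OF assms] by simp
  then show False using X_nonzero[OF assms] by simp
qed

lemma has_wt_H: assumes "\<beta> \<in> \<Phi>" shows "has_wt 0 (H \<beta>)"
  using has_wt_lie[OF has_wt_X[OF assms] has_wt_X[OF root_minus[OF rs assms]]] unfolding H_def by simp

lemma has_wt_0_span_H: assumes "h \<in> vs.span (H ` \<Phi>)" shows "has_wt 0 h"
  using assms
proof (induction h rule: vs.span_induct_alt)
  case base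
  then show ?case by (simp add: has_wt_def wt_0)
next
  case (step c x y)
  then obtain \<beta> where "\<beta> \<in> \<Phi>" "x = H \<beta>" by blast
  then show ?case using step(2) has_wt_sm[OF has_wt_H[of \<beta>], of c] unfolding has_wt_def
    by (auto simp: lie_add_right sm_add_right)
qed

text \<open>The operator ad \<open>H \<epsilon>\<close> minus its eigenvalue on the new summand
  removes that summand and multiplies the others by differences of eigenvalues. For each other
  weight some root \<epsilon> makes this difference nonzero.\<close>

lemma weights_independent:
  assumes "finite W" and "\<And>w. w \<in> W \<Longrightarrow> has_wt w (v w)" and "(\<Sum>w\<in>W. v w) = 0"
  shows "\<forall>w\<in>W. v w = 0"
  using assms
proof (induction W arbitrary: v rule: finite_induct)
  case (insert a W)
  have *: "v w = 0" if w: "w \<in> W" for w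
  proof -
    have "w \<noteq> a" using insert w by auto
    then obtain \<epsilon> where \<epsilon>: "\<epsilon> \<in> \<Phi>" "cartan_integer w \<epsilon> \<noteq> cartan_integer a \<epsilon>"
      using eq_if_cartan_integer_eq[OF rs] by blast
    have wts: "wt w" "wt a" using insert.prems(1) w unfolding has_wt_def by auto
    then have ne: "ev w \<epsilon> - ev a \<epsilon> \<noteq> 0"
      using \<epsilon> unfolding wt_def ev_def by (auto elim!: ballE Ints_cases)
    have "(\<Sum>u\<in>insert a W. sm (ev u \<epsilon> - ev a \<epsilon>) (v u)) =
        lie (H \<epsilon>) (\<Sum>u\<in>insert a W. v u) - sm (ev a \<epsilon>) (\<Sum>u\<in>insert a W. v u)"
      unfolding lie_sum_right sm_sum_right sum_subtractf[symmetric]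
      using insert.prems(1) \<epsilon>(1) unfolding has_wt_def
      by (intro sum.cong refl) (simp add: sm_diff_left)
    then have "(\<Sum>u\<in>W. sm (ev u \<epsilon> - ev a \<epsilon>) (v u)) = 0"
      using insert.prems(2) insert.hyps by simp
    then have "\<forall>u\<in>W. sm (ev u \<epsilon> - ev a \<epsilon>) (v u) = 0"
      by (intro insert.IH) (use insert.prems(1) has_wt_sm in auto)
    then show ?thesis using w ne by auto
  qed
  then show ?case using insert by simp
qed simp

text \<open>The bracket with a vector of weight \<open>z0\<close> shifts every weight by
  \<open>z0\<close>, so the images of the components still have distinct weights and vanish one by
  one.\<close>

lemma lie_components_eq_0:
  assumes fin: "finite W" and v: "\<And>w. w \<in> W \<Longrightarrow> has_wt w (v w)" and z: "has_wt z0 z"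
    and "lie z (\<Sum>w\<in>W. v w) = 0" and "w \<in> W"
  shows "lie z (v w) = 0"
proof -
  have "(\<Sum>u\<in>(\<lambda>w. z0 + w) ` W. lie z (v (u - z0))) = (\<Sum>w\<in>W. lie z (v w))"
    by (subst sum.reindex) (auto simp: inj_on_def)
  then have "(\<Sum>u\<in>(\<lambda>w. z0 + w) ` W. lie z (v (u - z0))) = 0"
    using assms(4) lie_sum_right by metis
  moreover have "has_wt u (lie z (v (u - z0)))" if "u \<in> (\<lambda>w. z0 + w) ` W" for u
    using that has_wt_lie[OF z v] by auto
  ultimately have "\<forall>u\<in>(\<lambda>w. z0 + w) ` W. lie z (v (u - z0)) = 0"
    using fin by (intro weights_independent) auto
  then show ?thesis using assms(5) by force
qed

lemma S_components:
  assumes "y \<in> S"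
  obtains c h where "y = (\<Sum>\<beta>\<in>\<Phi>. sm (c \<beta>) (X \<beta>)) + h" "h \<in> vs.span (H ` \<Phi>)"
proof -
  obtain y' h where y: "y = y' + h" and y': "y' \<in> vs.span (X ` \<Phi>)" and h: "h \<in> vs.span (H ` \<Phi>)"
    using assms unfolding S_def vs.span_Un by auto
  have "\<exists>c. y' = (\<Sum>\<beta>\<in>\<Phi>. sm (c \<beta>) (X \<beta>))"
    using y'
  proof (induction y' rule: vs.span_induct_alt)
    case base
    show ?case by (rule exI[of _ "\<lambda>_. 0"]) simp
  next
    case (step a x y)
    then obtain \<alpha> c where \<alpha>: "\<alpha> \<in> \<Phi>" "x = X \<alpha>" and c: "y = (\<Sum>\<beta>\<in>\<Phi>. sm (c \<beta>) (X \<beta>))" by blast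
    have "(\<Sum>\<beta>\<in>\<Phi>. sm (if \<beta> = \<alpha> then a else 0) (X \<beta>)) = sm a (X \<alpha>)"
      using \<alpha> finite_roots[OF rs] by (simp add: if_distrib[of "\<lambda>c. sm c _"] sum.delta cong: if_cong)
    then have "sm a x + y = (\<Sum>\<beta>\<in>\<Phi>. sm ((if \<beta> = \<alpha> then a else 0) + c \<beta>) (X \<beta>))"
      using \<alpha> c by (simp only: sm_add_left sum.distrib)
    then show ?case by (intro exI[of _ "\<lambda>\<beta>. (if \<beta> = \<alpha> then a else 0) + c \<beta>"])
  qed
  then show ?thesis using that y h by blast
qed

text \<open>The root vectors and the part in the span of the coroots are merged into one family
  indexed by weights, with 0 as the weight of the latter.\<close>

lemma S_components':
  assumes "y \<in> S"
  obtains c h where "y = (\<Sum>w\<in>insert 0 \<Phi>. if w = 0 then h else sm (c w) (X w))"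
    "h \<in> vs.span (H ` \<Phi>)" "y = (\<Sum>\<beta>\<in>\<Phi>. sm (c \<beta>) (X \<beta>)) + h"
    "\<And>w. w \<in> insert 0 \<Phi> \<Longrightarrow> has_wt w (if w = 0 then h else sm (c w) (X w))"
proof -
  obtain c h where y: "y = (\<Sum>\<beta>\<in>\<Phi>. sm (c \<beta>) (X \<beta>)) + h" and h: "h \<in> vs.span (H ` \<Phi>)"
    using S_components[OF assms] .
  have n: "w \<noteq> 0" if "w \<in> \<Phi>" for w using that root_nonzero[OF rs] by blast
  then have "(\<Sum>w\<in>\<Phi>. if w = 0 then h else sm (c w) (X w)) = (\<Sum>\<beta>\<in>\<Phi>. sm (c \<beta>) (X \<beta>))"
    by (intro sum.cong) auto
  then have "y = (\<Sum>w\<in>insert 0 \<Phi>. if w = 0 then h else sm (c w) (X w))"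
    using y finite_roots[OF rs] n by (subst sum.insert) auto
  moreover have "has_wt w (if w = 0 then h else sm (c w) (X w))" if "w \<in> insert 0 \<Phi>" for w
    using that has_wt_0_span_H[OF h] has_wt_sm[OF has_wt_X] n by auto
  ultimately show ?thesis using that h y by blast
qed

lemma X_in_S: "\<beta> \<in> \<Phi> \<Longrightarrow> X \<beta> \<in> S" unfolding S_def by (intro vs.span_base) auto

lemma H_in_S: "\<beta> \<in> \<Phi> \<Longrightarrow> H \<beta> \<in> S" unfolding S_def by (intro vs.span_base) auto

lemma subspace_S: "vs.subspace S" unfolding S_def by (rule vs.subspace_span)

lemma lie_X_S: assumes a: "\<alpha> \<in> \<Phi>" and y: "y \<in> S" shows "lie (X \<alpha>) y \<in> S"
  using y unfolding S_def
proof (induction y rule: vs.span_induct_alt)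
  case base
  then show ?case by (simp add: vs.span_zero)
next
  case (step c x y)
  have "lie (X \<alpha>) x \<in> S"
  proof -
    from step(1) consider \<beta> where "\<beta> \<in> \<Phi>" "x = X \<beta>" | \<beta> where "\<beta> \<in> \<Phi>" "x = H \<beta>" by blast
    then show ?thesis
    proof cases
      case (1 \<beta>)
      consider "\<alpha> + \<beta> \<in> \<Phi>" | "\<alpha> + \<beta> = 0" | "\<alpha> + \<beta> \<notin> \<Phi>" "\<alpha> + \<beta> \<noteq> 0" by blast
      then show ?thesis
      proof cases
        case 1
        then show ?thesis using lie_X_X[OF a \<open>\<beta> \<in> \<Phi>\<close>] \<open>x = X \<beta>\<close> X_in_S vs.subspace_scale[OF subspace_S] by auto
      next
        case 2
        then have "\<beta> = - \<alpha>" by (simp add: add_eq_0_iff)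
        then show ?thesis using \<open>x = X \<beta>\<close> H_in_S[OF a] unfolding H_def by simp
      next
        case 3
        then show ?thesis using lie_X_eq_0[OF a \<open>\<beta> \<in> \<Phi>\<close>] \<open>x = X \<beta>\<close> vs.subspace_0[OF subspace_S] by simp
      qed
    next
      case (2 \<beta>)
      then show ?thesis using lie_X_H[OF \<open>\<beta> \<in> \<Phi>\<close> a] X_in_S[OF a] vs.subspace_scale[OF subspace_S] by metis
    qed
  qed
  then have "sm c (lie (X \<alpha>) x) + lie (X \<alpha>) y \<in> vs.span (X ` \<Phi> \<union> H ` \<Phi>)"
    using step(2) unfolding S_def by (intro vs.span_add vs.span_scale)
  moreover have "lie (X \<alpha>) (sm c x + y) = sm c (lie (X \<alpha>) x) + lie (X \<alpha>) y"
    by (simp only: lie_add_right lie_sm_right)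
  ultimately show ?case by simp
qed

abbreviation "lg \<equiv> long \<Phi>"

text \<open>For a long root \<open>\<alpha>\<close> the structure constant is \<open>\<plusminus> 1\<close>. This follows from expanding the bracket of
  \<open>lie (X \<alpha>) (X \<beta>)\<close> with \<open>lie (X (- \<alpha>)) (X (- \<beta>))\<close> in two ways.\<close>

lemma lie_long:
  assumes a: "lg \<alpha>" and b: "\<beta> \<in> \<Phi>" and c: "cartan_integer \<beta> \<alpha> = -1"
  obtains c where "c * c = 1" "lie (X \<alpha>) (X \<beta>) = sm c (X (\<alpha> + \<beta>))"
    "lie (X (- \<alpha>)) (X (- \<beta>)) = sm (- c) (X (- (\<alpha> + \<beta>)))"
proof -
  note aR = long_root[OF rs a]
  note f = cartan_integer_neg_one[OF rs aR b c] and d = long_diff_not_root[OF rs a b c]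
  obtain k where k1: "lie (X \<alpha>) (X \<beta>) = sm k (X (\<alpha> + \<beta>))"
    and k2: "lie (X (- \<alpha>)) (X (- \<beta>)) = sm (- k) (X (- (\<alpha> + \<beta>)))"
    using lie_X_X[OF aR b f(1)] by blast
  have ma: "- \<alpha> \<in> \<Phi>" and mb: "- \<beta> \<in> \<Phi>" using root_minus[OF rs] aR b by auto
  have z1: "lie (X \<beta>) (X (- \<alpha>)) = 0" by (rule lie_X_eq_0[OF b ma]) (use d in auto)
  have z2: "lie (X \<alpha>) (X (- \<beta>)) = 0" by (rule lie_X_eq_0[OF aR mb]) (use d in auto)
  have eba: "ev \<beta> \<alpha> = -1" using ev_of_int[of \<beta> \<alpha> "-1"] c by simp
  let ?u = "lie (X (- \<alpha>)) (X (- \<beta>))"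
  have "lie (X \<beta>) ?u = lie (X (- \<alpha>)) (H \<beta>)"
    using jacobi[of "X \<beta>" "X (- \<alpha>)" "X (- \<beta>)"] z1 unfolding H_def by simp
  also have "\<dots> = sm (ev \<alpha> \<beta>) (X (- \<alpha>))"
    using lie_X_H[OF b ma] ev_minus[OF wt_root[OF aR] b] by simp
  finally have 1: "lie (X \<alpha>) (lie (X \<beta>) ?u) = sm (ev \<alpha> \<beta>) (H \<alpha>)"
    unfolding H_def by (simp only: lie_sm_right)
  have "lie (X \<alpha>) ?u = lie (H \<alpha>) (X (- \<beta>))"
    using jacobi[of "X \<alpha>" "X (- \<alpha>)" "X (- \<beta>)"] z2 unfolding H_def by simp
  also have "\<dots> = X (- \<beta>)"
    using lie_H_X[OF aR mb] ev_minus[OF wt_root[OF b] aR] eba by simp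
  finally have 2: "lie (X \<beta>) (lie (X \<alpha>) ?u) = H \<beta>" unfolding H_def by simp
  have "lie (lie (X \<alpha>) (X \<beta>)) ?u = lie (X \<alpha>) (lie (X \<beta>) ?u) - lie (X \<beta>) (lie (X \<alpha>) ?u)"
    using jacobi[of "X \<alpha>" "X \<beta>" ?u] by (simp add: algebra_simps)
  then have "lie (lie (X \<alpha>) (X \<beta>)) ?u = sm (ev \<alpha> \<beta>) (H \<alpha>) - H \<beta>"
    unfolding 1 2 .
  then have "lie (sm k (X (\<alpha> + \<beta>))) (sm (- k) (X (- (\<alpha> + \<beta>)))) = sm (ev \<alpha> \<beta>) (H \<alpha>) - H \<beta>"
    unfolding k1 k2 .
  then have 3: "sm (- (k * k)) (H (\<alpha> + \<beta>)) = sm (ev \<alpha> \<beta>) (H \<alpha>) - H \<beta>"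
    unfolding H_def by (simp only: lie_sm_left lie_sm_right sm_sm) (simp add: sm_diff_right)
  have "lie (sm (- (k * k)) (H (\<alpha> + \<beta>))) (X \<alpha>) = sm (- (k * k) * ev \<alpha> (\<alpha> + \<beta>)) (X \<alpha>)"
    by (simp only: lie_sm_left lie_H_X[OF f(1) aR] sm_sm)
  moreover have "lie (sm (ev \<alpha> \<beta>) (H \<alpha>) - H \<beta>) (X \<alpha>) = sm (ev \<alpha> \<beta>) (lie (H \<alpha>) (X \<alpha>)) - lie (H \<beta>) (X \<alpha>)"
    by (simp add: algebra_simps sm_diff_right)
  then have "lie (sm (ev \<alpha> \<beta>) (H \<alpha>) - H \<beta>) (X \<alpha>) = sm (ev \<alpha> \<beta> * 2 - ev \<alpha> \<beta>) (X \<alpha>)"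
    unfolding lie_H_X[OF aR aR] lie_H_X[OF b aR] ev_self[OF aR] sm_diff_left sm_sm .
  ultimately have "- (k * k) * ev \<alpha> (\<alpha> + \<beta>) = ev \<alpha> \<beta>"
    using 3 X_nonzero[OF aR] by (simp del: sm_minus_left)
  moreover obtain m where m: "cartan_integer \<alpha> \<beta> = of_int m"
    using cartan_integer_Ints[OF rs b aR] by (auto elim: Ints_cases)
  then have "ev \<alpha> \<beta> = of_int m" "ev \<alpha> (\<alpha> + \<beta>) = - of_int m" "m \<noteq> 0"
    using f(4,5) ev_of_int[of \<alpha> "\<alpha> + \<beta>" "- m"] ev_of_int[of \<alpha> \<beta> m] by auto
  ultimately have "k * k = 1" by simp
  then show ?thesis using that k1 k2 by blast
qed

text \<open>If the bracket vanished, bracketing it with \<open>X (- \<gamma>)\<close> would give a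
  relation between the coroots of \<beta> - \<gamma> and \<beta> with coefficients 1 or -1, by the
  structure constants at long roots. Applied to \<open>X \<beta>\<close> it says that the Cartan
  integer of \<beta> at \<beta> - \<gamma> has square 4. With q the ratio of the squared lengths of
  \<gamma> and \<beta> this integer is 2 - q, so q = 4 and \<gamma> = 2 \<beta>, impossible in a
  reduced system.\<close>

lemma lie_to_long_nonzero:
  assumes g: "lg \<gamma>" and b: "\<beta> \<in> \<Phi>" and c: "cartan_integer \<beta> \<gamma> = 1"
  shows "lie (X \<beta>) (X (\<gamma> - \<beta>)) \<noteq> 0"
proof
  assume 0: "lie (X \<beta>) (X (\<gamma> - \<beta>)) = 0"
  note gR = long_root[OF rs g]
  have mg: "lg (- \<gamma>)" using long_minus[OF rs g] .
  have c1: "cartan_integer \<beta> (- \<gamma>) = -1" using c by (simp add: cartan_integer_minus_right[OF rs])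
  note f = cartan_integer_neg_one[OF rs long_root[OF rs mg] b c1]
  have gb: "\<gamma> - \<beta> \<in> \<Phi>" using root_minus[OF rs f(1)] by simp
  have "cartan_integer \<gamma> (- \<gamma>) = - 2"
    using cartan_integer_self[OF rs gR] by (simp add: cartan_integer_minus_right[OF rs])
  then have c2: "cartan_integer (\<gamma> - \<beta>) (- \<gamma>) = -1"
    using c1 cartan_integer_add[OF rs, of \<gamma> "- \<beta>" "- \<gamma>"] cartan_integer_minus_left[OF rs, of \<beta> "- \<gamma>"] by simp
  obtain k1 where k1: "k1 * k1 = 1" "lie (X (- \<gamma>)) (X \<beta>) = sm k1 (X (- \<gamma> + \<beta>))"
    using lie_long[OF mg b c1] by metis
  obtain k2 where k2: "k2 * k2 = 1" "lie (X (- \<gamma>)) (X (\<gamma> - \<beta>)) = sm k2 (X (- \<gamma> + (\<gamma> - \<beta>)))"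
    using lie_long[OF mg gb c2] by metis
  have "0 = lie (sm k1 (X (- \<gamma> + \<beta>))) (X (\<gamma> - \<beta>)) + lie (X \<beta>) (sm k2 (X (- \<beta>)))"
    using jacobi[of "X (- \<gamma>)" "X \<beta>" "X (\<gamma> - \<beta>)"] 0 k1(2) k2(2) by simp
  then have "0 = sm k1 (H (- \<gamma> + \<beta>)) + sm k2 (H \<beta>)"
    unfolding H_def by (simp only: lie_sm_left lie_sm_right) simp
  then have "0 = lie (sm k1 (H (- \<gamma> + \<beta>)) + sm k2 (H \<beta>)) (X \<beta>)"
    by simp
  also have "\<dots> = sm k1 (lie (H (- \<gamma> + \<beta>)) (X \<beta>)) + sm k2 (lie (H \<beta>) (X \<beta>))"
    by (simp add: algebra_simps sm_diff_right)
  also have "\<dots> = sm (k1 * ev \<beta> (- \<gamma> + \<beta>) + k2 * 2) (X \<beta>)"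
    unfolding lie_H_X[OF f(1) b] lie_H_X[OF b b] ev_self[OF b] sm_sm sm_add_left ..
  finally have "k1 * ev \<beta> (- \<gamma> + \<beta>) = - (k2 * 2)"
    using X_nonzero[OF b] by (simp add: add_eq_0_iff2)
  then have "(k1 * ev \<beta> (- \<gamma> + \<beta>)) * (k1 * ev \<beta> (- \<gamma> + \<beta>)) = (k2 * 2) * (k2 * 2)" by simp
  then have "(k1 * k1) * (ev \<beta> (- \<gamma> + \<beta>) * ev \<beta> (- \<gamma> + \<beta>)) = (k2 * k2) * 4"
    by (simp add: algebra_simps)
  then have e4: "ev \<beta> (- \<gamma> + \<beta>) * ev \<beta> (- \<gamma> + \<beta>) = 4" unfolding k1(1) k2(1) by simp
  obtain m where m: "cartan_integer \<beta> (- \<gamma> + \<beta>) = of_int m"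
    using cartan_integer_Ints[OF rs f(1) b] by (auto elim: Ints_cases)
  then have "of_int (m * m) = (of_int 4 :: 'k)" using e4 ev_of_int[OF m] by simp
  then have "m * m = 4" by (simp only: of_int_eq_iff)
  then have m4: "cartan_integer \<beta> (- \<gamma> + \<beta>) * cartan_integer \<beta> (- \<gamma> + \<beta>) = 4"
    unfolding m of_int_mult[symmetric] by simp
  have bpos: "\<beta> \<bullet> \<beta> > 0" and gpos: "\<gamma> \<bullet> \<gamma> > 0" using root_nonzero[OF rs] b gR by auto
  have bg: "2 * (\<beta> \<bullet> \<gamma>) = \<gamma> \<bullet> \<gamma>" using f(2) by simp
  define q where "q = (\<gamma> \<bullet> \<gamma>) / (\<beta> \<bullet> \<beta>)"
  have "2 * (\<beta> \<bullet> (- \<gamma> + \<beta>)) = 2 * (\<beta> \<bullet> \<beta>) - \<gamma> \<bullet> \<gamma>" using bg by (simp add: inner_diff_right)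
  then have "cartan_integer \<beta> (- \<gamma> + \<beta>) = 2 - q"
    unfolding cartan_integer_def f(3) q_def using bpos by (simp add: field_simps)
  then have "(2 - q) * (2 - q) = 4" using m4 by simp
  then have "q * (q - 4) = 0" by (simp add: algebra_simps)
  moreover have "q \<noteq> 0" using bpos gpos unfolding q_def by simp
  ultimately have "\<gamma> \<bullet> \<gamma> = 4 * (\<beta> \<bullet> \<beta>)" using bpos unfolding q_def by (simp add: field_simps)
  then have "(\<gamma> - 2 *\<^sub>R \<beta>) \<bullet> (\<gamma> - 2 *\<^sub>R \<beta>) = 0"
    using bg by (simp add: inner_diff_left inner_diff_right inner_commute)
  then have "\<gamma> = 2 *\<^sub>R \<beta>" by simp
  then show False using root_multiple[OF rs b, of 2] gR by simp
qed

end

section \<open>The centralizer of the root vectors in a half-space\<close>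

context chevalley_system
begin

definition normalizes :: "'r \<Rightarrow> 'r \<Rightarrow> 'v \<Rightarrow> bool" where
  "normalizes u u' \<alpha> \<longleftrightarrow> u * u' = 1 \<and> u' * u = 1 \<and> u * H \<alpha> * u' \<in> S \<and> (\<forall>\<beta>\<in>\<Phi>. u * X \<beta> * u' \<in> S)"

lemma conj_lie:
  assumes "u' * u = (1::'r)" shows "u * lie x y * u' = lie (u * x * u') (u * y * u')"
proof -
  have "u * x * u' * (u * y * u') = u * x * y * u'" for x y
    by (metis assms mult.assoc mult_1)
  then show ?thesis by (simp add: algebra_simps)
qed

text \<open>The bracket with \<open>X \<gamma>\<close> for \<open>\<gamma> \<bullet> \<alpha> \<ge> 0\<close> kills only the highest root vector \<open>X \<alpha>\<close> and the centre.\<close>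

lemma centralizer_of_nonneg:
  assumes a: "lg \<alpha>" and y: "y \<in> S"
    and comm: "\<And>\<gamma>. \<gamma> \<in> \<Phi> \<Longrightarrow> \<gamma> \<bullet> \<alpha> \<ge> 0 \<Longrightarrow> lie (X \<gamma>) y = 0"
  obtains c h where "y = sm c (X \<alpha>) + h" "\<And>\<beta>. \<beta> \<in> \<Phi> \<Longrightarrow> lie (X \<beta>) h = 0"
proof -
  note aR = long_root[OF rs a]
  obtain c h where y: "y = (\<Sum>w\<in>insert 0 \<Phi>. if w = 0 then h else sm (c w) (X w))"
    and h: "h \<in> vs.span (H ` \<Phi>)" and y': "y = (\<Sum>\<beta>\<in>\<Phi>. sm (c \<beta>) (X \<beta>)) + h"
    and wt: "\<And>w. w \<in> insert 0 \<Phi> \<Longrightarrow> has_wt w (if w = 0 then h else sm (c w) (X w))"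
    using S_components'[OF y] by blast
  have n0: "w \<noteq> 0" if "w \<in> \<Phi>" for w using that root_nonzero[OF rs] by blast
  have comp: "lie (X \<gamma>) (if w = 0 then h else sm (c w) (X w)) = 0"
    if "\<gamma> \<in> \<Phi>" "\<gamma> \<bullet> \<alpha> \<ge> 0" "w \<in> insert 0 \<Phi>" for \<gamma> w
    by (rule lie_components_eq_0[OF _ wt has_wt_X[OF that(1)] _ that(3)])
      (use finite_roots[OF rs] comm[OF that(1,2)] y in auto)
  have "lie (X \<beta>) h = 0" if b: "\<beta> \<in> \<Phi>" for \<beta>
  proof -
    have h0: "lie (X \<beta>) h = 0" if "\<beta> \<in> \<Phi>" "\<beta> \<bullet> \<alpha> \<ge> 0" for \<beta>
      using comp[OF that, of 0] by simp
    show ?thesis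
    proof (cases "\<beta> \<bullet> \<alpha> \<ge> 0")
      case False
      then have z: "lie (X (- \<beta>)) h = 0" using h0[of "- \<beta>"] root_minus[OF rs b] by simp
      \<comment> \<open>A combination of coroots acts on \<open>X \<beta>\<close> and on
        \<open>X (- \<beta>)\<close> by opposite scalars, so vanishing at -\<beta> carries over to
        \<beta>.\<close>
      have hX: "\<exists>e. \<forall>\<delta>\<in>{\<beta>, - \<beta>}. lie h (X \<delta>) = sm (if \<delta> = \<beta> then e else - e) (X \<delta>)"
        using h
      proof (induction h rule: vs.span_induct_alt)
        case base
        show ?case by (rule exI[of _ 0]) simp
      next
        case (step k x y)
        then obtain \<epsilon> e where \<epsilon>: "\<epsilon> \<in> \<Phi>" "x = H \<epsilon>"
          and e: "\<forall>\<delta>\<in>{\<beta>, - \<beta>}. lie y (X \<delta>) = sm (if \<delta> = \<beta> then e else - e) (X \<delta>)" by blast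
        have "lie (sm k x + y) (X \<delta>) = sm (if \<delta> = \<beta> then k * ev \<beta> \<epsilon> + e else - (k * ev \<beta> \<epsilon> + e)) (X \<delta>)"
          if d: "\<delta> \<in> {\<beta>, - \<beta>}" for \<delta>
        proof -
          have dR: "\<delta> \<in> \<Phi>" using d b root_minus[OF rs b] by auto
          have "lie (sm k x + y) (X \<delta>) = sm k (lie (H \<epsilon>) (X \<delta>)) + lie y (X \<delta>)"
            unfolding \<epsilon>(2) by (simp add: algebra_simps sm_diff_right)
          also have "\<dots> = sm (k * ev \<delta> \<epsilon> + (if \<delta> = \<beta> then e else - e)) (X \<delta>)"
            unfolding lie_H_X[OF \<epsilon>(1) dR] bspec[OF e d] sm_sm sm_add_left ..
          also have "k * ev \<delta> \<epsilon> + (if \<delta> = \<beta> then e else - e) =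
              (if \<delta> = \<beta> then k * ev \<beta> \<epsilon> + e else - (k * ev \<beta> \<epsilon> + e))"
            using d ev_minus[OF wt_root[OF b] \<epsilon>(1)] by auto
          finally show ?thesis .
        qed
        then show ?case by blast
      qed
      then obtain e where e: "\<And>\<delta>. \<delta> \<in> {\<beta>, - \<beta>} \<Longrightarrow> lie h (X \<delta>) = sm (if \<delta> = \<beta> then e else - e) (X \<delta>)"
        by blast
      have "\<beta> \<noteq> - \<beta>" using n0[OF b] by (metis add_eq_0_iff scaleR_2 scaleR_eq_0_iff zero_neq_numeral)
      then have "sm (- e) (X (- \<beta>)) = 0"
        using e[of "- \<beta>"] z lie_anti[of h "X (- \<beta>)"] by simp
      then have "e = 0" using X_nonzero[OF root_minus[OF rs b]] by simp
      then show ?thesis using e[of \<beta>] lie_anti[of "X \<beta>" h] by simp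
    qed (use h0 b in blast)
  qed
  \<comment> \<open>Each coefficient is detected by one admissible bracket: with
    \<open>X (- \<beta>)\<close> if \<beta> has inner product at most 0 with \<alpha>, and otherwise
    with \<open>X (\<alpha> - \<beta>)\<close>, whose bracket with \<open>X \<beta>\<close> is
    nonzero.\<close>
  moreover have "c \<beta> = 0" if b: "\<beta> \<in> \<Phi>" "\<beta> \<noteq> \<alpha>" for \<beta>
  proof (cases "\<beta> \<bullet> \<alpha> \<le> 0")
    case True
    then have "lie (X (- \<beta>)) (sm (c \<beta>) (X \<beta>)) = 0"
      using comp[of "- \<beta>" \<beta>] root_minus[OF rs b(1)] b n0 by simp
    then have "sm (- c \<beta>) (H \<beta>) = 0" unfolding H_def by (simp only: lie_sm_right) (simp add: sm_diff_right)
    then show ?thesis using H_nonzero[OF b(1)] by simp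
  next
    case False
    then have "cartan_integer \<beta> \<alpha> > 0" using n0[OF aR] by (simp add: cartan_integer_def)
    moreover have "\<beta> \<noteq> - \<alpha>" using False by auto
    ultimately have c1: "cartan_integer \<beta> \<alpha> = 1" using cartan_integer_long[OF rs a b(1,2)] by auto
    then have "\<beta> - \<alpha> \<in> \<Phi>" using root_reflection[OF rs aR b(1)] by simp
    then have ab: "\<alpha> - \<beta> \<in> \<Phi>" using root_minus[OF rs] by fastforce
    have "2 * (\<beta> \<bullet> \<alpha>) = \<alpha> \<bullet> \<alpha>" using c1 n0[OF aR] by (simp add: cartan_integer_def divide_eq_eq)
    then have "(\<alpha> - \<beta>) \<bullet> \<alpha> \<ge> 0"
      unfolding inner_diff_left using inner_ge_zero[of \<alpha>] by linarith
    then have "lie (X (\<alpha> - \<beta>)) (sm (c \<beta>) (X \<beta>)) = 0"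
      using comp[OF ab, of \<beta>] b n0 by simp
    then have "sm (c \<beta>) (lie (X (\<alpha> - \<beta>)) (X \<beta>)) = 0"
      by (simp only: lie_sm_right)
    then show ?thesis using lie_to_long_nonzero[OF a b(1) c1] by auto
  qed
  then have "(\<Sum>\<beta>\<in>\<Phi>. sm (c \<beta>) (X \<beta>)) = sm (c \<alpha>) (X \<alpha>)"
    using finite_roots[OF rs] aR by (subst sum.remove[OF _ aR]) (auto intro!: sum.neutral)
  ultimately show ?thesis using that y' by metis
qed

text \<open>Conjugation by u moves \<open>H \<alpha>\<close> by an element of \<open>S\<close> that
  commutes with the same root vectors, hence by a multiple of \<open>X \<alpha>\<close> plus some h
  that commutes with all root vectors. Splitting off exp (t X_\<alpha>) with the right t leaves z,
  which moves \<open>H \<alpha>\<close> only by h. Then z fixes the root vectors of Cartan integer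
  -1 at \<alpha>, by their eigenvalue and the injectivity of the bracket with
  \<open>X \<alpha>\<close> on them, and finally \<open>X (- \<alpha>)\<close>, a multiple of a
  bracket of two of them.\<close>

theorem long_root_element:
  assumes a: "lg \<alpha>" and ex: "\<exists>\<beta>\<in>\<Phi>. cartan_integer \<beta> \<alpha> = -1"
    and nm: "normalizes u u' \<alpha>"
    and comm: "\<And>\<gamma>. \<gamma> \<in> \<Phi> \<Longrightarrow> \<gamma> \<bullet> \<alpha> \<ge> 0 \<Longrightarrow> u * X \<gamma> = X \<gamma> * u"
  obtains t z z' where "u = nexp (sm t (X \<alpha>)) * z" "z * z' = 1" "z' * z = 1" "\<And>\<beta>. \<beta> \<in> \<Phi> \<Longrightarrow> z * X \<beta> = X \<beta> * z"
proof -
  note aR = long_root[OF rs a]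
  have uu: "u * u' = 1" "u' * u = 1" and uH: "u * H \<alpha> * u' \<in> S"
    and uX: "\<And>\<beta>. \<beta> \<in> \<Phi> \<Longrightarrow> u * X \<beta> * u' \<in> S" using nm unfolding normalizes_def by auto
  have fixX: "u * X \<gamma> * u' = X \<gamma>" if "\<gamma> \<in> \<Phi>" "\<gamma> \<bullet> \<alpha> \<ge> 0" for \<gamma>
    using comm[OF that] uu by (simp add: mult.assoc)
  have yS: "u * H \<alpha> * u' - H \<alpha> \<in> S" using uH H_in_S[OF aR] vs.subspace_diff[OF subspace_S] by blast
  have "lie (X \<gamma>) (u * H \<alpha> * u' - H \<alpha>) = 0" if g: "\<gamma> \<in> \<Phi>" "\<gamma> \<bullet> \<alpha> \<ge> 0" for \<gamma>
  proof -
    have "lie (X \<gamma>) (u * H \<alpha> * u') = u * lie (X \<gamma>) (H \<alpha>) * u'"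
      using conj_lie[OF uu(2), of "X \<gamma>" "H \<alpha>"] fixX[OF g] by simp
    also have "\<dots> = lie (X \<gamma>) (H \<alpha>)"
      unfolding lie_X_H[OF aR g(1)] using fixX[OF g] by simp
    finally show ?thesis by (simp add: algebra_simps)
  qed
  then obtain c h where uHc: "u * H \<alpha> * u' - H \<alpha> = sm c (X \<alpha>) + h"
    and h: "\<And>\<beta>. \<beta> \<in> \<Phi> \<Longrightarrow> lie (X \<beta>) h = 0"
    using centralizer_of_nonneg[OF a yS] by blast
  \<comment> \<open>Conjugation by exp (-t X_\<alpha>) adds 2 t X_\<alpha> to
    \<open>H \<alpha>\<close>; this has to cancel c X_\<alpha>.\<close>
  define t where "t = - c / 2"
  define e where "e = nexp (sm t (X \<alpha>))"
  define e' where "e' = nexp (- sm t (X \<alpha>))"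
  have nil: "nilp (sm t (X \<alpha>))" "nilp (- sm t (X \<alpha>))" using nilp_sm nilp_minus nilp_X[OF aR] by auto
  have ee: "e * e' = 1" "e' * e = 1" unfolding e_def e'_def using nexp_minus nil by auto
  define z where "z = e' * u"
  define z' where "z' = u' * e"
  have zz: "z * z' = 1" "z' * z = 1" unfolding z_def z'_def using ee uu
    by (metis mult.assoc mult_1)+
  have Xe: "e * X \<gamma> = X \<gamma> * e" "e' * X \<gamma> = X \<gamma> * e'" if g: "\<gamma> \<in> \<Phi>" "\<gamma> \<bullet> \<alpha> \<ge> 0" for \<gamma>
  proof -
    have "lie (X \<alpha>) (X \<gamma>) = 0"
      using lie_X_eq_0[OF aR g(1)] long_inner_nonneg_add[OF rs a g] by blast
    then have "X \<gamma> * sm t (X \<alpha>) = sm t (X \<alpha>) * X \<gamma>" by simp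
    then show "e * X \<gamma> = X \<gamma> * e" "e' * X \<gamma> = X \<gamma> * e'"
      unfolding e_def e'_def using commute_nexp[of "X \<gamma>"] by (metis, metis minus_mult_left minus_mult_right)
  qed
  have eh: "e' * h = h * e'" unfolding e'_def
    by (rule commute_nexp[symmetric]) (use h[OF aR] in simp)
  have zX: "z * X \<gamma> * z' = X \<gamma>" if g: "\<gamma> \<in> \<Phi>" "\<gamma> \<bullet> \<alpha> \<ge> 0" for \<gamma>
  proof -
    have "z * X \<gamma> = X \<gamma> * z" unfolding z_def using comm[OF g] Xe[OF g] by (metis mult.assoc)
    then show ?thesis using zz by (simp add: mult.assoc)
  qed
  have "e' * H \<alpha> * e = H \<alpha> + sm (2 * t) (X \<alpha>)"
  proof -
    let ?x = "- sm t (X \<alpha>)"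
    have l1: "lie ?x (H \<alpha>) = sm (2 * t) (X \<alpha>)"
    proof -
      have "lie ?x (H \<alpha>) = sm (- t) (lie (X \<alpha>) (H \<alpha>))" by (simp add: sm_diff_right)
      then show ?thesis unfolding lie_X_H[OF aR aR] ev_self[OF aR] by (simp add: mult.commute)
    qed
    have l2: "lie ?x (sm (2 * t) (X \<alpha>)) = 0" by (simp add: mult.commute)
    have "nexp ?x * H \<alpha> * nexp (- ?x) = H \<alpha> + lie ?x (H \<alpha>) + sm (1 / 2) (lie ?x (lie ?x (H \<alpha>)))"
      by (rule nexp_conj_of_lie3_eq_0[OF nil(2)]) (simp only: l1 l2, simp)
    then show ?thesis unfolding l1 l2 e_def e'_def by simp
  qed
  moreover have "e' * X \<alpha> * e = X \<alpha>" using Xe[OF aR] ee by (simp add: mult.assoc)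
  moreover have "e' * h * e = h" using eh ee by (simp add: mult.assoc)
  moreover have "z * H \<alpha> * z' = e' * H \<alpha> * e + sm c (e' * X \<alpha> * e) + e' * h * e"
  proof -
    have "z * H \<alpha> * z' = e' * (u * H \<alpha> * u') * e" unfolding z_def z'_def by (simp add: mult.assoc)
    also have "u * H \<alpha> * u' = H \<alpha> + sm c (X \<alpha>) + h" using uHc by (simp add: algebra_simps)
    finally show ?thesis by (simp add: distrib_left distrib_right)
  qed
  moreover have "sm (2 * t) (X \<alpha>) + sm c (X \<alpha>) = 0"
    unfolding sm_add_left[symmetric] t_def by simp
  ultimately have zH: "z * H \<alpha> * z' = H \<alpha> + h" by (simp add: algebra_simps)
  have zS: "z * X \<beta> * z' \<in> S" if "\<beta> \<in> \<Phi>" for \<beta>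
  proof -
    have "nexp (- sm t (X \<alpha>)) * (u * X \<beta> * u') * nexp (- (- sm t (X \<alpha>))) \<in> S"
    proof (rule nexp_conj_in_subspace[OF nil(2) uX[OF that] subspace_S])
      fix v assume "v \<in> S"
      then have "sm (- t) (lie (X \<alpha>) v) \<in> S"
        using lie_X_S[OF aR] vs.subspace_scale[OF subspace_S] by blast
      then show "lie (- sm t (X \<alpha>)) v \<in> S" by (simp add: sm_diff_right)
    qed
    then show ?thesis unfolding z_def z'_def e_def e'_def by (simp add: mult.assoc)
  qed
  have hS: "lie h y = 0" if "y \<in> S" for y
    using that unfolding S_def
  proof (induction y rule: vs.span_induct_alt)
    case (step k x y)
    have hX: "lie h (X \<beta>) = 0" if "\<beta> \<in> \<Phi>" for \<beta> using h[OF that] by simp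
    have "lie h x = 0"
    proof -
      from step(1) consider \<beta> where "\<beta> \<in> \<Phi>" "x = X \<beta>" | \<beta> where "\<beta> \<in> \<Phi>" "x = H \<beta>" by blast
      then show ?thesis
      proof cases
        case (2 \<beta>)
        then show ?thesis
          using jacobi[of h "X \<beta>" "X (- \<beta>)"] hX[of \<beta>] hX[of "- \<beta>"] root_minus[OF rs, of \<beta>] unfolding H_def by simp
      qed (use hX in blast)
    qed
    then show ?case using step(2) by (simp only: lie_add_right lie_sm_right) simp
  qed simp
  \<comment> \<open>The difference y is an eigenvector of ad \<open>H \<alpha>\<close> for -1, so
    only root vectors with Cartan integer -1 occur in it. The bracket with \<open>X \<alpha>\<close>
    kills y and therefore each of its components, but it kills no such root vector.\<close>
  have deg1: "z * X \<beta> * z' = X \<beta>" if b: "\<beta> \<in> \<Phi>" "cartan_integer \<beta> \<alpha> = -1" for \<beta>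
  proof -
    note f = cartan_integer_neg_one[OF rs aR b]
    define y where "y = z * X \<beta> * z' - X \<beta>"
    have yS: "y \<in> S" unfolding y_def using zS[OF b(1)] X_in_S[OF b(1)] vs.subspace_diff[OF subspace_S] by blast
    have eb: "ev \<beta> \<alpha> = -1" using ev_of_int[of \<beta> \<alpha> "-1"] b(2) by simp
    have "lie (H \<alpha> + h) (z * X \<beta> * z') = z * lie (H \<alpha>) (X \<beta>) * z'"
      using conj_lie[OF zz(2), of "H \<alpha>" "X \<beta>"] zH by simp
    also have "\<dots> = - (z * X \<beta> * z')" unfolding lie_H_X[OF aR b(1)] eb by simp
    also have "lie (H \<alpha> + h) (z * X \<beta> * z') = lie (H \<alpha>) (z * X \<beta> * z') + lie h (z * X \<beta> * z')"
      by (simp add: algebra_simps)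
    also have "lie h (z * X \<beta> * z') = 0" by (rule hS[OF zS[OF b(1)]])
    finally have "lie (H \<alpha>) (z * X \<beta> * z') = - (z * X \<beta> * z')" by simp
    moreover have "lie (H \<alpha>) (X \<beta>) = - X \<beta>" using lie_H_X[OF aR b(1)] eb by simp
    moreover have "lie (H \<alpha>) y = lie (H \<alpha>) (z * X \<beta> * z') - lie (H \<alpha>) (X \<beta>)"
      unfolding y_def by (simp only: right_diff_distrib left_diff_distrib) simp
    ultimately have Hy: "lie (H \<alpha>) y = - y" unfolding y_def by simp
    have "lie (X \<alpha>) (z * X \<beta> * z') = z * lie (X \<alpha>) (X \<beta>) * z'"
      using conj_lie[OF zz(2), of "X \<alpha>" "X \<beta>"] zX[OF aR] by simp
    also have "\<dots> = lie (X \<alpha>) (X \<beta>)"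
    proof -
      obtain k where k: "lie (X \<alpha>) (X \<beta>) = sm k (X (\<alpha> + \<beta>))" using lie_X_X[OF aR b(1) f(1)] by blast
      have "(\<alpha> + \<beta>) \<bullet> \<alpha> \<ge> 0"
        unfolding inner_add_left using f(2) inner_ge_zero[of \<alpha>] by linarith
      then show ?thesis unfolding k using zX[OF f(1)] by simp
    qed
    finally have Xy: "lie (X \<alpha>) y = 0"
      unfolding y_def by (simp add: algebra_simps)
    obtain c h' where y: "y = (\<Sum>w\<in>insert 0 \<Phi>. if w = 0 then h' else sm (c w) (X w))"
      and wt: "\<And>w. w \<in> insert 0 \<Phi> \<Longrightarrow> has_wt w (if w = 0 then h' else sm (c w) (X w))"
      using S_components'[OF yS] by blast
    let ?v = "\<lambda>w. if w = 0 then h' else sm (c w) (X w)"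
    have "(\<Sum>w\<in>insert 0 \<Phi>. sm (ev w \<alpha> + 1) (?v w)) = lie (H \<alpha>) y + y"
      unfolding y lie_sum_right sum.distrib[symmetric]
      using wt aR unfolding has_wt_def by (intro sum.cong refl) (simp only: sm_add_left sm_1)
    then have sum0: "(\<Sum>w\<in>insert 0 \<Phi>. sm (ev w \<alpha> + 1) (?v w)) = 0" using Hy by simp
    have w0: "\<forall>w\<in>insert 0 \<Phi>. sm (ev w \<alpha> + 1) (?v w) = 0"
      by (rule weights_independent[OF _ _ sum0]) (use finite_roots[OF rs] has_wt_sm[OF wt] in auto)
    have "?v w = 0" if w: "w \<in> insert 0 \<Phi>" for w
    proof (cases "ev w \<alpha> + 1 = 0")
      case False
      then show ?thesis using bspec[OF w0 w] unfolding sm_eq_0_iff by blast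
    next
      case True
      then have wR: "w \<in> \<Phi>" "w \<noteq> 0" using w ev_0[of \<alpha>] by auto
      obtain m where m: "cartan_integer w \<alpha> = of_int m"
        using cartan_integer_Ints[OF rs aR wR(1)] by (auto elim: Ints_cases)
      have "(of_int (m + 1) :: 'k) = 0" using True ev_of_int[OF m] by simp
      then have "m = - 1" by (simp only: of_int_eq_0_iff)
      then have c1: "cartan_integer w \<alpha> = - 1" using m by simp
      obtain k where k: "k * k = 1" "lie (X \<alpha>) (X w) = sm k (X (\<alpha> + w))"
        using lie_long[OF a wR(1) c1] by metis
      have "lie (X \<alpha>) (?v w) = 0"
        by (rule lie_components_eq_0[OF _ wt has_wt_X[OF aR] _ w]) (use finite_roots[OF rs] Xy y in auto)
      then have "sm (c w) (lie (X \<alpha>) (X w)) = 0" using wR(2) by (simp only: if_False lie_sm_right)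
      then have "c w * k = 0" unfolding k(2) using X_nonzero[OF cartan_integer_neg_one(1)[OF rs aR wR(1) c1]] by simp
      moreover have "k \<noteq> 0" using k(1) by auto
      ultimately show ?thesis using wR(2) by simp
    qed
    then have "y = 0" unfolding y by (intro sum.neutral) blast
    then show ?thesis unfolding y_def by simp
  qed
  \<comment> \<open>-\<alpha> is the sum of \<beta> and -\<alpha> - \<beta>, both with Cartan
    integer -1 at \<alpha>.\<close>
  have zma: "z * X (- \<alpha>) * z' = X (- \<alpha>)"
  proof -
    obtain \<beta> where b: "\<beta> \<in> \<Phi>" "cartan_integer \<beta> \<alpha> = -1" using ex by blast
    note f = cartan_integer_neg_one[OF rs aR b]
    let ?g = "- \<alpha> - \<beta>"
    have g: "?g \<in> \<Phi>" using root_minus[OF rs f(1)] by simp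
    have "cartan_integer ?g \<alpha> = -1"
      using cartan_integer_add[OF rs, of "- \<alpha>" "- \<beta>" \<alpha>] cartan_integer_minus_left[OF rs, of _ \<alpha>] b(2)
        cartan_integer_self[OF rs aR] by simp
    note zg = deg1[OF g this] and zb = deg1[OF b]
    have c1: "cartan_integer \<beta> (- \<alpha>) = 1" using b(2) cartan_integer_minus_right[OF rs, of \<beta> \<alpha>] by simp
    have nz: "lie (X \<beta>) (X ?g) \<noteq> 0" by (rule lie_to_long_nonzero[OF long_minus[OF rs a] b(1) c1])
    have "\<beta> + ?g = - \<alpha>" by simp
    then obtain k where k: "lie (X \<beta>) (X ?g) = sm k (X (- \<alpha>))"
      using lie_X_X[OF b(1) g] root_minus[OF rs aR] by auto
    have "sm k (z * X (- \<alpha>) * z') = z * lie (X \<beta>) (X ?g) * z'" unfolding k by simp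
    also have "\<dots> = lie (X \<beta>) (X ?g)" using conj_lie[OF zz(2), of "X \<beta>" "X ?g"] zg zb by simp
    finally have "sm k (z * X (- \<alpha>) * z') = sm k (X (- \<alpha>))" unfolding k .
    moreover have "k \<noteq> 0" using nz k by auto
    ultimately show ?thesis by (rule sm_cancel)
  qed
  have "z * X \<beta> = X \<beta> * z" if b: "\<beta> \<in> \<Phi>" for \<beta>
  proof -
    have "z * X \<beta> * z' = X \<beta>"
    proof (cases "\<beta> \<bullet> \<alpha> \<ge> 0 \<or> \<beta> = - \<alpha>")
      case True
      then show ?thesis using zX[OF b] zma by auto
    next
      case False
      then have "\<beta> \<noteq> \<alpha>" "\<beta> \<bullet> \<alpha> < 0" by auto
      then have "cartan_integer \<beta> \<alpha> < 0"
        using root_nonzero[OF rs aR] by (simp add: cartan_integer_def divide_less_0_iff)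
      then have "cartan_integer \<beta> \<alpha> = -1"
        using cartan_integer_long[OF rs a b] False \<open>\<beta> \<noteq> \<alpha>\<close> by auto
      then show ?thesis using deg1[OF b] by blast
    qed
    then show ?thesis using zz by (metis mult.assoc mult.right_neutral)
  qed
  moreover have "u = e * z" unfolding z_def using ee by (simp add: mult.assoc[symmetric])
  ultimately show ?thesis using that zz unfolding e_def by blast
qed

end

text \<open>The Cartan integer m of \<alpha> at \<beta> is negative, and the positive squared length
  of 2 \<beta> + \<alpha> gives m > -4. The values -1 and -2 are the types A_2 and B_2. For -3 the
  type is G_2, and the long root \<alpha> + 3 \<beta> in place of \<beta> leads back to A_2.\<close>

lemma long_pair_dichotomy:
  assumes rs: "root_system \<Phi>" and ind: "indecomposable \<Phi>" and dim: "dim \<Phi> > 1"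
  obtains \<alpha> \<beta> where "long \<Phi> \<alpha>" "\<beta> \<in> \<Phi>" "cartan_integer \<beta> \<alpha> = -1"
    "long \<Phi> \<beta> \<and> cartan_integer \<alpha> \<beta> = -1 \<or> cartan_integer \<alpha> \<beta> = -2"
proof -
  have "\<Phi> \<noteq> {}" using ind unfolding indecomposable_def by blast
  then obtain \<alpha> where a: "long \<Phi> \<alpha>" using ex_long[OF rs] by blast
  obtain \<beta> where b: "\<beta> \<in> \<Phi>" "cartan_integer \<beta> \<alpha> = -1"
    using ex_cartan_integer_neg_one[OF rs ind dim a] by blast
  note aR = long_root[OF rs a]
  note f = cartan_integer_neg_one[OF rs aR b]
  have apos: "\<alpha> \<bullet> \<alpha> > 0" and bpos: "\<beta> \<bullet> \<beta> > 0" using root_nonzero[OF rs] aR b(1) by auto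
  have le: "\<beta> \<bullet> \<beta> \<le> \<alpha> \<bullet> \<alpha>" using a b(1) unfolding long_def[OF rs] by blast
  obtain m where m: "cartan_integer \<alpha> \<beta> = of_int m"
    using cartan_integer_Ints[OF rs b(1) aR] by (auto elim: Ints_cases)
  have eq: "of_int m * (\<beta> \<bullet> \<beta>) = - (\<alpha> \<bullet> \<alpha>)"
    using m f(2) bpos by (simp add: cartan_integer_def divide_eq_eq inner_commute)
  have "of_int m < (0::real)"
  proof (rule ccontr)
    assume "\<not> of_int m < (0::real)"
    then have "of_int m * (\<beta> \<bullet> \<beta>) \<ge> 0" using bpos by simp
    then show False using eq apos by linarith
  qed
  then have m0: "m < 0" by simp
  have "(2 *\<^sub>R \<beta> + \<alpha>) \<bullet> (2 *\<^sub>R \<beta> + \<alpha>) = 4 * (\<beta> \<bullet> \<beta>) - \<alpha> \<bullet> \<alpha>"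
    using f(2) by (simp add: inner_add_left inner_add_right inner_commute)
  moreover have "2 *\<^sub>R \<beta> + \<alpha> \<noteq> 0"
  proof
    assume "2 *\<^sub>R \<beta> + \<alpha> = 0"
    then have "\<alpha> = (- 2) *\<^sub>R \<beta>" by (simp add: eq_neg_iff_add_eq_0 add.commute)
    then have "(- 2) *\<^sub>R \<beta> \<in> \<Phi>" using aR by simp
    from root_multiple[OF rs b(1) this] show False by simp
  qed
  ultimately have "\<alpha> \<bullet> \<alpha> < 4 * (\<beta> \<bullet> \<beta>)" by (metis diff_gt_0_iff_gt inner_gt_zero_iff)
  then have "- of_int m * (\<beta> \<bullet> \<beta>) < 4 * (\<beta> \<bullet> \<beta>)" using eq by simp
  then have "- of_int m < (4::real)" using bpos mult_less_cancel_right_pos by blast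
  then have "m > - 4" by linarith
  then consider "m = - 1" | "m = - 2" | "m = - 3" using m0 by linarith
  then show ?thesis
  proof cases
    case 1
    then have "long \<Phi> \<beta>" using eq long_norm_eq[OF rs a b(1)] by simp
    then show ?thesis using that[OF a b] m 1 by simp
  next
    case 2
    then show ?thesis using that[OF a b] m by simp
  next
    case 3
    let ?d = "\<alpha> + 3 *\<^sub>R \<beta>"
    have d: "?d \<in> \<Phi>" using root_reflection[OF rs b(1) aR] m 3 by simp
    have "?d \<bullet> ?d = \<alpha> \<bullet> \<alpha>"
      using f(2) eq 3 by (simp add: inner_add_left inner_add_right inner_commute)
    then have dl: "long \<Phi> ?d" using long_norm_eq[OF rs a d] by simp
    have "?d \<bullet> \<alpha> = - (\<alpha> \<bullet> \<alpha>) / 2" using f(2) by (simp add: inner_add_left)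
    then have "cartan_integer ?d \<alpha> = -1" "cartan_integer \<alpha> ?d = -1"
      unfolding cartan_integer_def \<open>?d \<bullet> ?d = \<alpha> \<bullet> \<alpha>\<close> using apos by (simp_all add: inner_commute)
    then show ?thesis using that[OF a d] dl by simp
  qed
qed

section \<open>Commutators of root elements up to central factors\<close>

context chevalley_system
begin

lemma nilp_of_commuting_diff: "nilp x \<Longrightarrow> nilp y \<Longrightarrow> x * y = y * x \<Longrightarrow> nilp (y - x)"
  using nilp_add[of y "- x"] nilp_minus[of x] by simp

lemma inverse_unique: "g * g' = 1 \<Longrightarrow> g'' * g = 1 \<Longrightarrow> g'' = (g'::'r)"
  by (metis mult.assoc mult_1 mult.right_neutral)

text \<open>Central factors cancel in a commutator. The equation is verified after multiplication by
  h g on the right, where it takes the form g h = g h and the inverses of g and h have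
  disappeared.\<close>

lemma commutator_reduce:
  assumes A: "nilp A" and Y: "nilp Y" and g: "g = nexp A * z1" and h: "h = nexp Y * z2"
    and gg: "g * g' = 1" "g' * g = 1" and hh: "h * h' = 1" "h' * h = 1"
    and z1: "z1 * Y = Y * z1" and z2: "z2 * A = A * z2" and z12: "z1 * z2 = z2 * z1"
  shows "g * h * g' * h' = nexp A * nexp Y * nexp (- A) * nexp (- Y)"
proof -
  have gA: "nexp (- A) * g = z1" and hY: "nexp (- Y) * h = z2"
    unfolding g h mult.assoc[symmetric] using nexp_minus A Y by simp_all
  have c1: "z1 * nexp Y = nexp Y * z1" by (rule commute_nexp[OF z1])
  have c2: "z2 * nexp A = nexp A * z2" by (rule commute_nexp[OF z2])
  have "nexp A * nexp Y * nexp (- A) * nexp (- Y) * (h * g)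
      = nexp A * nexp Y * nexp (- A) * z2 * g"
    unfolding hY[symmetric] by (simp add: mult.assoc)
  also have "\<dots> = nexp A * nexp Y * nexp (- A) * (z2 * nexp A) * z1" by (simp add: g mult.assoc)
  also have "\<dots> = nexp A * nexp Y * (nexp (- A) * nexp A) * z2 * z1" unfolding c2 by (simp add: mult.assoc)
  also have "\<dots> = nexp A * nexp Y * z2 * z1" using nexp_minus(2)[OF A] by simp
  also have "\<dots> = nexp A * (nexp Y * z1) * z2" using z12 by (simp add: mult.assoc)
  also have "\<dots> = g * h" unfolding c1[symmetric] by (simp add: g h mult.assoc)
  finally have eq: "nexp A * nexp Y * nexp (- A) * nexp (- Y) * (h * g) = g * h" .
  have "h * g * (g' * h') = h * (g * g') * h'" by (simp add: mult.assoc)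
  then have "h * g * (g' * h') = 1" using gg hh by simp
  then have "nexp A * nexp Y * nexp (- A) * nexp (- Y) = g * h * (g' * h')"
    using eq by (metis mult.assoc mult.right_neutral)
  then show ?thesis by (simp add: mult.assoc)
qed

text \<open>\<open>[exp A, exp Y]\<close> is \<open>exp A\<close> times the inverse of the conjugate of \<open>exp A\<close> by \<open>exp Y\<close>.\<close>

lemma commutator_left:
  assumes A: "nilp A" and Y: "nilp Y" and l3: "lie Y (lie Y (lie Y A)) = 0"
    and D: "D = lie Y A + sm (1 / 2) (lie Y (lie Y A))" and AD: "lie A D = 0"
  shows "nexp A * nexp Y * nexp (- A) * nexp (- Y) = nexp (- D)" "nilp D"
proof -
  let ?A = "nexp Y * A * nexp (- Y)"
  have cA: "?A = A + D" using nexp_conj_of_lie3_eq_0[OF Y l3] D by simp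
  have nA: "nilp ?A"
  proof -
    obtain n where "A ^ n = 0" using A unfolding nilp_def by blast
    then have "A ^ Suc n = 0" using power_eq_0_mono[of A n "Suc n"] by simp
    then have "?A ^ Suc n = 0" using conj_power[OF nexp_minus(2)[OF Y], of A n] by simp
    then show ?thesis unfolding nilp_def by blast
  qed
  have comm: "A * ?A = ?A * A" using AD unfolding cA by (simp add: algebra_simps)
  show nD: "nilp D" using nilp_of_commuting_diff[OF A nA comm] unfolding cA by simp
  have "nexp (- ?A) = nexp (nexp Y * (- A) * nexp (- Y))" by simp
  also have "\<dots> = nexp Y * nexp (- A) * nexp (- Y)"
    by (rule conj_nexp) (use nexp_minus[OF Y] nilp_minus[OF A] in auto)
  finally have "nexp A * nexp Y * nexp (- A) * nexp (- Y) = nexp A * nexp (- ?A)"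
    by (simp add: mult.assoc)
  also have "\<dots> = nexp (A + (- ?A))"
    by (rule nexp_add[symmetric]) (use comm A nilp_minus[OF nA] in auto)
  finally show "nexp A * nexp Y * nexp (- A) * nexp (- Y) = nexp (- D)" unfolding cA by simp
qed

text \<open>This commutator is inverse to the one with A and Y exchanged, to which the preceding
  computation applies.\<close>

lemma commutator_right:
  assumes A: "nilp A" and Y: "nilp Y" and l3: "lie A (lie A (lie A Y)) = 0"
    and D: "D = lie A Y + sm (1 / 2) (lie A (lie A Y))" and YD: "lie Y D = 0"
  shows "nexp A * nexp Y * nexp (- A) * nexp (- Y) = nexp D" "nilp D"
proof -
  note l = commutator_left[OF Y A l3 D YD]
  show nD: "nilp D" by (rule l(2))
  let ?c = "nexp A * nexp Y * nexp (- A) * nexp (- Y)"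
  have "nexp Y * nexp A * nexp (- Y) * nexp (- A) * ?c
      = nexp Y * nexp A * nexp (- Y) * (nexp (- A) * nexp A) * nexp Y * nexp (- A) * nexp (- Y)"
    by (simp add: mult.assoc)
  also have "\<dots> = nexp Y * nexp A * (nexp (- Y) * nexp Y) * nexp (- A) * nexp (- Y)"
    unfolding nexp_minus[OF A] by (simp add: mult.assoc)
  also have "\<dots> = nexp Y * (nexp A * nexp (- A)) * nexp (- Y)"
    unfolding nexp_minus[OF Y] by (simp add: mult.assoc)
  also have "\<dots> = 1" unfolding nexp_minus[OF A] using nexp_minus(1)[OF Y] by simp
  finally have "nexp (- D) * ?c = 1" unfolding l(1) .
  then have "nexp D * (nexp (- D) * ?c) = nexp D" by simp
  then show "?c = nexp D" unfolding mult.assoc[symmetric] nexp_minus(1)[OF nD] by (simp add: mult.assoc)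
qed

lemma nilp_sm_X: "\<alpha> \<in> \<Phi> \<Longrightarrow> nilp (sm t (X \<alpha>))" using nilp_sm nilp_X by blast

lemma lie_sm_sm: "lie (sm a x) (sm b y) = sm (a * b) (lie x y)"
  by (simp only: lie_sm_left lie_sm_right sm_sm mult.commute)

lemma lie_add_left: "lie (x + y) (w::'r) = lie x w + lie y w" by (simp add: algebra_simps)

text \<open>A relation instead of a function, because the algebra has no inversion: the inverses of
  the four elements and of the intermediate commutators enter as witnesses.\<close>

definition nested_commutator :: "'r \<Rightarrow> 'r \<Rightarrow> 'r \<Rightarrow> 'r \<Rightarrow> 'r \<Rightarrow> bool" where
  "nested_commutator c1 c2 u v w \<longleftrightarrow> (\<exists>u' v' c1' c2' p p' q q'.
     u * u' = 1 \<and> u' * u = 1 \<and> v * v' = 1 \<and> v' * v = 1 \<and> c1 * c1' = 1 \<and> c1' * c1 = 1 \<and>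
     c2 * c2' = 1 \<and> c2' * c2 = 1 \<and> p = u * c1 * u' * c1' \<and> p * p' = 1 \<and> p' * p = 1 \<and>
     q = p * v * p' * v' \<and> q * q' = 1 \<and> q' * q = 1 \<and> w = q * c2 * q' * c2')"

definition centralizes :: "'r \<Rightarrow> bool" where
  "centralizes z \<longleftrightarrow> (\<forall>\<beta>\<in>\<Phi>. z * X \<beta> = X \<beta> * z)"

lemma centralizesD: "centralizes z \<Longrightarrow> \<beta> \<in> \<Phi> \<Longrightarrow> z * sm t (X \<beta>) = sm t (X \<beta>) * z"
  unfolding centralizes_def by simp

text \<open>Type A_2, with structure constants n1 and n2 equal to 1 or -1. The successive
  commutators are the root elements of \<alpha> at -n1 t, of \<alpha> + \<beta> at -n1 n2 t s, and
  of \<alpha> at n1^2 n2 t s, so k = n2. The other brackets that occur vanish because the sums of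
  roots are too long.\<close>

lemma nested_commutator_long:
  assumes a: "lg \<alpha>" and b: "lg \<beta>" and ba: "cartan_integer \<beta> \<alpha> = -1" and ab: "cartan_integer \<alpha> \<beta> = -1"
  obtains k where "k \<noteq> 0" "k \<in> \<int>" "\<And>t s z1 z2 w. centralizes z1 \<Longrightarrow> centralizes z2 \<Longrightarrow>
    nested_commutator (nexp (X (- \<beta>))) (nexp (X (- \<beta>)))
      (nexp (sm t (X (\<alpha> + \<beta>))) * z1) (nexp (sm s (X \<beta>)) * z2) w \<Longrightarrow>
    w = nexp (sm (k * (t * s)) (X \<alpha>))"
proof -
  note aR = long_root[OF rs a] and bR = long_root[OF rs b]
  note f = cartan_integer_neg_one[OF rs aR bR ba]
  note d = long_diff_not_root[OF rs a bR ba]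
  have mb: "- \<beta> \<in> \<Phi>" using root_minus[OF rs bR] .
  have abl: "lg (\<alpha> + \<beta>)" using long_norm_eq[OF rs b f(1) f(3)] .
  have "cartan_integer (\<alpha> + \<beta>) (- \<beta>) = -1"
    using ab cartan_integer_self[OF rs bR]
    by (simp add: cartan_integer_minus_right[OF rs] cartan_integer_add[OF rs])
  then obtain n1 where n1: "n1 * n1 = 1" "lie (X (- \<beta>)) (X (\<alpha> + \<beta>)) = sm n1 (X \<alpha>)"
    using lie_long[OF long_minus[OF rs b] f(1)] by (metis add.commute add_diff_cancel diff_conv_add_uminus)
  obtain n2 where n2: "n2 * n2 = 1" "lie (X \<alpha>) (X \<beta>) = sm n2 (X (\<alpha> + \<beta>))"
    using lie_long[OF a bR ba] by metis
  have z1: "lie (X (- \<beta>)) (X \<alpha>) = 0"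
    by (rule lie_X_eq_0[OF mb aR]) (use d in auto)
  have pos: "\<beta> \<bullet> \<alpha> = - (\<alpha> \<bullet> \<alpha>) / 2" using f(2) by simp
  have "(\<alpha> + \<beta>) \<bullet> \<alpha> \<ge> 0" using f(2) inner_ge_zero[of \<alpha>] unfolding inner_add_left by linarith
  then have z2: "lie (X \<alpha>) (X (\<alpha> + \<beta>)) = 0"
    using lie_X_eq_0[OF aR f(1)] long_inner_nonneg_add[OF rs a f(1)] by blast
  have "\<beta> \<bullet> \<beta> = \<alpha> \<bullet> \<alpha>" using a b aR bR unfolding long_def[OF rs] by (simp add: order_antisym)
  then have "(\<alpha> + \<beta>) \<bullet> \<beta> \<ge> 0" using f(2) inner_ge_zero[of \<alpha>] inner_commute[of \<alpha> \<beta>] unfolding inner_add_left by linarith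
  then have z3: "lie (X \<beta>) (X (\<alpha> + \<beta>)) = 0"
    using lie_X_eq_0[OF bR f(1)] long_inner_nonneg_add[OF rs b f(1)] by blast
  have first: "nexp (sm c (X (\<alpha> + \<beta>))) * nexp (X (- \<beta>)) * nexp (- sm c (X (\<alpha> + \<beta>))) * nexp (- X (- \<beta>))
      = nexp (sm (- (c * n1)) (X \<alpha>))" for c
  proof -
    have l1: "lie (X (- \<beta>)) (sm c (X (\<alpha> + \<beta>))) = sm (c * n1) (X \<alpha>)"
      by (simp only: lie_sm_right n1(2) sm_sm)
    have l2: "lie (X (- \<beta>)) (sm (c * n1) (X \<alpha>)) = 0" by (simp only: lie_sm_right z1) simp
    have l3: "lie (sm c (X (\<alpha> + \<beta>))) (sm (c * n1) (X \<alpha>)) = 0"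
      using lie_anti[of "X (\<alpha> + \<beta>)" "X \<alpha>"] by (simp only: lie_sm_sm z2) simp
    show ?thesis
      using commutator_left(1)[OF nilp_sm_X[OF f(1)] nilp_X[OF mb] _ refl, of c]
      unfolding l1 l2 using l3 by simp
  qed
  have nz: "n1 \<noteq> 0" "n2 \<noteq> 0" using n1 n2 by auto
  show ?thesis
  proof (rule that[of n2])
    show "n2 \<noteq> 0" by (rule nz)
    have "n2 = 1 \<or> n2 = - 1" using n2(1) by (simp add: square_eq_1_iff)
    then show "n2 \<in> \<int>" by auto
    fix t s z1 z2 w
    assume c1: "centralizes z1" and c2: "centralizes z2"
      and "nested_commutator (nexp (X (- \<beta>))) (nexp (X (- \<beta>)))
      (nexp (sm t (X (\<alpha> + \<beta>))) * z1) (nexp (sm s (X \<beta>)) * z2) w"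
    then obtain u u' v v' e1 e2 p p' q q' where
      u: "u = nexp (sm t (X (\<alpha> + \<beta>))) * z1" "u * u' = 1" "u' * u = 1" and
      v: "v = nexp (sm s (X \<beta>)) * z2" "v * v' = 1" "v' * v = 1" and
      e1: "nexp (X (- \<beta>)) * e1 = 1" "e1 * nexp (X (- \<beta>)) = 1" and
      e2: "nexp (X (- \<beta>)) * e2 = 1" "e2 * nexp (X (- \<beta>)) = 1" and
      p: "p = u * nexp (X (- \<beta>)) * u' * e1" "p * p' = 1" "p' * p = 1" and
      q: "q = p * v * p' * v'" "q * q' = 1" "q' * q = 1" and
      w: "w = q * nexp (X (- \<beta>)) * q' * e2"
      unfolding nested_commutator_def by blast
    have "p = nexp (sm (- (t * n1)) (X \<alpha>))" unfolding p(1) first[symmetric]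
      by (rule commutator_reduce[OF nilp_sm_X[OF f(1)] nilp_X[OF mb] u(1) _ u(2,3) e1, of 1])
        (use centralizesD[OF c1 mb, of 1] in auto)
    note p' = this
    have "q = nexp (sm (- (t * n1)) (X \<alpha>)) * nexp (sm s (X \<beta>)) *
        nexp (- sm (- (t * n1)) (X \<alpha>)) * nexp (- sm s (X \<beta>))"
      unfolding q(1)
      by (rule commutator_reduce[OF nilp_sm_X[OF aR] nilp_sm_X[OF bR] _ v(1) p(2,3) v(2,3), of _ 1])
        (use p' centralizesD[OF c2 aR, of "- (t * n1)"] in auto)
    also have "\<dots> = nexp (sm (- (t * n1) * s * n2) (X (\<alpha> + \<beta>)))"
    proof -
      have l1: "lie (sm (- (t * n1)) (X \<alpha>)) (sm s (X \<beta>)) = sm (- (t * n1) * s * n2) (X (\<alpha> + \<beta>))"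
        by (simp only: lie_sm_sm n2(2) sm_sm)
      have l2: "lie (sm (- (t * n1)) (X \<alpha>)) (sm (- (t * n1) * s * n2) (X (\<alpha> + \<beta>))) = 0"
        by (simp only: lie_sm_sm z2) simp
      have l3: "lie (sm s (X \<beta>)) (sm (- (t * n1) * s * n2) (X (\<alpha> + \<beta>))) = 0"
        by (simp only: lie_sm_sm z3) simp
      show ?thesis
        using commutator_right(1)[OF nilp_sm_X[OF aR] nilp_sm_X[OF bR] _ refl, of "- (t * n1)" s]
        unfolding l1 l2 using l3 by simp
    qed
    finally have q': "q = nexp (sm (- (t * n1) * s * n2) (X (\<alpha> + \<beta>)))" .
    have "w = nexp (sm (- (- (t * n1) * s * n2 * n1)) (X \<alpha>))" unfolding w first[symmetric]
      by (rule commutator_reduce[OF nilp_sm_X[OF f(1)] nilp_X[OF mb] _ _ q(2,3) e2, of _ 1 1])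
        (use q' in auto)
    also have "- (- (t * n1) * s * n2 * n1) = (n1 * n1) * (n2 * (t * s))" by (simp add: algebra_simps)
    finally show "w = nexp (sm (n2 * (t * s)) (X \<alpha>))" unfolding n1(1) by simp
  qed
qed

text \<open>Type B_2 with \<beta> long and \<alpha> short. The bracket of \<open>X \<alpha>\<close>
  and \<open>X (\<beta> + \<alpha>)\<close> is bracketed with \<open>X (- \<alpha>)\<close>. One
  evaluation uses the constants at long roots, which are 1 or -1; the other uses that
  \<open>H \<alpha>\<close> acts on \<open>X \<beta>\<close> by -2 and on
  \<open>X (\<beta> + \<alpha>)\<close> by 0. The comparison leaves c = 2 or c = -2.\<close>

lemma short_structure:
  assumes b: "lg \<beta>" and aR: "\<alpha> \<in> \<Phi>" and ab: "cartan_integer \<alpha> \<beta> = -1" and ba: "cartan_integer \<beta> \<alpha> = -2"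
  shows "\<beta> + 2 *\<^sub>R \<alpha> \<in> \<Phi>" "lg (\<beta> + 2 *\<^sub>R \<alpha>)" "\<alpha> \<bullet> \<alpha> = - (\<alpha> \<bullet> \<beta>)" "\<beta> \<bullet> \<beta> = - 2 * (\<alpha> \<bullet> \<beta>)"
    and "\<exists>c. c * c = 4 \<and> lie (X \<alpha>) (X (\<beta> + \<alpha>)) = sm c (X (\<beta> + 2 *\<^sub>R \<alpha>))"
proof -
  note bR = long_root[OF rs b]
  note f = cartan_integer_neg_one[OF rs bR aR ab] and d = long_diff_not_root[OF rs b aR ab]
  have n0: "\<alpha> \<bullet> \<alpha> \<noteq> 0" using root_nonzero[OF rs aR] by simp
  show bb: "\<beta> \<bullet> \<beta> = - 2 * (\<alpha> \<bullet> \<beta>)" using f(2) by simp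
  show aa: "\<alpha> \<bullet> \<alpha> = - (\<alpha> \<bullet> \<beta>)"
    using ba n0 by (simp add: cartan_integer_def divide_eq_eq inner_commute)
  let ?g = "\<beta> + 2 *\<^sub>R \<alpha>"
  show g: "?g \<in> \<Phi>" using root_reflection[OF rs aR bR] ba by simp
  have gg: "?g \<bullet> ?g = \<beta> \<bullet> \<beta>"
    using aa bb by (simp add: inner_add_left inner_add_right inner_commute)
  then show gl: "lg ?g" using long_norm_eq[OF rs b g] by simp
  have ma: "- \<alpha> \<in> \<Phi>" using root_minus[OF rs aR] .
  have "cartan_integer (- \<alpha>) ?g = -1"
    unfolding cartan_integer_def gg using aa bb n0 by (simp add: inner_add_right field_simps)
  then obtain k where k: "k * k = 1" "lie (X ?g) (X (- \<alpha>)) = sm k (X (\<beta> + \<alpha>))"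
    using lie_long[OF gl ma] by (auto simp: scaleR_2)
  obtain n2 where n2: "n2 * n2 = 1" "lie (X \<beta>) (X \<alpha>) = sm n2 (X (\<beta> + \<alpha>))"
    using lie_long[OF b aR ab] by metis
  have ab_R: "\<beta> + \<alpha> \<in> \<Phi>" by (rule f(1))
  obtain m where m: "lie (X (- \<alpha>)) (X (\<beta> + \<alpha>)) = sm m (X \<beta>)"
    using lie_X_X[OF ma ab_R] bR by auto
  have gsum: "\<alpha> + (\<beta> + \<alpha>) = ?g" by (simp add: scaleR_2)
  obtain c where c: "lie (X \<alpha>) (X (\<beta> + \<alpha>)) = sm c (X ?g)"
    using lie_X_X[OF aR ab_R] g unfolding gsum by blast
  have lmaa: "lie (X (- \<alpha>)) (X \<alpha>) = - H \<alpha>" unfolding H_def by simp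
  have "lie (X (- \<alpha>)) (X \<beta>) = 0" by (rule lie_X_eq_0[OF ma bR]) (use d in auto)
  then have "lie (X (- \<alpha>)) (lie (X \<alpha>) (X \<beta>)) = lie (- H \<alpha>) (X \<beta>)"
    using jacobi[of "X (- \<alpha>)" "X \<alpha>" "X \<beta>"] unfolding lmaa by simp
  also have "\<dots> = - lie (H \<alpha>) (X \<beta>)" by simp
  also have "\<dots> = sm 2 (X \<beta>)" unfolding lie_H_X[OF aR bR] using ev_of_int[of \<beta> \<alpha> "-2"] ba by simp
  finally have 1: "lie (X (- \<alpha>)) (lie (X \<alpha>) (X \<beta>)) = sm 2 (X \<beta>)" .
  have Xab: "lie (X \<alpha>) (X \<beta>) = sm (- n2) (X (\<beta> + \<alpha>))" using lie_anti[of "X \<alpha>" "X \<beta>"] n2 by simp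
  then have "sm (- n2 * m) (X \<beta>) = sm 2 (X \<beta>)" using 1 by (simp only: lie_sm_right m sm_sm)
  then have nm: "- n2 * m = 2" using X_nonzero[OF bR] by (simp del: sm_minus_left)
  have "cartan_integer (\<beta> + \<alpha>) \<alpha> = 0"
    using ba cartan_integer_self[OF rs aR] by (simp add: cartan_integer_add[OF rs])
  then have "lie (H \<alpha>) (X (\<beta> + \<alpha>)) = 0" using lie_H_X[OF aR ab_R] ev_of_int[of "\<beta> + \<alpha>" \<alpha> 0] by simp
  then have "lie (- H \<alpha>) (X (\<beta> + \<alpha>)) = 0" by simp
  then have "lie (X (- \<alpha>)) (lie (X \<alpha>) (X (\<beta> + \<alpha>))) = lie (X \<alpha>) (sm m (X \<beta>))"
    using jacobi[of "X (- \<alpha>)" "X \<alpha>" "X (\<beta> + \<alpha>)"] unfolding lmaa m by simp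
  then have "sm c (lie (X (- \<alpha>)) (X ?g)) = sm (m * - n2) (X (\<beta> + \<alpha>))"
    unfolding c by (simp only: lie_sm_right Xab sm_sm)
  moreover have "lie (X (- \<alpha>)) (X ?g) = sm (- k) (X (\<beta> + \<alpha>))"
    using lie_anti[of "X (- \<alpha>)" "X ?g"] k by simp
  ultimately have "sm (c * - k) (X (\<beta> + \<alpha>)) = sm (m * - n2) (X (\<beta> + \<alpha>))" by (simp only: sm_sm)
  then have "c * - k = m * - n2" using X_nonzero[OF ab_R] by (simp del: sm_minus_left)
  then have "c * - k = 2" using nm by (simp add: mult.commute)
  then have "(c * - k) * (c * - k) = 4" by simp
  then have "(c * c) * (k * k) = 4" by (simp add: algebra_simps)
  then have "c * c = 4" using k by simp
  then show "\<exists>c. c * c = 4 \<and> lie (X \<alpha>) (X (\<beta> + \<alpha>)) = sm c (X ?g)" using c by blast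
qed

text \<open>In type B_2 commutators have second-order terms, all in the long root \<gamma> = \<beta>
  + 2 \<alpha>. The first commutator is exp (t E) with E a combination of \<open>X \<alpha>\<close>
  and \<open>X \<gamma>\<close>; the second one has a component quadratic in t at \<gamma> and a
  bilinear one at \<beta> + \<alpha>. Only the latter fails to commute with
  \<open>X \<alpha>\<close>, so the last commutator is bilinear, with k = n1 n2 n3 and n3 = 2 or
  -2.\<close>

lemma nested_commutator_short:
  assumes b: "lg \<beta>" and aR: "\<alpha> \<in> \<Phi>" and ab: "cartan_integer \<alpha> \<beta> = -1" and ba: "cartan_integer \<beta> \<alpha> = -2"
  obtains k where "k \<noteq> 0" "k \<in> \<int>" "\<And>t s z1 z2 w. centralizes z1 \<Longrightarrow> centralizes z2 \<Longrightarrow>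
    nested_commutator (nexp (X (\<beta> + \<alpha>))) (nexp (X \<alpha>))
      (nexp (sm t (X (- \<beta>))) * z1) (nexp (sm s (X \<beta>)) * z2) w \<Longrightarrow>
    w = nexp (sm (k * (t * s)) (X (\<beta> + 2 *\<^sub>R \<alpha>)))"
proof -
  note bR = long_root[OF rs b]
  note f = cartan_integer_neg_one[OF rs bR aR ab] and d = long_diff_not_root[OF rs b aR ab]
  note ss = short_structure[OF assms]
  let ?g = "\<beta> + 2 *\<^sub>R \<alpha>"
  have ab_R: "\<beta> + \<alpha> \<in> \<Phi>" by (rule f(1))
  have mb: "- \<beta> \<in> \<Phi>" "lg (- \<beta>)" using root_minus[OF rs bR] long_minus[OF rs b] by auto
  have neg: "\<alpha> \<bullet> \<beta> < 0" using f(6) .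
  have big: "w \<notin> \<Phi>" "w \<noteq> 0" if "w \<bullet> w > \<beta> \<bullet> \<beta>" for w
    using that b inner_ge_zero[of \<beta>] unfolding long_def[OF rs] by (fastforce, fastforce)
  have zero: "lie (X v) (X w) = 0" if "v \<in> \<Phi>" "w \<in> \<Phi>" "(v + w) \<bullet> (v + w) > \<beta> \<bullet> \<beta>" for v w
    using lie_X_eq_0[OF that(1,2)] big[OF that(3)] by blast
  \<comment> \<open>The squared length is a quadratic form in the coordinates times the negative
    number (\<alpha>, \<beta>); the form is -2 at \<beta>. A value below -2 thus belongs to a vector
    longer than \<beta>, which is neither a root nor 0. The vanishing brackets below are read off
    from this.\<close>
  have exp: "(x *\<^sub>R \<alpha> + y *\<^sub>R \<beta>) \<bullet> (x *\<^sub>R \<alpha> + y *\<^sub>R \<beta>) = (2 * x * y - x * x - 2 * y * y) * (\<alpha> \<bullet> \<beta>)" for x y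
    using ss(3,4) by (simp add: inner_add_left inner_add_right inner_commute algebra_simps)
  have zero': "lie (X v) (X w) = 0" if "v \<in> \<Phi>" "w \<in> \<Phi>" "v + w = x *\<^sub>R \<alpha> + y *\<^sub>R \<beta>" "2 * x * y - x * x - 2 * y * y < - 2" for v w x y
  proof (rule zero[OF that(1,2)])
    have "(2 * x * y - x * x - 2 * y * y) * (\<alpha> \<bullet> \<beta>) > - 2 * (\<alpha> \<bullet> \<beta>)"
      by (rule mult_strict_right_mono_neg[OF that(4) neg])
    then show "(v + w) \<bullet> (v + w) > \<beta> \<bullet> \<beta>" unfolding that(3) exp ss(4) .
  qed
  have s3: "3 *\<^sub>R v = v + v + v" for v :: 'v
    using scaleR_left_distrib[of 1 2 v] by (simp add: scaleR_2 add.assoc)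
  have za_g: "lie (X \<alpha>) (X ?g) = 0"
    by (rule zero'[OF aR ss(1), of 3 1]) (simp_all add: s3 scaleR_2 algebra_simps)
  have zb_ab: "lie (X \<beta>) (X (\<beta> + \<alpha>)) = 0"
    by (rule zero'[OF bR ab_R, of 1 2]) (simp_all add: s3 scaleR_2 algebra_simps)
  have zb_g: "lie (X \<beta>) (X ?g) = 0"
    by (rule zero'[OF bR ss(1), of 2 2]) (simp_all add: s3 scaleR_2 algebra_simps)
  have zab_g: "lie (X (\<beta> + \<alpha>)) (X ?g) = 0"
    by (rule zero'[OF ab_R ss(1), of 3 2]) (simp_all add: s3 scaleR_2 algebra_simps)
  have zmb_a: "lie (X (- \<beta>)) (X \<alpha>) = 0"
    by (rule zero'[OF mb(1) aR, of 1 "-1"]) (simp_all add: algebra_simps)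
  have zmb_g: "lie (X (- \<beta>)) (X ?g) = 0"
    by (rule zero'[OF mb(1) ss(1), of 2 0]) (simp_all add: algebra_simps)
  have flip: "lie x y = 0 \<Longrightarrow> lie y x = 0" for x y :: 'r by simp
  obtain n2 where n2: "n2 * n2 = 1" "lie (X \<beta>) (X \<alpha>) = sm n2 (X (\<beta> + \<alpha>))"
    using lie_long[OF b aR ab] by metis
  obtain n3 where n3: "n3 * n3 = 4" "lie (X \<alpha>) (X (\<beta> + \<alpha>)) = sm n3 (X ?g)" using ss(5) by blast
  have "cartan_integer (\<beta> + \<alpha>) (- \<beta>) = -1"
    using ab cartan_integer_self[OF rs bR]
    by (simp add: cartan_integer_minus_right[OF rs] cartan_integer_add[OF rs])
  then obtain n1 where n1: "n1 * n1 = 1" "lie (X (- \<beta>)) (X (\<beta> + \<alpha>)) = sm n1 (X \<alpha>)"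
    using lie_long[OF mb(2) ab_R] by (metis add_minus_cancel minus_add_cancel)
  have nz: "n1 \<noteq> 0" "n2 \<noteq> 0" "n3 \<noteq> 0" using n1 n2 n3 by auto
  define E where "E = sm n1 (X \<alpha>) - sm (n1 * n3 / 2) (X ?g)"
  have E_lie: "lie E y = sm n1 (lie (X \<alpha>) y) - sm (n1 * n3 / 2) (lie (X ?g) y)" for y
    unfolding E_def by (simp add: algebra_simps sm_diff_right)
  have lie_E: "lie y E = sm n1 (lie y (X \<alpha>)) - sm (n1 * n3 / 2) (lie y (X ?g))" for y
    unfolding E_def by (simp add: algebra_simps sm_diff_right)
  have first: "nexp (sm t (X (- \<beta>))) * nexp (X (\<beta> + \<alpha>)) * nexp (- sm t (X (- \<beta>))) * nexp (- X (\<beta> + \<alpha>))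
      = nexp (sm t E)" and nE: "nilp (sm t E)" for t
  proof -
    let ?Y = "X (\<beta> + \<alpha>)" and ?A = "sm t (X (- \<beta>))"
    have l1: "lie ?Y ?A = sm (- t * n1) (X \<alpha>)"
      using lie_anti[of ?Y "X (- \<beta>)"] n1(2) by (simp only: lie_sm_right) simp
    have l2: "lie ?Y (sm (- t * n1) (X \<alpha>)) = sm (t * n1 * n3) (X ?g)"
      using lie_anti[of ?Y "X \<alpha>"] n3(2) by (simp only: lie_sm_right) simp
    have l3: "lie ?Y (sm (t * n1 * n3) (X ?g)) = 0" by (simp only: lie_sm_right zab_g) simp
    let ?D = "sm (- t * n1) (X \<alpha>) + sm (1 / 2) (sm (t * n1 * n3) (X ?g))"
    have D: "?D = sm (- t) E" unfolding E_def by (simp add: sm_diff_right)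
    have "lie ?A (sm (- t) E) = 0" unfolding lie_sm_sm lie_E zmb_a zmb_g by simp
    then have AD: "lie ?A ?D = 0" unfolding D .
    have D': "?D = lie ?Y ?A + sm (1 / 2) (lie ?Y (lie ?Y ?A))" unfolding l1 l2 ..
    have l3': "lie ?Y (lie ?Y (lie ?Y ?A)) = 0" unfolding l1 l2 l3 ..
    note c = commutator_left[OF nilp_sm_X[OF mb(1)] nilp_X[OF ab_R] l3' D' AD]
    show "nexp ?A * nexp ?Y * nexp (- ?A) * nexp (- ?Y) = nexp (sm t E)" using c(1) unfolding D by simp
    show "nilp (sm t E)" using nilp_minus[OF c(2)] unfolding D by simp
  qed
  have second: "nexp (sm t E) * nexp (sm s (X \<beta>)) * nexp (- sm t E) * nexp (- sm s (X \<beta>))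
      = nexp (sm (- t * s * n1 * n2) (X (\<beta> + \<alpha>)) + sm (- t * t * s * n1 * n1 * n2 * n3 / 2) (X ?g))"
    (is "_ = nexp ?D") and nD: "nilp (sm (- t * s * n1 * n2) (X (\<beta> + \<alpha>)) + sm (- t * t * s * n1 * n1 * n2 * n3 / 2) (X ?g))" for t s
  proof -
    let ?A = "sm t E" and ?Y = "sm s (X \<beta>)"
    have "lie E (X \<beta>) = sm (- n1 * n2) (X (\<beta> + \<alpha>))"
      unfolding E_lie flip[OF zb_g] using lie_anti[of "X \<alpha>" "X \<beta>"] n2(2) by simp
    then have l1: "lie ?A ?Y = sm (- t * s * n1 * n2) (X (\<beta> + \<alpha>))"
      unfolding lie_sm_sm by simp
    have "lie E (X (\<beta> + \<alpha>)) = sm (n1 * n3) (X ?g)" unfolding E_lie flip[OF zab_g] n3(2) by simp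
    then have l2: "lie ?A (sm (- t * s * n1 * n2) (X (\<beta> + \<alpha>))) = sm (- t * t * s * n1 * n1 * n2 * n3) (X ?g)"
      unfolding lie_sm_sm by (simp add: algebra_simps)
    have "lie E (X ?g) = 0" unfolding E_lie za_g by simp
    then have l3: "lie ?A (sm (- t * t * s * n1 * n1 * n2 * n3) (X ?g)) = 0" unfolding lie_sm_sm by simp
    have D': "?D = lie ?A ?Y + sm (1 / 2) (lie ?A (lie ?A ?Y))" unfolding l1 l2 by simp
    have "lie ?Y ?D = 0" unfolding lie_add_right lie_sm_sm zb_ab zb_g by simp
    from commutator_right[OF nE nilp_sm_X[OF bR] _ D' this]
    show "nexp ?A * nexp ?Y * nexp (- ?A) * nexp (- ?Y) = nexp ?D" "nilp ?D"
      unfolding l1 l2 l3 by blast+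
  qed
  have third: "nexp (sm c (X (\<beta> + \<alpha>)) + sm e (X ?g)) * nexp (X \<alpha>) *
      nexp (- (sm c (X (\<beta> + \<alpha>)) + sm e (X ?g))) * nexp (- X \<alpha>) = nexp (sm (- c * n3) (X ?g))"
    if nil: "nilp (sm c (X (\<beta> + \<alpha>)) + sm e (X ?g))" for c e
  proof -
    let ?A = "sm c (X (\<beta> + \<alpha>)) + sm e (X ?g)"
    have l1: "lie (X \<alpha>) ?A = sm (c * n3) (X ?g)"
      unfolding lie_add_right lie_sm_right za_g n3(2) by simp
    have l2: "lie (X \<alpha>) (sm (c * n3) (X ?g)) = 0" unfolding lie_sm_right za_g by simp
    have l3: "lie ?A (sm (c * n3) (X ?g)) = 0" unfolding lie_add_left lie_sm_sm zab_g by simp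
    show ?thesis
      using commutator_left(1)[OF nil nilp_X[OF aR] _ refl] unfolding l1 l2 using l3 by simp
  qed
  show ?thesis
  proof (rule that[of "n1 * n2 * n3"])
    show "n1 * n2 * n3 \<noteq> 0" using nz by simp
    have "(n3 - 2) * (n3 + 2) = 0" using n3(1) by (simp add: algebra_simps)
    then have "n3 = 2 \<or> n3 = - 2" by (simp add: add_eq_0_iff2)
    moreover have "n1 = 1 \<or> n1 = - 1" "n2 = 1 \<or> n2 = - 1"
      using n1(1) n2(1) by (auto simp: square_eq_1_iff)
    ultimately show "n1 * n2 * n3 \<in> \<int>" by auto
    fix t s z1 z2 w
    assume c1: "centralizes z1" and c2: "centralizes z2"
      and "nested_commutator (nexp (X (\<beta> + \<alpha>))) (nexp (X \<alpha>))
      (nexp (sm t (X (- \<beta>))) * z1) (nexp (sm s (X \<beta>)) * z2) w"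
    then obtain u u' v v' e1 e2 p p' q q' where
      u: "u = nexp (sm t (X (- \<beta>))) * z1" "u * u' = 1" "u' * u = 1" and
      v: "v = nexp (sm s (X \<beta>)) * z2" "v * v' = 1" "v' * v = 1" and
      e1: "nexp (X (\<beta> + \<alpha>)) * e1 = 1" "e1 * nexp (X (\<beta> + \<alpha>)) = 1" and
      e2: "nexp (X \<alpha>) * e2 = 1" "e2 * nexp (X \<alpha>) = 1" and
      p: "p = u * nexp (X (\<beta> + \<alpha>)) * u' * e1" "p * p' = 1" "p' * p = 1" and
      q: "q = p * v * p' * v'" "q * q' = 1" "q' * q = 1" and
      w: "w = q * nexp (X \<alpha>) * q' * e2"
      unfolding nested_commutator_def by blast
    have p': "p = nexp (sm t E)" unfolding p(1) first[symmetric]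
      by (rule commutator_reduce[OF nilp_sm_X[OF mb(1)] nilp_X[OF ab_R] u(1) _ u(2,3) e1, of 1])
        (use centralizesD[OF c1 ab_R, of 1] in auto)
    have zE: "z2 * sm t E = sm t E * z2"
    proof -
      have "z2 * X \<alpha> = X \<alpha> * z2" "z2 * X ?g = X ?g * z2" using c2 aR ss(1) unfolding centralizes_def by auto
      then show ?thesis unfolding E_def by (simp add: right_diff_distrib left_diff_distrib)
    qed
    have q': "q = nexp (sm (- t * s * n1 * n2) (X (\<beta> + \<alpha>)) + sm (- t * t * s * n1 * n1 * n2 * n3 / 2) (X ?g))"
      unfolding q(1) second[symmetric]
      by (rule commutator_reduce[OF nE nilp_sm_X[OF bR] _ v(1) p(2,3) v(2,3), of _ 1])
        (use p' zE in auto)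
    have "w = nexp (sm (- (- t * s * n1 * n2) * n3) (X ?g))" unfolding w third[OF nD, symmetric]
      by (rule commutator_reduce[OF nD nilp_X[OF aR] _ _ q(2,3) e2, where ?z1.0 = 1 and ?z2.0 = 1])
        (use q' in auto)
    also have "- (- t * s * n1 * n2) * n3 = n1 * n2 * n3 * (t * s)" by (simp add: algebra_simps)
    finally show "w = nexp (sm (n1 * n2 * n3 * (t * s)) (X ?g))" .
  qed
qed

section \<open>Contents of integral root vectors\<close>

text \<open>\<open>ct \<alpha>\<close> stands for the content of the integer matrix \<open>X \<alpha>\<close>.\<close>

definition content_function :: "('v \<Rightarrow> int) \<Rightarrow> bool" where
  "content_function ct \<longleftrightarrow> (\<forall>\<alpha>\<in>\<Phi>. ct \<alpha> > 0) \<and>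
     (\<forall>\<alpha>\<in>\<Phi>. \<forall>\<beta>\<in>\<Phi>. \<forall>c. \<alpha> + \<beta> \<in> \<Phi> \<longrightarrow> lie (X \<alpha>) (X \<beta>) = sm (of_int c) (X (\<alpha> + \<beta>)) \<longrightarrow>
        ct \<alpha> * ct \<beta> dvd c * ct (\<alpha> + \<beta>))"

text \<open>As the constant is 1 or -1, the product \<open>ct \<alpha> * ct \<beta>\<close> divides
  \<open>ct (\<alpha> + \<beta>)\<close>. The bracket with the vector of -\<alpha> leads back, so
  \<open>ct (\<alpha> + \<beta>)\<close> divides \<open>ct \<beta>\<close>. Together this leaves
  only 1 for \<open>ct \<alpha>\<close>.\<close>

lemma content_long:
  assumes ct: "content_function ct" and a: "lg \<alpha>" and b: "\<beta> \<in> \<Phi>" and ba: "cartan_integer \<beta> \<alpha> = -1"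
  shows "ct \<alpha> = 1" "ct (\<alpha> + \<beta>) = ct \<beta>"
proof -
  note aR = long_root[OF rs a]
  note f = cartan_integer_neg_one[OF rs aR b ba]
  have *: "ct \<alpha> * ct \<beta> dvd ct (\<alpha> + \<beta>)"
    if a: "lg \<alpha>" and b: "\<beta> \<in> \<Phi>" and ba: "cartan_integer \<beta> \<alpha> = -1" for \<alpha> \<beta>
  proof -
    note aR = long_root[OF rs a]
    have abR: "\<alpha> + \<beta> \<in> \<Phi>" by (rule cartan_integer_neg_one(1)[OF rs aR b ba])
    obtain c where c: "c * c = 1" "lie (X \<alpha>) (X \<beta>) = sm c (X (\<alpha> + \<beta>))"
      using lie_long[OF a b ba] by metis
    have "c = 1 \<or> c = -1" using c(1) by (simp add: square_eq_1_iff)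
    then obtain m :: int where m: "c = of_int m" "m = 1 \<or> m = - 1"
    proof
      assume "c = 1"
      then show ?thesis using that[of 1] by simp
    next
      assume "c = - 1"
      then show ?thesis using that[of "- 1"] by simp
    qed
    then have "ct \<alpha> * ct \<beta> dvd m * ct (\<alpha> + \<beta>)"
      using ct aR b abR c(2) unfolding content_function_def by blast
    then show ?thesis using m(2) by auto
  qed
  have mca: "cartan_integer (\<alpha> + \<beta>) (- \<alpha>) = -1"
    using ba cartan_integer_self[OF rs aR]
    by (simp add: cartan_integer_minus_right[OF rs] cartan_integer_add[OF rs])
  have 1: "ct \<alpha> * ct \<beta> dvd ct (\<alpha> + \<beta>)" by (rule *[OF a b ba])
  have 2: "ct (- \<alpha>) * ct (\<alpha> + \<beta>) dvd ct \<beta>" using *[OF long_minus[OF rs a] f(1) mca] by simp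
  have pos: "ct \<alpha> > 0" "ct \<beta> > 0" "ct (\<alpha> + \<beta>) > 0"
    using ct aR b f(1) unfolding content_function_def by auto
  have d2: "ct (\<alpha> + \<beta>) dvd ct \<beta>" using 2 by (rule dvd_mult_right)
  have d1: "ct \<beta> dvd ct (\<alpha> + \<beta>)" using 1 by (rule dvd_mult_right)
  show eq: "ct (\<alpha> + \<beta>) = ct \<beta>" using d1 d2 pos by (intro zdvd_antisym_nonneg) auto
  have "ct \<alpha> * ct \<beta> \<le> 1 * ct \<beta>" using zdvd_imp_le[OF 1] pos eq by simp
  then have "ct \<alpha> \<le> 1" using mult_right_le_imp_le pos(2) by blast
  then show "ct \<alpha> = 1" using pos by simp
qed

text \<open>The roots \<alpha> and \<beta> + \<alpha> have the same content, and their bracket has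
  constant 2 or -2 at a long root of content 1. Hence the square of \<open>ct \<alpha>\<close>
  divides 2.\<close>

lemma content_short:
  assumes ct: "content_function ct" and b: "lg \<beta>" and aR: "\<alpha> \<in> \<Phi>"
    and ab: "cartan_integer \<alpha> \<beta> = -1" and ba: "cartan_integer \<beta> \<alpha> = -2"
  shows "ct \<alpha> = 1"
proof -
  note ss = short_structure[OF b aR ab ba]
  note bR = long_root[OF rs b]
  have abR: "\<beta> + \<alpha> \<in> \<Phi>" by (rule cartan_integer_neg_one(1)[OF rs bR aR ab])
  have "\<alpha> \<bullet> \<beta> < 0" by (rule cartan_integer_neg_one(6)[OF rs bR aR ab])
  moreover have "(\<beta> + 2 *\<^sub>R \<alpha>) \<bullet> (\<beta> + 2 *\<^sub>R \<alpha>) = - 2 * (\<alpha> \<bullet> \<beta>)" "\<alpha> \<bullet> (\<beta> + 2 *\<^sub>R \<alpha>) = - (\<alpha> \<bullet> \<beta>)"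
    using ss(3,4) by (auto simp: inner_add_left inner_add_right inner_commute)
  ultimately have "cartan_integer (- \<alpha>) (\<beta> + 2 *\<^sub>R \<alpha>) = -1"
    unfolding cartan_integer_def by (simp add: divide_eq_eq)
  then have g: "ct (\<beta> + 2 *\<^sub>R \<alpha>) = 1"
    using content_long(1)[OF ct ss(2) root_minus[OF rs aR]] by simp
  have eq: "ct (\<beta> + \<alpha>) = ct \<alpha>" by (rule content_long(2)[OF ct b aR ab])
  have gsum: "\<alpha> + (\<beta> + \<alpha>) = \<beta> + 2 *\<^sub>R \<alpha>" by (simp add: scaleR_2)
  obtain c where c: "c * c = 4" "lie (X \<alpha>) (X (\<beta> + \<alpha>)) = sm c (X (\<beta> + 2 *\<^sub>R \<alpha>))" using ss(5) by blast
  have "(c - 2) * (c + 2) = 0" using c(1) by (simp add: algebra_simps)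
  then have "c = 2 \<or> c = -2" by (simp add: add_eq_0_iff2)
  then obtain m :: int where m: "c = of_int m" "m dvd 2"
  proof
    assume "c = 2"
    then show ?thesis using that[of 2] by simp
  next
    assume "c = - 2"
    then show ?thesis using that[of "- 2"] by simp
  qed
  then have "ct \<alpha> * ct (\<beta> + \<alpha>) dvd m * ct (\<beta> + 2 *\<^sub>R \<alpha>)"
    using ct aR abR ss(1) c(2) unfolding content_function_def gsum[symmetric] by blast
  then have "ct \<alpha> * ct \<alpha> dvd 2" using g eq m(2) by (simp add: dvd_trans)
  moreover have pos: "ct \<alpha> > 0" using ct aR unfolding content_function_def by blast
  ultimately have "ct \<alpha> * ct \<alpha> \<le> 2" by (simp add: zdvd_imp_le)
  show ?thesis
  proof (rule ccontr)
    assume "ct \<alpha> \<noteq> 1"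
    then have "2 \<le> ct \<alpha>" using pos by simp
    then have "2 * 2 \<le> ct \<alpha> * ct \<alpha>" by (intro mult_mono) auto
    then show False using \<open>ct \<alpha> * ct \<alpha> \<le> 2\<close> by simp
  qed
qed

text \<open>In the \<open>B\<^sub>2\<close> case the two inner commutators also have components in the long root \<open>\<gamma>\<close>,
  which the outer commutator with \<open>\<delta>2\<close> removes.\<close>

theorem bilinear_word:
  assumes ind: "indecomposable \<Phi>" and dim: "dim \<Phi> > 1" and ct: "content_function ct"
  obtains \<alpha>1 \<alpha>2 \<delta>1 \<delta>2 \<gamma> k where "lg \<alpha>1" "lg \<alpha>2" "\<delta>1 \<in> \<Phi>" "\<delta>2 \<in> \<Phi>" "\<gamma> \<in> \<Phi>" "k \<noteq> 0" "k \<in> \<int>"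
    "\<exists>\<epsilon>\<in>\<Phi>. cartan_integer \<epsilon> \<alpha>1 = -1 \<and> ct (\<alpha>1 + \<epsilon>) = 1"
    "\<exists>\<epsilon>\<in>\<Phi>. cartan_integer \<epsilon> \<alpha>2 = -1 \<and> ct (\<alpha>2 + \<epsilon>) = 1"
    "\<And>t s z1 z2 w. centralizes z1 \<Longrightarrow> centralizes z2 \<Longrightarrow>
    nested_commutator (nexp (X \<delta>1)) (nexp (X \<delta>2))
      (nexp (sm t (X \<alpha>1)) * z1) (nexp (sm s (X \<alpha>2)) * z2) w \<Longrightarrow>
    w = nexp (sm (k * (t * s)) (X \<gamma>))"
proof -
  obtain \<alpha> \<beta> where a: "lg \<alpha>" and b: "\<beta> \<in> \<Phi>" and ba: "cartan_integer \<beta> \<alpha> = -1"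
    and d: "lg \<beta> \<and> cartan_integer \<alpha> \<beta> = -1 \<or> cartan_integer \<alpha> \<beta> = -2"
    using long_pair_dichotomy[OF rs ind dim] .
  note aR = long_root[OF rs a]
  note f = cartan_integer_neg_one[OF rs aR b ba]
  from d show ?thesis
  proof
    \<comment> \<open>Type A_2: the parameters sit at \<alpha> + \<beta> and \<beta>, both constants
      at -\<beta>, the result at \<alpha>. The content condition holds at the long roots \<alpha>
      and \<beta> + \<alpha>.\<close>
    assume "lg \<beta> \<and> cartan_integer \<alpha> \<beta> = -1"
    then have bl: "lg \<beta>" and ab: "cartan_integer \<alpha> \<beta> = -1" by auto
    have abl: "lg (\<alpha> + \<beta>)" using long_norm_eq[OF rs bl f(1) f(3)] .
    have mb: "- \<beta> \<in> \<Phi>" using root_minus[OF rs b] .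
    have bb: "\<beta> \<bullet> \<beta> = \<alpha> \<bullet> \<alpha>" using bl a b aR unfolding long_def[OF rs] by (simp add: antisym)
    then have "2 * (- \<beta> \<bullet> (\<alpha> + \<beta>)) = - (\<beta> \<bullet> \<beta>)" using f(2) by (simp add: inner_add_right)
    then have "cartan_integer (- \<beta>) (\<alpha> + \<beta>) = -1"
      using root_nonzero[OF rs b] unfolding cartan_integer_def f(3) by simp
    then have e1: "\<exists>\<epsilon>\<in>\<Phi>. cartan_integer \<epsilon> (\<alpha> + \<beta>) = -1 \<and> ct (\<alpha> + \<beta> + \<epsilon>) = 1"
      using mb content_long(1)[OF ct a b ba] by force
    have e2: "\<exists>\<epsilon>\<in>\<Phi>. cartan_integer \<epsilon> \<beta> = -1 \<and> ct (\<beta> + \<epsilon>) = 1"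
      using content_long(2)[OF ct bl aR ab] content_long(1)[OF ct a b ba] aR ab by auto
    obtain k where "k \<noteq> 0" "k \<in> \<int>" "\<And>t s z1 z2 w. centralizes z1 \<Longrightarrow> centralizes z2 \<Longrightarrow>
      nested_commutator (nexp (X (- \<beta>))) (nexp (X (- \<beta>)))
        (nexp (sm t (X (\<alpha> + \<beta>))) * z1) (nexp (sm s (X \<beta>)) * z2) w \<Longrightarrow>
      w = nexp (sm (k * (t * s)) (X \<alpha>))"
      using nested_commutator_long[OF a bl ba ab] by blast
    then show ?thesis using that[OF abl bl mb mb aR _ _ e1 e2] by blast
  next
    \<comment> \<open>Type B_2 with \<beta> short: the parameters sit at -\<alpha> and \<alpha>, and
      the content condition holds at the short roots \<beta> and \<alpha> + \<beta>.\<close>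
    assume ab: "cartan_integer \<alpha> \<beta> = -2"
    have cb: "ct \<beta> = 1" by (rule content_short[OF ct a b ba ab])
    have "cartan_integer (\<alpha> + \<beta>) (- \<alpha>) = -1"
      using ba cartan_integer_self[OF rs aR]
      by (simp add: cartan_integer_minus_right[OF rs] cartan_integer_add[OF rs])
    then have e1: "\<exists>\<epsilon>\<in>\<Phi>. cartan_integer \<epsilon> (- \<alpha>) = -1 \<and> ct (- \<alpha> + \<epsilon>) = 1"
      using f(1) cb by force
    have e2: "\<exists>\<epsilon>\<in>\<Phi>. cartan_integer \<epsilon> \<alpha> = -1 \<and> ct (\<alpha> + \<epsilon>) = 1"
      using content_long(2)[OF ct a b ba] cb b ba by auto
    obtain k where "k \<noteq> 0" "k \<in> \<int>" "\<And>t s z1 z2 w. centralizes z1 \<Longrightarrow> centralizes z2 \<Longrightarrow>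
      nested_commutator (nexp (X (\<alpha> + \<beta>))) (nexp (X \<beta>))
        (nexp (sm t (X (- \<alpha>))) * z1) (nexp (sm s (X \<alpha>)) * z2) w \<Longrightarrow>
      w = nexp (sm (k * (t * s)) (X (\<alpha> + 2 *\<^sub>R \<beta>)))"
      using nested_commutator_short[OF a b ba ab] by blast
    then show ?thesis
      using that[OF long_minus[OF rs a] a f(1) b short_structure(1)[OF a b ba ab] _ _ e1 e2] by blast
  qed
qed

end

section \<open>The ring of square matrices\<close>

text \<open>A type of its own, whose multiplication is the matrix product, so that the results on
  associative algebras apply to matrices.\<close>

typedef ('a, 'n::finite) sqm = "UNIV :: ('a^'n^'n) set" morphisms mx Mx by simp

lemma Mx_inverse' [simp]: "mx (Mx A) = A" by (simp add: Mx_inverse)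

lemma mx_eq_iff: "A = B \<longleftrightarrow> mx A = mx B" by (simp add: mx_inject)

lemma matrix_add_rdistrib': "(B + C) ** A = B ** A + C ** (A :: 'a::comm_ring_1^'n^'m)"
  by (simp add: matrix_matrix_mult_def vec_eq_iff sum.distrib distrib_right)

instantiation sqm :: (comm_ring_1, finite) ring_1
begin
definition "0 = Mx 0"
definition "1 = Mx (Finite_Cartesian_Product.mat 1)"
definition "A + B = Mx (mx A + mx B)"
definition "A - B = Mx (mx A - mx B)"
definition "- A = Mx (- mx A)"
definition "A * B = Mx (mx A ** mx B)"
instance
proof
  show "(0::('a, 'b) sqm) \<noteq> 1"
    by (auto simp: zero_sqm_def one_sqm_def Mx_inject vec_eq_iff mat_def)
qed (auto simp: mx_eq_iff zero_sqm_def one_sqm_def plus_sqm_def minus_sqm_def uminus_sqm_def times_sqm_def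
    matrix_mul_assoc matrix_add_ldistrib matrix_add_rdistrib')
end

lemma mx_0: "mx 0 = 0" and mx_1: "mx 1 = mat 1" and mx_add: "mx (A + B) = mx A + mx B"
  and mx_diff: "mx (A - B) = mx A - mx B" and mx_minus: "mx (- A) = - mx A"
  and mx_mult: "mx (A * B) = mx A ** mx B"
  by (simp_all add: zero_sqm_def one_sqm_def plus_sqm_def minus_sqm_def uminus_sqm_def times_sqm_def)

definition ent :: "('a, 'n::finite) sqm \<Rightarrow> 'n \<Rightarrow> 'n \<Rightarrow> 'a" where "ent A i j = mx A $ i $ j"

lemma sqm_eqI: "(\<And>i j. ent A i j = ent B i j) \<Longrightarrow> A = B"
  by (simp add: mx_eq_iff vec_eq_iff ent_def)

lemma sqm_eq_iff: "A = B \<longleftrightarrow> (\<forall>i j. ent A i j = ent B i j)"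
  by (auto intro: sqm_eqI)

lemma ent_0 [simp]: "ent 0 i j = 0" by (simp add: ent_def mx_0)
lemma ent_1: "ent 1 i j = (if i = j then 1 else 0)" by (simp add: ent_def mx_1 mat_def)
lemma ent_add [simp]: "ent (A + B) i j = ent A i j + ent B i j" by (simp add: ent_def mx_add)
lemma ent_diff [simp]: "ent (A - B) i j = ent A i j - ent B i j" by (simp add: ent_def mx_diff)
lemma ent_minus [simp]: "ent (- A) i j = - ent A i j" by (simp add: ent_def mx_minus)
lemma ent_mult: "ent (A * B) i j = (\<Sum>k\<in>UNIV. ent A i k * ent B k j)"
  by (simp add: ent_def mx_mult matrix_matrix_mult_def)

lemma ent_sum: "ent (sum f I) i j = (\<Sum>k\<in>I. ent (f k) i j)"
  by (induction I rule: infinite_finite_induct) auto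

definition smq :: "'a::comm_ring_1 \<Rightarrow> ('a, 'n::finite) sqm \<Rightarrow> ('a, 'n) sqm" where
  "smq c A = Mx (\<chi> i j. c * mx A $ i $ j)"

lemma ent_smq [simp]: "ent (smq c A) i j = c * ent A i j" by (simp add: ent_def smq_def)

lemma mx_power: "mx (A ^ k) = mat_pow (mx A) k"
  by (induction k) (auto simp: mx_1 mx_mult)

interpretation sq: assoc_algebra "smq :: 'k::field_char_0 \<Rightarrow> ('k, 'n::finite) sqm \<Rightarrow> _"
  by unfold_locales
    (auto intro!: sqm_eqI simp: ent_mult algebra_simps sum_distrib_left)

section \<open>Ring homomorphisms\<close>

text \<open>Identities are proved over a universal ring and specialized by evaluation. The maps in
  question are the integers into a ring, integer polynomials evaluated at an element, and entry
  polynomials evaluated at a matrix.\<close>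

definition rhom :: "('a::comm_ring_1 \<Rightarrow> 'b::comm_ring_1) \<Rightarrow> bool" where
  "rhom h \<longleftrightarrow> h 1 = 1 \<and> (\<forall>a b. h (a + b) = h a + h b) \<and> (\<forall>a b. h (a * b) = h a * h b)"

lemma
  assumes "rhom h"
  shows rhom_1: "h 1 = 1" and rhom_add: "h (a + b) = h a + h b" and rhom_mult: "h (a * b) = h a * h b"
    and rhom_0: "h 0 = 0" and rhom_minus: "h (- a) = - h a" and rhom_diff: "h (a - b) = h a - h b"
    and rhom_sum: "h (sum f I) = (\<Sum>i\<in>I. h (f i))" and rhom_prod: "h (prod f I) = (\<Prod>i\<in>I. h (f i))"
    and rhom_of_int: "h (of_int m) = of_int m"
    and rhom_power: "h (a ^ n) = h a ^ n"
proof -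
  show 1: "h 1 = 1" and add: "\<And>a b. h (a + b) = h a + h b" and mult: "\<And>a b. h (a * b) = h a * h b"
    using assms unfolding rhom_def by auto
  show 0: "h 0 = 0" using add[of 0 0] by simp
  have min: "h (- a) = - h a" for a using add[of a "- a"] 0 by (simp add: eq_neg_iff_add_eq_0 add.commute)
  then show "h (- a) = - h a" .
  show "h (a - b) = h a - h b" using add[of a "- b"] min by simp
  show "h (sum f I) = (\<Sum>i\<in>I. h (f i))"
    by (induction I rule: infinite_finite_induct) (auto simp: 0 add)
  show "h (prod f I) = (\<Prod>i\<in>I. h (f i))"
    by (induction I rule: infinite_finite_induct) (auto simp: 1 mult)
  have nat: "h (of_nat n) = of_nat n" for n by (induction n) (auto simp: 0 1 add)
  show "h (of_int m) = of_int m" by (cases m rule: int_cases2) (simp_all add: nat min)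
  show "h (a ^ n) = h a ^ n" by (induction n) (auto simp: 1 mult)
qed

lemma rhom_of_int': "rhom (of_int :: int \<Rightarrow> 'a::comm_ring_1)" by (simp add: rhom_def)

lemma rhom_eval_poly: "rhom (\<lambda>p :: int poly. poly (map_poly of_int p) (t :: 'a::comm_ring_1))"
proof -
  have "map_poly of_int (p + q) = map_poly of_int p + (map_poly of_int q :: 'a poly)" for p q :: "int poly"
    by (intro poly_eqI) (simp add: coeff_map_poly)
  moreover have "map_poly of_int (p * q) = map_poly of_int p * (map_poly of_int q :: 'a poly)" for p q :: "int poly"
    by (intro poly_eqI) (simp add: coeff_map_poly coeff_mult)
  ultimately show ?thesis unfolding rhom_def by simp
qed

definition map_sqm :: "('a \<Rightarrow> 'b) \<Rightarrow> ('a, 'n::finite) sqm \<Rightarrow> ('b, 'n) sqm" where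
  "map_sqm h A = Mx (\<chi> i j. h (ent A i j))"

lemma ent_map_sqm [simp]: "ent (map_sqm h A) i j = h (ent A i j)" by (simp add: map_sqm_def ent_def)

lemma
  assumes "rhom h"
  shows map_sqm_1: "map_sqm h 1 = 1" and map_sqm_0: "map_sqm h 0 = 0"
    and map_sqm_diff: "map_sqm h (A - B) = map_sqm h A - map_sqm h B"
    and map_sqm_mult: "map_sqm h (A * B) = map_sqm h A * map_sqm h B"
    and map_sqm_smq: "map_sqm h (smq c A) = smq (h c) (map_sqm h A)"
    and map_sqm_sum: "map_sqm h (sum f I) = (\<Sum>i\<in>I. map_sqm h (f i))"
  using assms
  by (auto intro!: sqm_eqI simp: ent_1 ent_mult ent_sum rhom_0 rhom_1 rhom_add rhom_diff rhom_minus rhom_mult rhom_sum)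

lemma map_sqm_power: "rhom h \<Longrightarrow> map_sqm h (A ^ n) = map_sqm h A ^ n"
  by (induction n) (simp_all add: map_sqm_1 map_sqm_mult)

abbreviation iota :: "(int, 'n::finite) sqm \<Rightarrow> ('a::comm_ring_1, 'n) sqm" where
  "iota \<equiv> map_sqm of_int"

lemmas iota_0 = map_sqm_0[OF rhom_of_int']
  and iota_diff = map_sqm_diff[OF rhom_of_int']
  and iota_mult = map_sqm_mult[OF rhom_of_int']
  and iota_smq = map_sqm_smq[OF rhom_of_int']
  and iota_power = map_sqm_power[OF rhom_of_int']

lemma iota_eq_iff: "iota A = (iota B :: ('k::field_char_0, 'n::finite) sqm) \<longleftrightarrow> A = B"
  by (auto simp: sqm_eq_iff)

lemma map_sqm_iota: "rhom h \<Longrightarrow> map_sqm h (iota A) = iota A"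
  by (intro sqm_eqI) (simp add: rhom_of_int)

lemma rhom_det: assumes h: "rhom h" shows "h (det (mx A)) = det (mx (map_sqm h A))"
  unfolding det_def rhom_sum[OF h] rhom_mult[OF h] rhom_prod[OF h]
  by (intro sum.cong refl) (simp add: rhom_of_int[OF h] map_sqm_def ent_def)

section \<open>Polynomials in the matrix entries\<close>

definition eep :: "'n::finite entry_poly \<Rightarrow> ('a::comm_ring_1, 'n) sqm \<Rightarrow> 'a" where
  "eep p A = eval_entry_poly p (mx A)"

definition mon :: "('n \<times> 'n \<Rightarrow>\<^sub>0 nat) \<Rightarrow> ('a::comm_ring_1, 'n::finite) sqm \<Rightarrow> 'a" where
  "mon m A = (\<Prod>(i, j)\<in>UNIV. ent A i j ^ Poly_Mapping.lookup m (i, j))"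

lemma eep_superset:
  assumes "finite K" "Poly_Mapping.keys p \<subseteq> K"
  shows "eep p A = (\<Sum>m\<in>K. of_int (Poly_Mapping.lookup p m) * mon m A)"
  unfolding eep_def eval_entry_poly_def mon_def ent_def
  by (rule sum.mono_neutral_left) (use assms in \<open>auto simp: in_keys_iff\<close>)

lemma eep_add: "eep (p + q) A = eep p A + eep q A"
proof -
  let ?K = "Poly_Mapping.keys p \<union> Poly_Mapping.keys q"
  have "Poly_Mapping.keys (p + q) \<subseteq> ?K" by (rule keys_add)
  then show ?thesis
    using eep_superset[of ?K "p + q" A] eep_superset[of ?K p A] eep_superset[of ?K q A]
    by (simp add: lookup_add algebra_simps sum.distrib)
qed

lemma eep_single: "eep (Poly_Mapping.single m c) A = of_int c * mon m A"
  using eep_superset[of "{m}" "Poly_Mapping.single m c" A] by simp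

lemma eep_1: "eep 1 A = 1"
  using eep_single[of 0 1 A] by (simp add: mon_def case_prod_beta flip: single_one)

lemma mon_add: "mon (m + m') A = mon m A * mon m' A"
  unfolding mon_def prod.distrib[symmetric] by (intro prod.cong refl) (auto simp: lookup_add power_add)

lemma poly_mapping_add_induct:
  fixes p :: "'k \<Rightarrow>\<^sub>0 'c::comm_monoid_add"
  assumes single: "\<And>m c. P (Poly_Mapping.single m c)" and add: "\<And>f g. P f \<Longrightarrow> P g \<Longrightarrow> P (f + g)"
  shows "P p"
proof -
  have "P (\<Sum>m\<in>K. Poly_Mapping.single m (Poly_Mapping.lookup p m))" if "finite K" for K
    using that single[of undefined 0] by (induction K) (auto intro: single add)
  moreover have "(\<Sum>m\<in>Poly_Mapping.keys p. Poly_Mapping.single m (Poly_Mapping.lookup p m)) = p"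
    by (rule poly_mapping_eqI)
      (simp add: lookup_sum lookup_single when_def in_keys_iff)
  ultimately show ?thesis by (metis finite_keys)
qed

lemma eep_mult: "eep (p * q) A = eep p A * eep q A"
proof (induction p rule: poly_mapping_add_induct)
  case (1 m c)
  show ?case
  proof (induction q rule: poly_mapping_add_induct)
    case (1 m' c')
    then show ?case by (simp add: mult_single eep_single mon_add)
  next
    case (2 f g)
    then show ?case by (simp add: distrib_left eep_add)
  qed
next
  case (2 f g)
  then show ?case by (simp add: distrib_right eep_add)
qed

lemma rhom_eep: "rhom (\<lambda>p. eep p A)" unfolding rhom_def by (simp add: eep_1 eep_add eep_mult)

lemma eep_map_sqm: assumes h: "rhom h" shows "h (eep p A) = eep p (map_sqm h A)"
  unfolding eep_def eval_entry_poly_def rhom_sum[OF h] rhom_mult[OF h] rhom_of_int[OF h]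
  by (intro sum.cong refl) (simp add: rhom_prod[OF h] rhom_power[OF h] case_prod_beta map_sqm_def ent_def)

text \<open>The matrix of indeterminates. An expression in a matrix formed with ring operations,
  determinants and adjugates is the value there of the same expression in this matrix, and in this
  way an entry polynomial.\<close>

definition generic :: "('n::finite entry_poly, 'n) sqm" where
  "generic = Mx (\<chi> i j. Poly_Mapping.single (Poly_Mapping.single (i, j) 1) 1)"

lemma map_sqm_eep_generic: "map_sqm (\<lambda>p. eep p A) generic = A"
proof (rule sqm_eqI)
  fix i j
  have "mon (Poly_Mapping.single (i, j) 1) A = (\<Prod>k\<in>UNIV. if k = (i, j) then ent A i j else 1)"
    unfolding mon_def by (intro prod.cong refl) (auto simp: lookup_single when_def split: if_splits)
  also have "\<dots> = ent A i j" by (simp add: prod.delta)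
  finally show "ent (map_sqm (\<lambda>p. eep p A) generic) i j = ent A i j"
    by (simp add: generic_def eep_single) (simp add: ent_def eep_single)
qed

text \<open>The adjugate; on matrices of determinant 1 over a field it is the inverse, by Cramer's rule.\<close>

definition adj :: "('a::comm_ring_1, 'n::finite) sqm \<Rightarrow> ('a, 'n) sqm" where
  "adj A = Mx (\<chi> k j. det (\<chi> i l. if l = k then if i = j then 1 else 0 else mx A $ i $ l))"

lemma map_sqm_adj: assumes h: "rhom h" shows "map_sqm h (adj A) = adj (map_sqm h A)"
proof (rule sqm_eqI)
  fix k j
  have "h (det (\<chi> i l. if l = k then if i = j then 1 else 0 else mx A $ i $ l)) =
      det (mx (map_sqm h (Mx (\<chi> i l. if l = k then if i = j then 1 else 0 else mx A $ i $ l))))"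
    using rhom_det[OF h, of "Mx (\<chi> i l. if l = k then if i = j then 1 else 0 else mx A $ i $ l)"] by simp
  also have "mx (map_sqm h (Mx (\<chi> i l. if l = k then if i = j then 1 else 0 else mx A $ i $ l)))
      = (\<chi> i l. if l = k then if i = j then 1 else 0 else mx (map_sqm h A) $ i $ l)"
    by (auto simp: map_sqm_def ent_def vec_eq_iff rhom_1[OF h] rhom_0[OF h])
  finally show "ent (map_sqm h (adj A)) k j = ent (adj (map_sqm h A)) k j"
    by (simp add: adj_def ent_def[of "Mx _"] ent_def[of "adj _"])
qed

lemma
  fixes A :: "('k::field, 'n::finite) sqm"
  assumes d: "det (mx A) = 1"
  shows mult_adj: "A * adj A = 1" and adj_mult: "adj A * A = 1" and matrix_inv_adj: "matrix_inv (mx A) = mx (adj A)"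
proof -
  have inv: "invertible (mx A)" using d by (simp add: invertible_det_nz)
  obtain B where B: "mx A ** B = mat 1" "B ** mx A = mat 1" using inv unfolding invertible_def by blast
  have "B = mx (adj A)"
  proof -
    have "B $ k $ j = det (\<chi> i l. if l = k then if i = j then 1 else 0 else mx A $ i $ l)" for k j
    proof -
      let ?b = "\<chi> k. B $ k $ j"
      have "(mx A *v ?b) $ i = (mx A ** B) $ i $ j" for i
        by (simp add: matrix_vector_mult_def matrix_matrix_mult_def)
      then have "(mx A *v ?b) $ i = (if i = j then 1 else 0)" for i using B(1) by (simp add: mat_def)
      then have "(\<chi> i l. if l = k then (mx A *v ?b) $ i else mx A $ i $ l) =
          (\<chi> i l. if l = k then if i = j then 1 else 0 else mx A $ i $ l)" by (simp add: vec_eq_iff)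
      then show ?thesis using cramer_lemma[of k "mx A" ?b] d by simp
    qed
    then show ?thesis by (simp add: adj_def vec_eq_iff)
  qed
  then show 1: "A * adj A = 1" "adj A * A = 1" using B by (simp_all add: mx_eq_iff mx_mult mx_1)
  have "matrix_inv (mx A) ** mx A = mat 1"
    using inv unfolding invertible_def matrix_inv_def by (metis (mono_tags, lifting) someI_ex)
  then have "matrix_inv (mx A) ** (mx A ** mx (adj A)) = mx (adj A)"
    unfolding matrix_mul_assoc by simp
  then show "matrix_inv (mx A) = mx (adj A)" using 1(1) by (simp add: mx_eq_iff mx_mult mx_1)
qed

section \<open>Integral equations for rational subspaces\<close>

definition pairing :: "(int, 'n::finite) sqm \<Rightarrow> ('a::comm_ring_1, 'n) sqm \<Rightarrow> 'a" where
  "pairing L A = (\<Sum>i\<in>UNIV. \<Sum>j\<in>UNIV. of_int (ent L i j) * ent A i j)"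

lemma pairing_diff: "pairing L (A - B) = pairing L A - pairing L B"
  and pairing_smq: "pairing L (smq c A) = c * pairing L A"
  by (simp_all add: pairing_def algebra_simps sum.distrib sum_subtractf sum_distrib_left)

lemma pairing_diff_left: "pairing (L - M) A = pairing L A - pairing M A"
  and pairing_smq_left: "pairing (smq c L) A = of_int c * pairing L A"
  by (simp_all add: pairing_def algebra_simps sum.distrib sum_subtractf sum_distrib_left)

lemma rhom_pairing: "rhom h \<Longrightarrow> h (pairing L A) = pairing L (map_sqm h A)"
  unfolding pairing_def by (simp add: rhom_sum rhom_mult rhom_of_int)

lemma pairing_iota: "pairing L (iota A) = of_int (pairing L A)"
  by (rule rhom_pairing[OF rhom_of_int', symmetric])

definition unit_sqm :: "'n::finite \<Rightarrow> 'n \<Rightarrow> (int, 'n) sqm" where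
  "unit_sqm a b = Mx (\<chi> i j. if i = a \<and> j = b then 1 else 0)"

lemma pairing_unit_sqm: "pairing (unit_sqm a b) A = ent A a b"
proof -
  have "pairing (unit_sqm a b) A = (\<Sum>i\<in>UNIV. \<Sum>j\<in>UNIV. if j = b then if i = a then ent A i j else 0 else 0)"
    unfolding pairing_def by (intro sum.cong refl) (simp add: unit_sqm_def ent_def)
  then show ?thesis by (simp add: sum.delta)
qed

text \<open>A set of integral linear equations that defines the span of the given matrices over every
  field of characteristic zero simultaneously, obtained by eliminating one equation per matrix.\<close>

primrec cut :: "(int, 'n::finite) sqm list \<Rightarrow> (int, 'n) sqm set" where
  "cut [] = {unit_sqm a b | a b. True}"
| "cut (s # ss) = (if \<forall>L\<in>cut ss. pairing L s = (0 :: int) then cut ss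
     else let M = (SOME M. M \<in> cut ss \<and> pairing M s \<noteq> (0 :: int)) in
       {smq (pairing M s) L - smq (pairing L s) M | L. L \<in> cut ss})"

text \<open>The integral equations do not depend on the field, so membership in a span of integral
  matrices is the same condition over the complex numbers and over any other field of characteristic
  zero. In the step M is a pivot: subtracting from A the multiple of the new matrix s with
  coefficient (M, A) / (M, s) reduces to the equations of the tail.\<close>

lemma cut_iff_span:
  fixes A :: "('k::field_char_0, 'n::finite) sqm"
  shows "(\<forall>L\<in>cut ss. pairing L A = 0) \<longleftrightarrow> A \<in> sq.vs.span (iota ` set ss)"
proof (induction ss arbitrary: A)
  case Nil
  have "(\<forall>L\<in>cut []. pairing L A = 0) \<longleftrightarrow> (\<forall>a b. pairing (unit_sqm a b) A = 0)"
    unfolding cut.simps by blast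
  also have "\<dots> \<longleftrightarrow> (\<forall>a b. ent A a b = 0)" unfolding pairing_unit_sqm ..
  finally have "(\<forall>L\<in>cut []. pairing L A = 0) \<longleftrightarrow> (\<forall>a b. ent A a b = 0)" .
  then show ?case by (simp add: sqm_eq_iff)
next
  case (Cons s ss)
  show ?case
  proof (cases "\<forall>L\<in>cut ss. pairing L s = (0 :: int)")
    case True
    then have "\<forall>L\<in>cut ss. pairing L (iota s :: ('k, 'n) sqm) = 0" by (simp add: pairing_iota)
    then have "iota s \<in> sq.vs.span (iota ` set ss :: ('k, 'n) sqm set)" using Cons by blast
    then have "sq.vs.span (iota ` set (s # ss) :: ('k, 'n) sqm set) = sq.vs.span (iota ` set ss)"
      by (simp add: sq.vs.span_redundant)
    then show ?thesis using True Cons by (simp del: list.set)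
  next
    case False
    define M where "M = (SOME M. M \<in> cut ss \<and> pairing M s \<noteq> (0 :: int))"
    have M: "M \<in> cut ss" "pairing M s \<noteq> (0 :: int)"
      using False someI_ex[of "\<lambda>M. M \<in> cut ss \<and> pairing M s \<noteq> (0 :: int)"] unfolding M_def by blast+
    have cut: "cut (s # ss) = {smq (pairing M s) L - smq (pairing L s) M | L. L \<in> cut ss}"
      using False unfolding M_def cut.simps Let_def by (rule if_not_P)
    have p: "pairing (smq (pairing M s) L - smq (pairing L s) M) B =
        of_int (pairing M s) * pairing L B - of_int (pairing L s) * pairing M B"
      for L and B :: "('k, 'n) sqm" by (simp add: pairing_diff_left pairing_smq_left)
    show ?thesis
    proof
      assume A: "A \<in> sq.vs.span (iota ` set (s # ss))"
      then obtain k where "A - smq k (iota s) \<in> sq.vs.span (iota ` set ss)"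
        by (auto simp: sq.vs.span_insert)
      then have *: "pairing L (A - smq k (iota s)) = 0" if "L \<in> cut ss" for L using Cons that by blast
      have "pairing L A = k * of_int (pairing L s)" if "L \<in> cut ss" for L
        using *[OF that] by (simp add: pairing_diff pairing_smq pairing_iota)
      then show "\<forall>L\<in>cut (s # ss). pairing L A = 0"
        unfolding cut using M(1) by (auto simp: p)
    next
      assume A: "\<forall>L\<in>cut (s # ss). pairing L A = 0"
      define k where "k = pairing M A / of_int (pairing M s)"
      have "pairing L (A - smq k (iota s)) = 0" if L: "L \<in> cut ss" for L
      proof -
        have "of_int (pairing M s) * pairing L A - of_int (pairing L s) * pairing M A = 0"
          using A L unfolding cut p[symmetric] by blast
        then show ?thesis using M(2)
          by (simp add: pairing_diff pairing_smq pairing_iota k_def field_simps)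
      qed
      then have "A - smq k (iota s) \<in> sq.vs.span (iota ` set ss)" using Cons by blast
      then show "A \<in> sq.vs.span (iota ` set (s # ss))" by (auto simp: sq.vs.span_insert)
    qed
  qed
qed

section \<open>Integral Chevalley systems\<close>

text \<open>\<open>E \<alpha> k\<close> stands for the divided power X_\<alpha>^k / k! on an
  admissible lattice. The structure constants of a Chevalley basis are given as complex numbers;
  between integral matrices they appear as fractions p / q, with the same p and q for the negative
  roots up to the sign of p.\<close>

locale integral_chevalley_system =
  fixes \<Phi> :: "'v::euclidean_space set" and E :: "'v \<Rightarrow> nat \<Rightarrow> (int, 'n::finite) sqm" and K :: nat
  assumes rs: "root_system \<Phi>"
    and E_fact: "\<alpha> \<in> \<Phi> \<Longrightarrow> smq (fact k) (E \<alpha> k) = E \<alpha> 1 ^ k"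
    and E_eq_0: "\<alpha> \<in> \<Phi> \<Longrightarrow> k \<ge> K \<Longrightarrow> E \<alpha> k = 0"
    and E_nonzero: "\<alpha> \<in> \<Phi> \<Longrightarrow> E \<alpha> 1 \<noteq> 0"
    and E_comm: "\<alpha> \<in> \<Phi> \<Longrightarrow> \<beta> \<in> \<Phi> \<Longrightarrow> \<alpha> + \<beta> \<notin> \<Phi> \<Longrightarrow> \<alpha> + \<beta> \<noteq> 0 \<Longrightarrow> lie (E \<alpha> 1) (E \<beta> 1) = 0"
    and E_lie: "\<alpha> \<in> \<Phi> \<Longrightarrow> \<beta> \<in> \<Phi> \<Longrightarrow> \<alpha> + \<beta> \<in> \<Phi> \<Longrightarrow> \<exists>p q. q \<noteq> 0 \<and>
      smq q (lie (E \<alpha> 1) (E \<beta> 1)) = smq p (E (\<alpha> + \<beta>) 1) \<and>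
      smq q (lie (E (- \<alpha>) 1) (E (- \<beta>) 1)) = smq (- p) (E (- (\<alpha> + \<beta>)) 1)"
    and E_H: "\<alpha> \<in> \<Phi> \<Longrightarrow> \<beta> \<in> \<Phi> \<Longrightarrow>
      lie (lie (E \<alpha> 1) (E (- \<alpha>) 1)) (E \<beta> 1) = smq \<lfloor>cartan_integer \<beta> \<alpha>\<rfloor> (E \<beta> 1)"
begin

section \<open>Root elements over commutative rings\<close>

definition XF :: "'v \<Rightarrow> ('k::comm_ring_1, 'n) sqm" where "XF \<alpha> = iota (E \<alpha> 1)"

text \<open>exp (t X_\<alpha>) as a polynomial in t with integral matrix coefficients. It makes
  sense over every commutative ring, also over integer polynomials, where t can be an
  indeterminate.\<close>

definition xg :: "'v \<Rightarrow> 'k \<Rightarrow> ('k::comm_ring_1, 'n) sqm" where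
  "xg \<alpha> t = (\<Sum>k<K. smq (t ^ k) (iota (E \<alpha> k)))"

lemma map_sqm_xg: "rhom h \<Longrightarrow> map_sqm h (xg \<alpha> t) = xg \<alpha> (h t)"
  unfolding xg_def by (simp add: map_sqm_sum map_sqm_smq map_sqm_iota rhom_power)

lemma XF_power_eq_0: "\<alpha> \<in> \<Phi> \<Longrightarrow> (XF \<alpha> :: ('k::field_char_0, 'n) sqm) ^ K = 0"
  unfolding XF_def iota_power[symmetric] E_fact[symmetric] by (simp add: E_eq_0 iota_0 sqm_eq_iff)

lemma dp_XF: "\<alpha> \<in> \<Phi> \<Longrightarrow> sq.dp (XF \<alpha> :: ('k::field_char_0, 'n) sqm) k = iota (E \<alpha> k)"
  unfolding sq.dp_def XF_def iota_power[symmetric] E_fact[symmetric] iota_smq by simp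

lemma nexp_XF:
  assumes a: "\<alpha> \<in> \<Phi>" shows "sq.nexp (smq t (XF \<alpha>)) = xg \<alpha> (t :: 'k::field_char_0)"
proof -
  have "(smq t (XF \<alpha>)) ^ K = (0 :: ('k, 'n) sqm)" by (simp add: sq.power_sm XF_power_eq_0[OF a])
  then have "sq.nexp (smq t (XF \<alpha>)) = (\<Sum>k<K. sq.dp (smq t (XF \<alpha>)) k)" by (rule sq.nexp_eq)
  also have "\<dots> = (\<Sum>k<K. smq (t ^ k) (sq.dp (XF \<alpha>) k))"
    by (intro sum.cong refl) (simp add: sq.dp_def sq.power_sm mult.commute)
  finally show ?thesis unfolding xg_def dp_XF[OF a] .
qed

sublocale cs: chevalley_system "smq :: 'k::field_char_0 \<Rightarrow> ('k, 'n) sqm \<Rightarrow> _" \<Phi> XF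
proof unfold_locales
  have inj: "iota A = (0 :: ('k, 'n) sqm) \<longleftrightarrow> A = 0" for A
    using iota_eq_iff[of A 0] by (simp add: iota_0)
  show "root_system \<Phi>" by (rule rs)
  fix \<alpha> assume a: "\<alpha> \<in> \<Phi>"
  show "sq.nilp (XF \<alpha> :: ('k, 'n) sqm)" unfolding sq.nilp_def using XF_power_eq_0[OF a] by blast
  show "XF \<alpha> \<noteq> (0 :: ('k, 'n) sqm)" unfolding XF_def inj using E_nonzero[OF a] .
  fix \<beta> assume b: "\<beta> \<in> \<Phi>"
  have l: "lie (XF \<alpha>) (XF \<beta>) = (iota (lie (E \<alpha> 1) (E \<beta> 1)) :: ('k, 'n) sqm)" for \<alpha> \<beta>
    unfolding XF_def by (simp add: iota_mult iota_diff)
  show "lie (XF \<alpha>) (XF \<beta>) = (0 :: ('k, 'n) sqm)" if "\<alpha> + \<beta> \<notin> \<Phi>" "\<alpha> + \<beta> \<noteq> 0"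
    unfolding l E_comm[OF a b that] by (rule iota_0)
  show "\<exists>c. lie (XF \<alpha>) (XF \<beta>) = smq c (XF (\<alpha> + \<beta>)) \<and>
      lie (XF (- \<alpha>)) (XF (- \<beta>)) = smq (- c) (XF (- (\<alpha> + \<beta>)) :: ('k, 'n) sqm)" if ab: "\<alpha> + \<beta> \<in> \<Phi>"
  proof -
    obtain p q where pq: "q \<noteq> 0"
      "smq q (lie (E \<alpha> 1) (E \<beta> 1)) = smq p (E (\<alpha> + \<beta>) 1)"
      "smq q (lie (E (- \<alpha>) 1) (E (- \<beta>) 1)) = smq (- p) (E (- (\<alpha> + \<beta>)) 1)"
      using E_lie[OF a b ab] by blast
    have div: "A = smq (of_int p / of_int q) B" if "smq q A' = smq p B'" "A = iota A'" "B = iota B'"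
      for A' B' and A B :: "('k, 'n) sqm" and p
    proof -
      have "smq (of_int q) A = smq (of_int p) B" using that iota_smq by metis
      then have "smq (1 / of_int q) (smq (of_int q) A) = smq (1 / of_int q) (smq (of_int p) B)" by simp
      then show ?thesis using pq(1) by simp
    qed
    have "lie (XF (- \<alpha>)) (XF (- \<beta>)) = smq (of_int (- p) / of_int q) (XF (- (\<alpha> + \<beta>)) :: ('k, 'n) sqm)"
      using div[OF pq(3) l] unfolding XF_def by blast
    moreover have "lie (XF \<alpha>) (XF \<beta>) = smq (of_int p / of_int q) (XF (\<alpha> + \<beta>) :: ('k, 'n) sqm)"
      using div[OF pq(2) l] unfolding XF_def by blast
    ultimately show ?thesis by (intro exI[of _ "of_int p / of_int q"]) simp
  qed
  show "lie (lie (XF \<alpha>) (XF (- \<alpha>))) (XF \<beta>) = smq (of_int \<lfloor>cartan_integer \<beta> \<alpha>\<rfloor>) (XF \<beta> :: ('k, 'n) sqm)"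
    unfolding iota_smq[symmetric] XF_def using E_H[OF a b] by (metis iota_diff iota_mult)
qed

lemma xg_inverse:
  "\<alpha> \<in> \<Phi> \<Longrightarrow> xg \<alpha> t * xg \<alpha> (- t) = (1 :: ('k::field_char_0, 'n) sqm)"
  using sq.nexp_minus(1)[OF cs.nilp_sm_X[of \<alpha> t]] by (simp add: nexp_XF[symmetric])

text \<open>The determinant of \<open>xg \<alpha> t\<close> is a polynomial in \<open>t\<close> without zeros, hence constant.\<close>

lemma det_xg:
  assumes a: "\<alpha> \<in> \<Phi>" shows "det (mx (xg \<alpha> (t :: 'k::comm_ring_1))) = 1"
proof -
  define D :: "int poly" where "D = det (mx (xg \<alpha> [:0, 1:]))"
  have D: "poly (map_poly of_int D) t = det (mx (xg \<alpha> t))" for t :: "'b::comm_ring_1"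
    unfolding D_def rhom_det[OF rhom_eval_poly] map_sqm_xg[OF rhom_eval_poly]
    by (simp add: map_poly_pCons)
  have "poly (map_poly of_int D) t \<noteq> (0 :: complex)" for t
  proof -
    have "det (mx (xg \<alpha> t * xg \<alpha> (- t))) = (1 :: complex)"
      by (simp add: xg_inverse[OF a] mx_1 det_I)
    then show ?thesis unfolding D by (auto simp: mx_mult det_mul)
  qed
  then have "constant (poly (map_poly of_int D :: complex poly))"
    using fundamental_theorem_of_algebra by blast
  then have c: "poly (map_poly of_int D) t = poly (map_poly of_int D) (0::complex)" for t
    unfolding constant_def by blast
  have x0: "xg \<alpha> 0 = (1 :: (complex, 'n) sqm)"
    using nexp_XF[OF a, of "0::complex"] by (simp add: sq.nexp_0)
  have "poly (map_poly of_int D) t = (1::complex)" for t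
    using c[of t] unfolding D x0 by (simp add: mx_1 det_I)
  then have "poly (map_poly of_int D :: complex poly) = poly 1" by auto
  then have D1: "map_poly of_int D = (1 :: complex poly)" by (simp add: poly_eq_poly_eq_iff)
  have "D = 1"
  proof (rule poly_eqI)
    fix n
    have "of_int (coeff D n) = coeff (1 :: complex poly) n" using D1 by (metis coeff_map_poly of_int_0)
    also have "\<dots> = of_int (coeff 1 n)" by (cases n) auto
    finally show "coeff D n = coeff 1 n" by (simp only: of_int_eq_iff)
  qed
  then show ?thesis using D[of t] by (simp add: map_poly_1')
qed

end

definition subring :: "'k::comm_ring_1 set \<Rightarrow> bool" where
  "subring R \<longleftrightarrow> 1 \<in> R \<and> (\<forall>a\<in>R. \<forall>b\<in>R. a + b \<in> R \<and> a * b \<in> R \<and> - a \<in> R)"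

lemma subring_closed:
  assumes "subring R"
  shows "1 \<in> R" "0 \<in> R" "a \<in> R \<Longrightarrow> b \<in> R \<Longrightarrow> a + b \<in> R" "a \<in> R \<Longrightarrow> b \<in> R \<Longrightarrow> a * b \<in> R"
    "a \<in> R \<Longrightarrow> - a \<in> R" "a \<in> R \<Longrightarrow> b \<in> R \<Longrightarrow> a - b \<in> R" "of_int m \<in> R" "a \<in> R \<Longrightarrow> a ^ n \<in> R"
    "(\<And>i. i \<in> I \<Longrightarrow> f i \<in> R) \<Longrightarrow> sum f I \<in> R" "(\<And>i. i \<in> I \<Longrightarrow> f i \<in> R) \<Longrightarrow> prod f I \<in> R"
proof -
  show 1: "1 \<in> R" and add: "\<And>a b. a \<in> R \<Longrightarrow> b \<in> R \<Longrightarrow> a + b \<in> R"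
    and mult: "\<And>a b. a \<in> R \<Longrightarrow> b \<in> R \<Longrightarrow> a * b \<in> R" and min: "\<And>a. a \<in> R \<Longrightarrow> - a \<in> R"
    using assms unfolding subring_def by auto
  show 0: "0 \<in> R" using add[OF 1 min[OF 1]] by simp
  show "a \<in> R \<Longrightarrow> b \<in> R \<Longrightarrow> a - b \<in> R" using add[of a "- b"] min by simp
  have nat: "of_nat n \<in> R" for n by (induction n) (auto simp: 0 1 add)
  show "of_int m \<in> R" by (cases m rule: int_cases2) (auto simp: nat min)
  show "a \<in> R \<Longrightarrow> a ^ n \<in> R" by (induction n) (auto simp: 1 mult)
  show "(\<And>i. i \<in> I \<Longrightarrow> f i \<in> R) \<Longrightarrow> sum f I \<in> R"
    by (induction I rule: infinite_finite_induct) (auto simp: 0 add)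
  show "(\<And>i. i \<in> I \<Longrightarrow> f i \<in> R) \<Longrightarrow> prod f I \<in> R"
    by (induction I rule: infinite_finite_induct) (auto simp: 1 mult)
qed

lemma ideal_Gcd:
  fixes I :: "int set"
  assumes "finite A" "A \<subseteq> I" "0 \<in> I" "\<And>a b. a \<in> I \<Longrightarrow> b \<in> I \<Longrightarrow> a + b \<in> I" "\<And>a m. a \<in> I \<Longrightarrow> m * a \<in> I"
  shows "Gcd A \<in> I"
  using assms(1,2)
proof (induction A rule: finite_induct)
  case (insert a A)
  obtain u v where "u * a + v * Gcd A = gcd a (Gcd A)" using bezout_int by blast
  moreover have "u * a + v * Gcd A \<in> I" using insert assms(4,5) by auto
  ultimately show ?case by simp
qed (use assms(3) in simp)

lemma ent_adj_in:
  fixes A :: "('k::comm_ring_1, 'n::finite) sqm"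
  assumes R: "subring R" and "\<And>i j. ent A i j \<in> R" shows "ent (adj A) i j \<in> R"
  unfolding adj_def ent_def det_def using assms
  by (auto simp: ent_def intro!: subring_closed[OF R])

lemma ent_mult_in:
  fixes A :: "('k::comm_ring_1, 'n::finite) sqm"
  assumes R: "subring R" and "\<And>i j. ent A i j \<in> R" "\<And>i j. ent B i j \<in> R" shows "ent (A * B) i j \<in> R"
  unfolding ent_mult using assms by (auto intro!: subring_closed[OF R])

section \<open>Points of the group scheme and their action on the Lie algebra\<close>

context integral_chevalley_system
begin

inductive_set Gc :: "(complex, 'n) sqm set" where
  one: "1 \<in> Gc"
| step: "\<alpha> \<in> \<Phi> \<Longrightarrow> g \<in> Gc \<Longrightarrow> xg \<alpha> t * g \<in> Gc"

definition vanishing :: "'n entry_poly \<Rightarrow> bool" where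
  "vanishing p \<longleftrightarrow> (\<forall>g\<in>Gc. eep p g = 0)"

definition GR :: "'k::comm_ring_1 set \<Rightarrow> ('k, 'n) sqm set" where
  "GR R = {A. (\<forall>i j. ent A i j \<in> R) \<and> det (mx A) = 1 \<and> (\<forall>p. vanishing p \<longrightarrow> eep p A = 0)}"

text \<open>With an indeterminate in place of t, a polynomial that vanishes on the complex group
  turns into an integer polynomial in one variable. It is zero at all complex numbers, hence zero,
  and so is its value at t.\<close>

lemma xg_in_GR:
  fixes t :: "'k::comm_ring_1"
  assumes R: "subring R" and t: "t \<in> R" and a: "\<alpha> \<in> \<Phi>"
  shows "xg \<alpha> t \<in> GR R"
proof -
  have "ent (xg \<alpha> t) i j \<in> R" for i j
    unfolding xg_def ent_sum using R t by (auto intro!: subring_closed)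
  moreover have "eep p (xg \<alpha> t) = 0" if p: "vanishing p" for p
  proof -
    define q :: "int poly" where "q = eep p (xg \<alpha> [:0, 1:])"
    have q: "poly (map_poly of_int q) t = eep p (xg \<alpha> t)" for t :: "'b::comm_ring_1"
      unfolding q_def eep_map_sqm[OF rhom_eval_poly] map_sqm_xg[OF rhom_eval_poly]
      by (simp add: map_poly_pCons)
    have "poly (map_poly of_int q) t = (0 :: complex)" for t
      unfolding q using p Gc.step[OF a Gc.one, of t] unfolding vanishing_def by simp
    then have "map_poly of_int q = (0 :: complex poly)" using poly_all_0_iff_0 by blast
    then have "q = 0" by (intro poly_eqI) (metis coeff_map_poly of_int_0 coeff_0 of_int_eq_0_iff)
    then show ?thesis using q[of t] by simp
  qed
  ultimately show ?thesis unfolding GR_def using det_xg[OF a] by blast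
qed

text \<open>A generator acts by the exponential of a bracket that preserves the span. Uniqueness of
  inverses identifies the adjugate of a product.\<close>

lemma Gc_conj:
  assumes "g \<in> Gc"
  shows "det (mx g) = 1 \<and> (\<forall>Y\<in>cs.S. g * Y * adj g \<in> cs.S)"
  using assms
proof (induction rule: Gc.induct)
  case one
  have "adj 1 = (1 :: (complex, 'n) sqm)" using mult_adj[of "1 :: (complex, 'n) sqm"] by (simp add: mx_1 det_I)
  then show ?case by (simp add: mx_1 det_I)
next
  case (step \<alpha> g t)
  have d: "det (mx (xg \<alpha> t * g)) = 1" using step det_xg[OF step(1), of t] by (simp add: mx_mult det_mul)
  have g: "g * adj g = 1" using step mult_adj by blast
  have "xg \<alpha> t * g * (adj g * xg \<alpha> (- t)) = xg \<alpha> t * (g * adj g) * xg \<alpha> (- t)" by (simp add: mult.assoc)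
  then have "xg \<alpha> t * g * (adj g * xg \<alpha> (- t)) = 1" unfolding g using xg_inverse[OF step(1), of t] by simp
  then have adj: "adj (xg \<alpha> t * g) = adj g * xg \<alpha> (- t)"
    using adj_mult[OF d] cs.inverse_unique by blast
  have "xg \<alpha> t * g * Y * adj (xg \<alpha> t * g) \<in> cs.S" if Y: "Y \<in> cs.S" for Y
  proof -
    have 1: "g * Y * adj g \<in> cs.S" using step Y by blast
    have "sq.nexp (smq t (XF \<alpha>)) * (g * Y * adj g) * sq.nexp (- smq t (XF \<alpha>)) \<in> cs.S"
    proof (rule sq.nexp_conj_in_subspace[OF cs.nilp_sm_X[OF step(1)] 1 cs.subspace_S])
      fix v :: "(complex, 'n) sqm" assume "v \<in> cs.S"
      then have "smq t (lie (XF \<alpha>) v) \<in> cs.S"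
        using cs.lie_X_S[OF step(1)] sq.vs.subspace_scale[OF cs.subspace_S] by blast
      then show "lie (smq t (XF \<alpha>)) v \<in> cs.S" unfolding sq.lie_sm_left .
    qed
    moreover have "sq.nexp (- smq t (XF \<alpha>)) = xg \<alpha> (- t)"
      using nexp_XF[OF step(1), of "- t"] by simp
    ultimately show ?thesis unfolding adj nexp_XF[OF step(1)] by (simp only: mult.assoc)
  qed
  then show ?case using d by blast
qed

text \<open>Here membership in the scheme is exploited. To lie in the span of root vectors and
  coroots is a set of integral linear equations. Written for A Y A^-1, with the adjugate as inverse
  and the generic matrix for A, they become integer polynomials in the entries. These vanish on the
  complex group, hence at A.\<close>

lemma GR_conj:
  fixes A :: "('k::field_char_0, 'n) sqm"
  assumes A: "A \<in> GR R" and Y: "iota Y \<in> (cs.S :: (complex, 'n) sqm set)"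
  shows "A * iota Y * adj A \<in> cs.S"
proof -
  have "finite ((\<lambda>\<alpha>. E \<alpha> 1) ` \<Phi> \<union> (\<lambda>\<alpha>. lie (E \<alpha> 1) (E (- \<alpha>) 1)) ` \<Phi>)"
    by (intro finite_UnI finite_imageI finite_roots[OF rs])
  then obtain ss where ss: "set ss = (\<lambda>\<alpha>. E \<alpha> 1) ` \<Phi> \<union> (\<lambda>\<alpha>. lie (E \<alpha> 1) (E (- \<alpha>) 1)) ` \<Phi>"
    by (elim exE[OF finite_list])
  have H: "cs.H \<alpha> = (iota (lie (E \<alpha> 1) (E (- \<alpha>) 1)) :: ('m::field_char_0, 'n) sqm)" for \<alpha>
    unfolding cs.H_def XF_def iota_diff iota_mult ..
  have im: "iota ` set ss = (XF ` \<Phi> \<union> cs.H ` \<Phi> :: ('m::field_char_0, 'n) sqm set)"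
  proof -
    have "XF ` \<Phi> = (iota ` (\<lambda>\<alpha>. E \<alpha> 1) ` \<Phi> :: ('m, 'n) sqm set)"
      unfolding image_image XF_def ..
    moreover have "cs.H ` \<Phi> = (iota ` (\<lambda>\<alpha>. lie (E \<alpha> 1) (E (- \<alpha>) 1)) ` \<Phi> :: ('m, 'n) sqm set)"
      unfolding image_image by (intro image_cong refl H)
    ultimately show ?thesis by (simp only: ss image_Un)
  qed
  have S: "sq.vs.span (iota ` set ss) = (cs.S :: ('m::field_char_0, 'n) sqm set)"
    unfolding cs.S_def im ..
  have "pairing L (A * iota Y * adj A) = 0" if L: "L \<in> cut ss" for L
  proof -
    define q where "q = pairing L (generic * iota Y * adj generic)"
    have q: "eep q B = pairing L (B * iota Y * adj B)" for B :: "('m::comm_ring_1, 'n) sqm"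
      unfolding q_def rhom_pairing[OF rhom_eep]
      by (simp only: map_sqm_mult[OF rhom_eep] map_sqm_adj[OF rhom_eep] map_sqm_iota[OF rhom_eep] map_sqm_eep_generic)
    have "eep q g = 0" if g: "g \<in> Gc" for g
    proof -
      have "g * iota Y * adj g \<in> sq.vs.span (iota ` set ss)"
        unfolding S by (rule bspec[OF conjunct2[OF Gc_conj[OF g]] Y])
      then have "\<forall>L\<in>cut ss. pairing L (g * iota Y * adj g) = 0" by (rule iffD2[OF cut_iff_span])
      then show ?thesis unfolding q using L by (rule bspec)
    qed
    then have "vanishing q" unfolding vanishing_def by (rule ballI)
    moreover have "\<forall>p. vanishing p \<longrightarrow> eep p A = 0"
      using A unfolding GR_def mem_Collect_eq by (elim conjE)
    ultimately have "eep q A = 0" by simp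
    then show ?thesis unfolding q .
  qed
  then have "\<forall>L\<in>cut ss. pairing L (A * iota Y * adj A) = 0" by (rule ballI)
  then have "A * iota Y * adj A \<in> sq.vs.span (iota ` set ss)" by (rule iffD1[OF cut_iff_span])
  then show ?thesis unfolding S .
qed

lemma GR_normalizes:
  fixes A :: "('k::field_char_0, 'n) sqm"
  assumes A: "A \<in> GR R" and a: "\<alpha> \<in> \<Phi>"
  shows "cs.normalizes A (adj A) \<alpha>"
proof -
  have d: "det (mx A) = 1" using A unfolding GR_def by blast
  have "A * XF \<beta> * adj A \<in> cs.S" if "\<beta> \<in> \<Phi>" for \<beta>
    unfolding XF_def[of \<beta>] by (rule GR_conj[OF A cs.X_in_S[OF that, unfolded XF_def[of \<beta>]]])
  moreover have H: "cs.H \<alpha> = (iota (lie (E \<alpha> 1) (E (- \<alpha>) 1)) :: ('m::field_char_0, 'n) sqm)"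
    unfolding cs.H_def XF_def iota_diff iota_mult ..
  have "A * cs.H \<alpha> * adj A \<in> cs.S"
    unfolding H by (rule GR_conj[OF A cs.H_in_S[OF a, unfolded H]])
  ultimately show ?thesis unfolding cs.normalizes_def using mult_adj[OF d] adj_mult[OF d] by blast
qed

section \<open>Contents and integrality of the parameter\<close>

definition ct :: "'v \<Rightarrow> int" where "ct \<alpha> = Gcd {ent (E \<alpha> 1) i j | i j. True}"

lemma finite_entries: "finite {ent (A :: ('a, 'n) sqm) i j | i j. True}"
proof -
  have "{ent A i j | i j. True} = (\<lambda>(i, j). ent A i j) ` UNIV" by auto
  then show ?thesis by simp
qed

lemma ct_pos: assumes "\<alpha> \<in> \<Phi>" shows "ct \<alpha> > 0"
proof -
  obtain i j where ij: "ent (E \<alpha> 1) i j \<noteq> 0" using E_nonzero[OF assms] unfolding sqm_eq_iff by auto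
  have "ct \<alpha> \<noteq> 0" unfolding ct_def Gcd_0_iff using ij by blast
  moreover have "ct \<alpha> \<ge> 0" unfolding ct_def by simp
  ultimately show ?thesis by simp
qed

lemma ct_in_ideal:
  assumes "\<And>i j. ent (E \<alpha> 1) i j \<in> I" "0 \<in> I" "\<And>a b. a \<in> I \<Longrightarrow> b \<in> I \<Longrightarrow> a + b \<in> I" "\<And>a m. a \<in> I \<Longrightarrow> m * a \<in> I"
  shows "ct \<alpha> \<in> I"
  unfolding ct_def by (rule ideal_Gcd) (use assms finite_entries in auto)

text \<open>The entries of the bracket are sums of products of entries and so divisible by the
  product of the two contents. The integers m for which that product divides c m form an ideal; it
  contains the entries of the third matrix and therefore their gcd.\<close>

lemma content_function_ct:
  "chevalley_system.content_function (smq :: 'k::field_char_0 \<Rightarrow> ('k, 'n) sqm \<Rightarrow> _) \<Phi> XF ct"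
  unfolding cs.content_function_def
proof (intro conjI ballI allI impI)
  fix \<alpha> \<beta> c assume a: "\<alpha> \<in> \<Phi>" and b: "\<beta> \<in> \<Phi>" and ab: "\<alpha> + \<beta> \<in> \<Phi>"
    and eq: "lie (XF \<alpha>) (XF \<beta>) = smq (of_int c) (XF (\<alpha> + \<beta>) :: ('k, 'n) sqm)"
  have "lie (E \<alpha> 1) (E \<beta> 1) = smq c (E (\<alpha> + \<beta>) 1)"
    using eq unfolding XF_def iota_smq[symmetric] iota_mult[symmetric] iota_diff[symmetric] iota_eq_iff .
  then have c: "c * ent (E (\<alpha> + \<beta>) 1) i j = ent (lie (E \<alpha> 1) (E \<beta> 1)) i j" for i j by simp
  have d: "ct \<gamma> dvd ent (E \<gamma> 1) i j" for \<gamma> i j unfolding ct_def by (rule Gcd_dvd) blast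
  have "ct \<alpha> * ct \<beta> dvd ent (lie (E \<alpha> 1) (E \<beta> 1)) i j" for i j
    unfolding ent_diff ent_mult
  proof (intro dvd_diff dvd_sum)
    fix k
    show "ct \<alpha> * ct \<beta> dvd ent (E \<alpha> 1) i k * ent (E \<beta> 1) k j" by (rule mult_dvd_mono[OF d d])
    have "ct \<beta> * ct \<alpha> dvd ent (E \<beta> 1) i k * ent (E \<alpha> 1) k j" by (rule mult_dvd_mono[OF d d])
    then show "ct \<alpha> * ct \<beta> dvd ent (E \<beta> 1) i k * ent (E \<alpha> 1) k j" by (simp add: mult.commute)
  qed
  then have "ct \<alpha> * ct \<beta> dvd c * ent (E (\<alpha> + \<beta>) 1) i j" for i j unfolding c .
  then have "ct (\<alpha> + \<beta>) \<in> {m. ct \<alpha> * ct \<beta> dvd c * m}"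
    by (intro ct_in_ideal) (auto simp: distrib_left mult.left_commute[of c])
  then show "ct \<alpha> * ct \<beta> dvd c * ct (\<alpha> + \<beta>)" by simp
qed (rule ct_pos)

text \<open>The integers m with t m in R form an ideal. It contains all entries, hence by Bezout
  their gcd 1.\<close>

lemma in_subring_of_content_1:
  assumes R: "subring R" and ct: "ct \<alpha> = 1" and t: "\<And>i j. t * of_int (ent (E \<alpha> 1) i j) \<in> R"
  shows "t \<in> R"
proof -
  have "ct \<alpha> \<in> {m. t * of_int m \<in> R}"
  proof (rule ct_in_ideal)
    fix a m assume "a \<in> {m. t * of_int m \<in> R}"
    then have "of_int m * (t * of_int a) \<in> R" using subring_closed(4,7)[OF R] by simp
    then show "m * a \<in> {m. t * of_int m \<in> R}" by (simp add: mult.left_commute)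
  qed (use t subring_closed(2,3)[OF R] in \<open>auto simp: distrib_left\<close>)
  then show ?thesis using ct by simp
qed

definition Dom :: "'v \<Rightarrow> 'k::field_char_0 set \<Rightarrow> ('k, 'n) sqm set" where
  "Dom \<alpha> R = {A \<in> GR R. \<forall>\<gamma>\<in>\<Phi>. \<gamma> \<bullet> \<alpha> \<ge> 0 \<longrightarrow> A * xg \<gamma> 1 = xg \<gamma> 1 * A}"

lemma xg_1: "\<alpha> \<in> \<Phi> \<Longrightarrow> xg \<alpha> 1 = sq.nexp (XF \<alpha> :: ('k::field_char_0, 'n) sqm)"
  using nexp_XF[of \<alpha> "1 :: 'k"] by simp

lemma xg_in_Dom:
  assumes R: "subring R" and t: "t \<in> R" and a: "long \<Phi> \<alpha>"
  shows "xg \<alpha> t \<in> Dom \<alpha> (R :: 'k::field_char_0 set)"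
proof -
  note aR = long_root[OF rs a]
  have "xg \<alpha> t * xg \<gamma> 1 = (xg \<gamma> 1 * xg \<alpha> t :: ('k, 'n) sqm)" if g: "\<gamma> \<in> \<Phi>" "\<gamma> \<bullet> \<alpha> \<ge> 0" for \<gamma>
  proof -
    have "lie (XF \<alpha>) (XF \<gamma>) = (0 :: ('k, 'n) sqm)"
      using cs.lie_X_eq_0[OF aR g(1)] long_inner_nonneg_add[OF rs a g] by blast
    then have c: "XF \<gamma> * XF \<alpha> = (XF \<alpha> * XF \<gamma> :: ('k, 'n) sqm)" by simp
    have "xg \<alpha> t * XF \<gamma> = XF \<gamma> * (xg \<alpha> t :: ('k, 'n) sqm)"
      unfolding nexp_XF[OF aR, symmetric] by (rule sq.commute_nexp[symmetric]) (simp add: c)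
    then show ?thesis unfolding xg_1[OF g(1)] by (rule sq.commute_nexp)
  qed
  then show ?thesis unfolding Dom_def using xg_in_GR[OF R t aR] by blast
qed

text \<open>The parameter t is first found in the field. In the action of A on
  \<open>XF \<epsilon>\<close> the central factor disappears, and what is added is t c times the
  integral matrix of \<alpha> + \<epsilon>, where c = 1 or c = -1. Its entries lie in R because
  those of A and its adjugate do, and the matrix has content 1.\<close>

theorem Dom_structure:
  fixes A :: "('k::field_char_0, 'n) sqm"
  assumes R: "subring R" and a: "long \<Phi> \<alpha>"
    and ex: "\<exists>\<epsilon>\<in>\<Phi>. cartan_integer \<epsilon> \<alpha> = -1 \<and> ct (\<alpha> + \<epsilon>) = 1" and A: "A \<in> Dom \<alpha> R"
  obtains t z where "t \<in> R" "A = xg \<alpha> t * z" "cs.centralizes z"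
proof -
  note aR = long_root[OF rs a]
  obtain \<epsilon> where e: "\<epsilon> \<in> \<Phi>" "cartan_integer \<epsilon> \<alpha> = -1" "ct (\<alpha> + \<epsilon>) = 1" using ex by blast
  note f = cartan_integer_neg_one[OF rs aR e(1,2)]
  have AG: "A \<in> GR R" using A unfolding Dom_def by blast
  have comm: "A * XF \<gamma> = XF \<gamma> * A" if "\<gamma> \<in> \<Phi>" "\<gamma> \<bullet> \<alpha> \<ge> 0" for \<gamma>
  proof (rule sq.commute_of_commute_nexp[OF cs.nilp_X[OF that(1)]])
    have "A * xg \<gamma> 1 = xg \<gamma> 1 * A" using A that unfolding Dom_def by blast
    then show "A * sq.nexp (XF \<gamma>) = sq.nexp (XF \<gamma>) * A" unfolding xg_1[OF that(1)] .
  qed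
  obtain t z z' where A': "A = sq.nexp (smq t (XF \<alpha>)) * z" and zz: "z * z' = 1" "z' * z = 1"
    and z: "\<And>\<beta>. \<beta> \<in> \<Phi> \<Longrightarrow> z * XF \<beta> = XF \<beta> * z"
    using cs.long_root_element[OF a _ GR_normalizes[OF AG aR] comm] e by metis
  have Axg: "A = xg \<alpha> t * z" using A' unfolding nexp_XF[OF aR] .
  have d: "det (mx A) = 1" and AR: "\<And>i j. ent A i j \<in> R" using AG unfolding GR_def by auto
  have "A * (z' * xg \<alpha> (- t)) = xg \<alpha> t * (z * z') * xg \<alpha> (- t)" unfolding Axg by (simp add: mult.assoc)
  then have "A * (z' * xg \<alpha> (- t)) = 1" unfolding zz using xg_inverse[OF aR, of t] by simp
  then have adjA: "adj A = z' * xg \<alpha> (- t)" using adj_mult[OF d] cs.inverse_unique by blast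
  obtain c where c: "c * c = 1" "lie (XF \<alpha>) (XF \<epsilon>) = smq c (XF (\<alpha> + \<epsilon>) :: ('k, 'n) sqm)"
    using cs.lie_long[OF a e(1,2)] by metis
  have "A * XF \<epsilon> * adj A = xg \<alpha> t * (z * XF \<epsilon>) * z' * xg \<alpha> (- t)" unfolding adjA by (simp add: Axg mult.assoc)
  also have "\<dots> = xg \<alpha> t * XF \<epsilon> * (z * z') * xg \<alpha> (- t)" unfolding z[OF e(1)] by (simp add: mult.assoc)
  also have "\<dots> = xg \<alpha> t * XF \<epsilon> * xg \<alpha> (- t)" unfolding zz by simp
  also have "\<dots> = sq.nexp (smq t (XF \<alpha>)) * XF \<epsilon> * sq.nexp (- smq t (XF \<alpha>))"
    using nexp_XF[OF aR, of t] nexp_XF[OF aR, of "- t"] by simp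
  also have "\<dots> = XF \<epsilon> + smq (t * c) (XF (\<alpha> + \<epsilon>))"
  proof -
    have l1: "lie (smq t (XF \<alpha>)) (XF \<epsilon>) = smq (t * c) (XF (\<alpha> + \<epsilon>) :: ('k, 'n) sqm)"
      by (simp only: sq.lie_sm_left c(2) sq.sm_sm)
    have "(\<alpha> + \<epsilon>) \<bullet> \<alpha> \<ge> 0" unfolding inner_add_left using f(2) inner_ge_zero[of \<alpha>] by linarith
    then have "lie (XF \<alpha>) (XF (\<alpha> + \<epsilon>)) = (0 :: ('k, 'n) sqm)"
      using cs.lie_X_eq_0[OF aR f(1)] long_inner_nonneg_add[OF rs a f(1)] by blast
    then have l2: "lie (smq t (XF \<alpha>)) (smq (t * c) (XF (\<alpha> + \<epsilon>))) = (0 :: ('k, 'n) sqm)"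
      by (simp only: cs.lie_sm_sm) simp
    show ?thesis
      using sq.nexp_conj_of_lie3_eq_0[OF cs.nilp_sm_X[OF aR, of t], of "XF \<epsilon>"] unfolding l1 l2 by simp
  qed
  finally have eq: "A * XF \<epsilon> * adj A = XF \<epsilon> + smq (t * c) (XF (\<alpha> + \<epsilon>))" .
  have XR: "ent (XF \<beta> :: ('k, 'n) sqm) i j \<in> R" for \<beta> i j
    unfolding XF_def using subring_closed(7)[OF R] by simp
  have "ent (A * XF \<epsilon> * adj A) i j \<in> R" for i j
    by (intro ent_mult_in[OF R] ent_adj_in[OF R] AR XR)
  then have "ent (A * XF \<epsilon> * adj A) i j - ent (XF \<epsilon>) i j \<in> R" for i j
    by (intro subring_closed(6)[OF R] XR)
  then have "t * c * of_int (ent (E (\<alpha> + \<epsilon>) 1) i j) \<in> R" for i j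
    unfolding eq by (simp add: XF_def)
  then have tc: "t * c \<in> R" by (rule in_subring_of_content_1[OF R e(3)])
  have "c = 1 \<or> c = -1" using c(1) by (simp add: square_eq_1_iff)
  then have "t \<in> R" using tc subring_closed(5)[OF R, of "t * c"] by auto
  then show ?thesis using that[OF _ Axg] z unfolding cs.centralizes_def by blast
qed

text \<open>The action on \<open>XF (- \<alpha>)\<close> adds u times the coroot and a multiple of
  \<open>XF \<alpha>\<close>; the bracket with \<open>XF \<alpha>\<close> isolates u.\<close>

lemma xg_inj:
  assumes a: "\<alpha> \<in> \<Phi>" and eq: "xg \<alpha> s = (xg \<alpha> t :: ('k::field_char_0, 'n) sqm)"
  shows "s = t"
proof -
  have c: "xg \<alpha> u * XF (- \<alpha>) * xg \<alpha> (- u) = XF (- \<alpha>) + smq u (cs.H \<alpha>) - smq (u * u) (XF \<alpha>)" for u :: 'k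
  proof -
    have l1: "lie (smq u (XF \<alpha>)) (XF (- \<alpha>)) = smq u (cs.H \<alpha>)"
      unfolding cs.H_def by (simp only: sq.lie_sm_left)
    have l2: "lie (smq u (XF \<alpha>)) (smq u (cs.H \<alpha>)) = smq (- 2 * (u * u)) (XF \<alpha>)"
      unfolding cs.lie_sm_sm cs.lie_X_H[OF a a] cs.ev_self[OF a] sq.sm_sm by (simp add: mult.commute)
    have l3: "lie (smq u (XF \<alpha>)) (smq (- 2 * (u * u)) (XF \<alpha>)) = 0"
      unfolding cs.lie_sm_sm by simp
    have "sq.nexp (smq u (XF \<alpha>)) * XF (- \<alpha>) * sq.nexp (- smq u (XF \<alpha>)) =
        XF (- \<alpha>) + smq u (cs.H \<alpha>) + smq (1 / 2) (smq (- 2 * (u * u)) (XF \<alpha>))"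
      using sq.nexp_conj_of_lie3_eq_0[OF cs.nilp_sm_X[OF a, of u], of "XF (- \<alpha>)"] l3 unfolding l1 l2 by blast
    then show ?thesis using nexp_XF[OF a, of u] nexp_XF[OF a, of "- u"] by simp
  qed
  have inv: "xg \<alpha> (- s) * xg \<alpha> s = 1" "xg \<alpha> s * xg \<alpha> (- s) = 1" "xg \<alpha> t * xg \<alpha> (- t) = 1"
    using xg_inverse[OF a, of s] xg_inverse[OF a, of "- s"] xg_inverse[OF a, of t] by auto
  then have "xg \<alpha> (- s) = xg \<alpha> (- t)" using cs.inverse_unique[of "xg \<alpha> t" "xg \<alpha> (- t)" "xg \<alpha> (- s)"] eq by simp
  then have "XF (- \<alpha>) + smq s (cs.H \<alpha>) - smq (s * s) (XF \<alpha>) = XF (- \<alpha>) + smq t (cs.H \<alpha>) - smq (t * t) (XF \<alpha>)"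
    using c[of s] c[of t] eq by simp
  then have d: "smq (s - t) (cs.H \<alpha>) = smq (s * s - t * t) (XF \<alpha>)"
    by (simp add: sq.sm_diff_left algebra_simps)
  then have "smq (s - t) (lie (XF \<alpha>) (cs.H \<alpha>)) = smq (s * s - t * t) (lie (XF \<alpha>) (XF \<alpha>))"
    using sq.lie_sm_right by metis
  then have "smq ((s - t) * - 2) (XF \<alpha>) = 0"
    unfolding cs.lie_X_H[OF a a] cs.ev_self[OF a] sq.sm_sm by simp
  then show ?thesis using cs.X_nonzero[OF a, where 'k = 'k] by (simp del: sq.sm_minus_left)
qed

end

section \<open>Interpreting the ring in the group\<close>

context integral_chevalley_system
begin

definition Gs :: "'k::field_char_0 set \<Rightarrow> ('k^'n^'n) struct" where
  "Gs R = matrix_group_struct (mx ` GR R)"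

definition tmul :: "trm \<Rightarrow> trm \<Rightarrow> trm" where "tmul s t = App 0 [s, t]"
definition tinv :: "trm \<Rightarrow> trm" where "tinv t = App 1 [t]"
definition tone :: trm where "tone = App 2 []"
definition tcom :: "trm \<Rightarrow> trm \<Rightarrow> trm" where "tcom s t = tmul (tmul (tmul s t) (tinv s)) (tinv t)"

definition tcon :: "(nat \<Rightarrow> 'k^'n^'n) \<Rightarrow> ('k, 'n) sqm \<Rightarrow> trm" where
  "tcon \<nu> A = Const (SOME c. \<nu> c = mx A)"

text \<open>Values of group terms are computed in the ring of matrices. There an inverse is an
  adjugate when the determinant is 1, which explains the determinant conditions below.\<close>

definition tev :: "'k::field_char_0 set \<Rightarrow> (nat \<Rightarrow> 'k^'n^'n) \<Rightarrow> (nat \<Rightarrow> 'k^'n^'n) \<Rightarrow> trm \<Rightarrow> ('k, 'n) sqm" where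
  "tev R \<nu> \<rho> t = Mx (eval_trm (Gs R) \<nu> \<rho> t)"

lemma wf_group_terms:
  "wf_trm (Gs R) (tmul s t) \<longleftrightarrow> wf_trm (Gs R) s \<and> wf_trm (Gs R) t"
  "wf_trm (Gs R) (tinv s) \<longleftrightarrow> wf_trm (Gs R) s" "wf_trm (Gs R) tone"
  "wf_trm (Gs R) (tcom s t) \<longleftrightarrow> wf_trm (Gs R) s \<and> wf_trm (Gs R) t"
  "wf_trm (Gs R) (tcon \<nu> A)"
  by (auto simp: Gs_def matrix_group_struct_def tmul_def tinv_def tone_def tcom_def tcon_def)

lemma tev_group_terms:
  "tev R \<nu> \<rho> (tmul s t) = tev R \<nu> \<rho> s * tev R \<nu> \<rho> t"
  "tev R \<nu> \<rho> tone = 1"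
  "tev R \<nu> \<rho> (Var i) = Mx (\<rho> i)"
  by (simp_all add: tev_def tmul_def tone_def Gs_def matrix_group_struct_def times_sqm_def one_sqm_def)

lemma tev_tinv: "det (mx (tev R \<nu> \<rho> s)) = 1 \<Longrightarrow> tev R \<nu> \<rho> (tinv s) = adj (tev R \<nu> \<rho> s)"
  using matrix_inv_adj[of "tev R \<nu> \<rho> s"]
  by (simp add: tev_def tinv_def Gs_def matrix_group_struct_def mx_inverse)

lemma det_adj: "det (mx A) = 1 \<Longrightarrow> det (mx (adj A)) = (1 :: 'k::field_char_0)"
proof -
  assume d: "det (mx A) = 1"
  have "det (mx A) * det (mx (adj A)) = det (mx (A * adj A))" by (simp add: mx_mult det_mul)
  then show ?thesis using mult_adj[OF d] d by (simp add: mx_1 det_I)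
qed

definition cm :: "('k::field_char_0, 'n) sqm \<Rightarrow> ('k, 'n) sqm \<Rightarrow> ('k, 'n) sqm" where
  "cm A B = A * B * adj A * adj B"

lemma det_cm: "det (mx A) = 1 \<Longrightarrow> det (mx B) = 1 \<Longrightarrow> det (mx (cm A B)) = (1 :: 'k::field_char_0)"
  by (simp add: cm_def mx_mult det_mul det_adj)

lemma tev_tcom:
  assumes "det (mx (tev R \<nu> \<rho> s)) = 1" "det (mx (tev R \<nu> \<rho> t)) = 1"
  shows "tev R \<nu> \<rho> (tcom s t) = cm (tev R \<nu> \<rho> s) (tev R \<nu> \<rho> t)"
  unfolding tcom_def cm_def tev_group_terms tev_tinv[OF assms(1)] tev_tinv[OF assms(2)] ..

lemma holds_tev: "holds (Gs R) \<nu> \<rho> S \<longleftrightarrow> (\<forall>(s, t)\<in>set S. tev R \<nu> \<rho> s = tev R \<nu> \<rho> t)"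
  unfolding holds_def tev_def by (simp add: Mx_inject)

lemma tev_tcon:
  assumes "range \<nu> = dom (Gs R)" "A \<in> GR R" shows "tev R \<nu> \<rho> (tcon \<nu> A) = A"
proof -
  have "mx A \<in> range \<nu>" using assms by (simp add: Gs_def matrix_group_struct_def)
  then have "\<nu> (SOME c. \<nu> c = mx A) = mx A" by (metis (mono_tags) imageE someI_ex)
  then show ?thesis unfolding tev_def tcon_def by (simp add: mx_inverse)
qed

lemma det_GR: "A \<in> GR R \<Longrightarrow> det (mx A) = 1" unfolding GR_def by blast

lemma xg_add:
  "\<alpha> \<in> \<Phi> \<Longrightarrow> xg \<alpha> (s + t) = (xg \<alpha> s * xg \<alpha> t :: ('k::field_char_0, 'n) sqm)"
proof -
  assume a: "\<alpha> \<in> \<Phi>"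
  have "sq.nexp (smq s (XF \<alpha>) + smq t (XF \<alpha>)) = (sq.nexp (smq s (XF \<alpha>)) * sq.nexp (smq t (XF \<alpha>)) :: ('k, 'n) sqm)"
    by (rule sq.nexp_add[OF _ cs.nilp_sm_X[OF a] cs.nilp_sm_X[OF a]]) (simp add: mult.commute)
  then show ?thesis unfolding sq.sm_add_left[symmetric] nexp_XF[OF a] .
qed

lemma xg_0: "\<alpha> \<in> \<Phi> \<Longrightarrow> xg \<alpha> 0 = (1 :: ('k::field_char_0, 'n) sqm)"
  using nexp_XF[of \<alpha> "0 :: 'k"] by (simp add: sq.nexp_0)

definition word :: "('k::field_char_0, 'n) sqm \<Rightarrow> ('k, 'n) sqm \<Rightarrow> ('k, 'n) sqm \<Rightarrow> ('k, 'n) sqm \<Rightarrow> ('k, 'n) sqm" where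
  "word c1 c2 A B = cm (cm (cm A c1) B) c2"

text \<open>\<open>P r\<close> represents the ring element \<open>r\<close>; \<open>par1\<close> and \<open>par2\<close> relate the elements of two definable
  sets to their parameters.\<close>

definition coordinates where
  "coordinates (R :: 'k::field_char_0 set) \<alpha>1 \<alpha>2 c1 c2 e1 e2 P par1 par2 \<longleftrightarrow>
     c1 \<in> GR R \<and> c2 \<in> GR R \<and> e1 \<in> GR R \<and> e2 \<in> GR R \<and>
     (\<forall>r\<in>R. P r \<in> GR R) \<and> inj_on P R \<and> P 0 = 1 \<and> (\<forall>r s. P (r + s) = P r * P s) \<and>
     (\<forall>A\<in>Dom \<alpha>1 R. \<exists>t\<in>R. par1 A t) \<and> (\<forall>t\<in>R. \<exists>A\<in>Dom \<alpha>1 R. par1 A t) \<and>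
     (\<forall>A\<in>Dom \<alpha>2 R. \<exists>t\<in>R. par2 A t) \<and> (\<forall>t\<in>R. \<exists>A\<in>Dom \<alpha>2 R. par2 A t) \<and>
     par1 e1 1 \<and> par2 e2 1 \<and>
     (\<forall>A B t s. par1 A t \<longrightarrow> par2 B s \<longrightarrow> word c1 c2 A B = P (t * s :: 'k))"

lemma ex_coordinates:
  fixes R :: "'k::field_char_0 set"
  assumes R: "subring R" and ind: "indecomposable \<Phi>" and dim: "dim \<Phi> > 1"
  shows "\<exists>\<alpha>1 \<alpha>2 c1 c2 e1 e2 P par1 par2. coordinates R \<alpha>1 \<alpha>2 c1 c2 e1 e2 P par1 par2"
proof -
  obtain \<alpha>1 \<alpha>2 \<delta>1 \<delta>2 \<gamma> and k :: 'k where l1: "long \<Phi> \<alpha>1" and l2: "long \<Phi> \<alpha>2" and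
    d1: "\<delta>1 \<in> \<Phi>" and d2: "\<delta>2 \<in> \<Phi>" and g: "\<gamma> \<in> \<Phi>" and k0: "k \<noteq> 0" and kZ: "k \<in> \<int>" and
    ex1: "\<exists>\<epsilon>\<in>\<Phi>. cartan_integer \<epsilon> \<alpha>1 = -1 \<and> ct (\<alpha>1 + \<epsilon>) = 1" and
    ex2: "\<exists>\<epsilon>\<in>\<Phi>. cartan_integer \<epsilon> \<alpha>2 = -1 \<and> ct (\<alpha>2 + \<epsilon>) = 1" and
    wordk: "\<And>t s z1 z2 w. cs.centralizes z1 \<Longrightarrow> cs.centralizes z2 \<Longrightarrow>
      cs.nested_commutator (sq.nexp (XF \<delta>1)) (sq.nexp (XF \<delta>2))
        (sq.nexp (smq t (XF \<alpha>1)) * z1) (sq.nexp (smq s (XF \<alpha>2)) * z2) w \<Longrightarrow>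
      w = sq.nexp (smq (k * (t * s)) (XF \<gamma>) :: ('k, 'n) sqm)"
  proof (rule cs.bilinear_word[OF ind dim content_function_ct])
    fix \<alpha>1 \<alpha>2 \<delta>1 \<delta>2 \<gamma> and k :: 'k
    assume "long \<Phi> \<alpha>1" "long \<Phi> \<alpha>2" "\<delta>1 \<in> \<Phi>" "\<delta>2 \<in> \<Phi>" "\<gamma> \<in> \<Phi>" "k \<noteq> 0" "k \<in> \<int>"
      "\<exists>\<epsilon>\<in>\<Phi>. cartan_integer \<epsilon> \<alpha>1 = -1 \<and> ct (\<alpha>1 + \<epsilon>) = 1"
      "\<exists>\<epsilon>\<in>\<Phi>. cartan_integer \<epsilon> \<alpha>2 = -1 \<and> ct (\<alpha>2 + \<epsilon>) = 1"
      "\<And>t s z1 z2 w. cs.centralizes z1 \<Longrightarrow> cs.centralizes z2 \<Longrightarrow>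
        cs.nested_commutator (sq.nexp (XF \<delta>1)) (sq.nexp (XF \<delta>2))
          (sq.nexp (smq t (XF \<alpha>1)) * z1) (sq.nexp (smq s (XF \<alpha>2)) * z2) w \<Longrightarrow>
        w = sq.nexp (smq (k * (t * s)) (XF \<gamma>) :: ('k, 'n) sqm)"
    then show thesis by (rule that)
  qed
  note a1 = long_root[OF rs l1] and a2 = long_root[OF rs l2]
  define c1 where "c1 = (xg \<delta>1 1 :: ('k, 'n) sqm)"
  define c2 where "c2 = (xg \<delta>2 1 :: ('k, 'n) sqm)"
  define e1 where "e1 = (xg \<alpha>1 1 :: ('k, 'n) sqm)"
  define e2 where "e2 = (xg \<alpha>2 1 :: ('k, 'n) sqm)"
  have R1: "1 \<in> R" and R0: "0 \<in> R" using subring_closed[OF R] by auto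
  have kR: "k * r \<in> R" if "r \<in> R" for r using kZ that subring_closed(4,7)[OF R] by (auto elim: Ints_cases)
  have cG: "c1 \<in> GR R" "c2 \<in> GR R" "e1 \<in> GR R" "e2 \<in> GR R"
    unfolding c1_def c2_def e1_def e2_def using xg_in_GR[OF R R1] d1 d2 a1 a2 by auto
  \<comment> \<open>The factor z absorbs the centre. Membership in the group is included because the
    word is computed with adjugates, which are inverses for determinant 1.\<close>
  define par where "par \<alpha> A t \<longleftrightarrow> A \<in> GR R \<and> (\<exists>z. cs.centralizes z \<and> A = xg \<alpha> t * z)" for \<alpha> and A :: "('k, 'n) sqm" and t
  have F: "word c1 c2 A B = xg \<gamma> (k * (t * s))" if A: "par \<alpha>1 A t" and B: "par \<alpha>2 B s" for A B t s
  proof -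
    obtain z1 z2 where z1: "cs.centralizes z1" "A = xg \<alpha>1 t * z1" and z2: "cs.centralizes z2" "B = xg \<alpha>2 s * z2"
      using A B unfolding par_def by blast
    have dA: "det (mx A) = 1" and dB: "det (mx B) = 1" using A B det_GR unfolding par_def by auto
    note dc = det_GR[OF cG(1)] det_GR[OF cG(2)]
    note d = dA dB dc det_cm[OF dA dc(1)] det_cm[OF det_cm[OF dA dc(1)] dB]
    have "cs.nested_commutator c1 c2 A B (word c1 c2 A B)"
      unfolding cs.nested_commutator_def word_def
      by (rule exI[of _ "adj A"], rule exI[of _ "adj B"], rule exI[of _ "adj c1"], rule exI[of _ "adj c2"],
          rule exI[of _ "cm A c1"], rule exI[of _ "adj (cm A c1)"], rule exI[of _ "cm (cm A c1) B"],
          rule exI[of _ "adj (cm (cm A c1) B)"]) (intro conjI; ((rule mult_adj adj_mult, rule d) | (rule cm_def)))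
    then have "cs.nested_commutator (sq.nexp (XF \<delta>1)) (sq.nexp (XF \<delta>2))
        (sq.nexp (smq t (XF \<alpha>1)) * z1) (sq.nexp (smq s (XF \<alpha>2)) * z2) (word c1 c2 A B)"
      unfolding c1_def c2_def xg_1[OF d1] xg_1[OF d2] nexp_XF[OF a1] nexp_XF[OF a2] z1(2)[symmetric] z2(2)[symmetric] .
    from wordk[OF z1(1) z2(1) this] show ?thesis unfolding nexp_XF[OF g] .
  qed
  have cone: "cs.centralizes (1 :: ('k, 'n) sqm)" unfolding cs.centralizes_def by simp
  have par_xg: "par \<alpha> (xg \<alpha> t) t" if "\<alpha> \<in> \<Phi>" "t \<in> R" for \<alpha> t
    unfolding par_def using xg_in_GR[OF R that(2,1)] cone by (intro conjI exI[of _ 1]) auto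
  have Dom1: "\<exists>t\<in>R. par \<alpha>1 A t" if "A \<in> Dom \<alpha>1 R" for A
  proof (rule Dom_structure[OF R l1 ex1 that])
    fix t z assume "t \<in> R" "A = xg \<alpha>1 t * z" "cs.centralizes z"
    moreover have "A \<in> GR R" using that unfolding Dom_def by simp
    ultimately show "\<exists>t\<in>R. par \<alpha>1 A t" unfolding par_def by blast
  qed
  have Dom2: "\<exists>t\<in>R. par \<alpha>2 A t" if "A \<in> Dom \<alpha>2 R" for A
  proof (rule Dom_structure[OF R l2 ex2 that])
    fix t z assume "t \<in> R" "A = xg \<alpha>2 t * z" "cs.centralizes z"
    moreover have "A \<in> GR R" using that unfolding Dom_def by simp
    ultimately show "\<exists>t\<in>R. par \<alpha>2 A t" unfolding par_def by blast
  qed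
  note pe1 = par_xg[OF a1 R1, folded e1_def] and pe2 = par_xg[OF a2 R1, folded e2_def]
  \<comment> \<open>The ring element r is placed at k r, so that the value of the word at parameters
    t and s represents the product t s itself.\<close>
  have "coordinates R \<alpha>1 \<alpha>2 c1 c2 e1 e2 (\<lambda>r. xg \<gamma> (k * r)) (par \<alpha>1) (par \<alpha>2)"
    unfolding coordinates_def
  proof (intro conjI ballI allI impI)
    show "xg \<gamma> (k * r) \<in> GR R" if "r \<in> R" for r by (rule xg_in_GR[OF R kR[OF that] g])
    show "inj_on (\<lambda>r. xg \<gamma> (k * r) :: ('k, 'n) sqm) R"
    proof (rule inj_onI)
      fix x y assume "xg \<gamma> (k * x) = (xg \<gamma> (k * y) :: ('k, 'n) sqm)"
      from xg_inj[OF g this] show "x = y" using k0 by simp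
    qed
    show "xg \<gamma> (k * 0) = 1" using xg_0[OF g] by simp
    show "xg \<gamma> (k * (r + s)) = (xg \<gamma> (k * r) * xg \<gamma> (k * s) :: ('k, 'n) sqm)" for r s
      using xg_add[OF g] by (simp add: distrib_left)
    show "\<exists>A\<in>Dom \<alpha>1 R. par \<alpha>1 A t" "\<exists>A\<in>Dom \<alpha>2 R. par \<alpha>2 A t" if "t \<in> R" for t
      using par_xg[OF a1 that] par_xg[OF a2 that] xg_in_Dom[OF R that l1] xg_in_Dom[OF R that l2] by blast+
  qed (use cG Dom1 Dom2 pe1 pe2 F in auto)
  then show ?thesis by blast
qed

lemma sat_iff:
  assumes "range \<nu> = dom (Gs R)"
  shows "sat (Gs R) \<nu> S (map mx As) \<longleftrightarrow> (\<exists>\<rho>. (\<forall>i. \<rho> i \<in> GR R) \<and> (\<forall>i<length As. \<rho> i = As ! i) \<and>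
      (\<forall>(s, t)\<in>set S. tev R \<nu> (\<lambda>i. mx (\<rho> i)) s = tev R \<nu> (\<lambda>i. mx (\<rho> i)) t))"
proof
  assume "sat (Gs R) \<nu> S (map mx As)"
  then obtain \<rho> where \<rho>: "range \<rho> \<subseteq> mx ` GR R" "\<forall>i<length As. \<rho> i = mx (As ! i)" "holds (Gs R) \<nu> \<rho> S"
    unfolding sat_def by (auto simp: Gs_def matrix_group_struct_def)
  have "(\<lambda>i. mx (Mx (\<rho> i))) = \<rho>" by simp
  moreover have "Mx (\<rho> i) \<in> GR R" for i using \<rho>(1) by (metis (no_types) imageE mx_inverse rangeI subsetD)
  ultimately show "\<exists>\<rho>. (\<forall>i. \<rho> i \<in> GR R) \<and> (\<forall>i<length As. \<rho> i = As ! i) \<and>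
      (\<forall>(s, t)\<in>set S. tev R \<nu> (\<lambda>i. mx (\<rho> i)) s = tev R \<nu> (\<lambda>i. mx (\<rho> i)) t)"
    using \<rho>(2,3) unfolding holds_tev by (intro exI[of _ "\<lambda>i. Mx (\<rho> i)"]) (simp add: mx_inverse)
next
  assume "\<exists>\<rho>. (\<forall>i. \<rho> i \<in> GR R) \<and> (\<forall>i<length As. \<rho> i = As ! i) \<and>
      (\<forall>(s, t)\<in>set S. tev R \<nu> (\<lambda>i. mx (\<rho> i)) s = tev R \<nu> (\<lambda>i. mx (\<rho> i)) t)"
  then obtain \<rho> where \<rho>: "\<And>i. \<rho> i \<in> GR R" "\<forall>i<length As. \<rho> i = As ! i"
      "\<forall>(s, t)\<in>set S. tev R \<nu> (\<lambda>i. mx (\<rho> i)) s = tev R \<nu> (\<lambda>i. mx (\<rho> i)) t" by blast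
  then show "sat (Gs R) \<nu> S (map mx As)"
    unfolding sat_def holds_tev
    by (intro exI[of _ "\<lambda>i. mx (\<rho> i)"]) (auto simp: Gs_def matrix_group_struct_def)
qed

definition sol :: "'k::field_char_0 set \<Rightarrow> (nat \<Rightarrow> 'k^'n^'n) \<Rightarrow> (nat \<Rightarrow> ('k, 'n) sqm) \<Rightarrow> system \<Rightarrow> bool" where
  "sol R \<nu> \<rho> S \<longleftrightarrow> (\<forall>(s, t)\<in>set S. tev R \<nu> (\<lambda>i. mx (\<rho> i)) s = tev R \<nu> (\<lambda>i. mx (\<rho> i)) t)"

lemma sol_append: "sol R \<nu> \<rho> (S @ S') \<longleftrightarrow> sol R \<nu> \<rho> S \<and> sol R \<nu> \<rho> S'"
  and sol_single: "sol R \<nu> \<rho> [(s, t)] \<longleftrightarrow> tev R \<nu> (\<lambda>i. mx (\<rho> i)) s = tev R \<nu> (\<lambda>i. mx (\<rho> i)) t"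
  and sol_Cons: "sol R \<nu> \<rho> ((s, t) # S) \<longleftrightarrow> tev R \<nu> (\<lambda>i. mx (\<rho> i)) s = tev R \<nu> (\<lambda>i. mx (\<rho> i)) t \<and> sol R \<nu> \<rho> S"
  and sol_Nil: "sol R \<nu> \<rho> []"
  unfolding sol_def by auto

definition tword :: "(nat \<Rightarrow> 'k^'n^'n) \<Rightarrow> ('k::field_char_0, 'n) sqm \<Rightarrow> ('k, 'n) sqm \<Rightarrow> trm \<Rightarrow> trm \<Rightarrow> trm" where
  "tword \<nu> c1 c2 s t = tcom (tcom (tcom s (tcon \<nu> c1)) t) (tcon \<nu> c2)"

lemma tev_tword:
  assumes \<nu>: "range \<nu> = dom (Gs R)" and s: "tev R \<nu> \<rho> s \<in> GR R" and t: "tev R \<nu> \<rho> t \<in> GR R"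
    and c1: "c1 \<in> GR R" and c2: "c2 \<in> GR R"
  shows "tev R \<nu> \<rho> (tword \<nu> c1 c2 s t) = word c1 c2 (tev R \<nu> \<rho> s) (tev R \<nu> \<rho> t)"
proof -
  note c = tev_tcon[OF \<nu> c1] tev_tcon[OF \<nu> c2] and s = det_GR[OF s] and t = det_GR[OF t]
  have dc: "det (mx (tev R \<nu> \<rho> (tcon \<nu> c1))) = 1" "det (mx (tev R \<nu> \<rho> (tcon \<nu> c2))) = 1"
    unfolding c using det_GR c1 c2 by auto
  have 1: "tev R \<nu> \<rho> (tcom s (tcon \<nu> c1)) = cm (tev R \<nu> \<rho> s) c1" unfolding tev_tcom[OF s dc(1)] c ..
  have d1: "det (mx (tev R \<nu> \<rho> (tcom s (tcon \<nu> c1)))) = 1" unfolding 1 by (rule det_cm[OF s det_GR[OF c1]])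
  have 2: "tev R \<nu> \<rho> (tcom (tcom s (tcon \<nu> c1)) t) = cm (cm (tev R \<nu> \<rho> s) c1) (tev R \<nu> \<rho> t)"
    unfolding tev_tcom[OF d1 t] 1 ..
  have d2: "det (mx (tev R \<nu> \<rho> (tcom (tcom s (tcon \<nu> c1)) t))) = 1"
    unfolding 2 by (rule det_cm[OF det_cm[OF s det_GR[OF c1]] t])
  show ?thesis unfolding tword_def word_def tev_tcom[OF d2 dc(2)] 2 c ..
qed

lemma ex_dom_system:
  fixes R :: "'k::field_char_0 set"
  assumes R: "subring R" and \<nu>: "range \<nu> = dom (Gs R)"
  obtains tD where "\<And>i. wf_system (Gs R) (tD i)"
    "\<And>i \<rho>. (\<forall>i. \<rho> i \<in> GR R) \<Longrightarrow> sol R \<nu> \<rho> (tD i) = (\<rho> i \<in> Dom \<alpha> R)"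
proof -
  obtain gs where gs: "set gs = {\<delta> \<in> \<Phi>. \<delta> \<bullet> \<alpha> \<ge> 0}"
    using finite_list[of "{\<delta> \<in> \<Phi>. \<delta> \<bullet> \<alpha> \<ge> 0}"] finite_roots[OF rs] by auto
  define tD where "tD i = map (\<lambda>\<delta>. (tmul (Var i) (tcon \<nu> (xg \<delta> (1::'k))), tmul (tcon \<nu> (xg \<delta> 1)) (Var i))) gs" for i
  have "sol R \<nu> \<rho> (tD i) = (\<rho> i \<in> Dom \<alpha> R)" if \<rho>: "\<forall>i. \<rho> i \<in> GR R" for \<rho> i
  proof -
    have "tev R \<nu> \<rho>' (tcon \<nu> (xg \<delta> 1)) = xg \<delta> 1" if "\<delta> \<in> \<Phi>" for \<delta> \<rho>'
      by (rule tev_tcon[OF \<nu> xg_in_GR[OF R subring_closed(1)[OF R] that]])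
    then show ?thesis using \<rho> unfolding sol_def tD_def Dom_def by (auto simp: gs tev_group_terms mx_inverse)
  qed
  moreover have "wf_system (Gs R) (tD i)" for i
    unfolding tD_def wf_system_def by (auto simp: wf_group_terms)
  ultimately show ?thesis using that by blast
qed

end

lemma list_all2_length_1: "list_all2 Q xss es \<Longrightarrow> length es = 1 \<Longrightarrow> \<exists>x e. xss = [x] \<and> es = [e] \<and> Q x e"
  by (cases es; cases xss) (auto simp: list_all2_Cons2)

lemma list_all2_length_2:
  "list_all2 Q xss es \<Longrightarrow> length es = 2 \<Longrightarrow> \<exists>x y e e'. xss = [x, y] \<and> es = [e, e'] \<and> Q x e \<and> Q y e'"
  by (cases es; cases "tl es"; cases "tl (tl es)") (auto simp: list_all2_Cons2)

lemma nth_agree: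
  "(\<forall>i<length [a]. \<rho> i = [a] ! i) \<longleftrightarrow> \<rho> 0 = a"
  "(\<forall>i<length [a, b]. \<rho> i = [a, b] ! i) \<longleftrightarrow> \<rho> 0 = a \<and> \<rho> 1 = b"
  "(\<forall>i<length [a, b, c]. \<rho> i = [a, b, c] ! i) \<longleftrightarrow> \<rho> 0 = a \<and> \<rho> 1 = b \<and> \<rho> 2 = c"
  by (auto simp: less_Suc_eq numeral_2_eq_2)

lemma ring_struct_closed:
  assumes R: "subring R" and f: "f < length (ops (ring_struct R))"
    and es: "length es = fst (ops (ring_struct R) ! f)" "set es \<subseteq> R"
  shows "snd (ops (ring_struct R) ! f) es \<in> R"
proof -
  have el: "es ! i \<in> R" if "i < length es" for i using es(2) nth_mem[OF that] by blast
  have "f < 5" using f by (simp add: ring_struct_def)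
  then consider "f = 0" | "f = 1" | "f = 2" | "f = 3" | "f = 4" by linarith
  then show ?thesis
  proof cases
    case 1
    then show ?thesis using es(1) el by (simp add: ring_struct_def subring_closed(3)[OF R])
  next
    case 2
    then show ?thesis using es(1) el by (simp add: ring_struct_def subring_closed(4)[OF R])
  next
    case 3
    then show ?thesis using es(1) el by (simp add: ring_struct_def subring_closed(5)[OF R])
  next
    case 4
    then show ?thesis by (simp add: ring_struct_def subring_closed(2)[OF R])
  next
    case 5
    then show ?thesis by (simp add: ring_struct_def subring_closed(1)[OF R])
  qed
qed

context integral_chevalley_system
begin

text \<open>A ring element r is represented by the single group element \<open>P r\<close>. Elements
  of the two definable sets carry parameters; the word with the other argument fixed at
  \<open>e1\<close> or \<open>e2\<close>, of parameter 1, copies the parameter into the representing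
  set.\<close>

theorem ring_decidable_if_group_decidable:
  fixes R :: "'k::field_char_0 set"
  assumes R: "subring R" and ind: "indecomposable \<Phi>" and dim: "dim \<Phi> > 1"
    and dec: "diophantine_decidable (Gs R)"
  shows "diophantine_decidable (ring_struct R)"
proof -
  obtain \<alpha>1 \<alpha>2 c1 c2 e1 e2 and P :: "'k \<Rightarrow> ('k, 'n) sqm" and par1 par2
    where co: "coordinates R \<alpha>1 \<alpha>2 c1 c2 e1 e2 P par1 par2"
    using ex_coordinates[OF R ind dim] by (elim exE)
  have cG: "c1 \<in> GR R" "c2 \<in> GR R" "e1 \<in> GR R" "e2 \<in> GR R"
    and PG: "\<And>r. r \<in> R \<Longrightarrow> P r \<in> GR R" and Pinj: "inj_on P R" and P0: "P 0 = 1"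
    and Padd: "\<And>r s. P (r + s) = P r * P s"
    and D1: "\<And>A. A \<in> Dom \<alpha>1 R \<Longrightarrow> \<exists>t\<in>R. par1 A t" and D1': "\<And>t. t \<in> R \<Longrightarrow> \<exists>A\<in>Dom \<alpha>1 R. par1 A t"
    and D2: "\<And>A. A \<in> Dom \<alpha>2 R \<Longrightarrow> \<exists>t\<in>R. par2 A t" and D2': "\<And>t. t \<in> R \<Longrightarrow> \<exists>A\<in>Dom \<alpha>2 R. par2 A t"
    and pe: "par1 e1 1" "par2 e2 1"
    and word: "\<And>A B t s. par1 A t \<Longrightarrow> par2 B s \<Longrightarrow> word c1 c2 A B = P (t * s)"
    using co unfolding coordinates_def by simp_all
  have w1: "word c1 c2 A e2 = P t" if "par1 A t" for A t using word[OF that pe(2)] by simp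
  have w2: "word c1 c2 e1 A = P t" if "par2 A t" for A t using word[OF pe(1) that] by simp
  have w0: "word c1 c2 e1 e2 = P 1" using word[OF pe] by simp
  have Pm: "P (- r) * P r = 1" "P r * P (- r) = 1" for r
    using Padd[of "- r" r] Padd[of r "- r"] P0 by simp_all
  have DG: "A \<in> GR R" if "A \<in> Dom \<alpha> R" for A \<alpha> using that unfolding Dom_def by simp
  have Peq: "r = s" if "P r = P s" "r \<in> R" "s \<in> R" for r s using Pinj that by (simp add: inj_on_eq_iff)
  define Rep where "Rep xs r \<longleftrightarrow> r \<in> R \<and> xs = map mx [P r]" for xs and r :: 'k
  have domG: "dom (Gs R) = mx ` GR R" by (simp add: Gs_def matrix_group_struct_def)
  have domR: "dom (ring_struct R) = R" by (simp add: ring_struct_def)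
  have RepR: "Rep (map mx [A]) r \<longleftrightarrow> r \<in> R \<and> A = P r" for A r
    unfolding Rep_def by (simp add: mx_inject)
  have one_list: "\<exists>A\<in>GR R. ys = map mx [A]" if "length ys = 1" "set ys \<subseteq> dom (Gs R)" for ys
    using that unfolding domG by (cases ys) auto
  show ?thesis
  proof (rule interpretation_decidable[where E = R and d = 1 and Rep = Rep, OF dec])
    show "dom (ring_struct R) \<noteq> {}" "dom (ring_struct R) \<subseteq> R"
      unfolding domR using subring_closed(1)[OF R] by auto
    show "snd (ops (ring_struct R) ! f) es \<in> R"
      if "f < length (ops (ring_struct R))" "length es = fst (ops (ring_struct R) ! f)" "set es \<subseteq> R" for f es
      using ring_struct_closed[OF R] that by blast
    show "length xs = 1 \<and> set xs \<subseteq> dom (Gs R)" if "Rep xs e" for xs e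
      using that PG unfolding Rep_def domG by auto
    show "\<exists>xs. Rep xs e" if "e \<in> R" for e using that unfolding Rep_def by blast
  next
    fix \<nu> :: "nat \<Rightarrow> 'k^'n^'n" assume \<nu>: "range \<nu> = dom (Gs R)"
    obtain tD where tD: "\<And>i. wf_system (Gs R) (tD i)"
      "\<And>i \<rho>. (\<forall>i. \<rho> i \<in> GR R) \<Longrightarrow> sol R \<nu> \<rho> (tD i) = (\<rho> i \<in> Dom \<alpha>1 R)"
    proof (rule ex_dom_system[OF R \<nu>, of \<alpha>1])
      fix t assume "\<And>i. wf_system (Gs R) (t i)"
        "\<And>i \<rho>. (\<forall>i. \<rho> i \<in> GR R) \<Longrightarrow> sol R \<nu> \<rho> (t i) = (\<rho> i \<in> Dom \<alpha>1 R)"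
      then show thesis by (rule that)
    qed
    show "\<exists>S. wf_system (Gs R) S \<and> (\<forall>xs. length xs = 1 \<longrightarrow> set xs \<subseteq> dom (Gs R) \<longrightarrow>
        sat (Gs R) \<nu> S xs = (\<exists>e\<in>dom (ring_struct R). Rep xs e))"
    proof (intro exI conjI allI impI)
      \<comment> \<open>An element represents some r exactly if it is the word of an element of the
        first set and \<open>e2\<close>; then r is the parameter of that element.\<close>
      let ?S = "tD 1 @ [(Var 0, tword \<nu> c1 c2 (Var 1) (tcon \<nu> e2))]"
      show "wf_system (Gs R) ?S"
        unfolding wf_system_append using tD(1)
        by (simp add: wf_system_def tword_def wf_group_terms)
      fix xs :: "('k^'n^'n) list" assume "length xs = 1" and "set xs \<subseteq> dom (Gs R)"
      then obtain A where A: "A \<in> GR R" "xs = map mx [A]" using one_list by blast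
      have ch: "sol R \<nu> \<rho> ?S \<longleftrightarrow> \<rho> 1 \<in> Dom \<alpha>1 R \<and> \<rho> 0 = word c1 c2 (\<rho> 1) e2" if \<rho>: "\<forall>i. \<rho> i \<in> GR R" for \<rho>
      proof -
        have "tev R \<nu> (\<lambda>i. mx (\<rho> i)) (tword \<nu> c1 c2 (Var 1) (tcon \<nu> e2)) = word c1 c2 (\<rho> 1) e2"
          using tev_tword[OF \<nu> _ _ cG(1,2), of "\<lambda>i. mx (\<rho> i)" "Var 1" "tcon \<nu> e2"] \<rho> cG
          by (simp add: tev_group_terms tev_tcon[OF \<nu> cG(4)] mx_inverse)
        then show ?thesis unfolding sol_append tD(2)[OF \<rho>] sol_single by (simp add: tev_group_terms mx_inverse)
      qed
      show "sat (Gs R) \<nu> ?S xs = (\<exists>e\<in>dom (ring_struct R). Rep xs e)"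
        unfolding A(2) sat_iff[OF \<nu>] nth_agree sol_def[symmetric] domR RepR
      proof
        assume "\<exists>\<rho>. (\<forall>i::nat. \<rho> i \<in> GR R) \<and> \<rho> 0 = A \<and> sol R \<nu> \<rho> ?S"
        then obtain \<rho> where \<rho>: "\<forall>i. \<rho> i \<in> GR R" "\<rho> 0 = A" "sol R \<nu> \<rho> ?S" by auto
        then have h: "\<rho> 1 \<in> Dom \<alpha>1 R" "A = word c1 c2 (\<rho> 1) e2" using ch by auto
        then obtain t where "t \<in> R" "par1 (\<rho> 1) t" using D1 by blast
        then show "\<exists>e\<in>R. e \<in> R \<and> A = P e" using w1 h(2) by blast
      next
        assume "\<exists>e\<in>R. e \<in> R \<and> A = P e"
        then obtain e where e: "e \<in> R" "A = P e" by blast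
        obtain B where B: "B \<in> Dom \<alpha>1 R" "par1 B e" using D1'[OF e(1)] by blast
        let ?\<rho> = "\<lambda>i::nat. if i = 0 then A else B"
        have "\<forall>i. ?\<rho> i \<in> GR R" using A DG[OF B(1)] by simp
        then show "\<exists>\<rho>. (\<forall>i::nat. \<rho> i \<in> GR R) \<and> \<rho> 0 = A \<and> sol R \<nu> \<rho> ?S"
          using ch[of ?\<rho>] B w1[OF B(2)] e(2) by (intro exI[of _ ?\<rho>]) simp
      qed
    qed
    show "\<exists>S. wf_system (Gs R) S \<and> (\<forall>xs ys e e'. e \<in> R \<longrightarrow> e' \<in> R \<longrightarrow> Rep xs e \<longrightarrow> Rep ys e' \<longrightarrow>
        sat (Gs R) \<nu> S (xs @ ys) = (e = e'))"
    proof (intro exI conjI allI impI)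
      let ?S = "[(Var 0, Var 1)]"
      show "wf_system (Gs R) ?S" by (simp add: wf_system_def)
      fix xs ys e e' assume e: "e \<in> R" "e' \<in> R" and "Rep xs e" "Rep ys e'"
      then have xy: "xs @ ys = map mx [P e, P e']" unfolding Rep_def by simp
      have ch: "sol R \<nu> \<rho> ?S \<longleftrightarrow> \<rho> 0 = \<rho> 1" for \<rho>
        unfolding sol_single by (simp add: tev_group_terms mx_inverse)
      show "sat (Gs R) \<nu> ?S (xs @ ys) = (e = e')"
        unfolding xy sat_iff[OF \<nu>] nth_agree sol_def[symmetric] ch
      proof
        assume "\<exists>\<rho>. (\<forall>i::nat. \<rho> i \<in> GR R) \<and> (\<rho> 0 = P e \<and> \<rho> 1 = P e') \<and> \<rho> 0 = \<rho> 1"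
        then have "P e = P e'" by auto
        then show "e = e'" using Peq e by blast
      next
        assume "e = e'"
        then show "\<exists>\<rho>. (\<forall>i::nat. \<rho> i \<in> GR R) \<and> (\<rho> 0 = P e \<and> \<rho> 1 = P e') \<and> \<rho> 0 = \<rho> 1"
          using PG e by (intro exI[of _ "\<lambda>_. P e"]) auto
      qed
    qed
  next
    fix \<nu> :: "nat \<Rightarrow> 'k^'n^'n" and f assume \<nu>: "range \<nu> = dom (Gs R)" and f: "f < length (ops (ring_struct R))"
    obtain t1 where t1: "\<And>i. wf_system (Gs R) (t1 i)"
      "\<And>i \<rho>. (\<forall>i. \<rho> i \<in> GR R) \<Longrightarrow> sol R \<nu> \<rho> (t1 i) = (\<rho> i \<in> Dom \<alpha>1 R)"
    proof (rule ex_dom_system[OF R \<nu>, of \<alpha>1])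
      fix t assume "\<And>i. wf_system (Gs R) (t i)"
        "\<And>i \<rho>. (\<forall>i. \<rho> i \<in> GR R) \<Longrightarrow> sol R \<nu> \<rho> (t i) = (\<rho> i \<in> Dom \<alpha>1 R)"
      then show thesis by (rule that)
    qed
    obtain t2 where t2: "\<And>i. wf_system (Gs R) (t2 i)"
      "\<And>i \<rho>. (\<forall>i. \<rho> i \<in> GR R) \<Longrightarrow> sol R \<nu> \<rho> (t2 i) = (\<rho> i \<in> Dom \<alpha>2 R)"
    proof (rule ex_dom_system[OF R \<nu>, of \<alpha>2])
      fix t assume "\<And>i. wf_system (Gs R) (t i)"
        "\<And>i \<rho>. (\<forall>i. \<rho> i \<in> GR R) \<Longrightarrow> sol R \<nu> \<rho> (t i) = (\<rho> i \<in> Dom \<alpha>2 R)"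
      then show thesis by (rule that)
    qed
    have v: "tev R \<nu> (\<lambda>i. mx (\<rho> i)) (Var i) = \<rho> i" for \<rho> i by (simp add: tev_group_terms mx_inverse)
    have tw: "tev R \<nu> (\<lambda>i. mx (\<rho> i)) (tword \<nu> c1 c2 s t) =
        word c1 c2 (tev R \<nu> (\<lambda>i. mx (\<rho> i)) s) (tev R \<nu> (\<lambda>i. mx (\<rho> i)) t)"
      if "tev R \<nu> (\<lambda>i. mx (\<rho> i)) s \<in> GR R" "tev R \<nu> (\<lambda>i. mx (\<rho> i)) t \<in> GR R" for \<rho> s t
      by (rule tev_tword[OF \<nu> that cG(1,2)])
    note te = tev_tcon[OF \<nu> cG(3)] tev_tcon[OF \<nu> cG(4)]
    have "f < 5" using f by (simp add: ring_struct_def)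
    then consider "f = 0" | "f = 1" | "f = 2" | "f = 3" | "f = 4" by linarith
    then show "\<exists>S. wf_system (Gs R) S \<and> (\<forall>ys xss es. length ys = 1 \<longrightarrow> set ys \<subseteq> dom (Gs R) \<longrightarrow>
          length es = fst (ops (ring_struct R) ! f) \<longrightarrow> set es \<subseteq> R \<longrightarrow> list_all2 Rep xss es \<longrightarrow>
          sat (Gs R) \<nu> S (ys @ concat xss) = Rep ys (snd (ops (ring_struct R) ! f) es))"
    proof cases
      case 1
      show ?thesis
      proof (intro exI conjI allI impI)
        let ?S = "[(Var 0, tmul (Var 1) (Var 2))]"
        show "wf_system (Gs R) ?S" by (simp add: wf_system_def wf_group_terms)
        fix ys xss es assume "length ys = 1" "set ys \<subseteq> dom (Gs R)"
          and "length es = fst (ops (ring_struct R) ! f)" and xss: "list_all2 Rep xss es"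
        then have "length es = 2" using 1 by (simp add: ring_struct_def)
        then obtain x y a b where l: "xss = [x, y]" "es = [a, b]" "Rep x a" "Rep y b"
          using list_all2_length_2[OF xss] by blast
        obtain A where A: "A \<in> GR R" "ys = map mx [A]"
          using one_list \<open>length ys = 1\<close> \<open>set ys \<subseteq> dom (Gs R)\<close> by blast
        have ab: "a \<in> R" "b \<in> R" and ls: "ys @ concat xss = map mx [A, P a, P b]"
          using l unfolding Rep_def A by auto
        have abR: "a + b \<in> R" by (rule subring_closed(3)[OF R ab])
        have ch: "sol R \<nu> \<rho> ?S \<longleftrightarrow> \<rho> 0 = \<rho> 1 * \<rho> 2" for \<rho>
          unfolding sol_single tev_group_terms(1) v ..
        have val: "snd (ops (ring_struct R) ! f) es = a + b" using 1 l by (simp add: ring_struct_def)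
        show "sat (Gs R) \<nu> ?S (ys @ concat xss) = Rep ys (snd (ops (ring_struct R) ! f) es)"
          unfolding val ls unfolding sat_iff[OF \<nu>] nth_agree sol_def[symmetric] ch A(2)
        unfolding RepR
        proof (intro iffI conjI abR; (elim conjE)?)
          assume "\<exists>\<rho>. (\<forall>i::nat. \<rho> i \<in> GR R) \<and> (\<rho> 0 = A \<and> \<rho> 1 = P a \<and> \<rho> 2 = P b) \<and> \<rho> 0 = \<rho> 1 * \<rho> 2"
          then show "A = P (a + b)" by (auto simp: Padd)
        next
          assume "A = P (a + b)"
          then show "\<exists>\<rho>. (\<forall>i::nat. \<rho> i \<in> GR R) \<and> (\<rho> 0 = A \<and> \<rho> 1 = P a \<and> \<rho> 2 = P b) \<and> \<rho> 0 = \<rho> 1 * \<rho> 2"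
            using A(1) PG[OF ab(1)] PG[OF ab(2)]
            by (intro exI[of _ "\<lambda>i::nat. if i = 0 then A else if i = 1 then P a else P b"]) (auto simp: Padd)
        qed
      qed
    next
      case 2
      show ?thesis
      proof (intro exI conjI allI impI)
        \<comment> \<open>Variables 3 and 4 are auxiliary. The two word equations against parameter
          1 force their parameters to be a and b, by injectivity of \<open>P\<close>, and the last
          equation multiplies them.\<close>
        let ?S = "t1 3 @ t2 4 @ [(Var 1, tword \<nu> c1 c2 (Var 3) (tcon \<nu> e2)),
            (Var 2, tword \<nu> c1 c2 (tcon \<nu> e1) (Var 4)), (Var 0, tword \<nu> c1 c2 (Var 3) (Var 4))]"
        show "wf_system (Gs R) ?S"
          unfolding wf_system_append using t1(1) t2(1) by (simp add: wf_system_def tword_def wf_group_terms)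
        fix ys xss es assume "length ys = 1" "set ys \<subseteq> dom (Gs R)"
          and "length es = fst (ops (ring_struct R) ! f)" and xss: "list_all2 Rep xss es"
        then have "length es = 2" using 2 by (simp add: ring_struct_def)
        then obtain x y a b where l: "xss = [x, y]" "es = [a, b]" "Rep x a" "Rep y b"
          using list_all2_length_2[OF xss] by blast
        obtain A where A: "A \<in> GR R" "ys = map mx [A]"
          using one_list \<open>length ys = 1\<close> \<open>set ys \<subseteq> dom (Gs R)\<close> by blast
        have ab: "a \<in> R" "b \<in> R" and ls: "ys @ concat xss = map mx [A, P a, P b]"
          using l unfolding Rep_def A by auto
        have abR: "a * b \<in> R" by (rule subring_closed(4)[OF R ab])
        have ch: "sol R \<nu> \<rho> ?S \<longleftrightarrow> \<rho> 3 \<in> Dom \<alpha>1 R \<and> \<rho> 4 \<in> Dom \<alpha>2 R \<and> \<rho> 1 = word c1 c2 (\<rho> 3) e2 \<and>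
            \<rho> 2 = word c1 c2 e1 (\<rho> 4) \<and> \<rho> 0 = word c1 c2 (\<rho> 3) (\<rho> 4)" if \<rho>: "\<forall>i. \<rho> i \<in> GR R" for \<rho>
          unfolding sol_append sol_Cons t1(2)[OF \<rho>] t2(2)[OF \<rho>]
          using \<rho> cG by (simp add: tw v te sol_Nil)
        have val: "snd (ops (ring_struct R) ! f) es = a * b" using 2 l by (simp add: ring_struct_def)
        show "sat (Gs R) \<nu> ?S (ys @ concat xss) = Rep ys (snd (ops (ring_struct R) ! f) es)"
          unfolding val ls unfolding sat_iff[OF \<nu>] nth_agree sol_def[symmetric] A(2)
        unfolding RepR
        proof (intro iffI conjI abR; (elim conjE)?)
          assume "\<exists>\<rho>. (\<forall>i::nat. \<rho> i \<in> GR R) \<and> (\<rho> 0 = A \<and> \<rho> 1 = P a \<and> \<rho> 2 = P b) \<and> sol R \<nu> \<rho> ?S"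
          then obtain \<rho> where \<rho>: "\<forall>i. \<rho> i \<in> GR R" "\<rho> 0 = A" "\<rho> 1 = P a" "\<rho> 2 = P b" "sol R \<nu> \<rho> ?S"
            by (auto)
          have h: "\<rho> 3 \<in> Dom \<alpha>1 R" "\<rho> 4 \<in> Dom \<alpha>2 R" "P a = word c1 c2 (\<rho> 3) e2"
            "P b = word c1 c2 e1 (\<rho> 4)" "A = word c1 c2 (\<rho> 3) (\<rho> 4)"
            using ch[OF \<rho>(1)] \<rho> by auto
          obtain t where t: "t \<in> R" "par1 (\<rho> 3) t" using D1[OF h(1)] by blast
          obtain s where s: "s \<in> R" "par2 (\<rho> 4) s" using D2[OF h(2)] by blast
          have "a = t" "b = s" using Peq h(3,4) w1[OF t(2)] w2[OF s(2)] ab t s by auto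
          then show "A = P (a * b)" using h(5) word[OF t(2) s(2)] by simp
        next
          assume AP: "A = P (a * b)"
          obtain U where U: "U \<in> Dom \<alpha>1 R" "par1 U a" using D1'[OF ab(1)] by blast
          obtain V where V: "V \<in> Dom \<alpha>2 R" "par2 V b" using D2'[OF ab(2)] by blast
          let ?\<rho> = "\<lambda>i::nat. if i = 0 then A else if i = 1 then P a else if i = 2 then P b else if i = 3 then U else V"
          have G: "\<forall>i. ?\<rho> i \<in> GR R" using A(1) PG[OF ab(1)] PG[OF ab(2)] DG[OF U(1)] DG[OF V(1)] by simp
          have "sol R \<nu> ?\<rho> ?S"
            unfolding ch[OF G] using U V w1[OF U(2)] w2[OF V(2)] word[OF U(2) V(2)] AP by simp
          then show "\<exists>\<rho>. (\<forall>i::nat. \<rho> i \<in> GR R) \<and> (\<rho> 0 = A \<and> \<rho> 1 = P a \<and> \<rho> 2 = P b) \<and> sol R \<nu> \<rho> ?S"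
            using G by (intro exI[of _ ?\<rho>]) (simp)
        qed
      qed
    next
      case 3
      show ?thesis
      proof (intro exI conjI allI impI)
        let ?S = "[(tmul (Var 0) (Var 1), tone)]"
        show "wf_system (Gs R) ?S" by (simp add: wf_system_def wf_group_terms)
        fix ys xss es assume "length ys = 1" "set ys \<subseteq> dom (Gs R)"
          and "length es = fst (ops (ring_struct R) ! f)" and xss: "list_all2 Rep xss es"
        then have "length es = 1" using 3 by (simp add: ring_struct_def)
        then obtain x a where l: "xss = [x]" "es = [a]" "Rep x a"
          using list_all2_length_1[OF xss] by blast
        obtain A where A: "A \<in> GR R" "ys = map mx [A]"
          using one_list \<open>length ys = 1\<close> \<open>set ys \<subseteq> dom (Gs R)\<close> by blast
        have a: "a \<in> R" and ls: "ys @ concat xss = map mx [A, P a]"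
          using l unfolding Rep_def A by auto
        have aR: "- a \<in> R" by (rule subring_closed(5)[OF R a])
        have ch: "sol R \<nu> \<rho> ?S \<longleftrightarrow> \<rho> 0 * \<rho> 1 = 1" for \<rho>
          unfolding sol_single tev_group_terms(1,2) v ..
        have inv: "A * P a = 1 \<longleftrightarrow> A = P (- a)"
        proof
          assume "A * P a = 1"
          then have "A * (P a * P (- a)) = P (- a)" unfolding mult.assoc[symmetric] by simp
          then show "A = P (- a)" unfolding Pm by simp
        qed (simp add: Pm)
        have val: "snd (ops (ring_struct R) ! f) es = - a" using 3 l by (simp add: ring_struct_def)
        show "sat (Gs R) \<nu> ?S (ys @ concat xss) = Rep ys (snd (ops (ring_struct R) ! f) es)"
          unfolding val ls unfolding sat_iff[OF \<nu>] nth_agree sol_def[symmetric] ch A(2)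
        unfolding RepR
        proof (intro iffI conjI aR; (elim conjE)?)
          assume "\<exists>\<rho>. (\<forall>i::nat. \<rho> i \<in> GR R) \<and> (\<rho> 0 = A \<and> \<rho> 1 = P a) \<and> \<rho> 0 * \<rho> 1 = 1"
          then have "A * P a = 1" by auto
          then show "A = P (- a)" unfolding inv .
        next
          assume "A = P (- a)"
          then have "A * P a = 1" unfolding inv .
          then show "\<exists>\<rho>. (\<forall>i::nat. \<rho> i \<in> GR R) \<and> (\<rho> 0 = A \<and> \<rho> 1 = P a) \<and> \<rho> 0 * \<rho> 1 = 1"
            using A(1) PG[OF a] by (intro exI[of _ "\<lambda>i::nat. if i = 0 then A else P a"]) (simp)
        qed
      qed
    next
      case 4
      show ?thesis
      proof (intro exI conjI allI impI)
        let ?S = "[(Var 0, tone)]"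
        show "wf_system (Gs R) ?S" by (simp add: wf_system_def wf_group_terms)
        fix ys xss es assume "length ys = 1" "set ys \<subseteq> dom (Gs R)"
          and "length es = fst (ops (ring_struct R) ! f)" and xss: "list_all2 Rep xss es"
        then have "es = []" using 4 by (simp add: ring_struct_def)
        then have l: "xss = []" using xss by simp
        obtain A where A: "A \<in> GR R" "ys = map mx [A]"
          using one_list \<open>length ys = 1\<close> \<open>set ys \<subseteq> dom (Gs R)\<close> by blast
        have ls: "ys @ concat xss = map mx [A]" using l A by simp
        have ch: "sol R \<nu> \<rho> ?S \<longleftrightarrow> \<rho> 0 = 1" for \<rho>
          unfolding sol_single tev_group_terms(2) v ..
        have val: "snd (ops (ring_struct R) ! f) es = 0" using 4 by (simp add: ring_struct_def)
        show "sat (Gs R) \<nu> ?S (ys @ concat xss) = Rep ys (snd (ops (ring_struct R) ! f) es)"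
          unfolding val ls unfolding sat_iff[OF \<nu>] nth_agree sol_def[symmetric] ch A(2)
        unfolding RepR P0
        proof (intro iffI conjI subring_closed(2)[OF R]; (elim conjE)?)
          assume "A = 1"
          then show "\<exists>\<rho>. (\<forall>i::nat. \<rho> i \<in> GR R) \<and> \<rho> 0 = A \<and> \<rho> 0 = 1"
            using A(1) by (intro exI[of _ "\<lambda>i. A"]) simp
        qed auto
      qed
    next
      case 5
      show ?thesis
      proof (intro exI conjI allI impI)
        let ?S = "[(Var 0, tword \<nu> c1 c2 (tcon \<nu> e1) (tcon \<nu> e2))]"
        show "wf_system (Gs R) ?S" by (simp add: wf_system_def tword_def wf_group_terms)
        fix ys xss es assume "length ys = 1" "set ys \<subseteq> dom (Gs R)"
          and "length es = fst (ops (ring_struct R) ! f)" and xss: "list_all2 Rep xss es"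
        then have "es = []" using 5 by (simp add: ring_struct_def)
        then have l: "xss = []" using xss by simp
        obtain A where A: "A \<in> GR R" "ys = map mx [A]"
          using one_list \<open>length ys = 1\<close> \<open>set ys \<subseteq> dom (Gs R)\<close> by blast
        have ls: "ys @ concat xss = map mx [A]" using l A by simp
        have ch: "sol R \<nu> \<rho> ?S \<longleftrightarrow> \<rho> 0 = P 1" for \<rho>
          unfolding sol_single using cG by (simp add: tw te v w0)
        have val: "snd (ops (ring_struct R) ! f) es = 1" using 5 by (simp add: ring_struct_def)
        show "sat (Gs R) \<nu> ?S (ys @ concat xss) = Rep ys (snd (ops (ring_struct R) ! f) es)"
          unfolding val ls unfolding sat_iff[OF \<nu>] nth_agree sol_def[symmetric] ch A(2)
        unfolding RepR
        proof (intro iffI conjI subring_closed(1)[OF R]; (elim conjE)?)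
          assume "A = P 1"
          then show "\<exists>\<rho>. (\<forall>i::nat. \<rho> i \<in> GR R) \<and> \<rho> 0 = A \<and> \<rho> 0 = P 1"
            using A(1) by (intro exI[of _ "\<lambda>i. A"]) simp
        qed auto
      qed
    qed
  qed
qed

end

section \<open>The integral system of a Chevalley basis and an admissible lattice\<close>

context complex_lie_algebra
begin

lemma br_zero_left: "br 0 y = 0" using br_add_left[of 0 0 y] by simp

lemma br_anti: "br x y = - br y x"
proof -
  have "br (x + y) (x + y) = 0" by (rule br_self)
  then have "(br x x + br y x) + (br x y + br y y) = 0" unfolding br_add_left br_add_right .
  then have "br y x + br x y = 0" by (simp only: br_self add_0 add_0_right)
  then show ?thesis by (simp add: eq_neg_iff_add_eq_0 add.commute)
qed

context
  fixes H :: "'l set" and \<Phi> :: "'v::euclidean_space set" and r :: "'v \<Rightarrow> 'l \<Rightarrow> complex" and x :: "'v \<Rightarrow> 'l"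
  assumes rs: "root_system \<Phi>" and ri: "roots_identified H \<Phi> r" and cb: "chevalley_basis H \<Phi> r x"
begin

lemma root_vector: "\<alpha> \<in> \<Phi> \<Longrightarrow> h \<in> H \<Longrightarrow> br h (x \<alpha>) = scale (r \<alpha> h) (x \<alpha>)"
  using cb unfolding chevalley_basis_def by blast

lemma coroot_in: "\<alpha> \<in> \<Phi> \<Longrightarrow> br (x \<alpha>) (x (- \<alpha>)) \<in> H"
  using cb unfolding chevalley_basis_def by blast

lemma coroot_value: "\<alpha> \<in> \<Phi> \<Longrightarrow> \<beta> \<in> \<Phi> \<Longrightarrow> r \<beta> (br (x \<alpha>) (x (- \<alpha>))) = of_real (cartan_integer \<beta> \<alpha>)"
  using cb unfolding chevalley_basis_def by blast

text \<open>Otherwise the coroot would be 0. The root vanishes at 0, being an eigenvalue of the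
  bracket, whereas its value at the coroot is the Cartan integer 2.\<close>

lemma root_vector_nonzero: assumes a: "\<alpha> \<in> \<Phi>" shows "x \<alpha> \<noteq> 0"
proof
  assume "x \<alpha> = 0"
  then have 0: "br (x \<alpha>) (x (- \<alpha>)) = 0" by (simp add: br_zero_left)
  have "is_root H (r \<alpha>)" using ri a unfolding roots_identified_def by blast
  then obtain y where y: "y \<noteq> 0" "\<And>h. h \<in> H \<Longrightarrow> br h y = scale (r \<alpha> h) y" unfolding is_root_def by blast
  have "0 \<in> H" using coroot_in[OF a] 0 by simp
  then have "scale (r \<alpha> 0) y = 0" using y(2)[of 0] by (simp add: br_zero_left)
  moreover have "r \<alpha> 0 = 2" using coroot_value[OF a a] 0 cartan_integer_self[OF rs a] by simp
  ultimately show False using y(1) by simp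
qed

text \<open>The bracket has weight \<alpha> + \<beta>. If it were nonzero, this functional, which is
  not zero on \<open>H\<close>, would be a root, and by injectivity of the identification \<alpha> +
  \<beta> would lie in \<Phi>.\<close>

lemma br_root_vectors_eq_0:
  assumes a: "\<alpha> \<in> \<Phi>" and b: "\<beta> \<in> \<Phi>" and n: "\<alpha> + \<beta> \<notin> \<Phi>" "\<alpha> + \<beta> \<noteq> 0"
  shows "br (x \<alpha>) (x \<beta>) = 0"
proof (rule ccontr)
  assume ne: "br (x \<alpha>) (x \<beta>) \<noteq> 0"
  have lin: "linear (\<lambda>v. r v h)" if "h \<in> H" for h using ri that unfolding roots_identified_def by blast
  have "br h (br (x \<alpha>) (x \<beta>)) = scale (r (\<alpha> + \<beta>) h) (br (x \<alpha>) (x \<beta>))" if h: "h \<in> H" for h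
  proof -
    have "br h (br (x \<alpha>) (x \<beta>)) = - br (x \<alpha>) (br (x \<beta>) h) - br (x \<beta>) (br h (x \<alpha>))"
      using jacobi[of h "x \<alpha>" "x \<beta>"] by (simp add: algebra_simps eq_neg_iff_add_eq_0)
    also have "br (x \<beta>) h = - scale (r \<beta> h) (x \<beta>)" using br_anti[of "x \<beta>" h] root_vector[OF b h] by simp
    also have "- br (x \<alpha>) (- scale (r \<beta> h) (x \<beta>)) = scale (r \<beta> h) (br (x \<alpha>) (x \<beta>))"
      using br_scale_right[of "x \<alpha>" "- r \<beta> h" "x \<beta>"] by simp
    also have "br (x \<beta>) (br h (x \<alpha>)) = - scale (r \<alpha> h) (br (x \<alpha>) (x \<beta>))"
      unfolding root_vector[OF a h] br_scale_right using br_anti[of "x \<beta>" "x \<alpha>"] by simp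
    finally show ?thesis using linear_add[OF lin[OF h], of \<alpha> \<beta>] by (simp add: scale_left_distrib add.commute)
  qed
  moreover have "\<exists>h\<in>H. r (\<alpha> + \<beta>) h \<noteq> 0" using ri n(2) unfolding roots_identified_def by blast
  ultimately have "is_root H (r (\<alpha> + \<beta>))" unfolding is_root_def using ne by blast
  then obtain \<gamma> where g: "\<gamma> \<in> \<Phi>" "\<And>h. h \<in> H \<Longrightarrow> r (\<alpha> + \<beta>) h = r \<gamma> h"
    using ri unfolding roots_identified_def by blast
  have "\<forall>h\<in>H. r (\<alpha> + \<beta> - \<gamma>) h = 0" using g(2) linear_diff[OF lin, of _ "\<alpha> + \<beta>" \<gamma>] by simp
  then have "\<alpha> + \<beta> - \<gamma> = 0" using ri unfolding roots_identified_def by blast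
  then show False using g(1) n(1) by simp
qed

lemma br_coroot:
  "\<alpha> \<in> \<Phi> \<Longrightarrow> \<beta> \<in> \<Phi> \<Longrightarrow> br (br (x \<alpha>) (x (- \<alpha>))) (x \<beta>) = scale (of_int \<lfloor>cartan_integer \<beta> \<alpha>\<rfloor>) (x \<beta>)"
  using root_vector[OF _ coroot_in] coroot_value cartan_integer_Ints[OF rs, of \<alpha> \<beta>]
  by (auto elim!: Ints_cases)

end

end

lemma ent_power_bound:
  fixes m :: "(complex, 'n::finite) sqm"
  shows "norm (ent (m ^ k) i j) \<le> (\<Sum>i\<in>UNIV. \<Sum>j\<in>UNIV. norm (ent m i j)) ^ k"
proof (induction k arbitrary: i j)
  case 0
  show ?case by (simp add: ent_1)
next
  case (Suc k)
  let ?B = "\<Sum>i\<in>UNIV. \<Sum>j\<in>UNIV. norm (ent m i j)"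
  have "norm (ent (m ^ Suc k) i j) \<le> (\<Sum>l\<in>UNIV. norm (ent m i l * ent (m ^ k) l j))"
    by (simp add: ent_mult norm_sum)
  also have "\<dots> \<le> (\<Sum>l\<in>UNIV. norm (ent m i l) * ?B ^ k)"
    by (intro sum_mono) (simp add: norm_mult mult_left_mono Suc)
  also have "\<dots> = (\<Sum>l\<in>UNIV. norm (ent m i l)) * ?B ^ k" by (simp add: sum_distrib_right)
  also have "\<dots> \<le> ?B * ?B ^ k"
  proof (rule mult_right_mono)
    show "(\<Sum>l\<in>UNIV. norm (ent m i l)) \<le> ?B"
      by (rule member_le_sum[of i UNIV "\<lambda>i. \<Sum>l\<in>UNIV. norm (ent m i l)"]) (auto intro: sum_nonneg)
  qed (auto intro!: zero_le_power sum_nonneg)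
  finally show ?case by simp
qed

text \<open>The divided powers tend to zero, so if they are integral, then almost all of them vanish.\<close>

lemma integral_dp_nilpotent:
  fixes m :: "(complex, 'n::finite) sqm"
  assumes int: "\<And>k i j. ent (sq.dp m k) i j \<in> \<int>"
  shows "\<exists>K. \<forall>k\<ge>K. sq.dp m k = 0"
proof -
  define B where "B = (\<Sum>i\<in>UNIV. \<Sum>j\<in>UNIV. norm (ent m i j))"
  have "(\<lambda>k. inverse (fact k) * B ^ k) \<longlonglongrightarrow> 0"
    by (rule summable_LIMSEQ_zero[OF summable_exp])
  then have "\<forall>\<^sub>F k in sequentially. inverse (fact k) * B ^ k < 1"
    by (rule order_tendstoD(2)) simp
  then obtain K where K: "\<And>k. k \<ge> K \<Longrightarrow> inverse (fact k) * B ^ k < 1"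
    unfolding eventually_sequentially by blast
  have "ent (sq.dp m k) i j = 0" if k: "k \<ge> K" for k i j
  proof -
    have "norm (ent (sq.dp m k) i j) = inverse (fact k) * norm (ent (m ^ k) i j)"
      by (simp add: sq.dp_def norm_mult norm_divide field_simps)
    also have "\<dots> \<le> inverse (fact k) * B ^ k"
      unfolding B_def by (intro mult_left_mono ent_power_bound) simp
    also have "\<dots> < 1" by (rule K[OF k])
    finally have "norm (ent (sq.dp m k) i j) < 1" .
    moreover obtain z where z: "ent (sq.dp m k) i j = of_int z" using int[of k i j] by (auto elim: Ints_cases)
    ultimately show ?thesis by simp
  qed
  then show ?thesis by (intro exI[of _ K]) (auto intro: sqm_eqI)
qed

lemma iota_of_Ints:
  fixes A :: "('k::field_char_0, 'n::finite) sqm"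
  assumes "\<And>i j. ent A i j \<in> \<int>" shows "\<exists>B. iota B = A"
proof -
  have "\<forall>i j. \<exists>z. of_int z = ent A i j" using assms by (metis Ints_cases)
  then obtain f where f: "\<And>i j. of_int (f i j) = ent A i j" by metis
  have "iota (Mx (\<chi> i j. f i j)) = A" by (intro sqm_eqI) (simp add: ent_def[of "Mx _"] f)
  then show ?thesis by blast
qed

lemma Mx_mult: "Mx A * Mx B = Mx (A ** B)" by (simp add: mx_eq_iff mx_mult)

lemma Mx_smq: "Mx (mat c ** A) = smq c (Mx A)"
proof (rule sqm_eqI)
  fix i j
  have "(mat c ** A) $ i $ j = (\<Sum>k\<in>UNIV. if i = k then c * A $ k $ j else 0)"
    unfolding matrix_matrix_mult_def by (simp add: mat_def if_distrib if_distribR cong: if_cong)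
  then show "ent (Mx (mat c ** A)) i j = ent (smq c (Mx A)) i j" by (simp add: ent_def[of "Mx _"])
qed

lemma Mx_mat_pow: "Mx (mat_pow A k) = Mx A ^ k"
  by (simp add: mx_eq_iff mx_power)

lemma mx_sum: "mx (sum f I) = (\<Sum>i\<in>I. mx (f i))"
  by (induction I rule: infinite_finite_induct) (auto simp: mx_0 mx_add)

lemma sq_conj_lie:
  assumes "p * p' = (1 :: ('k::field_char_0, 'n::finite) sqm)"
  shows "lie (p' * x * p) (p' * y * p) = p' * lie x y * p"
proof -
  have "p' * x * p * (p' * y * p) = p' * (x * y) * p" for x y
    by (metis assms mult.assoc mult_1)
  then show ?thesis by (simp add: left_diff_distrib right_diff_distrib)
qed

text \<open>The lattice is stable under the divided powers, so these have integral matrices in its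
  basis. The axioms are identities between integral matrices and are checked after embedding into
  complex matrices. Divided powers vanish from some index on, so the exponential series breaks off
  and the generators of the complex group are the root elements.\<close>

theorem ex_integral_chevalley_system:
  fixes \<Phi> :: "'v::euclidean_space set" and scale :: "complex \<Rightarrow> 'l::ab_group_add \<Rightarrow> 'l"
    and \<pi> :: "'l \<Rightarrow> complex^'n^'n"
  assumes rs: "root_system \<Phi>" and L: "complex_lie_algebra scale br"
    and ri: "complex_lie_algebra.roots_identified scale br H \<Phi> r"
    and cb: "complex_lie_algebra.chevalley_basis scale br H \<Phi> r x"
    and fr: "complex_lie_algebra.faithful_representation scale br \<pi>"
    and al: "admissible_lattice_basis \<Phi> \<pi> x P"
  obtains E K where "integral_chevalley_system \<Phi> E K"
    "\<And>R :: 'f::field_char_0 set. chevalley_group \<Phi> \<pi> x P R = mx ` integral_chevalley_system.GR \<Phi> E K R"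
proof -
  interpret L: complex_lie_algebra scale br by (rule L)
  have pi_add: "\<pi> (y + z) = \<pi> y + \<pi> z" and pi_scale: "\<pi> (scale c y) = mat c ** \<pi> y"
    and pi_br: "\<pi> (br y z) = \<pi> y ** \<pi> z - \<pi> z ** \<pi> y" and inj: "inj \<pi>" for y z c
    using fr unfolding L.faithful_representation_def L.lie_representation_def by auto
  have pi_0: "\<pi> 0 = 0" using pi_add[of 0 0] by simp
  have invP: "invertible P" and adm: "\<And>\<alpha> k v. \<alpha> \<in> \<Phi> \<Longrightarrow> v \<in> integer_lattice P \<Longrightarrow>
      (mat (1 / fact k) ** mat_pow (\<pi> (x \<alpha>)) k) *v v \<in> integer_lattice P"
    using al unfolding admissible_lattice_basis_def by auto
  define p where "p = Mx P"
  define p' where "p' = Mx (matrix_inv P)"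
  have "P ** matrix_inv P = mat 1 \<and> matrix_inv P ** P = mat 1"
    using invP unfolding invertible_def matrix_inv_def by (rule someI_ex)
  then have pp: "p * p' = 1" "p' * p = 1" unfolding p_def p'_def Mx_mult one_sqm_def by simp_all
  define a where "a \<alpha> = Mx (\<pi> (x \<alpha>))" for \<alpha>
  define m where "m \<alpha> = p' * a \<alpha> * p" for \<alpha>
  have dpm: "sq.dp (m \<alpha>) k = p' * sq.dp (a \<alpha>) k * p" for \<alpha> k
    by (cases k) (simp_all add: sq.dp_def m_def sq.conj_power[OF pp(1)] pp del: power_Suc)
  have dpa: "sq.dp (a \<alpha>) k = Mx (mat (1 / fact k) ** mat_pow (\<pi> (x \<alpha>)) k)" for \<alpha> k
    unfolding Mx_smq Mx_mat_pow sq.dp_def a_def ..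
  have int: "ent (sq.dp (m \<alpha>) k) i j \<in> \<int>" if al: "\<alpha> \<in> \<Phi>" for \<alpha> k i j
  proof -
    let ?D = "mat (1 / fact k) ** mat_pow (\<pi> (x \<alpha>)) k"
    \<comment> \<open>Column j of the conjugated matrix consists of the lattice coordinates of the
      image of the j-th basis vector.\<close>
    have "P *v axis j 1 \<in> integer_lattice P"
      unfolding integer_lattice_def by (auto simp: axis_def)
    then obtain z :: "complex^'n" where z: "?D *v (P *v axis j 1) = P *v z" "\<And>i. vec_nth z i \<in> \<int>"
      using adm[OF al, of "P *v axis j 1" k] unfolding integer_lattice_def by auto
    have "matrix_inv P *v (?D *v (P *v axis j 1)) = (matrix_inv P ** P) *v z"
      unfolding z(1) by (simp add: matrix_vector_mul_assoc)
    then have "(matrix_inv P ** ?D ** P) *v axis j 1 = z"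
      using pp(2) by (simp add: matrix_vector_mul_assoc matrix_mul_assoc p_def p'_def Mx_mult one_sqm_def Mx_inject)
    moreover have "(matrix_inv P ** ?D ** P) *v axis j 1 = column j (matrix_inv P ** ?D ** P)"
      by (simp add: vec_eq_iff matrix_vector_mult_def column_def axis_def if_distrib cong: if_cong)
    ultimately have "(matrix_inv P ** ?D ** P) $ i $ j = z $ i" by (metis column_def vec_lambda_beta)
    then have "ent (sq.dp (m \<alpha>) k) i j = z $ i"
      unfolding dpm dpa p_def p'_def Mx_mult ent_def by simp
    then show ?thesis using z(2) by simp
  qed
  define E where "E \<alpha> k = (SOME B. iota B = sq.dp (m \<alpha>) k)" for \<alpha> k
  have E: "iota (E \<alpha> k) = sq.dp (m \<alpha>) k" if "\<alpha> \<in> \<Phi>" for \<alpha> k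
    unfolding E_def by (rule someI_ex[OF iota_of_Ints[OF int[OF that]]])
  have E1: "iota (E \<alpha> 1) = m \<alpha>" if "\<alpha> \<in> \<Phi>" for \<alpha> using E[OF that, of 1] by (simp add: sq.dp_def)
  have "\<exists>K. \<forall>k\<ge>K. sq.dp (m \<alpha>) k = 0" if "\<alpha> \<in> \<Phi>" for \<alpha> by (rule integral_dp_nilpotent[OF int[OF that]])
  then obtain K0 where K0: "\<And>\<alpha> k. \<alpha> \<in> \<Phi> \<Longrightarrow> k \<ge> K0 \<alpha> \<Longrightarrow> sq.dp (m \<alpha>) k = 0" by metis
  define K where "K = Max (insert 0 (K0 ` \<Phi>))"
  have "K0 \<alpha> \<le> K" if "\<alpha> \<in> \<Phi>" for \<alpha> unfolding K_def using finite_roots[OF rs] that by (intro Max_ge) auto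
  then have dp0: "sq.dp (m \<alpha>) k = 0" if "\<alpha> \<in> \<Phi>" "k \<ge> K" for \<alpha> k
    using K0[OF that(1)] that by (meson order_trans)
  have lie_m: "lie (m \<alpha>) (m \<beta>) = p' * Mx (\<pi> (br (x \<alpha>) (x \<beta>))) * p" for \<alpha> \<beta>
  proof -
    have "Mx (\<pi> (br (x \<alpha>) (x \<beta>))) = lie (a \<alpha>) (a \<beta>)"
      unfolding pi_br a_def Mx_mult minus_sqm_def by simp
    then show ?thesis unfolding m_def sq_conj_lie[OF pp(1)] by simp
  qed
  have sc: "p' * Mx (\<pi> (scale c y)) * p = smq c (p' * Mx (\<pi> y) * p)" for c y
    unfolding pi_scale Mx_smq by simp
  have sys: "integral_chevalley_system \<Phi> E K"
  proof
    show "root_system \<Phi>" by (rule rs)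
    fix \<alpha> assume \<alpha>: "\<alpha> \<in> \<Phi>"
    show "smq (fact k) (E \<alpha> k) = E \<alpha> 1 ^ k" for k
    proof -
      have "iota (smq (fact k) (E \<alpha> k)) = smq (fact k) (sq.dp (m \<alpha>) k)"
        unfolding iota_smq E[OF \<alpha>] by simp
      also have "\<dots> = iota (E \<alpha> 1 ^ k)" unfolding iota_power E1[OF \<alpha>] sq.dp_def by simp
      finally show ?thesis unfolding iota_eq_iff .
    qed
    show "E \<alpha> k = 0" if "k \<ge> K" for k
    proof -
      have "iota (E \<alpha> k) = (iota 0 :: (complex, 'n) sqm)" unfolding E[OF \<alpha>] dp0[OF \<alpha> that] iota_0 ..
      then show ?thesis unfolding iota_eq_iff .
    qed
    have m_nz: "m \<gamma> \<noteq> 0" if "\<gamma> \<in> \<Phi>" for \<gamma>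
    proof
      assume "m \<gamma> = 0"
      then have "p * (p' * a \<gamma> * p) * p' = 0" unfolding m_def by simp
      then have "(p * p') * a \<gamma> * (p * p') = 0" by (simp add: mult.assoc)
      then have "\<pi> (x \<gamma>) = \<pi> 0" unfolding pp a_def pi_0 by (simp add: zero_sqm_def Mx_inject)
      then have "x \<gamma> = 0" using inj by (simp add: inj_eq)
      then show False using L.root_vector_nonzero[OF rs ri cb that] by simp
    qed
    show "E \<alpha> 1 \<noteq> 0" using m_nz[OF \<alpha>] E1[OF \<alpha>] by (auto simp: iota_0)
    fix \<beta> assume \<beta>: "\<beta> \<in> \<Phi>"
    have iE: "iota (lie (E \<alpha>' 1) (E \<beta>' 1)) = lie (m \<alpha>') (m \<beta>')" if "\<alpha>' \<in> \<Phi>" "\<beta>' \<in> \<Phi>" for \<alpha>' \<beta>'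
      unfolding iota_diff iota_mult E1[OF that(1)] E1[OF that(2)] ..
    show "lie (E \<alpha> 1) (E \<beta> 1) = 0" if "\<alpha> + \<beta> \<notin> \<Phi>" "\<alpha> + \<beta> \<noteq> 0"
    proof -
      have "lie (m \<alpha>) (m \<beta>) = 0"
        unfolding lie_m L.br_root_vectors_eq_0[OF rs ri cb \<alpha> \<beta> that] pi_0
        by (simp add: zero_sqm_def[symmetric])
      then have "iota (lie (E \<alpha> 1) (E \<beta> 1)) = (iota 0 :: (complex, 'n) sqm)"
        unfolding iE[OF \<alpha> \<beta>] iota_0 .
      then show ?thesis unfolding iota_eq_iff .
    qed
    show "\<exists>p q. q \<noteq> 0 \<and> smq q (lie (E \<alpha> 1) (E \<beta> 1)) = smq p (E (\<alpha> + \<beta>) 1) \<and>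
      smq q (lie (E (- \<alpha>) 1) (E (- \<beta>) 1)) = smq (- p) (E (- (\<alpha> + \<beta>)) 1)" if ab: "\<alpha> + \<beta> \<in> \<Phi>"
    proof -
      have neg: "- \<alpha> \<in> \<Phi>" "- \<beta> \<in> \<Phi>" "- (\<alpha> + \<beta>) \<in> \<Phi>" using root_minus[OF rs] \<alpha> \<beta> ab by blast+
      obtain c where c: "br (x \<alpha>) (x \<beta>) = scale c (x (\<alpha> + \<beta>))"
        "br (x (- \<alpha>)) (x (- \<beta>)) = scale (- c) (x (- (\<alpha> + \<beta>)))"
        using cb \<alpha> \<beta> ab unfolding L.chevalley_basis_def by blast
      have l1: "iota (lie (E \<alpha> 1) (E \<beta> 1)) = smq c (iota (E (\<alpha> + \<beta>) 1))"
        unfolding iE[OF \<alpha> \<beta>] E1[OF ab] lie_m c(1) sc unfolding m_def a_def ..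
      have l2: "iota (lie (E (- \<alpha>) 1) (E (- \<beta>) 1)) = smq (- c) (iota (E (- (\<alpha> + \<beta>)) 1))"
        unfolding iE[OF neg(1,2)] E1[OF neg(3)] lie_m c(2) sc unfolding m_def a_def ..
      have "E (\<alpha> + \<beta>) 1 \<noteq> 0" using m_nz[OF ab] E1[OF ab] by (auto simp: iota_0)
      then obtain i j where ij: "ent (E (\<alpha> + \<beta>) 1) i j \<noteq> 0" unfolding sqm_eq_iff by auto
      \<comment> \<open>A nonzero entry of the matrix of \<alpha> + \<beta>, compared with the same
        entry of the bracket, shows that the structure constant is the rational number f / q. The
        negated fraction serves the negative roots.\<close>
      define q where "q = ent (E (\<alpha> + \<beta>) 1) i j"
      define f where "f = ent (lie (E \<alpha> 1) (E \<beta> 1)) i j"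
      have cf: "of_int q * c = of_int f"
        using arg_cong[OF l1, of "\<lambda>A. ent A i j"] unfolding f_def q_def by (simp add: mult.commute)
      have "iota (smq q (lie (E \<alpha> 1) (E \<beta> 1))) = (iota (smq f (E (\<alpha> + \<beta>) 1)) :: (complex, 'n) sqm)"
        unfolding iota_smq l1 by (simp add: cf)
      moreover have "iota (smq q (lie (E (- \<alpha>) 1) (E (- \<beta>) 1))) = (iota (smq (- f) (E (- (\<alpha> + \<beta>)) 1)) :: (complex, 'n) sqm)"
        unfolding iota_smq l2 by (simp add: cf)
      ultimately show ?thesis unfolding iota_eq_iff using ij q_def by blast
    qed
    show "lie (lie (E \<alpha> 1) (E (- \<alpha>) 1)) (E \<beta> 1) = smq \<lfloor>cartan_integer \<beta> \<alpha>\<rfloor> (E \<beta> 1)"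
    proof -
      let ?h = "br (x \<alpha>) (x (- \<alpha>))"
      have neg: "- \<alpha> \<in> \<Phi>" using root_minus[OF rs \<alpha>] .
      have "Mx (\<pi> (br ?h (x \<beta>))) = lie (Mx (\<pi> ?h)) (a \<beta>)"
        unfolding pi_br[of ?h] a_def Mx_mult minus_sqm_def by simp
      then have "p' * Mx (\<pi> (br ?h (x \<beta>))) * p = lie (p' * Mx (\<pi> ?h) * p) (m \<beta>)"
        unfolding m_def sq_conj_lie[OF pp(1)] by simp
      also have "p' * Mx (\<pi> ?h) * p = lie (m \<alpha>) (m (- \<alpha>))" unfolding lie_m ..
      finally have "lie (lie (m \<alpha>) (m (- \<alpha>))) (m \<beta>) = smq (of_int \<lfloor>cartan_integer \<beta> \<alpha>\<rfloor>) (m \<beta>)"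
        unfolding L.br_coroot[OF rs ri cb \<alpha> \<beta>] sc m_def a_def by simp
      then have "iota (lie (lie (E \<alpha> 1) (E (- \<alpha>) 1)) (E \<beta> 1)) = (iota (smq \<lfloor>cartan_integer \<beta> \<alpha>\<rfloor> (E \<beta> 1)) :: (complex, 'n) sqm)"
        unfolding iota_smq iota_diff iota_mult E1[OF \<alpha>] E1[OF \<beta>] E1[OF neg] by simp
      then show ?thesis unfolding iota_eq_iff .
    qed
  qed
  interpret S: integral_chevalley_system \<Phi> E K by (rule sys)
  have gen: "matrix_inv P ** mat_exp (mat t ** \<pi> (x \<alpha>)) ** P = mx (S.xg \<alpha> t)" if \<alpha>: "\<alpha> \<in> \<Phi>" for \<alpha> t
  proof -
    have XF: "S.XF \<alpha> = m \<alpha>" unfolding S.XF_def by (rule E1[OF \<alpha>])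
    have mK: "m \<alpha> ^ K = 0"
      using dp0[OF \<alpha> order_refl] unfolding sq.dp_def by simp
    have "a \<alpha> = p * m \<alpha> * p'"
    proof -
      have "p * (p' * a \<alpha> * p) * p' = (p * p') * a \<alpha> * (p * p')" by (simp add: mult.assoc)
      then show ?thesis unfolding m_def pp by simp
    qed
    then have "a \<alpha> ^ Suc K = p * m \<alpha> ^ Suc K * p'" using sq.conj_power[OF pp(2)] by simp
    then have aK: "a \<alpha> ^ Suc K = 0" using sq.power_eq_0_mono[OF mK, of "Suc K"] by simp
    let ?a = "smq t (a \<alpha>)"
    have aK': "?a ^ Suc K = 0" unfolding sq.power_sm aK by simp
    have "mat (1 / fact k) ** mat_pow (mat t ** \<pi> (x \<alpha>)) k = mx (sq.dp ?a k)" for k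
    proof -
      have "Mx (mat (1 / fact k) ** mat_pow (mat t ** \<pi> (x \<alpha>)) k) = sq.dp ?a k"
        unfolding Mx_smq Mx_mat_pow sq.dp_def a_def ..
      then show ?thesis by (metis Mx_inverse')
    qed
    then have "mat_exp (mat t ** \<pi> (x \<alpha>)) = suminf (\<lambda>k. mx (sq.dp ?a k))" unfolding mat_exp_def by simp
    also have "\<dots> = (\<Sum>k<Suc K. mx (sq.dp ?a k))"
    proof (rule suminf_finite)
      fix k assume "k \<notin> {..<Suc K}"
      then have "Suc K \<le> k" by simp
      from sq.dp_eq_0[OF aK' this] show "mx (sq.dp ?a k) = 0" by (simp add: mx_0)
    qed simp
    also have "\<dots> = mx (sq.nexp ?a)" unfolding sq.nexp_eq[OF aK'] mx_sum ..
    finally have ex: "Mx (mat_exp (mat t ** \<pi> (x \<alpha>))) = sq.nexp ?a" by (simp add: mx_inverse)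
    have nil: "sq.nilp ?a" unfolding sq.nilp_def using aK' by blast
    have "Mx (matrix_inv P ** mat_exp (mat t ** \<pi> (x \<alpha>)) ** P) = p' * sq.nexp ?a * p"
      unfolding Mx_mult[symmetric] ex p_def p'_def ..
    also have "\<dots> = sq.nexp (p' * ?a * p)" by (rule sq.conj_nexp[OF pp(2,1) nil, symmetric])
    also have "p' * ?a * p = smq t (S.XF \<alpha>)" unfolding XF m_def by simp
    finally have "Mx (matrix_inv P ** mat_exp (mat t ** \<pi> (x \<alpha>)) ** P) = S.xg \<alpha> t" unfolding S.nexp_XF[OF \<alpha>] .
    then show ?thesis by (metis Mx_inverse')
  qed
  have CG: "complex_chevalley_group \<Phi> \<pi> x P = mx ` S.Gc"
  proof (intro equalityI subsetI)
    fix g assume "g \<in> complex_chevalley_group \<Phi> \<pi> x P"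
    then show "g \<in> mx ` S.Gc"
    proof (induction rule: complex_chevalley_group.induct)
      case one
      then show ?case using S.Gc.one mx_1 by (metis image_eqI)
    next
      case (step \<alpha> g t)
      then obtain h where "g = mx h" "h \<in> S.Gc" by blast
      then show ?case unfolding gen[OF step(1)] using S.Gc.step[OF step(1), of h t]
        by (simp add: mx_mult[symmetric])
    qed
  next
    fix g assume "g \<in> mx ` S.Gc"
    then obtain h where h: "g = mx h" "h \<in> S.Gc" by blast
    have "mx h \<in> complex_chevalley_group \<Phi> \<pi> x P"
      using h(2)
    proof (induction rule: S.Gc.induct)
      case one
      show ?case unfolding mx_1 by (rule complex_chevalley_group.one)
    next
      case (step \<alpha> h t)
      show ?case unfolding mx_mult gen[OF step(1), symmetric]
        by (rule complex_chevalley_group.step[OF step(1,3)])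
    qed
    then show "g \<in> complex_chevalley_group \<Phi> \<pi> x P" unfolding h(1) .
  qed
  have van: "(\<forall>g\<in>complex_chevalley_group \<Phi> \<pi> x P. eval_entry_poly q g = 0) \<longleftrightarrow> S.vanishing q" for q
    unfolding CG S.vanishing_def eep_def by simp
  have "chevalley_group \<Phi> \<pi> x P R = mx ` S.GR R" for R :: "'f set"
  proof (intro equalityI subsetI)
    fix A assume "A \<in> chevalley_group \<Phi> \<pi> x P R"
    then have "Mx A \<in> S.GR R" unfolding chevalley_group_def van S.GR_def ent_def eep_def by simp
    then show "A \<in> mx ` S.GR R" by (metis Mx_inverse' image_eqI)
  next
    fix A assume "A \<in> mx ` S.GR R"
    then show "A \<in> chevalley_group \<Phi> \<pi> x P R"
      unfolding chevalley_group_def van S.GR_def ent_def eep_def by auto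
  qed
  then show ?thesis using that[OF sys] by blast
qed

section \<open>Algebraic integers form a ring\<close>

text \<open>The ideal generated by all values has a nonzero element g of least absolute value,
  unless it is zero. It involves finitely many values, and division with remainder shows that g
  divides each value.\<close>

lemma ex_int_combination:
  fixes a :: "nat \<Rightarrow> int"
  shows "\<exists>K. \<forall>k. \<exists>c. a k = (\<Sum>i<K. c i * a i)"
proof -
  define J where "J = {x. \<exists>K c. x = (\<Sum>i<K::nat. c i * a i)}"
  have aJ: "a k \<in> J" for k
  proof -
    have "a k = (\<Sum>i<Suc k. (if i = k then 1 else 0) * a i)" by simp
    then show ?thesis unfolding J_def mem_Collect_eq by (intro exI)
  qed
  show ?thesis
  proof (cases "\<exists>x\<in>J. x \<noteq> 0")
    case False
    then have "a k = 0" for k using aJ by blast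
    then show ?thesis by (intro exI[of _ 0]) simp
  next
    case True
    define d where "d = (LEAST d. \<exists>x\<in>J. x \<noteq> 0 \<and> nat \<bar>x\<bar> = d)"
    have "\<exists>x\<in>J. x \<noteq> 0 \<and> nat \<bar>x\<bar> = d" unfolding d_def by (rule LeastI_ex) (use True in blast)
    then obtain g where g: "g \<in> J" "g \<noteq> 0" "nat \<bar>g\<bar> = d" by blast
    have least: "d \<le> nat \<bar>x\<bar>" if "x \<in> J" "x \<noteq> 0" for x
      unfolding d_def by (rule Least_le) (use that in blast)
    obtain K c where K: "g = (\<Sum>i<K. c i * a i)" using g(1) unfolding J_def by blast
    have "g dvd a k" for k
    proof (rule ccontr)
      assume n: "\<not> g dvd a k"
      define L where "L = max K (Suc k)"
      have "(\<Sum>i<K. c i * a i) = (\<Sum>i<L. (if i < K then c i else 0) * a i)"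
        by (rule sum.mono_neutral_cong_left) (auto simp: L_def)
      moreover have "a k = (\<Sum>i<L. if i = k then a i else 0)" by (simp add: L_def)
      ultimately have "a k - a k div g * g = (\<Sum>i<L. if i = k then a i else 0) - a k div g * (\<Sum>i<L. (if i < K then c i else 0) * a i)"
        using K by simp
      also have "\<dots> = (\<Sum>i<L. ((if i = k then 1 else 0) - a k div g * (if i < K then c i else 0)) * a i)"
        unfolding sum_distrib_left sum_subtractf[symmetric] by (intro sum.cong refl) (simp add: algebra_simps)
      finally have "a k mod g = (\<Sum>i<L. ((if i = k then 1 else 0) - a k div g * (if i < K then c i else 0)) * a i)"
        unfolding minus_div_mult_eq_mod .
      then have "a k mod g \<in> J" unfolding J_def mem_Collect_eq by (intro exI)
      moreover have "a k mod g \<noteq> 0" using n by (simp add: dvd_eq_mod_eq_0)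
      ultimately have "d \<le> nat \<bar>a k mod g\<bar>" by (rule least)
      moreover have "\<bar>a k mod g\<bar> < \<bar>g\<bar>" using g(2) by (rule abs_mod_less)
      ultimately show False using g(3) by linarith
    qed
    have "\<exists>c. a k = (\<Sum>i<K. c i * a i)" for k
    proof -
      obtain q where "a k = g * q" using \<open>g dvd a k\<close> by (rule dvdE)
      then have "a k = (\<Sum>i<K. (q * c i) * a i)" unfolding K by (simp add: sum_distrib_left mult.commute mult.left_commute)
      then show ?thesis by (rule exI[of _ "\<lambda>i. q * c i"])
    qed
    then show ?thesis by (intro exI[of _ K]) blast
  qed
qed

lemma sum_lessThan_add: "(\<Sum>i<m + n. f i) = (\<Sum>i<m. f i) + (\<Sum>i<n. f (m + i :: nat) :: 'a::comm_monoid_add)"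
  by (induction n) (simp_all add: add.assoc)

text \<open>The noetherian property of a free module of finite rank over the integers, for
  sequences. In the step the first K vectors clear the coordinate \<open>j0\<close> in all later
  ones, and the induction hypothesis is applied to the cleared vectors.\<close>

lemma ex_int_vector_combination:
  fixes v :: "nat \<Rightarrow> 'j \<Rightarrow> int"
  assumes "finite J"
  shows "\<exists>k c. \<forall>j\<in>J. v k j = (\<Sum>i<k. c i * v i j)"
  using assms
proof (induction J arbitrary: v rule: finite_induct)
  case (insert j0 J)
  from ex_int_combination[of "\<lambda>k. v k j0"] obtain K where "\<forall>k. \<exists>c. v k j0 = (\<Sum>i<K. c i * v i j0)" ..
  from choice[OF this] obtain c where c: "\<forall>k. v k j0 = (\<Sum>i<K. c k i * v i j0)" ..
  define u where "u l j = v (K + l) j - (\<Sum>i<K. c (K + l) i * v i j)" for l j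
  from insert.IH[of u] obtain l b where lb: "\<forall>j\<in>J. u l j = (\<Sum>i<l. b i * u i j)" by (elim exE)
  have u0: "u i j0 = 0" for i unfolding u_def by (simp only: c[rule_format, of "K + i"] diff_self)
  have lb': "u l j = (\<Sum>i<l. b i * u i j)" if "j \<in> insert j0 J" for j
    using that lb u0 by auto
  define e where "e i = (if i < K then c (K + l) i - (\<Sum>h<l. b h * c (K + h) i) else b (i - K))" for i
  have "v (K + l) j = (\<Sum>i<K + l. e i * v i j)" if j: "j \<in> insert j0 J" for j
  proof -
    have "v (K + l) j = (\<Sum>i<K. c (K + l) i * v i j) + (\<Sum>h<l. b h * (v (K + h) j - (\<Sum>i<K. c (K + h) i * v i j)))"
      using lb'[OF j] unfolding u_def by simp
    also have "(\<Sum>h<l. b h * (v (K + h) j - (\<Sum>i<K. c (K + h) i * v i j))) =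
        (\<Sum>h<l. b h * v (K + h) j) - (\<Sum>h<l. \<Sum>i<K. b h * c (K + h) i * v i j)"
      by (simp add: right_diff_distrib sum_subtractf sum_distrib_left mult.assoc)
    also have "(\<Sum>h<l. \<Sum>i<K. b h * c (K + h) i * v i j) = (\<Sum>i<K. (\<Sum>h<l. b h * c (K + h) i) * v i j)"
      by (subst sum.swap) (simp add: sum_distrib_right)
    also have "(\<Sum>i<K. c (K + l) i * v i j) + ((\<Sum>h<l. b h * v (K + h) j) - (\<Sum>i<K. (\<Sum>h<l. b h * c (K + h) i) * v i j))
        = (\<Sum>i<K. e i * v i j) + (\<Sum>h<l. e (K + h) * v (K + h) j)"
      by (simp add: e_def left_diff_distrib sum_subtractf)
    also have "\<dots> = (\<Sum>i<K + l. e i * v i j)"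
      by (rule sum_lessThan_add[symmetric])
    finally show ?thesis .
  qed
  then have "\<forall>j\<in>insert j0 J. v (K + l) j = (\<Sum>i<K + l. e i * v i j)" by (rule ballI)
  then show ?case by (intro exI)
qed simp

interpretation zmod: module "\<lambda>(z::int) (x::'a::comm_ring_1). of_int z * x"
  by unfold_locales (auto simp: algebra_simps)

text \<open>The coordinates of the powers form a sequence of integer vectors, so some power is an
  integral combination of the earlier ones. This is a monic equation for w.\<close>

lemma algebraic_int_if_powers_in_span:
  fixes w :: "'a::field_char_0"
  assumes fin: "finite B" and w: "\<And>i. w ^ i \<in> zmod.span B"
  shows "algebraic_int w"
proof -
  have "\<exists>u. w ^ i = (\<Sum>b\<in>B. of_int (u b) * b)" for i
    using w[of i] unfolding zmod.span_finite[OF fin] by (rule rangeE) (rule exI)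
  then have "\<forall>i. \<exists>u. w ^ i = (\<Sum>b\<in>B. of_int (u b) * b)" by (rule allI)
  from choice[OF this] obtain v where "\<forall>i. w ^ i = (\<Sum>b\<in>B. of_int (v i b) * b)" ..
  then have v: "w ^ i = (\<Sum>b\<in>B. of_int (v i b) * b)" for i by (rule spec)
  from ex_int_vector_combination[OF fin, of v]
  obtain k c where kc: "\<forall>b\<in>B. v k b = (\<Sum>i<k. c i * v i b)" by (elim exE)
  have "w ^ k = (\<Sum>b\<in>B. of_int (\<Sum>i<k. c i * v i b) * b)" unfolding v by (intro sum.cong refl) (simp add: kc)
  also have "\<dots> = (\<Sum>b\<in>B. \<Sum>i<k. of_int (c i) * (of_int (v i b) * b))"
    by (simp only: of_int_sum of_int_mult sum_distrib_right mult.assoc)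
  also have "\<dots> = (\<Sum>i<k. \<Sum>b\<in>B. of_int (c i) * (of_int (v i b) * b))" by (rule sum.swap)
  also have "\<dots> = (\<Sum>i<k. of_int (c i) * w ^ i)" by (simp only: v sum_distrib_left)
  finally have wk: "w ^ k = (\<Sum>i<k. of_int (c i) * w ^ i)" .
  define p where "p = monom 1 k - (\<Sum>i<k. monom (of_int (c i)) i :: 'a poly)"
  have cp: "coeff p n = (if n = k then 1 else 0) - (if n < k then of_int (c n) else 0)" for n
    unfolding p_def by (simp add: coeff_sum)
  have "poly p w = 0" unfolding p_def using wk by (simp add: poly_monom poly_sum)
  moreover have "degree p = k"
    by (rule antisym[OF degree_le le_degree]) (auto simp: cp)
  then have "lead_coeff p = 1" by (simp add: cp)
  moreover have "coeff p n \<in> \<int>" for n by (simp add: cp)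
  ultimately show ?thesis by (intro algebraic_int.intros[of p]) auto
qed

lemma algebraic_int_power_reduction:
  assumes "algebraic_int (x :: 'a::field_char_0)"
  obtains m c where "x ^ m = (\<Sum>i<m. of_int (c i) * x ^ i)"
proof -
  obtain p where p: "poly p x = 0" "lead_coeff p = 1" "\<And>i. coeff p i \<in> \<int>"
    using assms by (auto elim: algebraic_int.cases)
  have "\<forall>i. \<exists>c. coeff p i = of_int c" using p(3) by (auto elim: Ints_cases)
  then obtain c where c: "\<And>i. coeff p i = of_int (c i)" by metis
  have "(\<Sum>i<degree p. coeff p i * x ^ i) + x ^ degree p = 0"
    using p(1,2) unfolding poly_altdef by (simp add: lessThan_Suc_atMost[symmetric])
  then have "x ^ degree p = (\<Sum>i<degree p. of_int (- c i) * x ^ i)"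
    by (simp add: c sum_negf eq_neg_iff_add_eq_0 add.commute)
  then show ?thesis by (rule that)
qed

text \<open>The products x^i y^j with exponents below the two degrees span a group that is preserved
  by multiplication with x and with y. It therefore contains all powers of the sum and of the
  product.\<close>

lemma algebraic_int_add_mult:
  fixes x y :: "'a::field_char_0"
  assumes x: "algebraic_int x" and y: "algebraic_int y"
  shows "algebraic_int (x + y)" "algebraic_int (x * y)"
proof -
  obtain m c where m: "x ^ m = (\<Sum>i<m. of_int (c i) * x ^ i)" by (rule algebraic_int_power_reduction[OF x])
  obtain n d where n: "y ^ n = (\<Sum>i<n. of_int (d i) * y ^ i)" by (rule algebraic_int_power_reduction[OF y])
  \<comment> \<open>Degree 0 would equate 1 with the empty sum.\<close>
  have m0: "m > 0" and n0: "n > 0" using m n by (auto intro!: gr0I)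
  define B where "B = (\<lambda>(i, j). x ^ i * y ^ j) ` ({..<m} \<times> {..<n})"
  have B: "x ^ i * y ^ j \<in> zmod.span B" if "i < m" "j < n" for i j
    by (rule zmod.span_base) (use that in \<open>force simp: B_def\<close>)
  have mul: "z * u \<in> zmod.span B" if "u \<in> zmod.span B" "\<And>b. b \<in> B \<Longrightarrow> z * b \<in> zmod.span B" for z u
    using that(1)
  proof (induction rule: zmod.span_induct_alt)
    case (step a b u)
    then show ?case
      using zmod.span_add[OF zmod.span_scale[OF that(2)[OF step(1)], of a] step(2)] by (simp add: algebra_simps)
  qed (simp add: zmod.span_zero)
  have mx: "x * u \<in> zmod.span B" if "u \<in> zmod.span B" for u
  proof (rule mul[OF that])
    fix b assume "b \<in> B"
    then obtain i j where ij: "b = x ^ i * y ^ j" "i < m" "j < n" unfolding B_def by auto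
    show "x * b \<in> zmod.span B"
    proof (cases "Suc i < m")
      case True
      then show ?thesis using B[of "Suc i" j] ij by (simp add: mult.assoc)
    next
      case False
      then have im: "m = Suc i" using ij(2) by simp
      have "x * b = x ^ m * y ^ j" unfolding im ij(1) by (simp add: mult.assoc)
      also have "\<dots> = (\<Sum>i<m. of_int (c i) * (x ^ i * y ^ j))" unfolding m by (simp add: sum_distrib_right mult.assoc)
      also have "\<dots> \<in> zmod.span B" using B ij(3) by (intro zmod.span_sum zmod.span_scale) auto
      finally show ?thesis .
    qed
  qed
  have my: "y * u \<in> zmod.span B" if "u \<in> zmod.span B" for u
  proof (rule mul[OF that])
    fix b assume "b \<in> B"
    then obtain i j where ij: "b = x ^ i * y ^ j" "i < m" "j < n" unfolding B_def by auto
    show "y * b \<in> zmod.span B"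
    proof (cases "Suc j < n")
      case True
      then show ?thesis using B[of i "Suc j"] ij by (simp add: mult.left_commute)
    next
      case False
      then have jn: "n = Suc j" using ij(3) by simp
      have "y * b = x ^ i * y ^ n" unfolding jn ij(1) by (simp add: mult.left_commute)
      also have "\<dots> = (\<Sum>j<n. of_int (d j) * (x ^ i * y ^ j))" unfolding n by (simp add: sum_distrib_left mult.left_commute)
      also have "\<dots> \<in> zmod.span B" using B ij(2) by (intro zmod.span_sum zmod.span_scale) auto
      finally show ?thesis .
    qed
  qed
  have 1: "1 \<in> zmod.span B" using B[OF m0 n0] by simp
  have fin: "finite B" unfolding B_def by simp
  have "(x + y) ^ i \<in> zmod.span B" for i
    by (induction i) (auto simp: 1 distrib_right intro: zmod.span_add mx my)
  then show "algebraic_int (x + y)" by (rule algebraic_int_if_powers_in_span[OF fin])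
  have "(x * y) ^ i \<in> zmod.span B" for i
    by (induction i) (auto simp: 1 mult.assoc intro: mx my)
  then show "algebraic_int (x * y)" by (rule algebraic_int_if_powers_in_span[OF fin])
qed

lemma subring_ring_of_integers: "subring (ring_of_integers :: 'a::field_char_0 set)"
  unfolding subring_def ring_of_integers_def by (auto intro: algebraic_int_add_mult algebraic_int_minus)

section \<open>The Hilbert basis theorem\<close>

text \<open>Combinations of elements of \<open>A\<close> with coefficients in \<open>S\<close>,
  inside an ambient ring. Working relative to a subset lets indeterminates be adjoined one at a time
  within a single type of polynomials.\<close>

inductive_set lin :: "'a::comm_ring_1 set \<Rightarrow> 'a set \<Rightarrow> 'a set" for S A where
  zero: "0 \<in> lin S A"
| step: "c \<in> S \<Longrightarrow> a \<in> A \<Longrightarrow> u \<in> lin S A \<Longrightarrow> c * a + u \<in> lin S A"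

lemma lin_add: "u \<in> lin S A \<Longrightarrow> v \<in> lin S A \<Longrightarrow> u + v \<in> lin S A"
  by (induction rule: lin.induct) (auto simp: add.assoc intro: lin.step)


lemma lin_scale: assumes S: "subring S" and c: "c \<in> S" and u: "u \<in> lin S A" shows "c * u \<in> lin S A"
  using u
proof (induction rule: lin.induct)
  case (step d a u)
  have "(c * d) * a + c * u \<in> lin S A"
    using step c by (intro lin.step subring_closed(4)[OF S]) auto
  then show ?case by (simp add: distrib_left mult.assoc)
qed (simp add: lin.zero)

lemma lin_diff: assumes S: "subring S" and u: "u \<in> lin S A" and v: "v \<in> lin S A" shows "u - v \<in> lin S A"
proof -
  have "- 1 \<in> S" using subring_closed(1,5)[OF S] by blast
  from lin_add[OF u lin_scale[OF S this v]] show ?thesis by simp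
qed

lemma lin_base: assumes S: "subring S" and a: "a \<in> A" shows "a \<in> lin S A"
  using lin.step[OF subring_closed(1)[OF S] a lin.zero] by simp

lemma lin_subset: assumes S: "subring S" and A: "A \<subseteq> lin S B" shows "lin S A \<subseteq> lin S B"
proof
  fix u assume "u \<in> lin S A"
  then show "u \<in> lin S B"
  proof (induction rule: lin.induct)
    case (step c a u)
    then have "a \<in> lin S B" using A by blast
    from lin_add[OF lin_scale[OF S step(1) this] step(4)] show ?case .
  qed (rule lin.zero)
qed

lemma lin_mono: "A \<subseteq> B \<Longrightarrow> lin S A \<subseteq> lin S B"
proof
  fix u assume AB: "A \<subseteq> B" and "u \<in> lin S A"
  from this(2) show "u \<in> lin S B"
  proof (induction rule: lin.induct)
    case (step c a u)
    then show ?case using AB by (intro lin.step) auto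
  qed (rule lin.zero)
qed

text \<open>The ascending chain condition for ideals, phrased by sequences: some element depends on
  its predecessors.\<close>

definition noetherian :: "'a::comm_ring_1 set \<Rightarrow> bool" where
  "noetherian S \<longleftrightarrow> (\<forall>f::nat \<Rightarrow> 'a. range f \<subseteq> S \<longrightarrow> (\<exists>n. f n \<in> lin S (f ` {..<n})))"

text \<open>Dependent choice where the condition on the next element involves the set of all earlier
  ones.\<close>

lemma ex_sequence:
  assumes "\<And>A. finite A \<Longrightarrow> \<exists>x. Q A x"
  shows "\<exists>f :: nat \<Rightarrow> 'a. \<forall>n. Q (f ` {..<n}) (f n)"
proof -
  define g where "g = rec_nat {} (\<lambda>_ A. insert (SOME x. Q A x) A)"
  define f where "f n = (SOME x. Q (g n) x)" for n
  have g: "f ` {..<n} = g n" for n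
    by (induction n) (auto simp: g_def f_def lessThan_Suc)
  have "Q (f ` {..<n}) (f n)" for n
    unfolding f_def[of n] g by (rule someI_ex) (rule assms, simp add: g[symmetric])
  then show ?thesis by blast
qed

lemma noetherian_finite_basis:
  assumes N: "noetherian S" and A: "A \<subseteq> S"
  shows "\<exists>B. finite B \<and> B \<subseteq> A \<and> A \<subseteq> lin S B"
proof (rule ccontr)
  assume n: "\<nexists>B. finite B \<and> B \<subseteq> A \<and> A \<subseteq> lin S B"
  then have "\<exists>x. B \<subseteq> A \<longrightarrow> x \<in> A \<and> x \<notin> lin S B" if "finite B" for B using that by blast
  from ex_sequence[where Q = "\<lambda>B x. B \<subseteq> A \<longrightarrow> x \<in> A \<and> x \<notin> lin S B", OF this]
  obtain f :: "nat \<Rightarrow> 'a" where f: "\<forall>n. f ` {..<n} \<subseteq> A \<longrightarrow> f n \<in> A \<and> f n \<notin> lin S (f ` {..<n})" ..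
  have fA: "f n \<in> A" for n
  proof (induction n rule: less_induct)
    case (less n)
    then have "f ` {..<n} \<subseteq> A" by auto
    then show ?case using f by blast
  qed
  then have "range f \<subseteq> S" using A by blast
  then obtain n where "f n \<in> lin S (f ` {..<n})" using N unfolding noetherian_def by blast
  moreover have "f ` {..<n} \<subseteq> A" using fA by blast
  ultimately show False using f by blast
qed

text \<open>\<open>pdeg S y d\<close> is the set of polynomials in \<open>y\<close> of degree less than \<open>d\<close> with coefficients in \<open>S\<close>.\<close>

primrec pdeg :: "'a::comm_ring_1 set \<Rightarrow> 'a \<Rightarrow> nat \<Rightarrow> 'a set" where
  "pdeg S y 0 = {0}"
| "pdeg S y (Suc d) = {u + a * y ^ d | u a. u \<in> pdeg S y d \<and> a \<in> S}"

definition adjoin :: "'a::comm_ring_1 set \<Rightarrow> 'a \<Rightarrow> 'a set" where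
  "adjoin S y = (\<Union>d. pdeg S y d)"

context
  fixes S :: "'a::comm_ring_1 set" and y :: 'a
  assumes S: "subring S"
begin

lemma pdeg_SucI: "u \<in> pdeg S y d \<Longrightarrow> a \<in> S \<Longrightarrow> u + a * y ^ d \<in> pdeg S y (Suc d)"
  by auto

lemma pdeg_zero: "0 \<in> pdeg S y d"
proof (induction d)
  case (Suc d)
  from pdeg_SucI[OF Suc subring_closed(2)[OF S]] show ?case by (simp del: pdeg.simps)
qed simp

lemma pdeg_Suc: "u \<in> pdeg S y d \<Longrightarrow> u \<in> pdeg S y (Suc d)"
  using pdeg_SucI[OF _ subring_closed(2)[OF S], of u d] by (simp del: pdeg.simps)

lemma pdeg_mono: "d \<le> e \<Longrightarrow> u \<in> pdeg S y d \<Longrightarrow> u \<in> pdeg S y e"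
  by (induction e rule: dec_induct) (auto intro: pdeg_Suc simp del: pdeg.simps)

lemma pdeg_add: "u \<in> pdeg S y d \<Longrightarrow> v \<in> pdeg S y d \<Longrightarrow> u + v \<in> pdeg S y d"
proof (induction d arbitrary: u v)
  case (Suc d)
  obtain u' a where u: "u = u' + a * y ^ d" "u' \<in> pdeg S y d" "a \<in> S" using Suc.prems(1) by auto
  obtain v' b where v: "v = v' + b * y ^ d" "v' \<in> pdeg S y d" "b \<in> S" using Suc.prems(2) by auto
  have "u + v = (u' + v') + (a + b) * y ^ d" unfolding u(1) v(1) by (simp add: algebra_simps)
  then show ?case using Suc.IH[OF u(2) v(2)] subring_closed(3)[OF S u(3) v(3)] by auto
qed simp

lemma pdeg_scale: "c \<in> S \<Longrightarrow> u \<in> pdeg S y d \<Longrightarrow> c * u \<in> pdeg S y d"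
proof (induction d arbitrary: u)
  case (Suc d)
  obtain u' a where u: "u = u' + a * y ^ d" "u' \<in> pdeg S y d" "a \<in> S" using Suc.prems(2) by auto
  have "c * u = c * u' + (c * a) * y ^ d" unfolding u(1) by (simp add: algebra_simps)
  then show ?case using Suc.IH[OF Suc.prems(1) u(2)] subring_closed(4)[OF S Suc.prems(1) u(3)] by auto
qed simp

lemma pdeg_diff: "u \<in> pdeg S y d \<Longrightarrow> v \<in> pdeg S y d \<Longrightarrow> u - v \<in> pdeg S y d"
  using pdeg_add[of u d "- 1 * v"] pdeg_scale[of "- 1" v d] subring_closed(1,5)[OF S] by simp

lemma pdeg_shift: "u \<in> pdeg S y d \<Longrightarrow> y ^ k * u \<in> pdeg S y (d + k)"
proof (induction d arbitrary: u)
  case (Suc d)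
  obtain u' a where u: "u = u' + a * y ^ d" "u' \<in> pdeg S y d" "a \<in> S" using Suc.prems by auto
  have "y ^ k * u = y ^ k * u' + a * y ^ (d + k)" unfolding u(1) by (simp add: algebra_simps power_add)
  then show ?case using Suc.IH[OF u(2)] u(3) by auto
next
  case 0
  then show ?case using pdeg_zero by simp
qed

lemma adjoin_add: "u \<in> adjoin S y \<Longrightarrow> v \<in> adjoin S y \<Longrightarrow> u + v \<in> adjoin S y"
proof -
  assume "u \<in> adjoin S y" "v \<in> adjoin S y"
  then obtain d e where "u \<in> pdeg S y d" "v \<in> pdeg S y e" unfolding adjoin_def by blast
  then have "u \<in> pdeg S y (max d e)" "v \<in> pdeg S y (max d e)" using pdeg_mono by (meson max.cobounded1 max.cobounded2)+
  from pdeg_add[OF this] show ?thesis unfolding adjoin_def by blast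
qed

lemma adjoin_scale: "c \<in> S \<Longrightarrow> u \<in> adjoin S y \<Longrightarrow> c * u \<in> adjoin S y"
  unfolding adjoin_def using pdeg_scale by blast

lemma adjoin_shift: "u \<in> adjoin S y \<Longrightarrow> y ^ k * u \<in> adjoin S y"
  unfolding adjoin_def using pdeg_shift by blast

lemma adjoin_mult: "u \<in> adjoin S y \<Longrightarrow> v \<in> adjoin S y \<Longrightarrow> u * v \<in> adjoin S y"
proof -
  assume "u \<in> adjoin S y" and v: "v \<in> adjoin S y"
  then obtain d where "u \<in> pdeg S y d" unfolding adjoin_def by blast
  then show ?thesis
  proof (induction d arbitrary: u)
    case 0
    then show ?case using pdeg_zero unfolding adjoin_def by auto
  next
    case (Suc d)
    obtain u' a where u: "u = u' + a * y ^ d" "u' \<in> pdeg S y d" "a \<in> S" using Suc.prems by auto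
    have "u' * v + a * (y ^ d * v) \<in> adjoin S y"
      by (intro adjoin_add Suc.IH u adjoin_scale adjoin_shift v)
    then show ?case unfolding u(1) by (simp add: algebra_simps)
  qed
qed

lemma subset_adjoin: "S \<subseteq> adjoin S y"
proof
  fix a assume "a \<in> S"
  then have "a \<in> pdeg S y 1" by auto
  then show "a \<in> adjoin S y" unfolding adjoin_def by blast
qed

lemma in_adjoin: "y \<in> adjoin S y"
proof -
  have "1 \<in> adjoin S y" using subset_adjoin subring_closed(1)[OF S] by blast
  from adjoin_shift[OF this, of 1] show ?thesis by simp
qed

lemma subring_adjoin: "subring (adjoin S y)"
proof -
  have "- 1 * u \<in> adjoin S y" if "u \<in> adjoin S y" for u
    by (rule adjoin_scale[OF _ that]) (intro subring_closed[OF S])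
  then show ?thesis
    unfolding subring_def using subset_adjoin subring_closed(1)[OF S] adjoin_add adjoin_mult by auto
qed

text \<open>Hilbert's argument: elements of an ideal are chosen of least degree outside the span of
  the earlier choices, and a dependence among their leading coefficients in \<open>S\<close> lowers
  the degree of one of them. As y may satisfy relations over \<open>S\<close>, the degree of an
  element is measured by its shortest expression in y.\<close>

theorem noetherian_adjoin:
  assumes N: "noetherian S"
  shows "noetherian (adjoin S y)"
proof (rule ccontr)
  let ?T = "adjoin S y"
  note T = subring_adjoin
  assume "\<not> noetherian ?T"
  then obtain f :: "nat \<Rightarrow> 'a" where fT: "range f \<subseteq> ?T" and fn: "\<And>n. f n \<notin> lin ?T (f ` {..<n})"
    unfolding noetherian_def by blast
  define I where "I = lin ?T (range f)"
  have IT: "u \<in> ?T" if "u \<in> I" for u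
    using that unfolding I_def
  proof (induction rule: lin.induct)
    case (step c a u)
    then show ?case using fT by (intro adjoin_add adjoin_mult) auto
  qed (rule subring_closed(2)[OF T])
  \<comment> \<open>A finite subset of \<open>I\<close> lies in the span of finitely many values of
    f, and the next value escapes this span.\<close>
  have I_proper: "\<exists>x\<in>I. x \<notin> lin ?T A" if "finite A" "A \<subseteq> I" for A
  proof -
    have "\<exists>n. u \<in> lin ?T (f ` {..<n})" if "u \<in> I" for u
      using that unfolding I_def
    proof (induction rule: lin.induct)
      case (step c a u)
      then obtain n m where nm: "u \<in> lin ?T (f ` {..<n})" "a = f m" by blast
      have "u \<in> lin ?T (f ` {..<max n (Suc m)})"
        by (rule subsetD[OF lin_mono nm(1)]) auto
      from lin.step[OF step(1) _ this, of a] nm(2) show ?case by auto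
    qed (use lin.zero in blast)
    then have "\<forall>u\<in>I. \<exists>n. u \<in> lin ?T (f ` {..<n})" by (rule ballI)
    from bchoice[OF this] obtain N where N: "\<forall>u\<in>I. u \<in> lin ?T (f ` {..<N u})" ..
    define n where "n = Max (insert 0 (N ` A))"
    have "A \<subseteq> lin ?T (f ` {..<n})"
    proof
      fix u assume u: "u \<in> A"
      then have "N u \<le> n" unfolding n_def using that(1) by (intro Max_ge) auto
      then have "f ` {..<N u} \<subseteq> f ` {..<n}" by auto
      then show "u \<in> lin ?T (f ` {..<n})" using N u that(2) lin_mono by blast
    qed
    then have "f n \<notin> lin ?T A" using fn[of n] lin_subset[OF T] by blast
    moreover have "f n \<in> I" unfolding I_def by (intro lin_base[OF T]) simp
    ultimately show ?thesis by blast
  qed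
  define dg where "dg u = (LEAST d. u \<in> pdeg S y d)" for u
  have dg: "u \<in> pdeg S y (dg u)" if "u \<in> I" for u
    unfolding dg_def by (rule LeastI_ex) (use IT[OF that] in \<open>simp add: adjoin_def\<close>)
  have dg_le: "dg u \<le> d" if "u \<in> pdeg S y d" for u d unfolding dg_def by (rule Least_le[where P="\<lambda>d. u \<in> pdeg S y d", OF that])
  \<comment> \<open>The guard \<open>A \<subseteq> I\<close> makes the choice possible for every
    finite set; along the sequence it is always met.\<close>
  define Q where "Q A x \<longleftrightarrow> (A \<subseteq> I \<longrightarrow> x \<in> I \<and> x \<notin> lin ?T A \<and> (\<forall>z\<in>I. z \<notin> lin ?T A \<longrightarrow> dg x \<le> dg z))" for A x
  have "\<exists>x. Q A x" if A: "finite A" for A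
  proof (cases "A \<subseteq> I")
    case True
    then obtain x0 where "x0 \<in> I \<and> x0 \<notin> lin ?T A" using I_proper[OF A] by blast
    from ex_has_least_nat[where P = "\<lambda>x. x \<in> I \<and> x \<notin> lin ?T A" and m = dg, OF this]
    show ?thesis unfolding Q_def by blast
  qed (auto simp: Q_def)
  from ex_sequence[where Q = Q, OF this]
  obtain g :: "nat \<Rightarrow> 'a" where gQ: "\<forall>n. Q (g ` {..<n}) (g n)" ..
  have gI: "g n \<in> I" for n
  proof (induction n rule: less_induct)
    case (less n)
    then have "g ` {..<n} \<subseteq> I" by auto
    then show ?case using gQ[rule_format, of n] unfolding Q_def by blast
  qed
  then have gI': "g ` {..<n} \<subseteq> I" for n by blast
  have gn: "g n \<notin> lin ?T (g ` {..<n})" and g_min: "\<And>z. z \<in> I \<Longrightarrow> z \<notin> lin ?T (g ` {..<n}) \<Longrightarrow> dg (g n) \<le> dg z" for n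
    using gQ[rule_format, of n] gI'[of n] unfolding Q_def by blast+
  have D_mono: "dg (g i) \<le> dg (g n)" if "i \<le> n" for i n
  proof (rule g_min[OF gI])
    have "lin ?T (g ` {..<i}) \<subseteq> lin ?T (g ` {..<n})" using that by (intro lin_mono) auto
    then show "g n \<notin> lin ?T (g ` {..<i})" using gn by blast
  qed
  \<comment> \<open>\<open>dg\<close> is an exclusive bound, so the leading term has degree d. The
    bound 0 would mean the element 0, which lies in every span.\<close>
  have "\<exists>d u a. dg (g n) = Suc d \<and> g n = u + a * y ^ d \<and> u \<in> pdeg S y d \<and> a \<in> S" for n
  proof (cases "dg (g n)")
    case 0
    then have "g n = 0" using dg[OF gI, of n] by simp
    then have False using gn[of n] lin.zero[of ?T "g ` {..<n}"] by simp
    then show ?thesis ..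
  next
    case (Suc d)
    then show ?thesis using dg[OF gI, of n] by auto
  qed
  then obtain d u a where da: "\<And>n. dg (g n) = Suc (d n)" "\<And>n. g n = u n + a n * y ^ d n"
      "\<And>n. u n \<in> pdeg S y (d n)" "\<And>n. a n \<in> S" by metis
  have "range a \<subseteq> S" using da(4) by blast
  then obtain n where n: "a n \<in> lin S (a ` {..<n})" using N unfolding noetherian_def by blast
  \<comment> \<open>A dependence of leading coefficients lifts to a combination of the earlier
    choices. Powers of y bring their leading terms to degree \<open>d n\<close>, which is possible
    because the degrees do not decrease.\<close>
  have "\<exists>w\<in>lin ?T (g ` {..<n}). w - b * y ^ d n \<in> pdeg S y (d n)" if "b \<in> lin S (a ` {..<n})" for b
    using that
  proof (induction rule: lin.induct)
    case zero
    then show ?case using lin.zero pdeg_zero by force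
  next
    case (step c e b)
    obtain w where w: "w \<in> lin ?T (g ` {..<n})" "w - b * y ^ d n \<in> pdeg S y (d n)" using step.IH by blast
    obtain i where i: "e = a i" "i < n" using step(2) by blast
    define k where "k = d n - d i"
    have "d i \<le> d n" using D_mono[of i n] i(2) da(1) by simp
    then have k: "d n = d i + k" by (simp add: k_def)
    have "(c * y ^ k) * g i + w \<in> lin ?T (g ` {..<n})"
    proof (rule lin.step[OF _ _ w(1)])
      show "c * y ^ k \<in> ?T"
        using subset_adjoin step(1) in_adjoin by (intro subring_closed(4)[OF T] subring_closed(8)[OF T]) auto
    qed (use i(2) in auto)
    moreover have "(c * y ^ k) * g i + w - (c * e + b) * y ^ d n = c * (y ^ k * u i) + (w - b * y ^ d n)"
      unfolding da(2)[of i] i(1) k power_add by (simp add: algebra_simps)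
    moreover have "c * (y ^ k * u i) + (w - b * y ^ d n) \<in> pdeg S y (d n)"
      using pdeg_scale[OF step(1) pdeg_shift[OF da(3)[of i], of k]] w(2) pdeg_add unfolding k by blast
    ultimately show ?case by (metis (no_types))
  qed
  from this[OF n] obtain w where w: "w \<in> lin ?T (g ` {..<n})" "w - a n * y ^ d n \<in> pdeg S y (d n)" by blast
  \<comment> \<open>Subtracting w cancels the leading term of \<open>g n\<close>. The difference
    still lies outside the span but has smaller degree, against the choice of
    \<open>g n\<close>.\<close>
  have "g n - w = u n - (w - a n * y ^ d n)" unfolding da(2)[of n] by simp
  then have deg: "g n - w \<in> pdeg S y (d n)" using pdeg_diff[OF da(3)[of n] w(2)] by (simp only:)
  have wI: "w \<in> I" using w(1) lin_subset[OF T, of "g ` {..<n}" "range f"] gI' unfolding I_def by blast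
  have "g n - w \<in> I" using lin_diff[OF T] gI wI unfolding I_def by blast
  moreover have "g n - w \<notin> lin ?T (g ` {..<n})"
  proof
    assume "g n - w \<in> lin ?T (g ` {..<n})"
    from lin_add[OF this w(1)] show False using gn[of n] by simp
  qed
  ultimately have "dg (g n) \<le> dg (g n - w)" by (rule g_min)
  then show False using dg_le[OF deg] da(1)[of n] by simp
qed

end

lemma noetherian_of_int: "noetherian (range of_int :: 'a::comm_ring_1 set)"
  unfolding noetherian_def
proof (intro allI impI)
  fix f :: "nat \<Rightarrow> 'a" assume "range f \<subseteq> range of_int"
  then have "\<forall>n. \<exists>z. f n = of_int z" by blast
  from choice[OF this] obtain z where z: "\<forall>n. f n = of_int (z n)" ..
  from ex_int_combination[of z] obtain n where "\<forall>k. \<exists>c. z k = (\<Sum>i<n. c i * z i)" ..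
  from spec[OF this, of n] obtain c where c: "z n = (\<Sum>i<n. c i * z i)" ..
  have "(\<Sum>i<m. of_int (c i) * f i) \<in> lin (range of_int) (f ` {..<n})" if "m \<le> n" for m
    using that
  proof (induction m)
    case (Suc m)
    then have "of_int (c m) * f m + (\<Sum>i<m. of_int (c i) * f i) \<in> lin (range of_int) (f ` {..<n})"
      by (intro lin.step) auto
    then show ?case by (simp add: add.commute)
  qed (simp add: lin.zero)
  moreover have "f n = (\<Sum>i<n. of_int (c i) * f i)"
    unfolding z[rule_format, of n] c of_int_sum of_int_mult by (simp add: z)
  ultimately show "\<exists>n. f n \<in> lin (range of_int) (f ` {..<n})" by (metis order_refl)
qed

lemma subring_of_int: "subring (range of_int :: 'a::comm_ring_1 set)"
proof -
  have "1 \<in> (range of_int :: 'a set)" by (rule range_eqI[of _ _ 1]) simp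
  moreover have "of_int a + of_int b \<in> (range of_int :: 'a set)" "of_int a * of_int b \<in> (range of_int :: 'a set)"
    "- of_int a \<in> (range of_int :: 'a set)" for a b
    by (rule range_eqI[of _ _ "a + b"], simp, rule range_eqI[of _ _ "a * b"], simp, rule range_eqI[of _ _ "- a"], simp)
  ultimately show ?thesis unfolding subring_def by auto
qed

lemma ex_noetherian_subring: "\<exists>S. subring S \<and> noetherian S \<and> set ys \<subseteq> (S :: 'a::comm_ring_1 set)"
proof (induction ys)
  case Nil
  then show ?case using subring_of_int noetherian_of_int by auto
next
  case (Cons y ys)
  then obtain S :: "'a set" where S: "subring S" "noetherian S" "set ys \<subseteq> S" by blast
  have "set (y # ys) \<subseteq> adjoin S y" using S(3) in_adjoin[OF S(1)] subset_adjoin[OF S(1)] by auto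
  then show ?case using subring_adjoin[OF S(1)] noetherian_adjoin[OF S(1,2)] by blast
qed

text \<open>Starting from the integers, the indeterminates are adjoined one by one. The resulting
  subring contains all monomials, hence all polynomials.\<close>

lemma noetherian_entry_poly: "noetherian (UNIV :: 'n::finite entry_poly set)"
proof -
  let ?X = "\<lambda>k :: 'n \<times> 'n. Poly_Mapping.single (Poly_Mapping.single k 1) 1 :: 'n entry_poly"
  obtain ys where ys: "set ys = range ?X" using finite_list[of "range ?X"] by auto
  from ex_noetherian_subring[of ys]
  obtain S where S: "subring S" "noetherian S" "range ?X \<subseteq> S" unfolding ys by (elim exE conjE) (rule that)
  have mon: "Poly_Mapping.single m 1 \<in> S" for m :: "'n \<times> 'n \<Rightarrow>\<^sub>0 nat"
  proof (induction m rule: poly_mapping_add_induct)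
    case (1 k c)
    have "Poly_Mapping.single (Poly_Mapping.single k c) (1::int) = ?X k ^ c"
    proof (induction c)
      case (Suc c)
      have "Poly_Mapping.single (Poly_Mapping.single k (Suc c)) (1::int) = ?X k * Poly_Mapping.single (Poly_Mapping.single k c) 1"
        unfolding mult_single single_add[symmetric] by simp
      then show ?case unfolding Suc.IH by simp
    qed simp
    moreover have "?X k \<in> S" using S(3) by blast
    ultimately show ?case using subring_closed(8)[OF S(1)] by (simp only:)
  next
    case (2 f g)
    have "Poly_Mapping.single (f + g) (1::int) = Poly_Mapping.single f 1 * Poly_Mapping.single g 1" unfolding mult_single by simp
    then show ?case using subring_closed(4)[OF S(1) 2] by (simp only:)
  qed
  have "p \<in> S" for p :: "'n entry_poly"
  proof (induction p rule: poly_mapping_add_induct)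
    case (1 m c)
    have "Poly_Mapping.single m c = of_int c * Poly_Mapping.single m 1"
      unfolding single_of_int[symmetric] mult_single by simp
    then show ?case using subring_closed(4)[OF S(1) subring_closed(7)[OF S(1)] mon[of m]] by (simp only:)
  next
    case (2 f g)
    then show ?case by (rule subring_closed(3)[OF S(1)])
  qed
  then have "S = UNIV" by blast
  then show ?thesis using S(2) by simp
qed

text \<open>A finite part of Q generates the rest with polynomial coefficients, and evaluation at a
  matrix is a homomorphism.\<close>

lemma finite_equations:
  fixes Q :: "'n::finite entry_poly set"
  obtains B where "finite B" "B \<subseteq> Q"
    "\<And>A :: ('a::comm_ring_1, 'n) sqm. \<forall>p\<in>B. eep p A = 0 \<Longrightarrow> \<forall>p\<in>Q. eep p A = 0"
proof -
  obtain B where B: "finite B" "B \<subseteq> Q" "Q \<subseteq> lin UNIV B"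
    using noetherian_finite_basis[OF noetherian_entry_poly, of Q] by blast
  have "eep p A = 0" if "\<forall>p\<in>B. eep p A = 0" "p \<in> lin UNIV B" for p and A :: "('a, 'n) sqm"
    using that(2) by (induction rule: lin.induct) (use that(1) in \<open>auto simp: eep_add eep_mult rhom_0[OF rhom_eep]\<close>)
  then show ?thesis using B(3) by (intro that[OF B(1,2)]) blast
qed

section \<open>Interpreting a matrix group in the ring\<close>

text \<open>As no constants are needed, the term does not depend on the enumeration.\<close>

definition ring_fun :: "((nat \<Rightarrow> 'k::comm_ring_1) \<Rightarrow> 'k) \<Rightarrow> bool" where
  "ring_fun F \<longleftrightarrow> (\<exists>T. \<forall>R \<nu> \<rho>. wf_trm (ring_struct R) T \<and> eval_trm (ring_struct R) \<nu> \<rho> T = F \<rho>)"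

lemma
  shows ring_fun_var: "ring_fun (\<lambda>\<rho>. \<rho> i)" and ring_fun_0: "ring_fun (\<lambda>_. 0)" and ring_fun_1: "ring_fun (\<lambda>_. 1)"
proof -
  show "ring_fun (\<lambda>\<rho>. \<rho> i)" unfolding ring_fun_def by (rule exI[of _ "Var i"]) simp
  show "ring_fun (\<lambda>_. 0)" unfolding ring_fun_def by (rule exI[of _ "App 3 []"]) (simp add: ring_struct_def)
  show "ring_fun (\<lambda>_. 1)" unfolding ring_fun_def by (rule exI[of _ "App 4 []"]) (simp add: ring_struct_def)
qed

lemma
  assumes F: "ring_fun F" and G: "ring_fun G"
  shows ring_fun_add: "ring_fun (\<lambda>\<rho>. F \<rho> + G \<rho>)" and ring_fun_mult: "ring_fun (\<lambda>\<rho>. F \<rho> * G \<rho>)"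
    and ring_fun_diff: "ring_fun (\<lambda>\<rho>. F \<rho> - G \<rho>)"
proof -
  obtain T U where T: "\<forall>R \<nu> \<rho>. wf_trm (ring_struct R) T \<and> eval_trm (ring_struct R) \<nu> \<rho> T = F \<rho>"
    and U: "\<forall>R \<nu> \<rho>. wf_trm (ring_struct R) U \<and> eval_trm (ring_struct R) \<nu> \<rho> U = G \<rho>"
    using F G unfolding ring_fun_def by (elim exE)
  show "ring_fun (\<lambda>\<rho>. F \<rho> + G \<rho>)" unfolding ring_fun_def
    by (rule exI[of _ "App 0 [T, U]"]) (use T U in \<open>simp add: ring_struct_def\<close>)
  show "ring_fun (\<lambda>\<rho>. F \<rho> * G \<rho>)" unfolding ring_fun_def
    by (rule exI[of _ "App 1 [T, U]"]) (use T U in \<open>simp add: ring_struct_def\<close>)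
  show "ring_fun (\<lambda>\<rho>. F \<rho> - G \<rho>)" unfolding ring_fun_def
    by (rule exI[of _ "App 0 [T, App 2 [U]]"]) (use T U in \<open>simp add: ring_struct_def\<close>)
qed

lemma ring_fun_sum: "(\<And>i. i \<in> I \<Longrightarrow> ring_fun (F i)) \<Longrightarrow> ring_fun (\<lambda>\<rho>. \<Sum>i\<in>I. F i \<rho>)"
  by (induction I rule: infinite_finite_induct) (auto simp: ring_fun_0 intro: ring_fun_add)

lemma ring_fun_prod: "(\<And>i. i \<in> I \<Longrightarrow> ring_fun (F i)) \<Longrightarrow> ring_fun (\<lambda>\<rho>. \<Prod>i\<in>I. F i \<rho>)"
  by (induction I rule: infinite_finite_induct) (auto simp: ring_fun_1 intro: ring_fun_mult)

lemma ring_fun_power: "ring_fun F \<Longrightarrow> ring_fun (\<lambda>\<rho>. F \<rho> ^ n)"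
  by (induction n) (auto simp: ring_fun_1 intro: ring_fun_mult)

lemma ring_fun_of_int: "ring_fun (\<lambda>_. of_int m)"
proof -
  have "ring_fun (\<lambda>_. of_nat n)" for n by (induction n) (auto intro: ring_fun_0 ring_fun_1 ring_fun_add)
  then show ?thesis using ring_fun_diff[OF ring_fun_0] by (cases m rule: int_cases2) fastforce+
qed

lemma ex_ring_system:
  assumes "finite K" "\<And>k. k \<in> K \<Longrightarrow> ring_fun (F k)"
  shows "\<exists>S. \<forall>R \<nu> \<rho>. wf_system (ring_struct R) S \<and> (holds (ring_struct R) \<nu> \<rho> S \<longleftrightarrow> (\<forall>k\<in>K. F k \<rho> = 0))"
  using assms
proof (induction K rule: finite_induct)
  case empty
  show ?case by (rule exI[of _ "[]"]) (simp add: holds_def wf_system_def)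
next
  case (insert k K)
  obtain S where S: "\<forall>R \<nu> \<rho>. wf_system (ring_struct R) S \<and> (holds (ring_struct R) \<nu> \<rho> S \<longleftrightarrow> (\<forall>k\<in>K. F k \<rho> = 0))"
    using insert.IH insert.prems by (meson insertI2)
  obtain T where T: "\<forall>R \<nu> \<rho>. wf_trm (ring_struct R) T \<and> eval_trm (ring_struct R) \<nu> \<rho> T = F k \<rho>"
    using insert.prems[of k] unfolding ring_fun_def by auto
  obtain Z where Z: "\<forall>R \<nu> \<rho>. wf_trm (ring_struct R) Z \<and> eval_trm (ring_struct R) \<nu> \<rho> Z = (0 :: 'b)"
    using ring_fun_0 unfolding ring_fun_def by auto
  show ?case
    by (rule exI[of _ "(T, Z) # S"]) (use S T Z in \<open>simp add: holds_def wf_system_def\<close>)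
qed

definition mat_fun :: "((nat \<Rightarrow> 'k::comm_ring_1) \<Rightarrow> 'k^'n^'n) \<Rightarrow> bool" where
  "mat_fun U \<longleftrightarrow> (\<forall>i j. ring_fun (\<lambda>\<rho>. U \<rho> $ i $ j))"

lemma mat_fun_one: "mat_fun (\<lambda>_. mat 1)"
  unfolding mat_fun_def by (auto simp: mat_def ring_fun_0 ring_fun_1)

lemma mat_fun_mult: "mat_fun U \<Longrightarrow> mat_fun V \<Longrightarrow> mat_fun (\<lambda>\<rho>. U \<rho> ** V \<rho>)"
  unfolding mat_fun_def by (auto simp: matrix_matrix_mult_def intro!: ring_fun_sum ring_fun_mult)

lemma ring_fun_det: "mat_fun U \<Longrightarrow> ring_fun (\<lambda>\<rho>. det (U \<rho>))"
  unfolding mat_fun_def det_def by (intro ring_fun_sum ring_fun_mult ring_fun_of_int ring_fun_prod) auto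

lemma ring_fun_entry_poly: "mat_fun U \<Longrightarrow> ring_fun (\<lambda>\<rho>. eval_entry_poly p (U \<rho>))"
  unfolding mat_fun_def eval_entry_poly_def case_prod_beta
  by (intro ring_fun_sum ring_fun_mult ring_fun_of_int ring_fun_prod ring_fun_power) auto

lemma ex_matrix_equation:
  fixes U V :: "(nat \<Rightarrow> 'k::comm_ring_1) \<Rightarrow> 'k^'n^'n"
  assumes "mat_fun U" "mat_fun V"
  shows "\<exists>S. \<forall>R \<nu> \<rho>. wf_system (ring_struct R) S \<and> (holds (ring_struct R) \<nu> \<rho> S \<longleftrightarrow> U \<rho> = V \<rho>)"
proof -
  have "ring_fun (\<lambda>\<rho>. U \<rho> $ fst k $ snd k - V \<rho> $ fst k $ snd k)" for k :: "'n \<times> 'n"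
    using assms unfolding mat_fun_def by (intro ring_fun_diff) auto
  from ex_ring_system[where F = "\<lambda>(k :: 'n \<times> 'n) \<rho>. U \<rho> $ fst k $ snd k - V \<rho> $ fst k $ snd k", OF finite_class.finite_UNIV this]
  obtain S where S: "\<forall>R \<nu> \<rho>. wf_system (ring_struct R) S \<and> (holds (ring_struct R) \<nu> \<rho> S \<longleftrightarrow>
      (\<forall>k\<in>UNIV. U \<rho> $ fst k $ snd k - V \<rho> $ fst k $ snd k = 0))" by (elim exE)
  then show ?thesis by (intro exI[of _ S]) (simp add: vec_eq_iff)
qed

section \<open>Matrices as tuples of ring elements\<close>

definition ents :: "'a^'n^'n \<Rightarrow> 'a list" where
  "ents A = map (\<lambda>k. case from_nat_into UNIV k of (i, j) \<Rightarrow> A $ i $ j) [0..<CARD('n \<times> 'n)]"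

text \<open>The m-th block of variables read as a matrix, in the order of entries that
  \<open>ents\<close> uses.\<close>

definition var_matrix :: "nat \<Rightarrow> (nat \<Rightarrow> 'a) \<Rightarrow> 'a^'n^'n" where
  "var_matrix m \<rho> = (\<chi> i j. \<rho> (m * CARD('n \<times> 'n) + to_nat_on (UNIV :: ('n \<times> 'n) set) (i, j)))"

lemma to_nat_on_less: "to_nat_on (UNIV :: 'b::finite set) k < CARD('b)"
  using to_nat_on_finite[of "UNIV :: 'b set"] unfolding bij_betw_def by auto

lemma to_nat_on_from_nat: "k < CARD('b) \<Longrightarrow> to_nat_on (UNIV :: 'b::finite set) (from_nat_into UNIV k) = k"
  using to_nat_on_finite[of "UNIV :: 'b set"] by (intro to_nat_on_from_nat_into) (auto simp: bij_betw_def)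

lemma length_ents: "length (ents (A :: 'a^'n^'n)) = CARD('n \<times> 'n)" unfolding ents_def by simp

lemma ents_nth:
  "ents (A :: 'a^'n^'n) ! to_nat_on (UNIV :: ('n \<times> 'n) set) (i, j) = A $ i $ j"
  unfolding ents_def using to_nat_on_less[of "(i, j)"]
  by (simp add: from_nat_into_to_nat_on del: upt_conv_Cons)

lemma set_ents: "set (ents (A :: 'a^'n^'n)) \<subseteq> R \<longleftrightarrow> (\<forall>i j. A $ i $ j \<in> R)"
proof
  assume R: "set (ents A) \<subseteq> R"
  show "\<forall>i j. A $ i $ j \<in> R"
  proof (intro allI)
    fix i j
    have "ents A ! to_nat_on (UNIV :: ('n \<times> 'n) set) (i, j) \<in> set (ents A)"
      by (rule nth_mem) (simp only: length_ents to_nat_on_less)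
    then show "A $ i $ j \<in> R" unfolding ents_nth using R by blast
  qed
qed (auto simp: ents_def split: prod.splits)

lemma ents_surj:
  assumes "length xs = CARD('n \<times> 'n)"
  shows "\<exists>A :: 'a^'n^'n. ents A = xs"
proof
  show "ents (\<chi> i j. xs ! to_nat_on (UNIV :: ('n \<times> 'n) set) (i, j)) = xs"
    by (rule nth_equalityI)
      (use assms in \<open>auto simp: ents_def case_prod_beta to_nat_on_from_nat simp del: upt_conv_Cons\<close>)
qed

lemma ents_inject: "ents A = ents B \<longleftrightarrow> A = B"
  by (metis ents_nth vec_eq_iff)

lemma concat_ents_nth:
  fixes As :: "('a^'n^'n) list"
  assumes "m < length As"
  shows "concat (map ents As) ! (m * CARD('n \<times> 'n) + to_nat_on (UNIV :: ('n \<times> 'n) set) (i, j)) = As ! m $ i $ j"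
  using assms
proof (induction As arbitrary: m)
  case (Cons A As)
  show ?case
  proof (cases m)
    case 0
    then show ?thesis using to_nat_on_less[of "(i, j)"] by (simp add: nth_append length_ents ents_nth del: card_prod)
  next
    case (Suc n)
    then show ?thesis using Cons by (simp add: nth_append length_ents del: card_prod)
  qed
qed simp

lemma length_concat_ents: "length (concat (map ents (As :: ('a^'n^'n) list))) = length As * CARD('n \<times> 'n)"
  by (induction As) (simp_all add: length_ents del: card_prod)

lemma mat_fun_var: "mat_fun (var_matrix m)"
  unfolding mat_fun_def var_matrix_def by (simp add: ring_fun_var)

text \<open>The truth of the condition depends only on the blocks filled by the given matrices, so
  the remaining variables may be set to 0.\<close>

lemma sat_ents:
  fixes As :: "('k::comm_ring_1^'n^'n) list" and R :: "'k set"
  assumes As: "\<And>A i j. A \<in> set As \<Longrightarrow> A $ i $ j \<in> R" and R0: "0 \<in> R"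
    and S: "\<forall>R \<nu> \<rho>. wf_system (ring_struct R) S \<and> (holds (ring_struct R) \<nu> \<rho> S \<longleftrightarrow> C (\<lambda>m. var_matrix m \<rho>))"
    and C: "\<And>f. (\<And>m. m < length As \<Longrightarrow> f m = As ! m) \<Longrightarrow> C f \<longleftrightarrow> D"
  shows "sat (ring_struct R) \<nu> S (concat (map ents As)) \<longleftrightarrow> D"
proof -
  let ?xs = "concat (map ents As)"
  have var: "var_matrix m \<rho> = As ! m" if \<rho>: "\<forall>i<length ?xs. \<rho> i = ?xs ! i" and m: "m < length As" for m \<rho>
  proof -
    have "m * CARD('n \<times> 'n) + to_nat_on (UNIV :: ('n \<times> 'n) set) (i, j) < length As * CARD('n \<times> 'n)" for i j
    proof -
      have "m * CARD('n \<times> 'n) + to_nat_on (UNIV :: ('n \<times> 'n) set) (i, j) < Suc m * CARD('n \<times> 'n)"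
        using to_nat_on_less[of "(i, j)"] unfolding mult_Suc by linarith
      also have "\<dots> \<le> length As * CARD('n \<times> 'n)" using m by (intro mult_le_mono1) simp
      finally show ?thesis .
    qed
    then show ?thesis
      unfolding var_matrix_def vec_eq_iff using \<rho> concat_ents_nth[OF m] by (simp add: length_concat_ents del: card_prod)
  qed
  have eq: "C (\<lambda>m. var_matrix m \<rho>) \<longleftrightarrow> D" if "\<forall>i<length ?xs. \<rho> i = ?xs ! i" for \<rho>
    by (rule C) (rule var[OF that])
  let ?\<rho> = "\<lambda>i. if i < length ?xs then ?xs ! i else 0"
  have "set (ents A) \<subseteq> R" if "A \<in> set As" for A unfolding set_ents using As[OF that] by blast
  then have xs: "set ?xs \<subseteq> R" by auto
  have \<rho>: "range ?\<rho> \<subseteq> dom (ring_struct R)"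
    unfolding ring_struct_def using R0 subsetD[OF xs nth_mem] by (auto simp del: set_concat)
  have S': "holds (ring_struct R) \<nu> \<rho> S \<longleftrightarrow> C (\<lambda>m. var_matrix m \<rho>)" for \<rho> using S by blast
  show ?thesis
  proof
    assume "sat (ring_struct R) \<nu> S ?xs"
    then obtain \<rho> where "\<forall>i<length ?xs. \<rho> i = ?xs ! i" "holds (ring_struct R) \<nu> \<rho> S" unfolding sat_def by blast
    then show D using eq S' by blast
  next
    assume D
    then have "holds (ring_struct R) \<nu> ?\<rho> S" unfolding S' using eq[of ?\<rho>] by simp
    then show "sat (ring_struct R) \<nu> S ?xs" unfolding sat_def using \<rho> by (intro exI[of _ ?\<rho>]) simp
  qed
qed

text \<open>SL_n(R) serves as the larger set of represented elements: it is closed under product and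
  inverse, since inverses are adjugates. A matrix is represented by its entries. Determinant 1 and
  finitely many polynomials from Q, found by the basis theorem, single out G.\<close>

theorem matrix_group_decidable_if_ring_decidable:
  fixes R :: "'k::field set" and Q :: "'n::finite entry_poly set"
  assumes R: "subring R" and dec: "diophantine_decidable (ring_struct R)"
    and G: "G = {A :: 'k^'n^'n. (\<forall>i j. A $ i $ j \<in> R) \<and> det A = 1 \<and> (\<forall>p\<in>Q. eval_entry_poly p A = 0)}"
    and ne: "G \<noteq> {}"
  shows "diophantine_decidable (matrix_group_struct G)"
proof -
  let ?d = "CARD('n \<times> 'n)"
  define E where "E = {A :: 'k^'n^'n. (\<forall>i j. A $ i $ j \<in> R) \<and> det A = 1}"
  define Rep where "Rep xs A \<longleftrightarrow> A \<in> E \<and> xs = ents A" for xs and A :: "'k^'n^'n"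
  have domR: "dom (ring_struct R) = R" by (simp add: ring_struct_def)
  have domG: "dom (matrix_group_struct G) = G" by (simp add: matrix_group_struct_def)
  note R0 = subring_closed(2)[OF R]
  have ER: "A $ i $ j \<in> R" if "A \<in> E" for A :: "'k^'n^'n" and i j using that unfolding E_def by blast
  have E_mult: "A ** B \<in> E" if "A \<in> E" "B \<in> E" for A B :: "'k^'n^'n"
  proof -
    have "det (A ** B) = 1" using that unfolding E_def by (simp add: det_mul)
    moreover have "(A ** B) $ i $ j \<in> R" for i j
      unfolding matrix_matrix_mult_def using ER[OF that(1)] ER[OF that(2)]
      by (auto intro!: subring_closed(9)[OF R] subring_closed(4)[OF R])
    ultimately show ?thesis unfolding E_def by blast
  qed
  have inv: "A ** matrix_inv A = mat 1" "matrix_inv A ** A = mat 1" if "A \<in> E" for A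
  proof -
    have d: "det (mx (Mx A)) = 1" using that unfolding E_def by simp
    show "A ** matrix_inv A = mat 1" "matrix_inv A ** A = mat 1"
      using mult_adj[OF d] adj_mult[OF d] matrix_inv_adj[OF d] by (simp_all add: mx_eq_iff mx_mult mx_1)
  qed
  have E_inv: "matrix_inv A \<in> E" if A: "A \<in> E" for A
  proof -
    have d: "det (mx (Mx A)) = 1" using A unfolding E_def by simp
    have "ent (adj (Mx A)) i j \<in> R" for i j
      by (rule ent_adj_in[OF R]) (use ER[OF A] in \<open>simp add: ent_def\<close>)
    moreover have "matrix_inv A = mx (adj (Mx A))" using matrix_inv_adj[OF d] by simp
    moreover have "det A * det (matrix_inv A) = 1" using inv(1)[OF A] by (metis det_I det_mul)
    ultimately show ?thesis using A unfolding E_def by (simp add: ent_def)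
  qed
  have E_one: "mat 1 \<in> E"
    unfolding E_def using R0 subring_closed(1)[OF R] by (simp add: mat_def det_I[unfolded mat_def])
  have two: "\<exists>A B. es = [A, B]" if "length es = 2" for es :: "('k^'n^'n) list"
    using that by (cases es; cases "tl es") auto
  have matr: "\<exists>A. ys = ents A \<and> (\<forall>i j. vec_nth (vec_nth (A :: 'k^'n^'n) i) j \<in> R)" if "length ys = ?d" "set ys \<subseteq> dom (ring_struct R)" for ys
    using ents_surj[OF that(1)] that(2) set_ents unfolding domR by blast
  have Rep_ents: "Rep (ents A) B \<longleftrightarrow> B \<in> E \<and> A = B" for A B unfolding Rep_def ents_inject by blast
  show ?thesis
  proof (rule interpretation_decidable[where E = E and d = ?d and Rep = Rep, OF dec])
    show "dom (matrix_group_struct G) \<noteq> {}" "dom (matrix_group_struct G) \<subseteq> E"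
      unfolding domG using ne by (auto simp: G E_def)
    show "snd (ops (matrix_group_struct G) ! f) es \<in> E"
      if f: "f < length (ops (matrix_group_struct G))" and l: "length es = fst (ops (matrix_group_struct G) ! f)"
        and es: "set es \<subseteq> E" for f es
    proof -
      have el: "es ! i \<in> E" if "i < length es" for i using es nth_mem[OF that] by blast
      have "f < 3" using f by (simp add: matrix_group_struct_def)
      then consider "f = 0" | "f = 1" | "f = 2" by linarith
      then show ?thesis
        using l by cases (simp_all add: matrix_group_struct_def E_mult E_inv E_one el)
    qed
    show "length xs = ?d \<and> set xs \<subseteq> dom (ring_struct R)" if "Rep xs e" for xs e
    proof -
      have e: "e \<in> E" "xs = ents e" using that unfolding Rep_def by auto
      have "set (ents e) \<subseteq> R" unfolding set_ents using ER[OF e(1)] by blast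
      then show ?thesis unfolding e(2) domR length_ents by simp
    qed
    show "\<exists>xs. Rep xs e" if "e \<in> E" for e using that unfolding Rep_def by blast
    fix \<nu> :: "nat \<Rightarrow> 'k"
    show "\<exists>S. wf_system (ring_struct R) S \<and>
       (\<forall>xs. length xs = ?d \<longrightarrow> set xs \<subseteq> dom (ring_struct R) \<longrightarrow>
         sat (ring_struct R) \<nu> S xs = (\<exists>e\<in>dom (matrix_group_struct G). Rep xs e))"
    proof (rule finite_equations[of Q, where 'a = 'k])
      fix B assume B: "finite B" "B \<subseteq> Q" "\<And>A :: ('k, 'n) sqm. \<forall>p\<in>B. eep p A = 0 \<Longrightarrow> \<forall>p\<in>Q. eep p A = 0"
      \<comment> \<open>\<open>None\<close> indexes the determinant equation, \<open>Some p\<close>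
        the equation of p.\<close>
      let ?F = "\<lambda>k \<rho>. case k of None \<Rightarrow> det (var_matrix 0 \<rho> :: 'k^'n^'n) - 1 | Some p \<Rightarrow> eval_entry_poly p (var_matrix 0 \<rho> :: 'k^'n^'n)"
      have "ring_fun (?F k)" for k
        using ring_fun_diff[OF ring_fun_det[OF mat_fun_var] ring_fun_1] ring_fun_entry_poly[OF mat_fun_var]
        by (cases k) simp_all
      from ex_ring_system[of "insert None (Some ` B)" ?F, OF _ this] B(1)
      obtain S where S: "\<forall>R \<nu> \<rho>. wf_system (ring_struct R) S \<and> (holds (ring_struct R) \<nu> \<rho> S \<longleftrightarrow>
          (\<forall>k\<in>insert None (Some ` B). ?F k \<rho> = 0))" by auto
      have S': "\<forall>R \<nu> \<rho>. wf_system (ring_struct R) S \<and> (holds (ring_struct R) \<nu> \<rho> S \<longleftrightarrow>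
          det (var_matrix 0 \<rho> :: 'k^'n^'n) = 1 \<and> (\<forall>p\<in>B. eval_entry_poly p (var_matrix 0 \<rho> :: 'k^'n^'n) = 0))"
        using S by simp
      have st: "sat (ring_struct R) \<nu> S xs = (\<exists>e\<in>dom (matrix_group_struct G). Rep xs e)"
        if xs: "length xs = ?d" "set xs \<subseteq> dom (ring_struct R)" for xs
      proof -
        obtain A :: "'k^'n^'n" where A: "xs = ents A" "\<And>i j. A $ i $ j \<in> R" using matr[OF xs] by blast
        have "sat (ring_struct R) \<nu> S (concat (map ents [A])) \<longleftrightarrow>
            det A = 1 \<and> (\<forall>p\<in>B. eval_entry_poly p A = 0)"
          by (rule sat_ents[where C = "\<lambda>f. det (f 0) = 1 \<and> (\<forall>p\<in>B. eval_entry_poly p (f 0) = 0)", OF _ R0 S'])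
            (use A(2) in auto)
        also have "(\<forall>p\<in>B. eval_entry_poly p A = 0) \<longleftrightarrow> (\<forall>p\<in>Q. eval_entry_poly p A = 0)"
          using B(2) B(3)[of "Mx A"] unfolding eep_def by auto
        finally show ?thesis unfolding A(1) Rep_ents domG using A(2) by (auto simp: G E_def)
      qed
      have "wf_system (ring_struct R) S" using S by blast
      with st show ?thesis by (intro exI[of _ S] conjI allI impI)
    qed
    have EQ: "sat (ring_struct R) \<nu> S (concat (map ents As)) \<longleftrightarrow> D"
      if "\<forall>R \<nu> \<rho>. wf_system (ring_struct R) S \<and> (holds (ring_struct R) \<nu> \<rho> S \<longleftrightarrow> C (\<lambda>m. var_matrix m \<rho>))"
        "\<And>A i j. A \<in> set As \<Longrightarrow> A $ i $ j \<in> R" "\<And>f. (\<And>m. m < length As \<Longrightarrow> f m = As ! m) \<Longrightarrow> C f \<longleftrightarrow> D"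
      for S and C :: "(nat \<Rightarrow> 'k^'n^'n) \<Rightarrow> bool" and D and As :: "('k^'n^'n) list"
      using sat_ents[OF that(2) R0 that(1,3)] by blast
    show "\<exists>S. wf_system (ring_struct R) S \<and>
       (\<forall>xs ys e e'. e \<in> E \<longrightarrow> e' \<in> E \<longrightarrow> Rep xs e \<longrightarrow> Rep ys e' \<longrightarrow> sat (ring_struct R) \<nu> S (xs @ ys) = (e = e'))"
    proof -
      from ex_matrix_equation[OF mat_fun_var[of 0] mat_fun_var[of 1]]
      obtain S where S: "\<forall>R \<nu> \<rho>. wf_system (ring_struct R) S \<and>
          (holds (ring_struct R) \<nu> \<rho> S \<longleftrightarrow> (var_matrix 0 \<rho> :: 'k^'n^'n) = var_matrix 1 \<rho>)" by (elim exE)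
      have st: "sat (ring_struct R) \<nu> S (xs @ ys) = (e = e')" if "e \<in> E" "e' \<in> E" "Rep xs e" "Rep ys e'" for xs ys e e'
        using EQ[of S "\<lambda>f. f 0 = f 1" "[e, e']", OF S] that ER unfolding Rep_def by auto
      have "wf_system (ring_struct R) S" using S by blast
      with st show ?thesis by (intro exI[of _ S] conjI allI impI)
    qed
    fix f assume f: "f < length (ops (matrix_group_struct G))"
    have "f < 3" using f by (simp add: matrix_group_struct_def)
    then consider "f = 0" | "f = 1" | "f = 2" by linarith
    then show "\<exists>S. wf_system (ring_struct R) S \<and>
       (\<forall>ys xss es. length ys = ?d \<longrightarrow> set ys \<subseteq> dom (ring_struct R) \<longrightarrow>
          length es = fst (ops (matrix_group_struct G) ! f) \<longrightarrow> set es \<subseteq> E \<longrightarrow> list_all2 Rep xss es \<longrightarrow>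
          sat (ring_struct R) \<nu> S (ys @ concat xss) = Rep ys (snd (ops (matrix_group_struct G) ! f) es))"
    proof cases
      case 1
      from ex_matrix_equation[OF mat_fun_var[of 0] mat_fun_mult[OF mat_fun_var[of 1] mat_fun_var[of 2]]]
      obtain S where S: "\<forall>R \<nu> \<rho>. wf_system (ring_struct R) S \<and>
          (holds (ring_struct R) \<nu> \<rho> S \<longleftrightarrow> (var_matrix 0 \<rho> :: 'k^'n^'n) = var_matrix 1 \<rho> ** var_matrix 2 \<rho>)" by (elim exE)
      have st: "sat (ring_struct R) \<nu> S (ys @ concat xss) = Rep ys (snd (ops (matrix_group_struct G) ! f) es)"
        if ys: "length ys = ?d" "set ys \<subseteq> dom (ring_struct R)" and es: "length es = fst (ops (matrix_group_struct G) ! f)"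
          "set es \<subseteq> E" and xss: "list_all2 Rep xss es" for ys xss es
      proof -
        have "length es = 2" using es(1) 1 by (simp add: matrix_group_struct_def)
        then obtain x x' e e' where l: "xss = [x, x']" "es = [e, e']" "Rep x e" "Rep x' e'"
          using list_all2_length_2[OF xss] by blast
        obtain A :: "'k^'n^'n" where A: "ys = ents A" "\<And>i j. A $ i $ j \<in> R" using matr[OF ys] by blast
        have "sat (ring_struct R) \<nu> S (concat (map ents [A, e, e'])) \<longleftrightarrow> A = e ** e'"
          by (rule EQ[where C = "\<lambda>f. f 0 = f 1 ** f 2", OF S]) (use A(2) ER l in \<open>auto simp: Rep_def\<close>)
        then show ?thesis using l E_mult[of e e'] unfolding A(1) 1
          by (simp add: matrix_group_struct_def Rep_ents) (simp add: Rep_def)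
      qed
      have "wf_system (ring_struct R) S" using S by blast
      with st show ?thesis by (intro exI[of _ S] conjI allI impI)
    next
      case 2
      \<comment> \<open>The graph of inversion is expressed by the matrix equation A e = 1.\<close>
      from ex_matrix_equation[OF mat_fun_mult[OF mat_fun_var[of 0] mat_fun_var[of 1]] mat_fun_one]
      obtain S where S: "\<forall>R \<nu> \<rho>. wf_system (ring_struct R) S \<and>
          (holds (ring_struct R) \<nu> \<rho> S \<longleftrightarrow> (var_matrix 0 \<rho> ** var_matrix 1 \<rho> :: 'k^'n^'n) = mat 1)" by (elim exE)
      have st: "sat (ring_struct R) \<nu> S (ys @ concat xss) = Rep ys (snd (ops (matrix_group_struct G) ! f) es)"
        if ys: "length ys = ?d" "set ys \<subseteq> dom (ring_struct R)" and es: "length es = fst (ops (matrix_group_struct G) ! f)"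
          "set es \<subseteq> E" and xss: "list_all2 Rep xss es" for ys xss es
      proof -
        have "length es = 1" using es(1) 2 by (simp add: matrix_group_struct_def)
        then obtain x e where l: "xss = [x]" "es = [e]" "Rep x e"
          using list_all2_length_1[OF xss] by blast
        obtain A :: "'k^'n^'n" where A: "ys = ents A" "\<And>i j. A $ i $ j \<in> R" using matr[OF ys] by blast
        have e: "e \<in> E" using l(3) unfolding Rep_def by blast
        have "sat (ring_struct R) \<nu> S (concat (map ents [A, e])) \<longleftrightarrow> A ** e = mat 1"
          by (rule EQ[where C = "\<lambda>f. f 0 ** f 1 = mat 1", OF S]) (use A(2) ER l in \<open>auto simp: Rep_def\<close>)
        also have "A ** e = mat 1 \<longleftrightarrow> A = matrix_inv e"
          using inv[OF e] by (metis matrix_mul_assoc matrix_mul_lid matrix_mul_rid)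
        finally show ?thesis using l E_inv[of e] unfolding A(1) 2
          by (simp add: matrix_group_struct_def Rep_ents) (simp add: Rep_def)
      qed
      have "wf_system (ring_struct R) S" using S by blast
      with st show ?thesis by (intro exI[of _ S] conjI allI impI)
    next
      case 3
      from ex_matrix_equation[OF mat_fun_var[of 0] mat_fun_one]
      obtain S where S: "\<forall>R \<nu> \<rho>. wf_system (ring_struct R) S \<and>
          (holds (ring_struct R) \<nu> \<rho> S \<longleftrightarrow> (var_matrix 0 \<rho> :: 'k^'n^'n) = mat 1)" by (elim exE)
      have st: "sat (ring_struct R) \<nu> S (ys @ concat xss) = Rep ys (snd (ops (matrix_group_struct G) ! f) es)"
        if ys: "length ys = ?d" "set ys \<subseteq> dom (ring_struct R)" and es: "length es = fst (ops (matrix_group_struct G) ! f)"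
          "set es \<subseteq> E" and xss: "list_all2 Rep xss es" for ys xss es
      proof -
        have "es = []" using es(1) 3 by (simp add: matrix_group_struct_def)
        then have l: "xss = []" using xss by simp
        obtain A :: "'k^'n^'n" where A: "ys = ents A" "\<And>i j. A $ i $ j \<in> R" using matr[OF ys] by blast
        have "sat (ring_struct R) \<nu> S (concat (map ents [A])) \<longleftrightarrow> A = mat 1"
          by (rule EQ[where C = "\<lambda>f. f 0 = mat 1", OF S]) (use A(2) in auto)
        then show ?thesis using l E_one unfolding A(1) 3 by (simp add: matrix_group_struct_def Rep_ents)
      qed
      have "wf_system (ring_struct R) S" using S by blast
      with st show ?thesis by (intro exI[of _ S] conjI allI impI)
    qed
  qed
qed

theorem mainTheorem5:
  fixes \<Phi> :: "'v::euclidean_space set"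
    and scale :: "complex \<Rightarrow> 'l::ab_group_add \<Rightarrow> 'l"
    and br :: "'l \<Rightarrow> 'l \<Rightarrow> 'l"
    and H :: "'l set"
    and r :: "'v \<Rightarrow> 'l \<Rightarrow> complex"
    and x :: "'v \<Rightarrow> 'l"
    and \<pi> :: "'l \<Rightarrow> complex^'n^'n"
    and P :: "complex^'n^'n"
    and R :: "'f::field_char_0 set"
  assumes "root_system \<Phi>" and "indecomposable \<Phi>" and "dim \<Phi> > 1"
    and "complex_lie_algebra scale br"
    and "complex_lie_algebra.semisimple scale br"
    and "complex_lie_algebra.cartan_subalgebra scale br H"
    and "complex_lie_algebra.roots_identified scale br H \<Phi> r"
    and "complex_lie_algebra.chevalley_basis scale br H \<Phi> r x"
    and "complex_lie_algebra.faithful_representation scale br \<pi>"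
    and "admissible_lattice_basis \<Phi> \<pi> x P"
    and "number_field TYPE('f)"
    and "R = UNIV \<or> R = ring_of_integers"
  shows "\<not> diophantine_decidable (ring_struct R) \<longleftrightarrow>
         \<not> diophantine_decidable (matrix_group_struct (chevalley_group \<Phi> \<pi> x P R))"
proof -
  have R: "subring R" using assms(12) subring_ring_of_integers by (auto simp: subring_def)
  obtain E K where sys: "integral_chevalley_system \<Phi> (E :: 'v \<Rightarrow> nat \<Rightarrow> (int, 'n) sqm) K" and
    G: "chevalley_group \<Phi> \<pi> x P R = mx ` integral_chevalley_system.GR \<Phi> E K R"
  proof (rule ex_integral_chevalley_system[OF assms(1,4,7-10), where 'f = 'f])
    fix E K
    assume "integral_chevalley_system \<Phi> (E :: 'v \<Rightarrow> nat \<Rightarrow> (int, 'n) sqm) K"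
      "\<And>R :: 'f set. chevalley_group \<Phi> \<pi> x P R = mx ` integral_chevalley_system.GR \<Phi> E K R"
    then show thesis by (rule that)
  qed
  interpret S: integral_chevalley_system \<Phi> E K by (rule sys)
  have "S.Gs R = matrix_group_struct (chevalley_group \<Phi> \<pi> x P R)" unfolding S.Gs_def G ..
  then have "diophantine_decidable (matrix_group_struct (chevalley_group \<Phi> \<pi> x P R)) \<Longrightarrow>
      diophantine_decidable (ring_struct R)"
    using S.ring_decidable_if_group_decidable[OF R assms(2,3)] by simp
  moreover have "diophantine_decidable (matrix_group_struct (chevalley_group \<Phi> \<pi> x P R))"
    if "diophantine_decidable (ring_struct R)"
  proof (rule matrix_group_decidable_if_ring_decidable[OF R that])
    show "chevalley_group \<Phi> \<pi> x P R = {A. (\<forall>i j. A $ i $ j \<in> R) \<and> det A = 1 \<and>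
        (\<forall>p\<in>{p. \<forall>g\<in>complex_chevalley_group \<Phi> \<pi> x P. eval_entry_poly p g = 0}. eval_entry_poly p A = 0)}"
      unfolding chevalley_group_def by simp
    \<comment> \<open>A root element at parameter 1 witnesses that the group is nonempty, so that it
      has an enumeration.\<close>
    obtain \<alpha> where "\<alpha> \<in> \<Phi>" using assms(2) unfolding indecomposable_def by blast
    from S.xg_in_GR[OF R subring_closed(1)[OF R] this] show "chevalley_group \<Phi> \<pi> x P R \<noteq> {}" unfolding G by blast
  qed
  ultimately show ?thesis by blast
qed

end
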